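(* Let the exponential family $(P_\tau)_{\tau\in J}$, the response process and the adaptive $p$-step-ahead algorithm be as described in the context, with true parameter point $\overline\theta\in\Theta$, adaptive estimators $\widehat\theta_k$ employed by the algorithm, and adaptive maximum likelihood estimators $\widehat\theta_k^{(\mathrm{ML})}$. Assume the following. (GLM$^*$) $\Theta\subseteq\mathbb R^p$ (with the Euclidean metric); $G:I\to\mathbb R$ is a continuously differentiable function on an open interval $I\subseteq\mathbb R$ with $G'>0$ and $G(I)\subseteq b'(J)$; $f:\mathcal X\to\mathbb R^p$ is continuous with $f^{T}(x)\theta\in I$ for all $(x,\theta)\in\mathcal X\times\Theta$; and for all $(x,\theta)\in\mathcal X\times\Theta$ $$\mu(x,\theta)=G\bigl(f^{T}(x)\theta\bigr),\qquad f_\theta(x)=\varphi\bigl(f^{T}(x)\theta\bigr)f(x),\qquad\text{where } \varphi(u)=\frac{G'(u)}{\sqrt{b''\bigl((b')^{-1}(G(u))\bigr)}},\ u\in I,$$ with $\psi(x,\theta)=\varphi(f^{T}(x)\theta)$ a continuous function $\mathcal X\times\Theta\to(0,\infty)$. (a1) There is a nondecreasing sequence $\mathcal F_0\subseteq\mathcal F_1\subseteq\cdots$ of sub-sigma-fields of $\mathcal F$ such that for each $k\in\mathbb N$ the random vector $\boldsymbol X_k=(X_{n_{k-1}+1},\ldots,X_{n_k})$ is $\mathcal F_{k-1}$-measurable and $\boldsymbol Y_k=(Y_{n_{k-1}+1},\ldots,Y_{n_k})^{T}$ is $\mathcal F_k$-measurable. (a2') For each $k\in\mathbb N$ the conditional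 distribution of $\boldsymbol Y_k$ given $\mathcal F_{k-1}$ is the product of the distributions $P_{\overline\tau_i}$, $n_{k-1}+1\le i\le n_k$, where $\overline\tau_i=(b')^{-1}\bigl(G(f^{T}(X_i)\overline\theta)\bigr)$. (SD)$(\overline\theta)$ The information matrices $M(\eta^*,\overline\theta)$ of all locally D-optimal saturated designs $\eta^*$ at $\overline\theta$ coincide; denote their common value by $M_{\mathrm s*}(\overline\theta)$. Assume further that $G$ is twice continuously differentiable, that $\overline\theta\in\mathrm{int}(\Theta)$ (interior in $\mathbb R^p$), and that $\widehat\theta_k\to\overline\theta$ almost surely as $k\to\infty$. Then $$\sqrt{n_k}\,\bigl(\widehat\theta_k^{(\mathrm{ML})}-\overline\theta\bigr)\ \longrightarrow\ \mathrm N\bigl(0,\ M_{\mathrm s*}^{-1}(\overline\theta)\bigr)\quad\text{in distribution as }k\to\infty .$$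
   Context: Setting: $p\in\mathbb N$; $\mathcal X$ (experimental region) and $\Theta$ (parameter space) are compact metric spaces; $\mu:\mathcal X\times\Theta\to\mathbb R$ is continuous; $f_\theta:\mathcal X\to\mathbb R^p$, $\theta\in\Theta$, is a family of functions such that $(x,\theta)\mapsto f_\theta(x)$ is continuous on $\mathcal X\times\Theta$ and, for each $\theta\in\Theta$, the image $f_\theta(\mathcal X)$ spans $\mathbb R^p$. Vectors are column vectors, and $\mathrm N(0,C)$ is the $p$-dimensional normal distribution with mean $0$ and positive definite covariance matrix $C$. Designs: A design is a probability measure $\xi$ on $\mathcal X$ with finite support. Its information matrix at $\theta$ is $M(\xi,\theta)=\sum_{x\in\mathrm{supp}(\xi)}\xi(x)f_\theta(x)f_\theta^{T}(x)$. A design is saturated if its support has exactly $p$ points. A locally D-optimal saturated design at $\overline\theta$ is a saturated design maximizing $\det M(\eta,\overline\theta)$ over all saturated designs $\eta$. Exponential family: $J\subseteq\mathbb R$ is an open interval and $P_\tau$, $\tau\in J$, are probability distributions on the Borel sigma-field of $\mathbb R$ with densities with respect to some Borel measure $\nu$ of the form $p_\tau(y)=K(y)\exp(\tau y-b(\tau))$, $y\in\mathbb R$, where $K$ is a nonnegative measurable function and $b:J\to\mathbb R$. The function $b$ is infinitely differentiable, $b'(\tau)$ is the expectation and $b''(\tau)>0$ is the variance of $P_\tau$ (so the family is non-degenerate); hence $b'$ is a bijection from $J$ onto the open interval $b'(J)$, with inverse $(b')^{-1}$. Process and algorithm: $X_i$ and $Y_i$, $i\in\mathbb N$, are random variables on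 a probability space $(\Omega,\mathcal F,\mathbb P_{\overline\theta})$ with values in $\mathcal X$ and $\mathbb R$, respectively, where $\overline\theta\in\Theta$ is the true parameter point. Let $n_1\in\mathbb N$, $n_0:=0$, and $n_k:=n_1+(k-1)p$ for $k\ge1$. The adaptive estimators employed by the algorithm are $\Theta$-valued estimators $\widehat\theta_k=\widehat\theta_k(X_1,Y_1,\ldots,X_{n_k},Y_{n_k})$, $k\ge1$. The points $X_1,\ldots,X_{n_1}$ are arbitrary initial design points, and the $p$-step-ahead algorithm chooses the subsequent points so that for every $k\ge1$ (pathwise) $$\bigl(\det[f_{\widehat\theta_k}(X_{n_k+1}),\ldots,f_{\widehat\theta_k}(X_{n_k+p})]\bigr)^2=\max_{z_1,\ldots,z_p\in\mathcal X}\bigl(\det[f_{\widehat\theta_k}(z_1),\ldots,f_{\widehat\theta_k}(z_p)]\bigr)^2 .$$ The adaptive maximum likelihood estimator $\widehat\theta_k^{(\mathrm{ML})}=\widehat\theta_k^{(\mathrm{ML})}(X_1,Y_1,\ldots,X_{n_k},Y_{n_k})$ is a $\Theta$-valued random variable maximizing over $\theta\in\Theta$ the log-likelihood $$L_{n_k}(\theta)=\sum_{i=1}^{n_k}\bigl(\log K(Y_i)+\tau_i(\theta)Y_i-b(\tau_i(\theta))\bigr),\qquad \tau_i(\theta)=(b')^{-1}\bigl(G(f^{T}(X_i)\theta)\bigr).$$ It need not coincide with $\widehat\theta_k$. *)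

theory Defs
  imports "HOL-Probability.Probability"
begin

text \<open>A probability measure with finite support on the experimental region is represented by a
  probability mass function; its support is \<^const>\<open>set_pmf\<close>.\<close>

definition design :: "'x set \<Rightarrow> 'x pmf \<Rightarrow> bool" where
  "design XX \<xi> \<longleftrightarrow> finite (set_pmf \<xi>) \<and> set_pmf \<xi> \<subseteq> XX"

definition outer :: "real ^ 'p \<Rightarrow> real ^ 'p ^ 'p" where
  "outer v = (\<chi> i j. v $ i * v $ j)"

definition info_matrix ::
    "('t \<Rightarrow> 'x \<Rightarrow> real ^ 'p) \<Rightarrow> 'x pmf \<Rightarrow> 't \<Rightarrow> real ^ 'p ^ 'p" where
  "info_matrix f\<^sub>\<theta> \<xi> \<theta> = (\<Sum>x\<in>set_pmf \<xi>. pmf \<xi> x *\<^sub>R outer (f\<^sub>\<theta> \<theta> x))"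

definition saturated_design :: "'p::finite itself \<Rightarrow> 'x set \<Rightarrow> 'x pmf \<Rightarrow> bool" where
  "saturated_design _ XX \<xi> \<longleftrightarrow> design XX \<xi> \<and> card (set_pmf \<xi>) = CARD('p)"

definition D_opt_saturated ::
    "'x set \<Rightarrow> ('t \<Rightarrow> 'x \<Rightarrow> real ^ 'p) \<Rightarrow> 't \<Rightarrow> 'x pmf \<Rightarrow> bool" where
  "D_opt_saturated XX f\<^sub>\<theta> \<theta> =
     is_arg_max (\<lambda>\<eta>. det (info_matrix f\<^sub>\<theta> \<eta> \<theta>)) (saturated_design TYPE('p) XX)"

definition cond_SD :: "'x set \<Rightarrow> ('t \<Rightarrow> 'x \<Rightarrow> real ^ 'p) \<Rightarrow> 't \<Rightarrow> bool" where
  "cond_SD XX f\<^sub>\<theta> \<theta> \<longleftrightarrow>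
     (\<forall>\<eta> \<eta>'. D_opt_saturated XX f\<^sub>\<theta> \<theta> \<eta> \<longrightarrow> D_opt_saturated XX f\<^sub>\<theta> \<theta> \<eta>' \<longrightarrow>
        info_matrix f\<^sub>\<theta> \<eta> \<theta> = info_matrix f\<^sub>\<theta> \<eta>' \<theta>)"

text \<open>The common value of the information matrices of the locally D-optimal saturated designs;
  meaningful only under \<^const>\<open>cond_SD\<close>.\<close>

definition M_sat :: "'x set \<Rightarrow> ('t \<Rightarrow> 'x \<Rightarrow> real ^ 'p) \<Rightarrow> 't \<Rightarrow> real ^ 'p ^ 'p" where
  "M_sat XX f\<^sub>\<theta> \<theta> = (THE A. \<exists>\<eta>. D_opt_saturated XX f\<^sub>\<theta> \<theta> \<eta> \<and> A = info_matrix f\<^sub>\<theta> \<eta> \<theta>)"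

text \<open>\<open>b\<close> and, below, \<open>G\<close> are total functions, but \<open>J\<close> and \<open>I\<close> are open, so their derivatives there do not
  depend on the values outside.\<close>

definition exp_family ::
    "real set \<Rightarrow> real measure \<Rightarrow> (real \<Rightarrow> real) \<Rightarrow> (real \<Rightarrow> real) \<Rightarrow> (real \<Rightarrow> real measure) \<Rightarrow> bool" where
  "exp_family J \<nu> K b P \<longleftrightarrow>
     open J \<and> is_interval J \<and> J \<noteq> {} \<and>
     sets \<nu> = sets borel \<and>
     K \<in> borel_measurable borel \<and> (\<forall>y. 0 \<le> K y) \<and>
     (\<forall>\<tau>\<in>J. prob_space (P \<tau>) \<and>
        P \<tau> = density \<nu> (\<lambda>y. ennreal (K y * exp (\<tau> * y - b \<tau>)))) \<and>
     (\<forall>m. (deriv ^^ m) b differentiable_on J) \<and>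
     (\<forall>\<tau>\<in>J. has_bochner_integral (P \<tau>) (\<lambda>y. y) (deriv b \<tau>) \<and>
        has_bochner_integral (P \<tau>) (\<lambda>y. (y - deriv b \<tau>)\<^sup>2) (deriv (deriv b) \<tau>) \<and>
        0 < deriv (deriv b) \<tau>)"

definition nat_param :: "real set \<Rightarrow> (real \<Rightarrow> real) \<Rightarrow> (real \<Rightarrow> real) \<Rightarrow> real \<Rightarrow> real" where
  "nat_param J b G u = the_inv_into J (deriv b) (G u)"

definition glm_phi :: "real set \<Rightarrow> (real \<Rightarrow> real) \<Rightarrow> (real \<Rightarrow> real) \<Rightarrow> real \<Rightarrow> real" where
  "glm_phi J b G u = deriv G u / sqrt (deriv (deriv b) (nat_param J b G u))"

definition cond_GLM_star ::
    "'x::metric_space set \<Rightarrow> (real ^ 'p) set \<Rightarrow> ('x \<Rightarrow> real ^ 'p \<Rightarrow> real) \<Rightarrow>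
     (real ^ 'p \<Rightarrow> 'x \<Rightarrow> real ^ 'p) \<Rightarrow> real set \<Rightarrow> (real \<Rightarrow> real) \<Rightarrow>
     real set \<Rightarrow> (real \<Rightarrow> real) \<Rightarrow> ('x \<Rightarrow> real ^ 'p) \<Rightarrow> bool" where
  "cond_GLM_star XX \<Theta> \<mu> f\<^sub>\<theta> J b I G f \<longleftrightarrow>
     open I \<and> is_interval I \<and>
     G C1_differentiable_on I \<and> (\<forall>u\<in>I. 0 < deriv G u) \<and> G ` I \<subseteq> deriv b ` J \<and>
     continuous_on XX f \<and>
     (\<forall>x\<in>XX. \<forall>\<theta>\<in>\<Theta>. f x \<bullet> \<theta> \<in> I \<and>
        \<mu> x \<theta> = G (f x \<bullet> \<theta>) \<and>
        f\<^sub>\<theta> \<theta> x = glm_phi J b G (f x \<bullet> \<theta>) *\<^sub>R f x \<and>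
        0 < glm_phi J b G (f x \<bullet> \<theta>)) \<and>
     continuous_on (XX \<times> \<Theta>) (\<lambda>(x, \<theta>). glm_phi J b G (f x \<bullet> \<theta>))"

text \<open>\<open>n_obs p n\<^sub>1 k\<close> is the sample size after stage \<open>k\<close>. Observations are numbered from 1, so the
  values of \<open>X\<close> and \<open>Y\<close> at index 0 play no role.\<close>

definition n_obs :: "nat \<Rightarrow> nat \<Rightarrow> nat \<Rightarrow> nat" where
  "n_obs p n\<^sub>1 k = (if k = 0 then 0 else n\<^sub>1 + (k - 1) * p)"

definition stage :: "nat \<Rightarrow> nat \<Rightarrow> nat \<Rightarrow> nat set" where
  "stage p n\<^sub>1 k = {n_obs p n\<^sub>1 (k - 1)<..n_obs p n\<^sub>1 k}"

definition estimator ::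
    "'w measure \<Rightarrow> 'x::metric_space set \<Rightarrow> (real ^ 'p) set \<Rightarrow> (nat \<Rightarrow> 'w \<Rightarrow> 'x) \<Rightarrow>
     (nat \<Rightarrow> 'w \<Rightarrow> real) \<Rightarrow> nat \<Rightarrow> ('w \<Rightarrow> real ^ 'p) \<Rightarrow> bool" where
  "estimator M XX \<Theta> X Y n T \<longleftrightarrow>
     (\<exists>g \<in> PiM {1..n} (\<lambda>_. restrict_space borel XX \<Otimes>\<^sub>M borel) \<rightarrow>\<^sub>M restrict_space borel \<Theta>.
        \<forall>\<omega>\<in>space M. T \<omega> = g (\<lambda>i\<in>{1..n}. (X i \<omega>, Y i \<omega>)))"

definition cond_a1 ::
    "'w measure \<Rightarrow> 'x::metric_space set \<Rightarrow> nat \<Rightarrow> nat \<Rightarrow> (nat \<Rightarrow> 'w \<Rightarrow> 'x) \<Rightarrow>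
     (nat \<Rightarrow> 'w \<Rightarrow> real) \<Rightarrow> (nat \<Rightarrow> 'w measure) \<Rightarrow> bool" where
  "cond_a1 M XX p n\<^sub>1 X Y F \<longleftrightarrow>
     filtration (space M) F \<and> (\<forall>k. subalgebra M (F k)) \<and>
     (\<forall>k\<ge>1.
        (\<lambda>\<omega>. \<lambda>i\<in>stage p n\<^sub>1 k. X i \<omega>)
          \<in> F (k - 1) \<rightarrow>\<^sub>M PiM (stage p n\<^sub>1 k) (\<lambda>_. restrict_space borel XX) \<and>
        (\<lambda>\<omega>. \<lambda>i\<in>stage p n\<^sub>1 k. Y i \<omega>)
          \<in> F k \<rightarrow>\<^sub>M PiM (stage p n\<^sub>1 k) (\<lambda>_. borel))"

text \<open>The kernel \<open>Q\<close> is a (regular) conditional distribution of the \<open>N\<close>-valued random element \<open>Z\<close>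
  given the sub-sigma-field \<open>F\<close>.\<close>

definition is_cond_distr ::
    "'w measure \<Rightarrow> 'w measure \<Rightarrow> 'e measure \<Rightarrow> ('w \<Rightarrow> 'e) \<Rightarrow> ('w \<Rightarrow> 'e measure) \<Rightarrow> bool" where
  "is_cond_distr M F N Z Q \<longleftrightarrow>
     Q \<in> F \<rightarrow>\<^sub>M prob_algebra N \<and>
     (\<forall>B\<in>sets N. AE \<omega> in M. real_cond_exp M F (\<lambda>\<omega>. indicator B (Z \<omega>)) \<omega> = measure (Q \<omega>) B)"

definition cond_a2' ::
    "'w measure \<Rightarrow> nat \<Rightarrow> nat \<Rightarrow> (nat \<Rightarrow> 'w \<Rightarrow> 'x) \<Rightarrow> (nat \<Rightarrow> 'w \<Rightarrow> real) \<Rightarrow> (nat \<Rightarrow> 'w measure) \<Rightarrow>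
     real set \<Rightarrow> (real \<Rightarrow> real) \<Rightarrow> (real \<Rightarrow> real measure) \<Rightarrow> (real \<Rightarrow> real) \<Rightarrow>
     ('x \<Rightarrow> real ^ 'p) \<Rightarrow> real ^ 'p \<Rightarrow> bool" where
  "cond_a2' M p n\<^sub>1 X Y F J b P G f \<theta>\<^sub>0 \<longleftrightarrow>
     (\<forall>k\<ge>1. is_cond_distr M (F (k - 1)) (PiM (stage p n\<^sub>1 k) (\<lambda>_. borel))
        (\<lambda>\<omega>. \<lambda>i\<in>stage p n\<^sub>1 k. Y i \<omega>)
        (\<lambda>\<omega>. PiM (stage p n\<^sub>1 k) (\<lambda>i. P (nat_param J b G (f (X i \<omega>) \<bullet> \<theta>\<^sub>0)))))"

definition sq_det_cols ::
    "('t \<Rightarrow> 'x \<Rightarrow> real ^ 'p) \<Rightarrow> 't \<Rightarrow> ('p \<Rightarrow> 'x) \<Rightarrow> real" where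
  "sq_det_cols f\<^sub>\<theta> \<theta> z = (det (\<chi> i j. f\<^sub>\<theta> \<theta> (z j) $ i))\<^sup>2"

text \<open>\<open>to_nat_on UNIV\<close> enumerates the column index type \<open>'p\<close> by \<open>0, \<dots>, p - 1\<close>. The squared
  determinant does not depend on the order of the columns, hence not on this enumeration.\<close>

definition p_step_ahead ::
    "'w measure \<Rightarrow> 'x set \<Rightarrow> nat \<Rightarrow> (nat \<Rightarrow> 'w \<Rightarrow> 'x) \<Rightarrow> ('t \<Rightarrow> 'x \<Rightarrow> real ^ 'p) \<Rightarrow>
     (nat \<Rightarrow> 'w \<Rightarrow> 't) \<Rightarrow> bool" where
  "p_step_ahead M XX n\<^sub>1 X f\<^sub>\<theta> T \<longleftrightarrow>
     (\<forall>k\<ge>1. \<forall>\<omega>\<in>space M.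
        is_arg_max (sq_det_cols f\<^sub>\<theta> (T k \<omega>)) (\<lambda>z. \<forall>j. z j \<in> XX)
          (\<lambda>j::'p. X (n_obs CARD('p) n\<^sub>1 k + 1 + to_nat_on UNIV j) \<omega>))"

text \<open>The log-likelihood takes values in the extended reals because \<open>K\<close> may vanish, in which case
  \<open>log K = -\<infinity>\<close>.\<close>

definition log_lik ::
    "real set \<Rightarrow> (real \<Rightarrow> real) \<Rightarrow> (real \<Rightarrow> real) \<Rightarrow> (real \<Rightarrow> real) \<Rightarrow> ('x \<Rightarrow> real ^ 'p) \<Rightarrow>
     (nat \<Rightarrow> 'x) \<Rightarrow> (nat \<Rightarrow> real) \<Rightarrow> nat \<Rightarrow> real ^ 'p \<Rightarrow> ereal" where
  "log_lik J b K G f x y n \<theta> =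
     (\<Sum>i=1..n. (if K (y i) = 0 then -\<infinity> else ereal (ln (K (y i)))) +
        ereal (nat_param J b G (f (x i) \<bullet> \<theta>) * y i - b (nat_param J b G (f (x i) \<bullet> \<theta>))))"

definition adaptive_mle ::
    "'w measure \<Rightarrow> 'x::metric_space set \<Rightarrow> (real ^ 'p) set \<Rightarrow> nat \<Rightarrow> (nat \<Rightarrow> 'w \<Rightarrow> 'x) \<Rightarrow>
     (nat \<Rightarrow> 'w \<Rightarrow> real) \<Rightarrow> real set \<Rightarrow> (real \<Rightarrow> real) \<Rightarrow> (real \<Rightarrow> real) \<Rightarrow> (real \<Rightarrow> real) \<Rightarrow>
     ('x \<Rightarrow> real ^ 'p) \<Rightarrow> (nat \<Rightarrow> 'w \<Rightarrow> real ^ 'p) \<Rightarrow> bool" where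
  "adaptive_mle M XX \<Theta> n\<^sub>1 X Y J b K G f T \<longleftrightarrow>
     (\<forall>k\<ge>1. estimator M XX \<Theta> X Y (n_obs CARD('p) n\<^sub>1 k) (T k) \<and>
        (\<forall>\<omega>\<in>space M. is_arg_max
           (log_lik J b K G f (\<lambda>i. X i \<omega>) (\<lambda>i. Y i \<omega>) (n_obs CARD('p) n\<^sub>1 k))
           (\<lambda>\<theta>. \<theta> \<in> \<Theta>) (T k \<omega>)))"

text \<open>The density formula gives \<open>N(0, C)\<close> for positive definite \<open>C\<close> only.\<close>

definition mvnormal :: "real ^ 'p ^ 'p \<Rightarrow> (real ^ 'p) measure" where
  "mvnormal C = density lborel
     (\<lambda>x. ennreal (exp (- (x \<bullet> (matrix_inv C *v x)) / 2) / sqrt ((2 * pi) ^ CARD('p) * det C)))"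

definition converges_in_distribution ::
    "'w measure \<Rightarrow> (nat \<Rightarrow> 'w \<Rightarrow> 'e::topological_space) \<Rightarrow> 'e measure \<Rightarrow> bool" where
  "converges_in_distribution M Z N \<longleftrightarrow>
     (\<forall>g::'e \<Rightarrow> real. continuous_on UNIV g \<and> bounded (range g) \<longrightarrow>
        (\<lambda>k. \<integral>\<omega>. g (Z k \<omega>) \<partial>M) \<longlonglongrightarrow> (\<integral>z. g z \<partial>N))"

end

theory Submission
  imports Defs
begin

text \<open>
  Conditionally on the past the responses of a stage are independent with moments that are bounded
  uniformly over the compact design region. Hence the exponential of a weighted sum of the centred
  responses, compensated by half its conditional variance, has an expectation that moves by a
  third-order term per stage. This one estimate yields the law of large numbers (scaling \<open>1 / n\<close>)
  and the central limit theorem (scaling \<open>1 / sqrt n\<close>) for the score; for the latter the normalised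
  conditional variance has to converge, and it does: the blocks chosen by the algorithm maximise a
  determinant at a parameter tending to the truth, so by compactness and (SD) their information
  matrices converge to that of a D-optimal saturated design, and Cesaro averaging preserves the limit.

  The log-likelihood ratio is a sum of Kullback-Leibler divergences, which is bounded below by a
  positive definite quadratic form in the parameter, minus a noise term that is small uniformly in the
  parameter by the law of large numbers on a finite net; so the maximiser is consistent. Expanding the
  score equation at the maximiser then transfers the central limit theorem to the estimator. The limit
  law is identified through characteristic functions.
\<close>

section \<open>Gaussian measure\<close>

text \<open>Because the design is adaptive, the responses are neither independent nor identically
  distributed, and the conditional variance of the score is random. Multiplying by the exponential
  of half that variance cancels the random decay of the characteristic function. This factor stays
  bounded because the scalings satisfy n * s^2 <= 1, and it is traded for a constant only at the
  end, by dominated convergence. No Lindeberg condition is checked: the linear predictors lie in a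
  compact part of the open \<open>I\<close>, the natural parameters in a compact subinterval of
  \<open>J\<close>, and third moments are bounded there. The maximum likelihood estimator has no a
  priori rate. The remainder of the score expansion is therefore bounded by a small multiple of the
  estimation error itself, and invertibility of the limit matrix absorbs it. The square of
  \<open>glm_phi\<close> is both the weight in the negative mean derivative of the score and the
  conditional variance factor of a score summand; this coincidence makes the limit covariance a
  plain inverse rather than a sandwich.\<close>

definition gauss :: "'a::euclidean_space measure" where
  "gauss = density lborel (\<lambda>y. ennreal (exp (- (norm y)\<^sup>2 / 2) / sqrt (2 * pi) ^ DIM('a)))"

text \<open>This is the characteristic function of the standard normal distribution with the density
  written out and its normalisation moved to the right-hand side.\<close>

lemma gauss_fourier_real:
  "integrable lborel (\<lambda>x. iexp (t * x) * complex_of_real (exp (- x\<^sup>2 / 2)))" (is ?A)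
  "(\<integral>x. iexp (t * x) * complex_of_real (exp (- x\<^sup>2 / 2)) \<partial>lborel) =
     complex_of_real (sqrt (2 * pi) * exp (- t\<^sup>2 / 2))" (is ?B)
proof -
  have eq: "iexp (t * x) * complex_of_real (exp (- x\<^sup>2 / 2))
      = complex_of_real (sqrt (2 * pi)) * (std_normal_density x *\<^sub>R iexp (t * x))" for x
    by (simp add: std_normal_density_def scaleR_conv_of_real)
  interpret N: real_distribution std_normal_distribution by (rule real_dist_normal_dist)
  have "integrable std_normal_distribution (\<lambda>x. iexp (t * x))"
    by (rule N.integrable_iexp) auto
  then have int: "integrable lborel (\<lambda>x. std_normal_density x *\<^sub>R iexp (t * x))"
    by (subst (asm) integrable_density) auto
  then show ?A unfolding eq by (rule integrable_mult_right)
  have "(\<integral>x. std_normal_density x *\<^sub>R iexp (t * x) \<partial>lborel) = char std_normal_distribution t"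
    unfolding char_def by (subst integral_density) auto
  then show ?B unfolding eq integral_mult_right_zero by (simp add: char_std_normal_distribution)
qed

text \<open>Lebesgue measure is the image of a product of one-dimensional ones, and both the
  character and the Gaussian factor over the coordinates. The integral is thus a product of
  one-dimensional Fourier integrals.\<close>

lemma gauss_fourier:
  fixes s :: "'a::euclidean_space"
  shows "integrable lborel (\<lambda>y. iexp (s \<bullet> y) * complex_of_real (exp (- (norm y)\<^sup>2 / 2)))" (is ?A)
  and "(\<integral>y. iexp (s \<bullet> y) * complex_of_real (exp (- (norm y)\<^sup>2 / 2)) \<partial>lborel) =
     complex_of_real (sqrt (2 * pi) ^ DIM('a) * exp (- (norm s)\<^sup>2 / 2))" (is ?B)
proof -
  let ?h = "\<lambda>y::'a. iexp (s \<bullet> y) * complex_of_real (exp (- (norm y)\<^sup>2 / 2))"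
  let ?S = "\<lambda>f. \<Sum>b\<in>(Basis::'a set). f b *\<^sub>R b"
  have fb: "?S f \<bullet> b = f b" if "b \<in> Basis" for f :: "'a \<Rightarrow> real" and b
    using that by (simp add: inner_sum_left_Basis)
  have eq: "?h (?S f) = (\<Prod>b\<in>Basis. iexp ((s \<bullet> b) * f b) * complex_of_real (exp (- (f b)\<^sup>2 / 2)))" for f
  proof -
    have "s \<bullet> ?S f = (\<Sum>b\<in>Basis. (s \<bullet> b) * f b)"
      by (simp add: inner_sum_right mult.commute)
    moreover have "(norm (?S f))\<^sup>2 = (\<Sum>b\<in>Basis. (f b)\<^sup>2)"
      by (subst power2_norm_eq_inner, subst euclidean_inner, simp add: fb power2_eq_square)
    ultimately show ?thesis
      by (simp add: prod.distrib sum_negf flip: exp_sum of_real_prod sum_distrib_left sum_divide_distrib)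
  qed
  interpret P: product_sigma_finite "\<lambda>_::'a. lborel :: real measure" ..
  have [measurable]: "?S \<in> (\<Pi>\<^sub>M b\<in>Basis. lborel) \<rightarrow>\<^sub>M borel" by measurable
  have hm: "?h \<in> borel_measurable borel" by measurable
  have "integrable (\<Pi>\<^sub>M b\<in>Basis. lborel) (\<lambda>f. ?h (?S f))"
    unfolding eq by (intro P.product_integrable_prod gauss_fourier_real) auto
  then show ?A by (subst lborel_eq, subst integrable_distr_eq) (use hm in auto)
  have "integral\<^sup>L lborel ?h = (\<integral>f. ?h (?S f) \<partial>(\<Pi>\<^sub>M b\<in>Basis. lborel))"
    by (subst lborel_eq, subst integral_distr) (use hm in auto)
  also have "\<dots> = (\<Prod>b\<in>Basis. complex_of_real (sqrt (2 * pi) * exp (- (s \<bullet> b)\<^sup>2 / 2)))"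
    unfolding eq by (subst P.product_integral_prod, simp, rule gauss_fourier_real) (simp only: gauss_fourier_real)
  also have "\<dots> = complex_of_real (sqrt (2 * pi) ^ DIM('a) * exp (- (norm s)\<^sup>2 / 2))"
  proof -
    have "(norm s)\<^sup>2 = (\<Sum>b\<in>Basis. (s \<bullet> b)\<^sup>2)"
      by (subst power2_norm_eq_inner, subst euclidean_inner, simp add: power2_eq_square)
    then show ?thesis
      by (simp add: prod.distrib sum_negf prod_constant flip: exp_sum of_real_prod sum_divide_distrib)
  qed
  finally show ?B .
qed

lemma sets_gauss [simp, measurable_cong]: "sets gauss = sets borel"
  and space_gauss [simp]: "space gauss = UNIV"
  by (simp_all add: gauss_def)

text \<open>The total mass is the Fourier integral at frequency 0.\<close>

lemma prob_space_gauss: "prob_space (gauss :: 'a::euclidean_space measure)"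
proof
  have int: "integrable lborel (\<lambda>y::'a. exp (- (norm y)\<^sup>2 / 2))"
    and val: "integral\<^sup>L lborel (\<lambda>y::'a. exp (- (norm y)\<^sup>2 / 2)) = sqrt (2 * pi) ^ DIM('a)"
    using gauss_fourier[of "0::'a"] unfolding inner_zero_left of_real_0 mult_zero_right exp_zero mult_1
      complex_of_real_integrable_eq integral_complex_of_real of_real_eq_iff by auto
  have "emeasure (gauss :: 'a measure) UNIV
      = integral\<^sup>N lborel (\<lambda>y::'a. ennreal (exp (- (norm y)\<^sup>2 / 2) / sqrt (2 * pi) ^ DIM('a)))"
    unfolding gauss_def by (subst emeasure_density) auto
  also have "\<dots> = ennreal (integral\<^sup>L lborel (\<lambda>y::'a. exp (- (norm y)\<^sup>2 / 2) / sqrt (2 * pi) ^ DIM('a)))"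
    by (rule nn_integral_eq_integral) (use int in auto)
  also have "\<dots> = 1" using val by simp
  finally show "emeasure (gauss :: 'a measure) (space gauss) = 1" by simp
qed

lemma gauss_char:
  fixes s :: "'a::euclidean_space"
  shows "(\<integral>y. iexp (s \<bullet> y) \<partial>gauss) = complex_of_real (exp (- (norm s)\<^sup>2 / 2))"
proof -
  let ?c = "sqrt (2 * pi) ^ DIM('a)"
  have "(\<integral>y. iexp (s \<bullet> y) \<partial>gauss)
      = (\<integral>y. (exp (- (norm y)\<^sup>2 / 2) / ?c) *\<^sub>R iexp (s \<bullet> y) \<partial>lborel)"
    unfolding gauss_def by (subst integral_density) auto
  also have "\<dots> = (\<integral>y. (iexp (s \<bullet> y) * complex_of_real (exp (- (norm y)\<^sup>2 / 2))) / complex_of_real ?c \<partial>lborel)"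
    by (intro Bochner_Integration.integral_cong) (auto simp: scaleR_conv_of_real)
  also have "\<dots> = complex_of_real (exp (- (norm s)\<^sup>2 / 2))"
    by (subst integral_divide_zero, subst gauss_fourier) simp
  finally show ?thesis .
qed

section \<open>Convergence of characteristic functions\<close>

text \<open>The substitution z = x + \<sigma> y moves \<open>x\<close> out of \<open>f\<close> and
  into the Gaussian kernel, so that a later integration over \<open>x\<close> acts on the kernel
  alone.\<close>

lemma gauss_smoothing:
  fixes f :: "'a::euclidean_space \<Rightarrow> real"
  assumes [measurable]: "f \<in> borel_measurable borel" and "0 < \<sigma>"
  shows "(\<integral>y. f (x + \<sigma> *\<^sub>R y) \<partial>gauss) =
    (\<integral>z. f z * (exp (- (norm ((1 / \<sigma>) *\<^sub>R (z - x)))\<^sup>2 / 2) / (sqrt (2 * pi) * \<sigma>) ^ DIM('a)) \<partial>lborel)"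
proof -
  let ?c = "sqrt (2 * pi) ^ DIM('a)"
  have "(\<integral>y. f (x + \<sigma> *\<^sub>R y) \<partial>gauss)
      = (\<integral>y. (exp (- (norm y)\<^sup>2 / 2) / ?c) * f (x + \<sigma> *\<^sub>R y) \<partial>lborel)"
    unfolding gauss_def by (subst integral_density) auto
  also have "\<dots> = (\<integral>z. f z * (exp (- (norm ((1 / \<sigma>) *\<^sub>R (z - x)))\<^sup>2 / 2) / (sqrt (2 * pi) * \<sigma>) ^ DIM('a)) \<partial>lborel)"
    using \<open>0 < \<sigma>\<close>
    apply (subst (2) lborel_affine[of \<sigma> x])
     apply simp
    apply (subst integral_density)
       apply (simp_all)
    apply (subst integral_distr)
      apply (simp_all add: power_mult_distrib)
    apply (intro Bochner_Integration.integral_cong)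
     apply (simp_all add: field_simps)
    done
  finally show ?thesis .
qed

text \<open>Fubini applies because the kernel is at most 1 and \<open>f\<close> is integrable.
  Afterwards \<mu> enters only through its average of the kernel, which
  \<open>gauss_kernel_char\<close> expresses by characteristic functions.\<close>

lemma expectation_smoothing:
  fixes f :: "'a::euclidean_space \<Rightarrow> real"
  assumes "prob_space \<mu>" and [measurable_cong]: "sets \<mu> = sets borel"
    and f: "integrable lborel f" and "0 < \<sigma>"
  shows "(\<integral>x. (\<integral>y. f (x + \<sigma> *\<^sub>R y) \<partial>gauss) \<partial>\<mu>) =
    (\<integral>z. f z * ((\<integral>x. exp (- (norm ((1 / \<sigma>) *\<^sub>R (z - x)))\<^sup>2 / 2) \<partial>\<mu>) / (sqrt (2 * pi) * \<sigma>) ^ DIM('a)) \<partial>lborel)"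
proof -
  interpret \<mu>: prob_space \<mu> by fact
  interpret pair_sigma_finite \<mu> "lborel :: 'a measure" ..
  let ?C = "(sqrt (2 * pi) * \<sigma>) ^ DIM('a)"
  let ?e = "\<lambda>x z::'a. exp (- (norm ((1 / \<sigma>) *\<^sub>R (z - x)))\<^sup>2 / 2)"
  have fm [measurable]: "f \<in> borel_measurable borel" using f by auto
  have e1: "?e x z \<le> 1" for x z by simp
  have fi: "integrable (\<mu> \<Otimes>\<^sub>M lborel) (\<lambda>(x, z). f z)"
    by (rule Fubini_integrable) (use f in \<open>auto simp: measurable_split_conv\<close>)
  have int: "integrable (\<mu> \<Otimes>\<^sub>M lborel) (\<lambda>(x, z). f z * (?e x z / ?C))"
  proof (rule Bochner_Integration.integrable_bound)
    show "integrable (\<mu> \<Otimes>\<^sub>M lborel) (\<lambda>p. (case p of (x, z) \<Rightarrow> f z) * (1 / ?C))"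
      using fi by simp
    show "(\<lambda>(x, z). f z * (?e x z / ?C)) \<in> borel_measurable (\<mu> \<Otimes>\<^sub>M lborel)"
      by (simp add: measurable_split_conv)
    have "norm (f z * (?e x z / ?C)) \<le> norm (f z * (1 / ?C))" for x z
    proof -
      have "\<bar>f z\<bar> * (?e x z / ?C) \<le> \<bar>f z\<bar> * (1 / ?C)"
        using \<open>0 < \<sigma>\<close> e1 by (intro mult_left_mono divide_right_mono) auto
      moreover have "0 \<le> ?e x z / ?C" "0 \<le> 1 / ?C" using \<open>0 < \<sigma>\<close> by auto
      ultimately show ?thesis by (simp only: real_norm_def abs_mult abs_of_nonneg)
    qed
    then show "AE p in \<mu> \<Otimes>\<^sub>M lborel. norm (case p of (x, z) \<Rightarrow> f z * (?e x z / ?C))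
        \<le> norm ((case p of (x, z) \<Rightarrow> f z) * (1 / ?C))"
      by (intro AE_I2) (simp only: split_beta)
  qed
  have "(\<integral>x. (\<integral>y. f (x + \<sigma> *\<^sub>R y) \<partial>gauss) \<partial>\<mu>) = (\<integral>x. (\<integral>z. f z * (?e x z / ?C) \<partial>lborel) \<partial>\<mu>)"
    by (subst gauss_smoothing) (use \<open>0 < \<sigma>\<close> in auto)
  also have "\<dots> = (\<integral>z. (\<integral>x. f z * (?e x z / ?C) \<partial>\<mu>) \<partial>lborel)"
    by (rule Fubini_integral[OF int, symmetric])
  finally show ?thesis by simp
qed

text \<open>By \<open>gauss_char\<close> the kernel is a Gaussian average of characters; exchanging
  the integrals leaves the characteristic function of \<mu> at frequency - t / \<sigma>.\<close>

lemma gauss_kernel_char: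
  fixes z :: "'a::euclidean_space"
  assumes "prob_space \<mu>" and [measurable_cong]: "sets \<mu> = sets borel"
  shows "complex_of_real (\<integral>x. exp (- (norm ((1 / \<sigma>) *\<^sub>R (z - x)))\<^sup>2 / 2) \<partial>\<mu>) =
    (\<integral>t. iexp ((1 / \<sigma>) *\<^sub>R t \<bullet> z) * (\<integral>x. iexp ((- 1 / \<sigma>) *\<^sub>R t \<bullet> x) \<partial>\<mu>) \<partial>gauss)"
proof -
  interpret \<mu>: prob_space \<mu> by fact
  interpret g: prob_space "gauss :: 'a measure" by (rule prob_space_gauss)
  interpret pair_prob_space \<mu> "gauss :: 'a measure" ..
  have int: "integrable (\<mu> \<Otimes>\<^sub>M gauss) (\<lambda>(x, t). iexp (((1 / \<sigma>) *\<^sub>R (z - x)) \<bullet> t))"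
    by (rule integrable_const_bound[where B=1]) (auto simp: measurable_split_conv)
  have "complex_of_real (\<integral>x. exp (- (norm ((1 / \<sigma>) *\<^sub>R (z - x)))\<^sup>2 / 2) \<partial>\<mu>)
     = (\<integral>x. (\<integral>t. iexp (((1 / \<sigma>) *\<^sub>R (z - x)) \<bullet> t) \<partial>gauss) \<partial>\<mu>)"
    by (simp only: gauss_char integral_complex_of_real)
  also have "\<dots> = (\<integral>t. (\<integral>x. iexp (((1 / \<sigma>) *\<^sub>R (z - x)) \<bullet> t) \<partial>\<mu>) \<partial>gauss)"
    by (rule Fubini_integral[OF int, symmetric])
  also have "\<dots> = (\<integral>t. (\<integral>x. iexp ((1 / \<sigma>) *\<^sub>R t \<bullet> z) * iexp ((- 1 / \<sigma>) *\<^sub>R t \<bullet> x) \<partial>\<mu>) \<partial>gauss)"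
    apply (intro Bochner_Integration.integral_cong refl)
    unfolding exp_add[symmetric]
    by (simp add: algebra_simps inner_commute diff_divide_distrib)
  finally show ?thesis by simp
qed

text \<open>Smoothing \<open>f\<close> with a Gaussian of small variance changes its integrals by little, and the
  integral of the smoothed function depends on the measure through its characteristic function only,
  because the Gaussian kernel is itself a Gaussian average of characters.\<close>

lemma weak_conv_compact_support:
  fixes \<mu> :: "nat \<Rightarrow> 'a::euclidean_space measure" and f :: "'a \<Rightarrow> real"
  assumes \<mu>: "\<And>k. prob_space (\<mu> k)" "\<And>k. sets (\<mu> k) = sets borel"
    and N: "prob_space N" "sets N = sets borel"
    and char: "\<And>t. (\<lambda>k. \<integral>x. iexp (t \<bullet> x) \<partial>\<mu> k) \<longlonglongrightarrow> (\<integral>x. iexp (t \<bullet> x) \<partial>N)"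
    and f: "continuous_on UNIV f" and S: "compact S" "\<And>x. x \<notin> S \<Longrightarrow> f x = 0"
  shows "(\<lambda>k. \<integral>x. f x \<partial>\<mu> k) \<longlonglongrightarrow> (\<integral>x. f x \<partial>N)"
proof -
  interpret g: prob_space "gauss :: 'a measure" by (rule prob_space_gauss)
  have fm [measurable]: "f \<in> borel_measurable borel"
    using f by (rule borel_measurable_continuous_onI)
  have fi: "integrable lborel f"
  proof -
    have "integrable lborel (\<lambda>x. indicator S x *\<^sub>R f x)"
      by (rule borel_integrable_compact) (use S f in \<open>auto intro: continuous_on_subset\<close>)
    also have "(\<lambda>x. indicator S x *\<^sub>R f x) = f" using S by (intro ext) (auto simp: indicator_def)
    finally show ?thesis .
  qed
  have "compact (f ` S)" using f S by (auto intro: compact_continuous_image continuous_on_subset)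
  then obtain B0 where "\<And>x. x \<in> S \<Longrightarrow> norm (f x) \<le> B0"
    by (meson bounded_iff compact_imp_bounded imageI)
  then have B: "\<bar>f x\<bar> \<le> max B0 0" for x using S by (cases "x \<in> S") (auto simp: le_max_iff_disj)
  define B where "B = max B0 0"
  have B: "\<bar>f x\<bar> \<le> B" and B0: "0 \<le> B" for x using B by (auto simp: B_def)
  \<comment> \<open>If one of two points at distance below 1 lies in \<open>S\<close>, both lie in
    the ball of radius R + 1, where compactness gives uniform continuity; otherwise both values are
    0.\<close>
  have uc: "uniformly_continuous_on UNIV f"
  proof -
    obtain R where R: "S \<subseteq> cball 0 R" using S(1) compact_imp_bounded bounded_iff[of S] by (metis mem_cball_0 subsetI)
    have "uniformly_continuous_on (cball 0 (R + 1)) f"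
      by (rule compact_uniformly_continuous) (use f in \<open>auto intro: continuous_on_subset\<close>)
    show ?thesis unfolding uniformly_continuous_on_def
    proof (intro allI impI)
      fix e :: real assume "0 < e"
      with \<open>uniformly_continuous_on (cball 0 (R + 1)) f\<close> obtain d where
        d: "0 < d" "\<And>x y. x \<in> cball 0 (R+1) \<Longrightarrow> y \<in> cball 0 (R+1) \<Longrightarrow> dist y x < d \<Longrightarrow> dist (f y) (f x) < e"
        unfolding uniformly_continuous_on_def by meson
      show "\<exists>d>0. \<forall>x\<in>UNIV. \<forall>x'\<in>UNIV. dist x' x < d \<longrightarrow> dist (f x') (f x) < e"
      proof (intro exI[of _ "min d 1"] conjI ballI impI)
        fix x x' :: 'a assume xx: "dist x' x < min d 1"
        show "dist (f x') (f x) < e"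
        proof (cases "x \<in> S \<or> x' \<in> S")
          case True
          then have "norm x \<le> R \<or> norm x' \<le> R" using R by auto
          moreover have "norm x \<le> norm x' + dist x' x" "norm x' \<le> norm x + dist x' x"
            by norm+
          ultimately have "norm x \<le> R + 1" "norm x' \<le> R + 1" using xx by auto
          then show ?thesis using d(2)[of x x'] xx by auto
        qed (use S \<open>0 < e\<close> in auto)
      qed (use d in auto)
    qed
  qed
  define sm where "sm \<sigma> x = (\<integral>y. f (x + \<sigma> *\<^sub>R y) \<partial>gauss)" for \<sigma> x
  have approx: "\<exists>\<sigma>>0. \<forall>x. \<bar>sm \<sigma> x - f x\<bar> \<le> \<epsilon>" if "0 < \<epsilon>" for \<epsilon>
  proof -
    obtain d where d: "0 < d" "\<And>x y. dist y x < d \<Longrightarrow> dist (f y) (f x) < \<epsilon> / 2"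
      using uc \<open>0 < \<epsilon>\<close> unfolding uniformly_continuous_on_def by (meson UNIV_I half_gt_zero)
    \<comment> \<open>The Gaussian tail vanishes. Outside a large ball the difference of values of
      \<open>f\<close> is bounded crudely by 2 * B.\<close>
    have "(\<lambda>n. g.expectation (\<lambda>y. indicator {y. real n < norm y} y :: real)) \<longlonglongrightarrow> g.expectation (\<lambda>y::'a. 0 :: real)"
    proof (rule integral_dominated_convergence[where w="\<lambda>_. 1"])
      have "(\<lambda>n. indicator {y. real n < norm y} y :: real) \<longlonglongrightarrow> 0" for y :: 'a
      proof (rule tendsto_eventually)
        show "\<forall>\<^sub>F n in sequentially. (indicator {y. real n < norm y} y :: real) = 0"
          using eventually_ge_at_top[of "nat \<lceil>norm y\<rceil>"]
          by eventually_elim (auto simp: indicator_def ceiling_le_iff nat_le_iff)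
      qed
      then show "AE y::'a in gauss. (\<lambda>n. indicator {y. real n < norm y} y :: real) \<longlonglongrightarrow> 0" by simp
    qed (auto simp: indicator_def)
    then have "(\<lambda>n. 2 * B * g.expectation (\<lambda>y. indicator {y. real n < norm y} y :: real)) \<longlonglongrightarrow> 0"
      by (auto intro: tendsto_mult_right_zero)
    then obtain n where n: "2 * B * g.expectation (\<lambda>y. indicator {y. real n < norm y} y :: real) < \<epsilon> / 2"
      using \<open>0 < \<epsilon>\<close> by (metis (no_types, lifting) eventually_sequentially half_gt_zero order_tendstoD(2) order_refl)
    \<comment> \<open>With this choice every y of norm at most n moves the argument by less than
      \<open>d\<close>.\<close>
    define \<sigma> where "\<sigma> = d / (real n + 1)"
    have \<sigma>: "0 < \<sigma>" using d by (simp add: \<sigma>_def)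
    have "\<bar>sm \<sigma> x - f x\<bar> \<le> \<epsilon>" for x
    proof -
      have fint: "integrable gauss (\<lambda>y. f (x + \<sigma> *\<^sub>R y))"
        by (rule g.integrable_const_bound[where B=B]) (use B in auto)
      have iint: "integrable gauss (\<lambda>y::'a. indicator {y. real n < norm y} y :: real)"
        by (rule g.integrable_const_bound[where B=1]) (auto simp: indicator_def)
      have pt: "\<bar>f (x + \<sigma> *\<^sub>R y) - f x\<bar> \<le> \<epsilon> / 2 + 2 * B * indicator {y. real n < norm y} y" for y
      proof (cases "real n < norm y")
        case True then show ?thesis using B[of x] B[of "x + \<sigma> *\<^sub>R y"] \<open>0 < \<epsilon>\<close> by simp
      next
        case False
        have "\<sigma> * norm y \<le> d * (real n / (real n + 1))"
          using False \<sigma> d by (simp add: \<sigma>_def divide_right_mono)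
        also have "\<dots> < d" using d by (simp add: field_simps)
        finally have "dist (x + \<sigma> *\<^sub>R y) x < d" using \<sigma> by (simp add: dist_norm)
        from d(2)[OF this] show ?thesis using False by (simp add: dist_real_def)
      qed
      have "sm \<sigma> x - f x = (\<integral>y. f (x + \<sigma> *\<^sub>R y) - f x \<partial>gauss)"
        unfolding sm_def using fint by (simp add: g.prob_space[simplified])
      also have "\<bar>\<dots>\<bar> \<le> (\<integral>y. \<bar>f (x + \<sigma> *\<^sub>R y) - f x\<bar> \<partial>gauss)"
        by (rule integral_abs_bound)
      also have "\<dots> \<le> (\<integral>y. \<epsilon> / 2 + 2 * B * indicator {y::'a. real n < norm y} y \<partial>gauss)"
        by (rule integral_mono) (use fint iint pt in auto)
      also have "\<dots> \<le> \<epsilon>" using n iint by (simp add: g.prob_space[simplified])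
      finally show ?thesis .
    qed
    with \<sigma> show ?thesis by blast
  qed
  have sm_conv: "(\<lambda>k. \<integral>x. sm \<sigma> x \<partial>\<mu> k) \<longlonglongrightarrow> (\<integral>x. sm \<sigma> x \<partial>N)" if "0 < \<sigma>" for \<sigma>
  proof -
    let ?C = "(sqrt (2 * pi) * \<sigma>) ^ DIM('a)"
    let ?p = "\<lambda>\<nu> z. \<integral>x. exp (- (norm ((1 / \<sigma>) *\<^sub>R (z - x)))\<^sup>2 / 2) \<partial>\<nu>"
    have pm [measurable]: "?p \<nu> \<in> borel_measurable borel" if "prob_space \<nu>" "sets \<nu> = sets borel" for \<nu> :: "'a measure"
    proof -
      interpret \<nu>: prob_space \<nu> by fact
      note [measurable_cong] = that(2)
      show ?thesis by measurable
    qed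
    have p1: "\<bar>?p \<nu> z\<bar> \<le> 1" if "prob_space \<nu>" "sets \<nu> = sets borel" for \<nu> :: "'a measure" and z
    proof -
      interpret \<nu>: prob_space \<nu> by fact
      note [measurable_cong] = that(2)
      have "\<bar>?p \<nu> z\<bar> \<le> (\<integral>x. \<bar>exp (- (norm ((1 / \<sigma>) *\<^sub>R (z - x)))\<^sup>2 / 2)\<bar> \<partial>\<nu>)"
        by (rule integral_abs_bound)
      also have "\<dots> \<le> (\<integral>x. 1 \<partial>\<nu>)"
        by (rule integral_mono) (auto intro!: \<nu>.integrable_const_bound[where B=1])
      finally show ?thesis by (simp add: \<nu>.prob_space)
    qed
    have pconv: "(\<lambda>k. ?p (\<mu> k) z) \<longlonglongrightarrow> ?p N z" for z
    proof -
      have "(\<lambda>k. complex_of_real (?p (\<mu> k) z)) \<longlonglongrightarrow> complex_of_real (?p N z)"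
        unfolding gauss_kernel_char[OF \<mu>] gauss_kernel_char[OF N]
      proof (rule integral_dominated_convergence[where w="\<lambda>_. 1"])
        have cm: "(\<lambda>t. \<integral>x. iexp ((- 1 / \<sigma>) *\<^sub>R t \<bullet> x) \<partial>\<nu>) \<in> borel_measurable borel"
          if "prob_space \<nu>" "sets \<nu> = sets borel" for \<nu> :: "'a measure"
        proof -
          interpret \<nu>: prob_space \<nu> by fact
          note [measurable_cong] = that(2)
          show ?thesis by measurable
        qed
        note [measurable] = cm[OF \<mu>] cm[OF N]
        show "(\<lambda>t. iexp ((1 / \<sigma>) *\<^sub>R t \<bullet> z) * (CLINT x|N. iexp ((- 1 / \<sigma>) *\<^sub>R t \<bullet> x))) \<in> borel_measurable gauss"
          by measurable
        show "(\<lambda>t. iexp ((1 / \<sigma>) *\<^sub>R t \<bullet> z) * (CLINT x|\<mu> k. iexp ((- 1 / \<sigma>) *\<^sub>R t \<bullet> x))) \<in> borel_measurable gauss" for k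
          by measurable
        show "AE t in gauss. (\<lambda>k. iexp ((1 / \<sigma>) *\<^sub>R t \<bullet> z) * (CLINT x|\<mu> k. iexp ((- 1 / \<sigma>) *\<^sub>R t \<bullet> x)))
           \<longlonglongrightarrow> iexp ((1 / \<sigma>) *\<^sub>R t \<bullet> z) * (CLINT x|N. iexp ((- 1 / \<sigma>) *\<^sub>R t \<bullet> x))"
          by (intro AE_I2 tendsto_mult tendsto_const char)
        fix k
        interpret k: prob_space "\<mu> k" by (rule \<mu>)
        note [measurable_cong] = \<mu>(2)[of k]
        have "norm (CLINT x|\<mu> k. iexp ((- 1 / \<sigma>) *\<^sub>R t \<bullet> x)) \<le> 1" for t
        proof -
          have "norm (CLINT x|\<mu> k. iexp ((- 1 / \<sigma>) *\<^sub>R t \<bullet> x)) \<le> (\<integral>x. norm (iexp ((- 1 / \<sigma>) *\<^sub>R t \<bullet> x)) \<partial>\<mu> k)"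
            by (rule integral_norm_bound)
          then show ?thesis by (simp add: k.prob_space)
        qed
        then show "AE t in gauss. norm (iexp ((1 / \<sigma>) *\<^sub>R t \<bullet> z) * (CLINT x|\<mu> k. iexp ((- 1 / \<sigma>) *\<^sub>R t \<bullet> x))) \<le> 1"
          by (intro AE_I2) (simp add: norm_mult)
      qed auto
      then show ?thesis by (simp only: tendsto_of_real_iff)
    qed
    \<comment> \<open>The averaged kernels converge pointwise and are at most 1, so the Lebesgue
      integrable \<open>f\<close> dominates; compact support is what makes \<open>f\<close>
      integrable.\<close>
    have "(\<lambda>k. \<integral>z. f z * (?p (\<mu> k) z / ?C) \<partial>lborel) \<longlonglongrightarrow> (\<integral>z. f z * (?p N z / ?C) \<partial>lborel)"
    proof (rule integral_dominated_convergence[where w="\<lambda>z. \<bar>f z\<bar> / ?C"])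
      note [measurable] = pm[OF \<mu>] pm[OF N]
      show "AE z in lborel. (\<lambda>k. f z * (?p (\<mu> k) z / ?C)) \<longlonglongrightarrow> f z * (?p N z / ?C)"
        using \<open>0 < \<sigma>\<close> by (intro AE_I2 tendsto_intros pconv) auto
      show "integrable lborel (\<lambda>z. \<bar>f z\<bar> / ?C)" using fi by auto
      show "(\<lambda>z. f z * (?p N z / ?C)) \<in> borel_measurable lborel" by measurable
      show "(\<lambda>z. f z * (?p (\<mu> k) z / ?C)) \<in> borel_measurable lborel" for k by measurable
      show "AE z in lborel. norm (f z * (?p (\<mu> k) z / ?C)) \<le> \<bar>f z\<bar> / ?C" for k
      proof (rule AE_I2)
        fix z
        have "\<bar>f z\<bar> * (\<bar>?p (\<mu> k) z\<bar> / ?C) \<le> \<bar>f z\<bar> * (1 / ?C)"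
          using \<open>0 < \<sigma>\<close> p1[OF \<mu>, of k z] by (intro mult_left_mono divide_right_mono) auto
        then show "norm (f z * (?p (\<mu> k) z / ?C)) \<le> \<bar>f z\<bar> / ?C"
          using \<open>0 < \<sigma>\<close> by (simp add: abs_mult)
      qed
    qed
    then show ?thesis
      unfolding sm_def expectation_smoothing[OF \<mu> fi \<open>0 < \<sigma>\<close>] expectation_smoothing[OF N fi \<open>0 < \<sigma>\<close>] .
  qed
  have diff: "\<bar>(\<integral>x. sm \<sigma> x \<partial>\<nu>) - (\<integral>x. f x \<partial>\<nu>)\<bar> \<le> \<epsilon>"
    if "prob_space \<nu>" "sets \<nu> = sets borel" "\<forall>x. \<bar>sm \<sigma> x - f x\<bar> \<le> \<epsilon>" for \<nu> :: "'a measure" and \<sigma> \<epsilon>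
  proof -
    interpret \<nu>: prob_space \<nu> by fact
    note [measurable_cong] = that(2)
    have sb: "\<bar>sm \<sigma> x\<bar> \<le> B + \<epsilon>" for x using that(3)[rule_format, of x] B[of x] by linarith
    have [measurable]: "sm \<sigma> \<in> borel_measurable borel" unfolding sm_def by measurable
    have i1: "integrable \<nu> (sm \<sigma>)"
      by (rule \<nu>.integrable_const_bound[where B="B + \<epsilon>"]) (use sb in auto)
    have i2: "integrable \<nu> f"
      by (rule \<nu>.integrable_const_bound[where B=B]) (use B in auto)
    have "\<bar>(\<integral>x. sm \<sigma> x \<partial>\<nu>) - (\<integral>x. f x \<partial>\<nu>)\<bar> = \<bar>\<integral>x. sm \<sigma> x - f x \<partial>\<nu>\<bar>" using i1 i2 by simp
    also have "\<dots> \<le> (\<integral>x. \<bar>sm \<sigma> x - f x\<bar> \<partial>\<nu>)" by (rule integral_abs_bound)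
    also have "\<dots> \<le> (\<integral>x. \<epsilon> \<partial>\<nu>)" by (rule integral_mono) (use i1 i2 that(3) in auto)
    finally show ?thesis by (simp add: \<nu>.prob_space)
  qed
  show ?thesis
  proof (rule LIMSEQ_I)
    fix r :: real assume "0 < r"
    then obtain \<sigma> where \<sigma>: "0 < \<sigma>" "\<forall>x. \<bar>sm \<sigma> x - f x\<bar> \<le> r / 4" using approx[of "r/4"] by auto
    obtain n0 where n0: "\<And>k. k \<ge> n0 \<Longrightarrow> norm ((\<integral>x. sm \<sigma> x \<partial>\<mu> k) - (\<integral>x. sm \<sigma> x \<partial>N)) < r / 4"
      using LIMSEQ_D[OF sm_conv[OF \<sigma>(1)], of "r/4"] \<open>0 < r\<close> by auto
    have "norm ((\<integral>x. f x \<partial>\<mu> k) - (\<integral>x. f x \<partial>N)) < r" if "k \<ge> n0" for k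
      using n0[OF that] diff[OF \<mu> \<sigma>(2), of k] diff[OF N \<sigma>(2)] \<open>0 < r\<close>
      unfolding real_norm_def abs_le_iff abs_less_iff by linarith
    then show "\<exists>n0. \<forall>k\<ge>n0. norm ((\<integral>x. f x \<partial>\<mu> k) - (\<integral>x. f x \<partial>N)) < r" by blast
  qed
qed

text \<open>Tightness need not be assumed. A compactly supported cut-off that carries almost all
  mass of \<open>N\<close> also carries almost all mass of \<open>\<mu> k\<close> for large k,
  because its integrals converge; hence replacing \<open>f\<close> by its product with the cut-off
  costs little on either side.\<close>

theorem char_conv_imp_weak_conv:
  fixes \<mu> :: "nat \<Rightarrow> 'a::euclidean_space measure" and f :: "'a \<Rightarrow> real"
  assumes \<mu>: "\<And>k. prob_space (\<mu> k)" "\<And>k. sets (\<mu> k) = sets borel"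
    and N: "prob_space N" "sets N = sets borel"
    and char: "\<And>t. (\<lambda>k. \<integral>x. iexp (t \<bullet> x) \<partial>\<mu> k) \<longlonglongrightarrow> (\<integral>x. iexp (t \<bullet> x) \<partial>N)"
    and f: "continuous_on UNIV f" "bounded (range f)"
  shows "(\<lambda>k. \<integral>x. f x \<partial>\<mu> k) \<longlonglongrightarrow> (\<integral>x. f x \<partial>N)"
proof -
  interpret N: prob_space N by (rule N)
  note [measurable_cong] = \<mu>(2) N(2)
  have fm [measurable]: "f \<in> borel_measurable borel"
    using f(1) by (rule borel_measurable_continuous_onI)
  obtain B where B: "0 < B" "\<And>x. \<bar>f x\<bar> \<le> B"
    using f(2) unfolding bounded_pos by auto
  define \<eta> where "\<eta> n x = max 0 (min 1 (real n + 1 - norm x))" for n and x :: 'a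
  have \<eta>01: "0 \<le> \<eta> n x" "\<eta> n x \<le> 1" for n x by (auto simp: \<eta>_def)
  have \<eta>c: "continuous_on UNIV (\<eta> n)" for n
    unfolding \<eta>_def by (intro continuous_intros)
  have [measurable]: "\<eta> n \<in> borel_measurable borel" for n
    using \<eta>c by (rule borel_measurable_continuous_onI)
  have \<eta>0: "\<eta> n x = 0" if "x \<notin> cball 0 (real n + 1)" for n x using that by (auto simp: \<eta>_def)
  have cv: "(\<lambda>k. \<integral>x. \<eta> n x \<partial>\<mu> k) \<longlonglongrightarrow> (\<integral>x. \<eta> n x \<partial>N)" for n
    by (rule weak_conv_compact_support[OF \<mu> N char \<eta>c, of "cball 0 (real n + 1)"]) (use \<eta>0 in auto)
  have fcv: "(\<lambda>k. \<integral>x. f x * \<eta> n x \<partial>\<mu> k) \<longlonglongrightarrow> (\<integral>x. f x * \<eta> n x \<partial>N)" for n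
    by (rule weak_conv_compact_support[OF \<mu> N char continuous_on_mult[OF f(1) \<eta>c], of "cball 0 (real n + 1)"])
       (use \<eta>0 in auto)
  have lim: "(\<lambda>n. \<integral>x. \<eta> n x \<partial>N) \<longlonglongrightarrow> (\<integral>x. 1 \<partial>N)"
  proof (rule integral_dominated_convergence[where w="\<lambda>_. 1"])
    have "(\<lambda>n. \<eta> n x) \<longlonglongrightarrow> 1" for x
    proof (rule tendsto_eventually)
      show "\<forall>\<^sub>F n in sequentially. \<eta> n x = 1"
        using eventually_ge_at_top[of "nat \<lceil>norm x\<rceil>"]
        by eventually_elim (auto simp: \<eta>_def ceiling_le_iff nat_le_iff)
    qed
    then show "AE x in N. (\<lambda>n. \<eta> n x) \<longlonglongrightarrow> 1" by simp
  qed (use \<eta>01 in auto)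
  have diff: "\<bar>(\<integral>x. f x \<partial>\<nu>) - (\<integral>x. f x * \<eta> n x \<partial>\<nu>)\<bar> \<le> B * (1 - (\<integral>x. \<eta> n x \<partial>\<nu>))"
    if "prob_space \<nu>" "sets \<nu> = sets borel" for \<nu> :: "'a measure" and n
  proof -
    interpret \<nu>: prob_space \<nu> by fact
    note [measurable_cong] = that(2)
    have i1: "integrable \<nu> f" by (rule \<nu>.integrable_const_bound[where B=B]) (use B in auto)
    have i2: "integrable \<nu> (\<eta> n)" by (rule \<nu>.integrable_const_bound[where B=1]) (use \<eta>01 in auto)
    have i3: "integrable \<nu> (\<lambda>x. f x * \<eta> n x)"
      by (rule \<nu>.integrable_const_bound[where B="B * 1"])
         (use B \<eta>01 in \<open>auto simp: abs_mult intro!: mult_mono simp del: mult_1_right\<close>)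
    have "\<bar>(\<integral>x. f x \<partial>\<nu>) - (\<integral>x. f x * \<eta> n x \<partial>\<nu>)\<bar> = \<bar>\<integral>x. f x - f x * \<eta> n x \<partial>\<nu>\<bar>" using i1 i3 by simp
    also have "\<dots> \<le> (\<integral>x. \<bar>f x - f x * \<eta> n x\<bar> \<partial>\<nu>)" by (rule integral_abs_bound)
    also have "\<dots> \<le> (\<integral>x. B * (1 - \<eta> n x) \<partial>\<nu>)"
    proof (rule integral_mono)
      fix x
      have "\<bar>f x - f x * \<eta> n x\<bar> = \<bar>f x\<bar> * (1 - \<eta> n x)"
        using \<eta>01[of n x] abs_mult[of "f x" "1 - \<eta> n x"] by (simp add: algebra_simps)
      then show "\<bar>f x - f x * \<eta> n x\<bar> \<le> B * (1 - \<eta> n x)"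
        using B \<eta>01[of n x] by (simp add: mult_right_mono)
    qed (use i1 i2 i3 in auto)
    also have "\<dots> = B * (1 - (\<integral>x. \<eta> n x \<partial>\<nu>))" using i2 by (simp add: \<nu>.prob_space)
    finally show ?thesis .
  qed
  show ?thesis
  proof (rule LIMSEQ_I)
    \<comment> \<open>The budget is B * 2e = r/4 for the mass of \<open>\<mu> k\<close> outside the
      cut-off, B * e = r/8 for that of \<open>N\<close>, and r/8 for the compactly supported
      part.\<close>
    fix r :: real assume "0 < r"
    define e where "e = r / (8 * B)"
    have "0 < e" using \<open>0 < r\<close> B by (simp add: e_def)
    have Be: "B * e = r / 8" using B by (simp add: e_def)
    obtain n where n: "1 - (\<integral>x. \<eta> n x \<partial>N) < e"
    proof -
      have "\<forall>\<^sub>F n in sequentially. 1 - e < (\<integral>x. \<eta> n x \<partial>N)"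
        by (rule order_tendstoD(1)[OF lim]) (use \<open>0 < e\<close> in \<open>simp add: N.prob_space\<close>)
      then show ?thesis using that by (auto simp: eventually_sequentially less_diff_eq diff_less_eq add.commute)
    qed
    have "\<forall>\<^sub>F k in sequentially. (\<integral>x. \<eta> n x \<partial>N) - e < (\<integral>x. \<eta> n x \<partial>\<mu> k)"
      by (rule order_tendstoD(1)[OF cv]) (use \<open>0 < e\<close> in simp)
    moreover have "\<forall>\<^sub>F k in sequentially. dist (\<integral>x. f x * \<eta> n x \<partial>\<mu> k) (\<integral>x. f x * \<eta> n x \<partial>N) < r / 8"
      by (rule tendstoD[OF fcv]) (use \<open>0 < r\<close> in simp)
    ultimately have "\<forall>\<^sub>F k in sequentially. norm ((\<integral>x. f x \<partial>\<mu> k) - (\<integral>x. f x \<partial>N)) < r"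
    proof eventually_elim
      case (elim k)
      have "B * (1 - (\<integral>x. \<eta> n x \<partial>\<mu> k)) \<le> B * (2 * e)"
        using elim n B by (intro mult_left_mono) auto
      moreover have "B * (1 - (\<integral>x. \<eta> n x \<partial>N)) \<le> B * e"
        using n B by (intro mult_left_mono) auto
      ultimately show ?case
        using diff[OF \<mu>, of k n] diff[OF N, of n] elim Be \<open>0 < r\<close> unfolding dist_real_def real_norm_def by linarith
    qed
    then show "\<exists>n0. \<forall>k\<ge>n0. norm ((\<integral>x. f x \<partial>\<mu> k) - (\<integral>x. f x \<partial>N)) < r"
      by (simp add: eventually_sequentially)
  qed
qed

section \<open>Exponential families\<close>

lemma exp_familyD:
  assumes "exp_family J \<nu> K b P" "\<tau> \<in> J"
  shows "prob_space (P \<tau>)" "sets (P \<tau>) = sets borel"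
    and "has_bochner_integral (P \<tau>) (\<lambda>y. y) (deriv b \<tau>)"
    and "has_bochner_integral (P \<tau>) (\<lambda>y. (y - deriv b \<tau>)\<^sup>2) (deriv (deriv b) \<tau>)"
    and "0 < deriv (deriv b) \<tau>"
proof -
  have *: "sets \<nu> = sets borel" "P \<tau> = density \<nu> (\<lambda>y. ennreal (K y * exp (\<tau> * y - b \<tau>)))"
    using assms unfolding exp_family_def by blast+
  show "sets (P \<tau>) = sets borel" unfolding *(2) using *(1) by simp
qed (use assms in \<open>unfold exp_family_def, blast+\<close>)

lemma exp_family_regular:
  assumes "exp_family J \<nu> K b P"
  shows "\<And>\<tau>. \<tau> \<in> J \<Longrightarrow> (b has_real_derivative deriv b \<tau>) (at \<tau>)"
    and "\<And>\<tau>. \<tau> \<in> J \<Longrightarrow> (deriv b has_real_derivative deriv (deriv b) \<tau>) (at \<tau>)"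
    and "\<And>\<tau>. \<tau> \<in> J \<Longrightarrow> (deriv (deriv b) has_real_derivative deriv (deriv (deriv b)) \<tau>) (at \<tau>)"
    and "continuous_on J b" "continuous_on J (deriv b)" "continuous_on J (deriv (deriv b))"
    and "continuous_on J (deriv (deriv (deriv b)))"
proof -
  have J: "open J" and d: "\<And>m. (deriv ^^ m) b differentiable_on J"
    using assms by (auto simp: exp_family_def)
  have D: "((deriv ^^ m) b has_real_derivative (deriv ^^ Suc m) b \<tau>) (at \<tau>)" if "\<tau> \<in> J" for m \<tau>
    using d[of m] J that
    by (metis DERIV_deriv_iff_real_differentiable at_within_open differentiable_on_def funpow_simps_right(2) funpow_swap1 comp_apply)
  show "\<And>\<tau>. \<tau> \<in> J \<Longrightarrow> (b has_real_derivative deriv b \<tau>) (at \<tau>)" using D[of _ 0] by simp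
  show "\<And>\<tau>. \<tau> \<in> J \<Longrightarrow> (deriv b has_real_derivative deriv (deriv b) \<tau>) (at \<tau>)" using D[of _ 1] by simp
  show "\<And>\<tau>. \<tau> \<in> J \<Longrightarrow> (deriv (deriv b) has_real_derivative deriv (deriv (deriv b)) \<tau>) (at \<tau>)"
    using D[of _ 2] by (simp add: numeral_2_eq_2)
  have C: "continuous_on J ((deriv ^^ m) b)" for m
    using d[of m] by (rule differentiable_imp_continuous_on)
  show "continuous_on J b" "continuous_on J (deriv b)" "continuous_on J (deriv (deriv b))"
    "continuous_on J (deriv (deriv (deriv b)))"
    using C[of 0] C[of 1] C[of 2] C[of 3] by (simp_all add: numeral_2_eq_2 numeral_3_eq_3)
qed

text \<open>The constant is 3^3: the inequality z / 3 <= exp (z / 3) is cubed.\<close>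

lemma cube_le_exp:
  fixes z :: real
  assumes "0 \<le> z"
  shows "z ^ 3 \<le> 27 * exp z"
proof -
  have "z / 3 \<le> exp (z / 3)" using exp_ge_add_one_self[of "z / 3"] by linarith
  then have "(z / 3) ^ 3 \<le> exp (z / 3) ^ 3" using assms by (intro power_mono) auto
  also have "exp (z / 3) ^ 3 = exp z" by (simp flip: exp_of_nat_mult)
  finally show ?thesis by (simp add: power_divide)
qed

text \<open>A cubic factor is paid for by widening the exponent by \<delta> on either side. The
  right-hand side no longer depends on \<tau>, which makes the moment bound uniform.\<close>

lemma abs_cube_exp_le:
  fixes y :: real
  assumes "0 < \<delta>" "c \<le> \<tau>" "\<tau> \<le> d"
  shows "\<bar>y\<bar> ^ 3 * exp (\<tau> * y) \<le> 27 / \<delta> ^ 3 * (exp ((c - \<delta>) * y) + exp ((d + \<delta>) * y))"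
proof -
  have "(\<delta> * \<bar>y\<bar>) ^ 3 \<le> 27 * exp (\<delta> * \<bar>y\<bar>)"
    using assms by (intro cube_le_exp) auto
  then have "\<bar>y\<bar> ^ 3 \<le> 27 / \<delta> ^ 3 * exp (\<delta> * \<bar>y\<bar>)"
    using assms by (simp add: power_mult_distrib field_simps)
  then have "\<bar>y\<bar> ^ 3 * exp (\<tau> * y) \<le> 27 / \<delta> ^ 3 * exp (\<delta> * \<bar>y\<bar>) * exp (\<tau> * y)"
    by (rule mult_right_mono) simp
  also have "\<dots> = 27 / \<delta> ^ 3 * exp (\<delta> * \<bar>y\<bar> + \<tau> * y)" by (simp add: exp_add)
  also have "\<dots> \<le> 27 / \<delta> ^ 3 * (exp ((c - \<delta>) * y) + exp ((d + \<delta>) * y))"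
  proof (rule mult_left_mono)
   show "exp (\<delta> * \<bar>y\<bar> + \<tau> * y) \<le> exp ((c - \<delta>) * y) + exp ((d + \<delta>) * y)"
   proof (cases "0 \<le> y")
    case True
    then have "\<delta> * \<bar>y\<bar> + \<tau> * y \<le> (d + \<delta>) * y"
      using assms mult_right_mono[of \<tau> d y] by (simp add: algebra_simps)
    then have "exp (\<delta> * \<bar>y\<bar> + \<tau> * y) \<le> exp ((d + \<delta>) * y)" by simp
    then show ?thesis using exp_ge_zero[of "(c - \<delta>) * y"] by linarith
  next
    case False
    then have "\<delta> * \<bar>y\<bar> + \<tau> * y \<le> (c - \<delta>) * y"
      using assms mult_right_mono_neg[of c \<tau> y] by (simp add: algebra_simps)
    then have "exp (\<delta> * \<bar>y\<bar> + \<tau> * y) \<le> exp ((c - \<delta>) * y)" by simp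
    then show ?thesis using exp_ge_zero[of "(d + \<delta>) * y"] by linarith
   qed
  qed (use assms in simp)
  finally show ?thesis using assms by simp
qed

text \<open>Since \<open>J\<close> is open, a slightly larger interval still lies in it. At its
  endpoints the exponential integrals are finite, being the normalising constants of members of the
  family, and they dominate the third moments over the original interval.\<close>

lemma exp_family_third_moment:
  assumes ef: "exp_family J \<nu> K b P" and cd: "{c..d} \<subseteq> J" "c \<le> d"
  obtains C where "0 \<le> C" "\<And>\<tau>. \<tau> \<in> {c..d} \<Longrightarrow> (\<integral>\<^sup>+y. ennreal (\<bar>y\<bar> ^ 3) \<partial>P \<tau>) \<le> ennreal C"
proof -
  have J: "open J" and K: "K \<in> borel_measurable borel" "\<And>y. 0 \<le> K y" and \<nu> [measurable_cong]: "sets \<nu> = sets borel"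
    and P: "\<And>\<tau>. \<tau> \<in> J \<Longrightarrow> prob_space (P \<tau>)"
      "\<And>\<tau>. \<tau> \<in> J \<Longrightarrow> P \<tau> = density \<nu> (\<lambda>y. ennreal (K y * exp (\<tau> * y - b \<tau>)))"
    using ef by (auto simp: exp_family_def)
  note [measurable] = K(1)
  have "c \<in> J" "d \<in> J" using cd by auto
  then obtain e1 e2 where e: "0 < e1" "cball c e1 \<subseteq> J" "0 < e2" "cball d e2 \<subseteq> J"
    using J by (meson open_contains_cball)
  define \<delta> where "\<delta> = min e1 e2"
  have \<delta>: "0 < \<delta>" "c - \<delta> \<in> J" "d + \<delta> \<in> J"
  proof -
    show "0 < \<delta>" using e by (simp add: \<delta>_def)
    show "c - \<delta> \<in> J" by (rule subsetD[OF e(2)]) (use e in \<open>auto simp: \<delta>_def dist_real_def\<close>)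
    show "d + \<delta> \<in> J" by (rule subsetD[OF e(4)]) (use e in \<open>auto simp: \<delta>_def dist_real_def\<close>)
  qed
  \<comment> \<open>Total mass 1 of \<open>P \<tau>\<close> identifies \<open>b\<close> as the
    log-partition function.\<close>
  have Z: "(\<integral>\<^sup>+y. ennreal (K y * exp (\<tau> * y)) \<partial>\<nu>) = ennreal (exp (b \<tau>))" if "\<tau> \<in> J" for \<tau>
  proof -
    interpret prob_space "P \<tau>" by (rule P(1)[OF that])
    have "1 = emeasure (P \<tau>) (space (P \<tau>))" by (simp add: emeasure_space_1)
    also have "\<dots> = (\<integral>\<^sup>+y. ennreal (exp (- b \<tau>)) * ennreal (K y * exp (\<tau> * y)) \<partial>\<nu>)"
      unfolding P(2)[OF that]
      by (subst emeasure_density)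
         (auto simp: K exp_diff exp_minus field_simps ennreal_mult'[symmetric] intro!: nn_integral_cong)
    also have "\<dots> = ennreal (exp (- b \<tau>)) * (\<integral>\<^sup>+y. ennreal (K y * exp (\<tau> * y)) \<partial>\<nu>)"
      by (rule nn_integral_cmult) simp
    finally have "ennreal (exp (b \<tau>)) * 1 = ennreal (exp (b \<tau>)) * (ennreal (exp (- b \<tau>)) * (\<integral>\<^sup>+y. ennreal (K y * exp (\<tau> * y)) \<partial>\<nu>))"
      by (simp only:)
    then show ?thesis
      by (simp add: mult.assoc[symmetric] ennreal_mult'[symmetric] exp_minus)
  qed
  have "compact (b ` {c..d})"
    using exp_family_regular(4)[OF ef] cd by (intro compact_continuous_image) (auto intro: continuous_on_subset)
  then obtain B where B: "\<And>\<tau>. \<tau> \<in> {c..d} \<Longrightarrow> \<bar>b \<tau>\<bar> \<le> B"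
    by (metis bounded_iff compact_imp_bounded imageI real_norm_def)
  define C where "C = 27 / \<delta> ^ 3 * exp B * (exp (b (c - \<delta>)) + exp (b (d + \<delta>)))"
  show ?thesis
  proof (rule that[of C])
    show "0 \<le> C" using \<delta> by (auto simp: C_def)
    fix \<tau> assume \<tau>: "\<tau> \<in> {c..d}"
    then have "\<tau> \<in> J" using cd by auto
    have pt: "(K y * exp (\<tau> * y - b \<tau>)) * \<bar>y\<bar> ^ 3
        \<le> 27 / \<delta> ^ 3 * exp B * (K y * exp ((c - \<delta>) * y) + K y * exp ((d + \<delta>) * y))" for y
    proof -
      have "(K y * exp (\<tau> * y - b \<tau>)) * \<bar>y\<bar> ^ 3 = (K y * exp (- b \<tau>)) * (\<bar>y\<bar> ^ 3 * exp (\<tau> * y))"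
        by (simp add: exp_diff exp_minus field_simps)
      also have "\<dots> \<le> (K y * exp B) * (27 / \<delta> ^ 3 * (exp ((c - \<delta>) * y) + exp ((d + \<delta>) * y)))"
        using B[OF \<tau>] \<tau> K(2)[of y] \<delta> by (intro mult_mono abs_cube_exp_le) auto
      finally show ?thesis by (simp add: algebra_simps)
    qed
    have "(\<integral>\<^sup>+y. ennreal (\<bar>y\<bar> ^ 3) \<partial>P \<tau>) = (\<integral>\<^sup>+y. ennreal ((K y * exp (\<tau> * y - b \<tau>)) * \<bar>y\<bar> ^ 3) \<partial>\<nu>)"
      unfolding P(2)[OF \<open>\<tau> \<in> J\<close>] by (subst nn_integral_density) (auto simp: K ennreal_mult')
    also have "\<dots> \<le> (\<integral>\<^sup>+y. ennreal (27 / \<delta> ^ 3 * exp B) * (ennreal (K y * exp ((c - \<delta>) * y)) + ennreal (K y * exp ((d + \<delta>) * y))) \<partial>\<nu>)"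
    proof (intro nn_integral_mono)
      fix y
      have "ennreal ((K y * exp (\<tau> * y - b \<tau>)) * \<bar>y\<bar> ^ 3)
        \<le> ennreal (27 / \<delta> ^ 3 * exp B * (K y * exp ((c - \<delta>) * y) + K y * exp ((d + \<delta>) * y)))"
        by (rule ennreal_leI[OF pt])
      also have "\<dots> = ennreal (27 / \<delta> ^ 3 * exp B) * (ennreal (K y * exp ((c - \<delta>) * y)) + ennreal (K y * exp ((d + \<delta>) * y)))"
        using K(2)[of y] \<delta> by (subst ennreal_mult) auto
      finally show "ennreal ((K y * exp (\<tau> * y - b \<tau>)) * \<bar>y\<bar> ^ 3) \<le> \<dots>" .
    qed
    also have "\<dots> = ennreal (27 / \<delta> ^ 3 * exp B) * (ennreal (exp (b (c - \<delta>))) + ennreal (exp (b (d + \<delta>))))"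
      by (subst nn_integral_cmult, simp, subst nn_integral_add, simp, simp) (simp only: Z \<delta>)
    also have "\<dots> = ennreal C"
      unfolding C_def using \<delta> by (subst ennreal_mult) auto
    finally show "(\<integral>\<^sup>+y. ennreal (\<bar>y\<bar> ^ 3) \<partial>P \<tau>) \<le> ennreal C" .
  qed
qed

text \<open>Turns the Taylor polynomial of a characteristic function into the exponential that a
  compensating factor can cancel exactly. For a <= 1 the upper bound rests on (1 - a + a^2) * (1 +
  a) = 1 + a^3.\<close>

lemma exp_minus_quadratic_bound:
  fixes a :: real
  assumes "0 \<le> a"
  shows "\<bar>exp (- a) - (1 - a)\<bar> \<le> a\<^sup>2"
proof -
  have "1 - a \<le> exp (- a)" using exp_ge_add_one_self[of "- a"] by simp
  moreover have "exp (- a) \<le> 1 - a + a\<^sup>2"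
  proof (cases "a \<le> 1")
    case True
    have "exp (- a) = 1 / exp a" by (simp add: exp_minus field_simps)
    also have "\<dots> \<le> 1 / (1 + a)" using assms exp_ge_add_one_self[of a] by (intro divide_left_mono) auto
    also have "\<dots> \<le> 1 - a + a\<^sup>2"
    proof -
      have "1 \<le> (1 - a + a\<^sup>2) * (1 + a)" using assms by (simp add: algebra_simps power2_eq_square)
      then show ?thesis using assms by (simp add: divide_le_eq)
    qed
    finally show ?thesis .
  next
    case False
    then have "a \<le> a\<^sup>2" by (simp add: power2_eq_square)
    moreover have "exp (- a) \<le> 1" using assms by simp
    ultimately show ?thesis by linarith
  qed
  ultimately show ?thesis by simp
qed

lemma abs_diff_cube_le: "\<bar>y - m\<bar> ^ 3 \<le> 8 * (\<bar>y\<bar> ^ 3 + \<bar>m\<bar> ^ 3)" for y m :: real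
proof -
  have "\<bar>y - m\<bar> ^ 3 \<le> (2 * max \<bar>y\<bar> \<bar>m\<bar>) ^ 3" by (intro power_mono) auto
  also have "\<dots> \<le> 8 * (\<bar>y\<bar> ^ 3 + \<bar>m\<bar> ^ 3)" by (auto simp: max_def)
  finally show ?thesis .
qed

text \<open>Third-order Taylor expansion of the characteristic function. The factor 8 comes from
  passing from the central to the raw third absolute moment, the form in which uniform bounds are
  available.\<close>

lemma centered_char_approx:
  fixes p :: "real measure"
  assumes "prob_space p" and [measurable_cong]: "sets p = sets borel"
    and i1: "integrable p (\<lambda>y. y)" "(\<integral>y. y \<partial>p) = m"
    and i2: "integrable p (\<lambda>y. (y - m)\<^sup>2)" "(\<integral>y. (y - m)\<^sup>2 \<partial>p) = v"
    and i3: "integrable p (\<lambda>y. \<bar>y\<bar> ^ 3)"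
  shows "cmod ((\<integral>y. iexp (x * (y - m)) \<partial>p) - complex_of_real (1 - x\<^sup>2 * v / 2))
    \<le> \<bar>x\<bar> ^ 3 * (8 * ((\<integral>y. \<bar>y\<bar> ^ 3 \<partial>p) + \<bar>m\<bar> ^ 3)) / 6"
proof -
  interpret p: prob_space p by fact
  have e0: "p.expectation (\<lambda>y. y - m) = 0"
    using i1 by (subst Bochner_Integration.integral_diff) (auto simp: p.prob_space)
  have i1': "integrable p (\<lambda>y. y - m)" using i1(1) by (intro Bochner_Integration.integrable_diff) auto
  have var: "p.variance (\<lambda>y. y - m) = v" unfolding e0 using i2(2) by simp
  have rv: "p.random_variable borel (\<lambda>y. y - m)" by measurable
  have "cmod (char (distr p borel (\<lambda>y. y - m)) x - (1 - x\<^sup>2 * v / 2))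
      \<le> (x\<^sup>2 / 6) * p.expectation (\<lambda>y. min (6 * (y - m)\<^sup>2) (\<bar>x\<bar> * \<bar>y - m\<bar> ^ 3))"
    by (rule p.char_approx3'[OF rv i1' i2(1) e0 var refl])
  also have "char (distr p borel (\<lambda>y. y - m)) x = (\<integral>y. iexp (x * (y - m)) \<partial>p)"
    unfolding char_def by (subst integral_distr) auto
  also have "p.expectation (\<lambda>y. min (6 * (y - m)\<^sup>2) (\<bar>x\<bar> * \<bar>y - m\<bar> ^ 3))
      \<le> p.expectation (\<lambda>y. \<bar>x\<bar> * (8 * (\<bar>y\<bar> ^ 3 + \<bar>m\<bar> ^ 3)))"
  proof (rule integral_mono)
    show "integrable p (\<lambda>y. min (6 * (y - m)\<^sup>2) (\<bar>x\<bar> * \<bar>y - m\<bar> ^ 3))"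
      by (rule Bochner_Integration.integrable_bound[OF integrable_mult_right[of 6, OF i2(1)]]) auto
    show "integrable p (\<lambda>y. \<bar>x\<bar> * (8 * (\<bar>y\<bar> ^ 3 + \<bar>m\<bar> ^ 3)))"
      by (intro integrable_mult_right Bochner_Integration.integrable_add i3) auto
    fix y
    have "\<bar>x\<bar> * \<bar>y - m\<bar> ^ 3 \<le> \<bar>x\<bar> * (8 * (\<bar>y\<bar> ^ 3 + \<bar>m\<bar> ^ 3))"
      by (intro mult_left_mono abs_diff_cube_le) auto
    then show "min (6 * (y - m)\<^sup>2) (\<bar>x\<bar> * \<bar>y - m\<bar> ^ 3) \<le> \<bar>x\<bar> * (8 * (\<bar>y\<bar> ^ 3 + \<bar>m\<bar> ^ 3))"
      by linarith
  qed
  also have "p.expectation (\<lambda>y. \<bar>x\<bar> * (8 * (\<bar>y\<bar> ^ 3 + \<bar>m\<bar> ^ 3))) = \<bar>x\<bar> * (8 * (p.expectation (\<lambda>y. \<bar>y\<bar> ^ 3) + \<bar>m\<bar> ^ 3))"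
    using i3 by (simp add: p.prob_space)
  finally have "cmod ((\<integral>y. iexp (x * (y - m)) \<partial>p) - (1 - x\<^sup>2 * v / 2))
      \<le> (x\<^sup>2 / 6) * (\<bar>x\<bar> * (8 * (p.expectation (\<lambda>y. \<bar>y\<bar> ^ 3) + \<bar>m\<bar> ^ 3)))"
    by (simp add: mult_left_mono)
  also have "\<dots> = \<bar>x\<bar> ^ 3 * (8 * (p.expectation (\<lambda>y. \<bar>y\<bar> ^ 3) + \<bar>m\<bar> ^ 3)) / 6"
    by (simp add: power2_eq_square power3_eq_cube)
  finally show ?thesis by simp
qed

text \<open>All moments involved are bounded on the compact parameter interval, so one constant
  serves every \<tau>. Restricting to frequencies |x| <= R lets the fourth-order error of passing to
  the exponential be absorbed in a cubic one.\<close>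

lemma exp_family_char_approx:
  assumes ef: "exp_family J \<nu> K b P" and cd: "{c..d} \<subseteq> J" "c \<le> d"
  obtains C where "0 \<le> C" "\<And>\<tau> x. \<tau> \<in> {c..d} \<Longrightarrow> \<bar>x\<bar> \<le> R \<Longrightarrow>
     cmod ((\<integral>y. iexp (x * (y - deriv b \<tau>)) \<partial>P \<tau>) - complex_of_real (exp (- (x\<^sup>2 * deriv (deriv b) \<tau> / 2)))) \<le> C * \<bar>x\<bar> ^ 3"
proof -
  note P = exp_familyD[OF ef]
  obtain C3 where C3: "0 \<le> C3" "\<And>\<tau>. \<tau> \<in> {c..d} \<Longrightarrow> (\<integral>\<^sup>+y. ennreal (\<bar>y\<bar> ^ 3) \<partial>P \<tau>) \<le> ennreal C3"
    using exp_family_third_moment[OF ef cd] by blast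
  have "compact (deriv b ` {c..d})" "compact (deriv (deriv b) ` {c..d})"
    using exp_family_regular(5,6)[OF ef] cd by (auto intro!: compact_continuous_image intro: continuous_on_subset)
  then obtain B V where B: "\<And>\<tau>. \<tau> \<in> {c..d} \<Longrightarrow> \<bar>deriv b \<tau>\<bar> \<le> B" and V: "\<And>\<tau>. \<tau> \<in> {c..d} \<Longrightarrow> \<bar>deriv (deriv b) \<tau>\<bar> \<le> V"
    by (metis bounded_iff compact_imp_bounded imageI real_norm_def)
  have B0: "0 \<le> B" "0 \<le> V" using B[of c] V[of c] cd by auto
  \<comment> \<open>The first term is the Taylor remainder, the second the cost of replacing 1 - a
    by exp (- a) with a = x^2 v / 2.\<close>
  define C where "C = 8 * (C3 + B ^ 3) / 6 + \<bar>R\<bar> * V\<^sup>2"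
  show ?thesis
  proof (rule that[of C])
    show "0 \<le> C" using C3 B0 by (auto simp: C_def)
    fix \<tau> x assume \<tau>: "\<tau> \<in> {c..d}" and x: "\<bar>x\<bar> \<le> R"
    have \<tau>J: "\<tau> \<in> J" using \<tau> cd by auto
    let ?m = "deriv b \<tau>" and ?v = "deriv (deriv b) \<tau>"
    interpret p: prob_space "P \<tau>" by (rule P[OF \<tau>J])
    note [measurable_cong] = P(2)[OF \<tau>J]
    note i1 = P(3)[OF \<tau>J, unfolded has_bochner_integral_iff]
    note i2 = P(4)[OF \<tau>J, unfolded has_bochner_integral_iff]
    have i3: "integrable (P \<tau>) (\<lambda>y. \<bar>y\<bar> ^ 3)"
    proof (rule integrableI_nonneg)
      show "(\<integral>\<^sup>+y. ennreal (\<bar>y\<bar> ^ 3) \<partial>P \<tau>) < \<infinity>"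
        using le_less_trans[OF C3(2)[OF \<tau>] ennreal_less_top] by simp
    qed auto
    have e3: "p.expectation (\<lambda>y. \<bar>y\<bar> ^ 3) \<le> C3"
    proof -
      have "(\<integral>\<^sup>+y. ennreal (\<bar>y\<bar> ^ 3) \<partial>P \<tau>) = ennreal (p.expectation (\<lambda>y. \<bar>y\<bar> ^ 3))"
        by (rule nn_integral_eq_integral[OF i3]) auto
      with C3(2)[OF \<tau>] have "ennreal (p.expectation (\<lambda>y. \<bar>y\<bar> ^ 3)) \<le> ennreal C3" by (simp only:)
      then show ?thesis using C3(1) by (simp only: ennreal_le_iff)
    qed
    have "cmod ((\<integral>y. iexp (x * (y - ?m)) \<partial>P \<tau>) - complex_of_real (1 - x\<^sup>2 * ?v / 2))
        \<le> \<bar>x\<bar> ^ 3 * (8 * (p.expectation (\<lambda>y. \<bar>y\<bar> ^ 3) + \<bar>?m\<bar> ^ 3)) / 6"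
      by (rule centered_char_approx[OF P(1,2)[OF \<tau>J] conjunct1[OF i1] conjunct2[OF i1] conjunct1[OF i2] conjunct2[OF i2] i3])
    also have "\<dots> \<le> \<bar>x\<bar> ^ 3 * (8 * (C3 + B ^ 3)) / 6"
      using e3 B[OF \<tau>] by (intro divide_right_mono mult_left_mono add_mono power_mono) auto
    finally have h2: "cmod ((\<integral>y. iexp (x * (y - ?m)) \<partial>P \<tau>) - complex_of_real (1 - x\<^sup>2 * ?v / 2)) \<le> \<bar>x\<bar> ^ 3 * (8 * (C3 + B ^ 3)) / 6" .
    have "cmod (complex_of_real (1 - x\<^sup>2 * ?v / 2) - complex_of_real (exp (- (x\<^sup>2 * ?v / 2))))
        = \<bar>exp (- (x\<^sup>2 * ?v / 2)) - (1 - x\<^sup>2 * ?v / 2)\<bar>"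
      by (simp only: of_real_diff[symmetric] norm_of_real abs_minus_commute)
    also have "\<dots> \<le> (x\<^sup>2 * ?v / 2)\<^sup>2"
      by (rule exp_minus_quadratic_bound) (use P(5)[OF \<tau>J] in auto)
    also have "\<dots> \<le> \<bar>x\<bar> ^ 3 * (\<bar>R\<bar> * V\<^sup>2)"
    proof -
      have "(x\<^sup>2 * ?v / 2)\<^sup>2 = \<bar>x\<bar> ^ 3 * (\<bar>x\<bar> * (?v)\<^sup>2 / 4)"
        by (simp add: power_mult_distrib power_divide power2_eq_square power3_eq_cube)
      also have "\<dots> \<le> \<bar>x\<bar> ^ 3 * (\<bar>R\<bar> * V\<^sup>2)"
      proof (intro mult_left_mono)
        have "\<bar>x\<bar> * (?v)\<^sup>2 \<le> \<bar>R\<bar> * V\<^sup>2"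
          using x V[OF \<tau>] by (intro mult_mono) (auto simp: power2_le_iff_abs_le abs_le_square_iff)
        moreover have "0 \<le> \<bar>x\<bar> * (?v)\<^sup>2" by simp
        ultimately show "\<bar>x\<bar> * (?v)\<^sup>2 / 4 \<le> \<bar>R\<bar> * V\<^sup>2" by linarith
      qed auto
      finally show ?thesis .
    qed
    finally have h3: "cmod (complex_of_real (1 - x\<^sup>2 * ?v / 2) - complex_of_real (exp (- (x\<^sup>2 * ?v / 2)))) \<le> \<bar>x\<bar> ^ 3 * (\<bar>R\<bar> * V\<^sup>2)" .
    have "cmod ((\<integral>y. iexp (x * (y - ?m)) \<partial>P \<tau>) - complex_of_real (exp (- (x\<^sup>2 * ?v / 2))))
       \<le> cmod ((\<integral>y. iexp (x * (y - ?m)) \<partial>P \<tau>) - complex_of_real (1 - x\<^sup>2 * ?v / 2))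
        + cmod (complex_of_real (1 - x\<^sup>2 * ?v / 2) - complex_of_real (exp (- (x\<^sup>2 * ?v / 2))))"
      by norm
    also have "\<dots> \<le> \<bar>x\<bar> ^ 3 * (8 * (C3 + B ^ 3)) / 6 + \<bar>x\<bar> ^ 3 * (\<bar>R\<bar> * V\<^sup>2)"
      by (rule add_mono[OF h2 h3])
    also have "\<dots> = C * \<bar>x\<bar> ^ 3"
      by (simp add: C_def field_simps)
    finally show "cmod ((\<integral>y. iexp (x * (y - ?m)) \<partial>P \<tau>) - complex_of_real (exp (- (x\<^sup>2 * ?v / 2)))) \<le> C * \<bar>x\<bar> ^ 3" .
  qed
qed

text \<open>From |z| <= 1 + z^2 the moment is at most 1 plus the variance, which is continuous in
  \<tau>.\<close>

lemma exp_family_first_abs_moment: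
  assumes ef: "exp_family J \<nu> K b P" and cd: "{c..d} \<subseteq> J" "c \<le> d"
  obtains C where "0 \<le> C" "\<And>\<tau>. \<tau> \<in> {c..d} \<Longrightarrow> (\<integral>\<^sup>+y. ennreal \<bar>y - deriv b \<tau>\<bar> \<partial>P \<tau>) \<le> ennreal C"
proof -
  have "compact (deriv (deriv b) ` {c..d})"
    using exp_family_regular(6)[OF ef] cd by (auto intro!: compact_continuous_image intro: continuous_on_subset)
  then obtain V where V: "\<And>\<tau>. \<tau> \<in> {c..d} \<Longrightarrow> \<bar>deriv (deriv b) \<tau>\<bar> \<le> V"
    by (metis bounded_iff compact_imp_bounded imageI real_norm_def)
  show ?thesis
  proof (rule that[of "1 + V"])
    show "0 \<le> 1 + V" using V[of c] cd by auto
    fix \<tau> assume \<tau>: "\<tau> \<in> {c..d}"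
    then have "\<tau> \<in> J" using cd by auto
    note p = exp_familyD(1)[OF ef this] and i2 = exp_familyD(4)[OF ef this]
    interpret p: prob_space "P \<tau>" by (rule p)
    have "(\<integral>\<^sup>+y. ennreal \<bar>y - deriv b \<tau>\<bar> \<partial>P \<tau>) \<le> (\<integral>\<^sup>+y. ennreal (1 + (y - deriv b \<tau>)\<^sup>2) \<partial>P \<tau>)"
    proof (intro nn_integral_mono ennreal_leI)
      fix y
      show "\<bar>y - deriv b \<tau>\<bar> \<le> 1 + (y - deriv b \<tau>)\<^sup>2"
        using zero_le_power2[of "\<bar>y - deriv b \<tau>\<bar> - 1"] by (simp add: power2_diff) (smt (verit) zero_le_power2)
    qed
    also have "\<dots> = ennreal (p.expectation (\<lambda>y. 1 + (y - deriv b \<tau>)\<^sup>2))"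
      by (rule nn_integral_eq_integral) (use i2 in \<open>auto simp: has_bochner_integral_iff\<close>)
    also have "p.expectation (\<lambda>y. 1 + (y - deriv b \<tau>)\<^sup>2) = 1 + deriv (deriv b) \<tau>"
      using i2 by (auto simp: has_bochner_integral_iff p.prob_space)
    also have "ennreal \<dots> \<le> ennreal (1 + V)" using V[OF \<tau>] by (intro ennreal_leI) auto
    finally show "(\<integral>\<^sup>+y. ennreal \<bar>y - deriv b \<tau>\<bar> \<partial>P \<tau>) \<le> ennreal (1 + V)" .
  qed
qed

text \<open>The density vanishes wherever \<open>K\<close> does. This keeps the extended-real
  log-likelihood away from minus infinity almost surely.\<close>

lemma exp_family_K_pos:
  assumes ef: "exp_family J \<nu> K b P" and "\<tau> \<in> J"
  shows "AE y in P \<tau>. K y \<noteq> 0"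
proof -
  have [measurable_cong]: "sets \<nu> = sets borel" and [measurable]: "K \<in> borel_measurable borel"
    and P: "P \<tau> = density \<nu> (\<lambda>y. ennreal (K y * exp (\<tau> * y - b \<tau>)))"
    using ef \<open>\<tau> \<in> J\<close> by (auto simp: exp_family_def)
  show ?thesis unfolding P by (subst AE_density) auto
qed

section \<open>Regular conditional distributions\<close>

text \<open>A conditional distribution is specified one event at a time, each with its own null set.
  On rectangles this determines the joint law of the past and \<open>Z\<close>, and rectangles
  generate the product sigma-field. The outer measure is restricted to \<open>F\<close> because the
  kernel is measurable only with respect to \<open>F\<close>.\<close>

lemma cond_distr_joint_law:
  assumes M: "prob_space M" and sub: "subalgebra M F" and Z [measurable]: "Z \<in> M \<rightarrow>\<^sub>M N"
    and cd: "is_cond_distr M F N Z Q"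
  shows "distr M (F \<Otimes>\<^sub>M N) (\<lambda>\<omega>. (\<omega>, Z \<omega>)) =
    restr_to_subalg M F \<bind> (\<lambda>\<omega>. distr (Q \<omega>) (F \<Otimes>\<^sub>M N) (Pair \<omega>))" (is "?L = ?R")
    and "(\<lambda>\<omega>. distr (Q \<omega>) (F \<Otimes>\<^sub>M N) (Pair \<omega>)) \<in> restr_to_subalg M F \<rightarrow>\<^sub>M subprob_algebra (F \<Otimes>\<^sub>M N)"
proof -
  interpret M: prob_space M by fact
  interpret S: sigma_finite_subalgebra M F
    using sub M.finite_measure_axioms
    by (intro finite_measure_subalgebra_is_sigma_finite finite_measure_subalgebra.intro finite_measure_subalgebra_axioms.intro)
  have Q: "Q \<in> F \<rightarrow>\<^sub>M prob_algebra N"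
    and QB: "\<And>B. B \<in> sets N \<Longrightarrow> AE \<omega> in M. real_cond_exp M F (\<lambda>\<omega>. indicator B (Z \<omega>)) \<omega> = measure (Q \<omega>) B"
    using cd by (auto simp: is_cond_distr_def)
  have sr: "sets (restr_to_subalg M F) = sets F" by (rule sets_restr_to_subalg[OF sub])
  have spF: "space F = space M" using sub by (simp add: subalgebra_def)
  have spr: "space (restr_to_subalg M F) = space M" by (simp add: space_restr_to_subalg)
  have idF [measurable]: "(\<lambda>x. x) \<in> M \<rightarrow>\<^sub>M F" using sub by (auto simp: subalgebra_def measurable_def)
  have Qs [measurable]: "Q \<in> restr_to_subalg M F \<rightarrow>\<^sub>M subprob_algebra N"
    using measurable_prob_algebraD[OF Q] sr by (simp add: measurable_cong_sets[OF sr refl])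
  have idr: "(\<lambda>x. x) \<in> restr_to_subalg M F \<rightarrow>\<^sub>M F" by (simp add: measurable_ident_sets sr)
  show D: "(\<lambda>\<omega>. distr (Q \<omega>) (F \<Otimes>\<^sub>M N) (Pair \<omega>)) \<in> restr_to_subalg M F \<rightarrow>\<^sub>M subprob_algebra (F \<Otimes>\<^sub>M N)"
    by (rule measurable_distr2[OF _ Qs]) (subst measurable_cong_sets[OF sets_pair_measure_cong[OF sr refl] refl], simp)
  have ne: "space (restr_to_subalg M F) \<noteq> {}" using M.not_empty spr by simp
  have Qp: "prob_space (Q \<omega>)" "sets (Q \<omega>) = sets N" if "\<omega> \<in> space M" for \<omega>
    using measurable_space[OF Q] that spF by (auto simp: space_prob_algebra)
  show "?L = ?R"
  proof (rule measure_eqI_generator_eq[where E="{a \<times> b | a b. a \<in> sets F \<and> b \<in> sets N}" and \<Omega>="space F \<times> space N" and A="\<lambda>_::nat. space F \<times> space N"])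
    show "Int_stable {a \<times> b | a b. a \<in> sets F \<and> b \<in> sets N}" by (rule Int_stable_pair_measure_generator)
    show "{a \<times> b | a b. a \<in> sets F \<and> b \<in> sets N} \<subseteq> Pow (space F \<times> space N)"
      by (rule pair_measure_closed)
    show "sets ?L = sigma_sets (space F \<times> space N) {a \<times> b | a b. a \<in> sets F \<and> b \<in> sets N}"
      by (simp add: sets_pair_measure)
    show "sets ?R = sigma_sets (space F \<times> space N) {a \<times> b | a b. a \<in> sets F \<and> b \<in> sets N}"
      by (subst sets_bind[OF _ ne, where N="F \<Otimes>\<^sub>M N"]) (auto simp: sets_pair_measure)
    fix X assume "X \<in> {a \<times> b | a b. a \<in> sets F \<and> b \<in> sets N}"
    then obtain A B where X: "X = A \<times> B" and A [measurable]: "A \<in> sets F" and B [measurable]: "B \<in> sets N" by auto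
    have AM [measurable]: "A \<in> sets M" using A sub by (auto simp: subalgebra_def)
    have Bi: "integrable M (\<lambda>\<omega>. indicator B (Z \<omega>) :: real)"
      by (rule M.integrable_const_bound[where B=1]) (auto simp: indicator_def)
    have mQ [measurable]: "(\<lambda>\<omega>. measure (Q \<omega>) B) \<in> borel_measurable M"
    proof -
      have "(\<lambda>\<omega>. measure (Q \<omega>) B) \<in> borel_measurable F"
        by (rule measurable_compose[OF measurable_prob_algebraD[OF Q]]) measurable
      then show ?thesis using sub measurable_from_subalg by blast
    qed
    have "emeasure ?L X = emeasure M (A \<inter> (Z -` B \<inter> space M))"
      unfolding X by (subst emeasure_distr) (auto intro!: arg_cong2[where f=emeasure] dest: sets.sets_into_space[OF AM, THEN subsetD])
    also have "\<dots> = ennreal (\<integral>\<omega>. indicator A \<omega> * indicator B (Z \<omega>) \<partial>M)"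
    proof -
      have "(\<integral>\<omega>. indicator A \<omega> * indicator B (Z \<omega>) \<partial>M) = (\<integral>\<omega>. indicator (A \<inter> (Z -` B \<inter> space M)) \<omega> \<partial>M :: real)"
        by (intro Bochner_Integration.integral_cong) (auto simp: indicator_def)
      then show ?thesis by (simp add: M.emeasure_eq_measure)
    qed
    \<comment> \<open>The defining property of conditional expectation, applicable because
      \<open>A\<close> belongs to \<open>F\<close>.\<close>
    also have "(\<integral>\<omega>. indicator A \<omega> * indicator B (Z \<omega>) \<partial>M) = (\<integral>\<omega>. indicator A \<omega> * real_cond_exp M F (\<lambda>\<omega>. indicator B (Z \<omega>)) \<omega> \<partial>M :: real)"
      using S.real_cond_exp_intA[OF Bi A] by (simp add: set_lebesgue_integral_def)
    also have "\<dots> = (\<integral>\<omega>. indicator A \<omega> * measure (Q \<omega>) B \<partial>M)"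
      by (rule integral_cong_AE) (use QB[OF B] in auto)
    also have "ennreal \<dots> = (\<integral>\<^sup>+\<omega>. ennreal (indicator A \<omega> * measure (Q \<omega>) B) \<partial>M)"
      by (intro nn_integral_eq_integral[symmetric] M.integrable_const_bound[where B=1] AE_I2)
         (use prob_space.prob_le_1[OF Qp(1)] in \<open>auto simp: indicator_def\<close>)
    also have "\<dots> = (\<integral>\<^sup>+\<omega>. emeasure (distr (Q \<omega>) (F \<Otimes>\<^sub>M N) (Pair \<omega>)) X \<partial>M)"
    proof (intro nn_integral_cong)
      fix \<omega> assume \<omega>: "\<omega> \<in> space M"
      interpret q: prob_space "Q \<omega>" by (rule Qp[OF \<omega>])
      note [measurable_cong] = Qp(2)[OF \<omega>]
      have "Pair \<omega> \<in> N \<rightarrow>\<^sub>M F \<Otimes>\<^sub>M N" using \<omega> spF by (intro measurable_Pair1') simp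
      then have "Pair \<omega> \<in> Q \<omega> \<rightarrow>\<^sub>M F \<Otimes>\<^sub>M N"
        by (simp only: measurable_cong_sets[OF Qp(2)[OF \<omega>] refl])
      then have "emeasure (distr (Q \<omega>) (F \<Otimes>\<^sub>M N) (Pair \<omega>)) X = emeasure (Q \<omega>) (Pair \<omega> -` X \<inter> space (Q \<omega>))"
        by (rule emeasure_distr) (simp add: X)
      also have "Pair \<omega> -` X \<inter> space (Q \<omega>) = (if \<omega> \<in> A then B else {})"
        using sets.sets_into_space[OF B] sets_eq_imp_space_eq[OF Qp(2)[OF \<omega>]] by (auto simp: X)
      finally show "ennreal (indicator A \<omega> * measure (Q \<omega>) B) = emeasure (distr (Q \<omega>) (F \<Otimes>\<^sub>M N) (Pair \<omega>)) X"
        by (simp add: q.emeasure_eq_measure)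
    qed
    also have "\<dots> = (\<integral>\<^sup>+\<omega>. emeasure (distr (Q \<omega>) (F \<Otimes>\<^sub>M N) (Pair \<omega>)) X \<partial>restr_to_subalg M F)"
    proof (rule nn_integral_subalgebra2[OF sub, symmetric])
      have "X \<in> sets (F \<Otimes>\<^sub>M N)" unfolding X by simp
      with D have "(\<lambda>\<omega>. emeasure (distr (Q \<omega>) (F \<Otimes>\<^sub>M N) (Pair \<omega>)) X) \<in> borel_measurable (restr_to_subalg M F)"
        by (rule measurable_emeasure_kernel)
      then show "(\<lambda>\<omega>. emeasure (distr (Q \<omega>) (F \<Otimes>\<^sub>M N) (Pair \<omega>)) X) \<in> borel_measurable F"
        by (simp add: measurable_cong_sets[OF sr refl])
    qed
    also have "\<dots> = emeasure ?R X"
      by (rule emeasure_bind[OF ne D, symmetric]) (simp add: X)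
    finally show "emeasure ?L X = emeasure ?R X" .
  next
    show "range (\<lambda>_::nat. space F \<times> space N) \<subseteq> {a \<times> b | a b. a \<in> sets F \<and> b \<in> sets N}" by auto
    show "(\<Union>i::nat. space F \<times> space N) = space F \<times> space N" by simp
    fix i :: nat
    interpret L: prob_space ?L by (rule M.prob_space_distr) simp
    show "emeasure ?L (space F \<times> space N) \<noteq> \<infinity>" by simp
  qed
qed

text \<open>The nonnegative version needs no prior integrability, so it can be used to establish
  moments of the responses.\<close>

lemma cond_distr_nn_integral:
  assumes M: "prob_space M" and sub: "subalgebra M F" and Z [measurable]: "Z \<in> M \<rightarrow>\<^sub>M N"
    and cd: "is_cond_distr M F N Z Q"
    and H [measurable]: "H \<in> borel_measurable (F \<Otimes>\<^sub>M N)"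
  shows "(\<integral>\<^sup>+\<omega>. H (\<omega>, Z \<omega>) \<partial>M) = (\<integral>\<^sup>+\<omega>. (\<integral>\<^sup>+y. H (\<omega>, y) \<partial>Q \<omega>) \<partial>M)"
proof -
  have spF: "space F = space M" using sub by (simp add: subalgebra_def)
  have idF [measurable]: "(\<lambda>x. x) \<in> M \<rightarrow>\<^sub>M F" using sub by (auto simp: subalgebra_def measurable_def)
  have Q: "Q \<in> F \<rightarrow>\<^sub>M prob_algebra N" using cd by (auto simp: is_cond_distr_def)
  have Qp: "prob_space (Q \<omega>)" "sets (Q \<omega>) = sets N" if "\<omega> \<in> space M" for \<omega>
    using measurable_space[OF Q] that spF by (auto simp: space_prob_algebra)
  note Qs [measurable] = measurable_prob_algebraD[OF Q]
  have "(\<integral>\<^sup>+\<omega>. H (\<omega>, Z \<omega>) \<partial>M) = (\<integral>\<^sup>+p. H p \<partial>distr M (F \<Otimes>\<^sub>M N) (\<lambda>\<omega>. (\<omega>, Z \<omega>)))"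
    by (subst nn_integral_distr) auto
  also have "\<dots> = (\<integral>\<^sup>+\<omega>. (\<integral>\<^sup>+p. H p \<partial>distr (Q \<omega>) (F \<Otimes>\<^sub>M N) (Pair \<omega>)) \<partial>restr_to_subalg M F)"
    unfolding cond_distr_joint_law(1)[OF M sub Z cd]
    by (rule nn_integral_bind[OF H cond_distr_joint_law(2)[OF M sub Z cd]])
  also have "\<dots> = (\<integral>\<^sup>+\<omega>. (\<integral>\<^sup>+y. H (\<omega>, y) \<partial>Q \<omega>) \<partial>restr_to_subalg M F)"
  proof (intro nn_integral_cong)
    fix \<omega> assume "\<omega> \<in> space (restr_to_subalg M F)"
    then have \<omega>: "\<omega> \<in> space M" by (simp add: space_restr_to_subalg)
    note [measurable_cong] = Qp(2)[OF \<omega>]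
    show "(\<integral>\<^sup>+p. H p \<partial>distr (Q \<omega>) (F \<Otimes>\<^sub>M N) (Pair \<omega>)) = (\<integral>\<^sup>+y. H (\<omega>, y) \<partial>Q \<omega>)"
      using \<omega> spF by (subst nn_integral_distr) auto
  qed
  also have "\<dots> = (\<integral>\<^sup>+\<omega>. (\<integral>\<^sup>+y. H (\<omega>, y) \<partial>Q \<omega>) \<partial>M)"
    by (rule nn_integral_subalgebra2[OF sub]) (rule nn_integral_measurable_subprob_algebra2[OF _ Qs], simp)
  finally show ?thesis .
qed

lemma cond_distr_integral_measurable:
  fixes H :: "_ \<Rightarrow> 'b::{banach, second_countable_topology}"
  assumes M: "prob_space M" and sub: "subalgebra M F" and Z: "Z \<in> M \<rightarrow>\<^sub>M N"
    and cd: "is_cond_distr M F N Z Q"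
    and H [measurable]: "H \<in> borel_measurable (F \<Otimes>\<^sub>M N)"
  shows "(\<lambda>\<omega>. \<integral>y. H (\<omega>, y) \<partial>Q \<omega>) \<in> borel_measurable F"
proof -
  have sr: "sets (restr_to_subalg M F) = sets F" by (rule sets_restr_to_subalg[OF sub])
  have Q: "Q \<in> F \<rightarrow>\<^sub>M prob_algebra N" using cd by (auto simp: is_cond_distr_def)
  have "(\<lambda>\<omega>. integral\<^sup>L (distr (Q \<omega>) (F \<Otimes>\<^sub>M N) (Pair \<omega>)) H) \<in> borel_measurable (restr_to_subalg M F)"
    by (rule measurable_compose[OF cond_distr_joint_law(2)[OF M sub Z cd] integral_measurable_subprob_algebra[OF H]])
  then have "(\<lambda>\<omega>. integral\<^sup>L (distr (Q \<omega>) (F \<Otimes>\<^sub>M N) (Pair \<omega>)) H) \<in> borel_measurable F"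
    by (simp add: measurable_cong_sets[OF sr refl])
  also have "?this \<longleftrightarrow> ?thesis"
  proof (rule measurable_cong)
    fix \<omega> assume \<omega>: "\<omega> \<in> space F"
    then have [measurable_cong]: "sets (Q \<omega>) = sets N"
      using measurable_space[OF Q] by (auto simp: space_prob_algebra)
    show "integral\<^sup>L (distr (Q \<omega>) (F \<Otimes>\<^sub>M N) (Pair \<omega>)) H = (\<integral>y. H (\<omega>, y) \<partial>Q \<omega>)"
      using \<omega> by (subst integral_distr) auto
  qed
  finally show ?thesis .
qed

lemma cond_distr_integral_real:
  fixes H :: "_ \<Rightarrow> real"
  assumes M: "prob_space M" and sub: "subalgebra M F" and Z [measurable]: "Z \<in> M \<rightarrow>\<^sub>M N"
    and cd: "is_cond_distr M F N Z Q"
    and H [measurable]: "H \<in> borel_measurable (F \<Otimes>\<^sub>M N)" and B: "\<And>p. \<bar>H p\<bar> \<le> B"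
  shows "(\<integral>\<omega>. H (\<omega>, Z \<omega>) \<partial>M) = (\<integral>\<omega>. (\<integral>y. H (\<omega>, y) \<partial>Q \<omega>) \<partial>M)"
proof -
  interpret M: prob_space M by fact
  have spF: "space F = space M" using sub by (simp add: subalgebra_def)
  have idF [measurable]: "(\<lambda>x. x) \<in> M \<rightarrow>\<^sub>M F" using sub by (auto simp: subalgebra_def measurable_def)
  have Q: "Q \<in> F \<rightarrow>\<^sub>M prob_algebra N" using cd by (auto simp: is_cond_distr_def)
  have Qp: "prob_space (Q \<omega>)" "sets (Q \<omega>) = sets N" if "\<omega> \<in> space M" for \<omega>
    using measurable_space[OF Q] that spF by (auto simp: space_prob_algebra)
  note Qs [measurable] = measurable_prob_algebraD[OF Q]
  have meas: "(\<lambda>\<omega>. \<integral>y. H (\<omega>, y) \<partial>Q \<omega>) \<in> borel_measurable F"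
    by (rule cond_distr_integral_measurable[OF M sub Z cd H])
  have "(\<integral>\<omega>. H (\<omega>, Z \<omega>) \<partial>M) = (\<integral>p. H p \<partial>distr M (F \<Otimes>\<^sub>M N) (\<lambda>\<omega>. (\<omega>, Z \<omega>)))"
    by (subst integral_distr) auto
  also have "\<dots> = (\<integral>\<omega>. (\<integral>p. H p \<partial>distr (Q \<omega>) (F \<Otimes>\<^sub>M N) (Pair \<omega>)) \<partial>restr_to_subalg M F)"
    unfolding cond_distr_joint_law(1)[OF M sub Z cd]
  proof (rule integral_bind[OF H _ cond_distr_joint_law(2)[OF M sub Z cd], where B=B and B'=1])
    show "finite_measure (restr_to_subalg M F)"
      by (rule finite_measure_restr_to_subalg[OF sub M.finite_measure_axioms])
    show "AE \<omega> in restr_to_subalg M F. emeasure (distr (Q \<omega>) (F \<Otimes>\<^sub>M N) (Pair \<omega>)) (space (distr (Q \<omega>) (F \<Otimes>\<^sub>M N) (Pair \<omega>))) \<le> ennreal 1"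
    proof (rule AE_I2)
      fix \<omega> assume "\<omega> \<in> space (restr_to_subalg M F)"
      then have "subprob_space (distr (Q \<omega>) (F \<Otimes>\<^sub>M N) (Pair \<omega>))"
        by (rule subprob_space_kernel[OF cond_distr_joint_law(2)[OF M sub Z cd]])
      from subprob_space.subprob_emeasure_le_1[OF this]
      show "emeasure (distr (Q \<omega>) (F \<Otimes>\<^sub>M N) (Pair \<omega>)) (space (distr (Q \<omega>) (F \<Otimes>\<^sub>M N) (Pair \<omega>))) \<le> ennreal 1"
        by simp
    qed
  qed (use B in auto)
  also have "\<dots> = (\<integral>\<omega>. (\<integral>y. H (\<omega>, y) \<partial>Q \<omega>) \<partial>restr_to_subalg M F)"
  proof (intro Bochner_Integration.integral_cong refl)
    fix \<omega> assume "\<omega> \<in> space (restr_to_subalg M F)"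
    then have \<omega>: "\<omega> \<in> space M" by (simp add: space_restr_to_subalg)
    note [measurable_cong] = Qp(2)[OF \<omega>]
    show "(\<integral>p. H p \<partial>distr (Q \<omega>) (F \<Otimes>\<^sub>M N) (Pair \<omega>)) = (\<integral>y. H (\<omega>, y) \<partial>Q \<omega>)"
      using \<omega> spF by (subst integral_distr) auto
  qed
  also have "\<dots> = (\<integral>\<omega>. (\<integral>y. H (\<omega>, y) \<partial>Q \<omega>) \<partial>M)"
    by (rule integral_subalgebra2[OF sub meas])
  finally show "(\<integral>\<omega>. H (\<omega>, Z \<omega>) \<partial>M) = (\<integral>\<omega>. (\<integral>y. H (\<omega>, y) \<partial>Q \<omega>) \<partial>M)" .
qed

text \<open>Reduction to real and imaginary parts. Boundedness is demanded at every point of the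
  product type, not only over \<open>space M\<close>; integrands are adapted to this where the lemma
  is applied.\<close>

lemma cond_distr_integral_complex:
  fixes H :: "_ \<Rightarrow> complex"
  assumes M: "prob_space M" and sub: "subalgebra M F" and Z [measurable]: "Z \<in> M \<rightarrow>\<^sub>M N"
    and cd: "is_cond_distr M F N Z Q"
    and H [measurable]: "H \<in> borel_measurable (F \<Otimes>\<^sub>M N)" and B: "\<And>p. cmod (H p) \<le> B"
  shows "(\<integral>\<omega>. H (\<omega>, Z \<omega>) \<partial>M) = (\<integral>\<omega>. (\<integral>y. H (\<omega>, y) \<partial>Q \<omega>) \<partial>M)"
    and "integrable M (\<lambda>\<omega>. \<integral>y. H (\<omega>, y) \<partial>Q \<omega>)"
proof -
  interpret M: prob_space M by fact
  have spF: "space F = space M" using sub by (simp add: subalgebra_def)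
  have idF [measurable]: "(\<lambda>x. x) \<in> M \<rightarrow>\<^sub>M F" using sub by (auto simp: subalgebra_def measurable_def)
  have Q: "Q \<in> F \<rightarrow>\<^sub>M prob_algebra N" using cd by (auto simp: is_cond_distr_def)
  have Qp: "prob_space (Q \<omega>)" "sets (Q \<omega>) = sets N" if "\<omega> \<in> space M" for \<omega>
    using measurable_space[OF Q] that spF by (auto simp: space_prob_algebra)
  note Qs [measurable] = measurable_prob_algebraD[OF Q]
  have meas: "(\<lambda>\<omega>. \<integral>y. H (\<omega>, y) \<partial>Q \<omega>) \<in> borel_measurable F"
    by (rule cond_distr_integral_measurable[OF M sub Z cd H])
  then have measM [measurable]: "(\<lambda>\<omega>. \<integral>y. H (\<omega>, y) \<partial>Q \<omega>) \<in> borel_measurable M"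
    using sub measurable_from_subalg by blast
  have iy: "integrable (Q \<omega>) (\<lambda>y. H (\<omega>, y))" "cmod (\<integral>y. H (\<omega>, y) \<partial>Q \<omega>) \<le> B" if \<omega>: "\<omega> \<in> space M" for \<omega>
  proof -
    interpret q: prob_space "Q \<omega>" by (rule Qp[OF \<omega>])
    note [measurable_cong] = Qp(2)[OF \<omega>]
    show 1: "integrable (Q \<omega>) (\<lambda>y. H (\<omega>, y))"
      by (rule q.integrable_const_bound[where B=B]) (use \<omega> spF B in auto)
    have "cmod (\<integral>y. H (\<omega>, y) \<partial>Q \<omega>) \<le> (\<integral>y. cmod (H (\<omega>, y)) \<partial>Q \<omega>)" by (rule integral_norm_bound)
    also have "\<dots> \<le> (\<integral>y. B \<partial>Q \<omega>)" by (rule integral_mono) (use 1 B in auto)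
    finally show "cmod (\<integral>y. H (\<omega>, y) \<partial>Q \<omega>) \<le> B" by (simp add: q.prob_space)
  qed
  show i2: "integrable M (\<lambda>\<omega>. \<integral>y. H (\<omega>, y) \<partial>Q \<omega>)"
    by (rule M.integrable_const_bound[where B=B]) (use iy in auto)
  have i1: "integrable M (\<lambda>\<omega>. H (\<omega>, Z \<omega>))"
    by (rule M.integrable_const_bound[where B=B]) (use B in auto)
  have Bc: "\<bar>Re (H p)\<bar> \<le> B" "\<bar>Im (H p)\<bar> \<le> B" for p
    using B[of p] abs_Re_le_cmod[of "H p"] abs_Im_le_cmod[of "H p"] by linarith+
  show "(\<integral>\<omega>. H (\<omega>, Z \<omega>) \<partial>M) = (\<integral>\<omega>. (\<integral>y. H (\<omega>, y) \<partial>Q \<omega>) \<partial>M)"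
  proof (rule complex_eqI)
    have "Re (\<integral>\<omega>. H (\<omega>, Z \<omega>) \<partial>M) = (\<integral>\<omega>. Re (H (\<omega>, Z \<omega>)) \<partial>M)" using i1 by (rule integral_Re[symmetric])
    also have "\<dots> = (\<integral>\<omega>. (\<integral>y. Re (H (\<omega>, y)) \<partial>Q \<omega>) \<partial>M)"
      by (rule cond_distr_integral_real[OF M sub Z cd]) (use Bc in auto)
    also have "\<dots> = (\<integral>\<omega>. Re (\<integral>y. H (\<omega>, y) \<partial>Q \<omega>) \<partial>M)"
      by (intro Bochner_Integration.integral_cong refl integral_Re iy)
    also have "\<dots> = Re (\<integral>\<omega>. (\<integral>y. H (\<omega>, y) \<partial>Q \<omega>) \<partial>M)" using i2 by (rule integral_Re)
    finally show "Re (\<integral>\<omega>. H (\<omega>, Z \<omega>) \<partial>M) = Re (\<integral>\<omega>. (\<integral>y. H (\<omega>, y) \<partial>Q \<omega>) \<partial>M)" .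
    have "Im (\<integral>\<omega>. H (\<omega>, Z \<omega>) \<partial>M) = (\<integral>\<omega>. Im (H (\<omega>, Z \<omega>)) \<partial>M)" using i1 by (rule integral_Im[symmetric])
    also have "\<dots> = (\<integral>\<omega>. (\<integral>y. Im (H (\<omega>, y)) \<partial>Q \<omega>) \<partial>M)"
      by (rule cond_distr_integral_real[OF M sub Z cd]) (use Bc in auto)
    also have "\<dots> = (\<integral>\<omega>. Im (\<integral>y. H (\<omega>, y) \<partial>Q \<omega>) \<partial>M)"
      by (intro Bochner_Integration.integral_cong refl integral_Im iy)
    also have "\<dots> = Im (\<integral>\<omega>. (\<integral>y. H (\<omega>, y) \<partial>Q \<omega>) \<partial>M)" using i2 by (rule integral_Im)
    finally show "Im (\<integral>\<omega>. H (\<omega>, Z \<omega>) \<partial>M) = Im (\<integral>\<omega>. (\<integral>y. H (\<omega>, y) \<partial>Q \<omega>) \<partial>M)" .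
  qed
qed

section \<open>The link function\<close>

lemma C1_real:
  fixes g :: "real \<Rightarrow> real"
  assumes "g C1_differentiable_on S" "open S"
  shows "\<And>u. u \<in> S \<Longrightarrow> (g has_real_derivative deriv g u) (at u)" "continuous_on S (deriv g)"
proof -
  obtain D where D: "\<And>x. x \<in> S \<Longrightarrow> (g has_vector_derivative D x) (at x)" "continuous_on S D"
    using assms(1) by (auto simp: C1_differentiable_on_def)
  have D': "(g has_real_derivative D x) (at x)" if "x \<in> S" for x
    using D(1)[OF that] by (simp add: has_real_derivative_iff_has_vector_derivative)
  have eq: "deriv g x = D x" if "x \<in> S" for x using D'[OF that] by (rule DERIV_imp_deriv)
  show "\<And>u. u \<in> S \<Longrightarrow> (g has_real_derivative deriv g u) (at u)" using D' eq by simp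
  show "continuous_on S (deriv g)" using D(2) eq by (simp cong: continuous_on_cong)
qed

text \<open>The mean value inequality is applied to x \<mapsto> g x - g' w * x, whose derivative g'
  x - g' w is small near w, uniformly in w by uniform continuity of \<open>g'\<close>.\<close>

lemma uniform_derivative_interval:
  fixes g :: "real \<Rightarrow> real"
  assumes d: "\<And>u. u \<in> {lo..hi} \<Longrightarrow> (g has_real_derivative g' u) (at u)"
    and c: "continuous_on {lo..hi} g'" and "0 < \<epsilon>"
  obtains \<delta> where "0 < \<delta>" "\<And>u w. u \<in> {lo..hi} \<Longrightarrow> w \<in> {lo..hi} \<Longrightarrow> \<bar>u - w\<bar> < \<delta> \<Longrightarrow>
    \<bar>g u - g w - g' w * (u - w)\<bar> \<le> \<epsilon> * \<bar>u - w\<bar>"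
proof -
  have "uniformly_continuous_on {lo..hi} g'" using c by (intro compact_uniformly_continuous) auto
  then obtain \<delta> where \<delta>: "0 < \<delta>" "\<And>x y. x \<in> {lo..hi} \<Longrightarrow> y \<in> {lo..hi} \<Longrightarrow> dist y x < \<delta> \<Longrightarrow> dist (g' y) (g' x) < \<epsilon>"
    using \<open>0 < \<epsilon>\<close> unfolding uniformly_continuous_on_def by meson
  show ?thesis
  proof (rule that[OF \<delta>(1)])
    fix u w assume u: "u \<in> {lo..hi}" and w: "w \<in> {lo..hi}" and uw: "\<bar>u - w\<bar> < \<delta>"
    have "norm ((g u - g' w * u) - (g w - g' w * w)) \<le> \<epsilon> * norm (u - w)"
    proof (rule field_differentiable_bound[of "closed_segment w u" "\<lambda>x. g x - g' w * x" "\<lambda>x. g' x - g' w"])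
      fix z assume z: "z \<in> closed_segment w u"
      then have zI: "z \<in> {lo..hi}" using u w by (auto simp: closed_segment_eq_real_ivl split: if_splits)
      show "((\<lambda>x. g x - g' w * x) has_field_derivative g' z - g' w) (at z within closed_segment w u)"
        by (auto intro!: derivative_eq_intros has_field_derivative_at_within[OF d[OF zI]])
      have "dist z w < \<delta>"
        using z uw by (auto simp: closed_segment_eq_real_ivl dist_real_def split: if_splits)
      then show "norm (g' z - g' w) \<le> \<epsilon>" using \<delta>(2)[OF w zI] by (simp add: dist_real_def)
    qed auto
    then show "\<bar>g u - g w - g' w * (u - w)\<bar> \<le> \<epsilon> * \<bar>u - w\<bar>" by (simp add: algebra_simps)
  qed
qed

lemma pos_lower_bound_interval:
  fixes g :: "real \<Rightarrow> real"
  assumes "continuous_on {lo..hi} g" "\<And>u. u \<in> {lo..hi} \<Longrightarrow> 0 < g u"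
  obtains m where "0 < m" "\<And>u. u \<in> {lo..hi} \<Longrightarrow> m \<le> g u"
proof (cases "lo \<le> hi")
  case True
  then obtain x where "x \<in> {lo..hi}" "\<And>y. y \<in> {lo..hi} \<Longrightarrow> g x \<le> g y"
    using continuous_attains_inf[OF compact_Icc _ assms(1)] by auto
  then show ?thesis using assms(2) that by blast
next
  case False
  \<comment> \<open>On an empty interval any positive number is a lower bound.\<close>
  then show ?thesis using that[of 1] by auto
qed

locale glm_link =
  fixes J I :: "real set" and \<nu> :: "real measure" and K b G :: "real \<Rightarrow> real" and P :: "real \<Rightarrow> real measure"
  assumes ef: "exp_family J \<nu> K b P"
    and I: "open I" "is_interval I"
    and G: "G C1_differentiable_on I" "deriv G C1_differentiable_on I"
    and G_pos: "\<And>u. u \<in> I \<Longrightarrow> 0 < deriv G u"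
    and G_range: "G ` I \<subseteq> deriv b ` J"
begin

abbreviation h :: "real \<Rightarrow> real" where "h \<equiv> nat_param J b G"

text \<open>The derivative of the natural parameter \<open>h\<close> with respect to the linear
  predictor; it is the weight of a residual in the score.\<close>

definition h1 :: "real \<Rightarrow> real" where "h1 u = deriv G u / deriv (deriv b) (h u)"

text \<open>The derivative of \<open>h1\<close> by the quotient rule; this is where the second
  derivative of \<open>G\<close> enters.\<close>

definition h2 :: "real \<Rightarrow> real" where
  "h2 u = (deriv (deriv G) u * deriv (deriv b) (h u) - deriv G u * (deriv (deriv (deriv b)) (h u) * h1 u))
     / (deriv (deriv b) (h u) * deriv (deriv b) (h u))"

lemma J: "open J" "is_interval J" "J \<noteq> {}"
  using ef by (auto simp: exp_family_def)

lemma inj_db: "inj_on (deriv b) J"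
proof (rule linorder_inj_onI')
  fix x y assume xy: "x \<in> J" "y \<in> J" "x < y"
  have "deriv b x < deriv b y"
  proof (rule DERIV_pos_imp_increasing[OF xy(3)])
    fix z assume "x \<le> z" "z \<le> y"
    then have "z \<in> J" using xy J(2) unfolding is_interval_1 by blast
    then show "\<exists>d. (deriv b has_real_derivative d) (at z) \<and> 0 < d"
      using exp_family_regular(2)[OF ef] exp_familyD(5)[OF ef] by blast
  qed
  then show "deriv b x \<noteq> deriv b y" by simp
qed

lemma h_in: "h u \<in> J" and db_h: "deriv b (h u) = G u" if "u \<in> I"
proof -
  have "G u \<in> deriv b ` J" using G_range that by auto
  then show "h u \<in> J" "deriv b (h u) = G u"
    unfolding nat_param_def using the_inv_into_into[OF inj_db] f_the_inv_into_f[OF inj_db] by auto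
qed

lemma v_pos: "u \<in> I \<Longrightarrow> 0 < deriv (deriv b) (h u)"
  using exp_familyD(5)[OF ef h_in] .

lemma DERIV_G: "u \<in> I \<Longrightarrow> (G has_real_derivative deriv G u) (at u)"
  and DERIV_G': "u \<in> I \<Longrightarrow> (deriv G has_real_derivative deriv (deriv G) u) (at u)"
  and cont_G': "continuous_on I (deriv G)" "continuous_on I (deriv (deriv G))"
  using C1_real[OF G(1) I(1)] C1_real[OF G(2) I(1)] by auto

text \<open>\<open>h\<close> is \<open>G\<close> followed by the inverse of \<open>deriv b\<close>.
  The inverse function theorem applies because the variance b'' is positive on the open
  \<open>J\<close>.\<close>

lemma DERIV_h: "(h has_real_derivative h1 u) (at u)" if u: "u \<in> I"
proof -
  have "(the_inv_into J (deriv b) has_real_derivative inverse (deriv (deriv b) (h u))) (at (deriv b (h u)))"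
    unfolding has_field_derivative_def
  proof (rule has_derivative_inverse_strong[of J "h u" "deriv b" "the_inv_into J (deriv b)"])
    show "(deriv b has_derivative (*) (deriv (deriv b) (h u))) (at (h u))"
      using exp_family_regular(2)[OF ef h_in[OF u]] by (simp add: has_field_derivative_def)
    show "(*) (deriv (deriv b) (h u)) \<circ> (*) (inverse (deriv (deriv b) (h u))) = id"
      using v_pos[OF u] by (auto simp: fun_eq_iff)
    show "continuous_on J (deriv b)" by (rule exp_family_regular(5)[OF ef])
    show "\<And>z. z \<in> J \<Longrightarrow> the_inv_into J (deriv b) (deriv b z) = z"
      by (rule the_inv_into_f_f[OF inj_db])
  qed (use J h_in[OF u] in auto)
  then have "((\<lambda>w. the_inv_into J (deriv b) (G w)) has_real_derivative inverse (deriv (deriv b) (h u)) * deriv G u) (at u)"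
    using DERIV_chain2[OF _ DERIV_G[OF u]] db_h[OF u] by simp
  moreover have "h = (\<lambda>w. the_inv_into J (deriv b) (G w))" by (simp add: fun_eq_iff nat_param_def)
  ultimately show ?thesis by (simp add: h1_def divide_inverse mult.commute)
qed

lemma DERIV_h1: "(h1 has_real_derivative h2 u) (at u)" if u: "u \<in> I"
proof -
  have "((\<lambda>w. deriv (deriv b) (h w)) has_real_derivative deriv (deriv (deriv b)) (h u) * h1 u) (at u)"
    by (rule DERIV_chain2[OF exp_family_regular(3)[OF ef h_in[OF u]] DERIV_h[OF u]])
  from DERIV_divide[OF DERIV_G'[OF u] this] v_pos[OF u]
  show ?thesis unfolding h1_def[abs_def] h2_def[unfolded h1_def] by (simp add: h1_def)
qed

lemma cont_h: "continuous_on I h" "continuous_on I h1" "continuous_on I h2" "continuous_on I G"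
  "continuous_on I (\<lambda>u. deriv (deriv b) (h u))" "continuous_on I (\<lambda>u. b (h u))"
proof -
  show h: "continuous_on I h" "continuous_on I h1" "continuous_on I G"
    using DERIV_h DERIV_h1 DERIV_G by (auto intro!: continuous_at_imp_continuous_on dest: DERIV_isCont)
  have c: "continuous_on I (\<lambda>u. g (h u))" if "continuous_on J g" for g :: "real \<Rightarrow> real"
    by (rule continuous_on_compose2[OF that h(1)]) (use h_in in auto)
  show "continuous_on I (\<lambda>u. deriv (deriv b) (h u))" "continuous_on I (\<lambda>u. b (h u))"
    using c exp_family_regular[OF ef] by auto
  have nz: "deriv (deriv b) (h u) \<noteq> 0" if "u \<in> I" for u using v_pos[OF that] by simp
  show "continuous_on I h2"
    unfolding h2_def[abs_def]
    by (intro continuous_intros c exp_family_regular(6,7)[OF ef] cont_G' h) (use nz in auto)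
qed

lemma h1_pos: "u \<in> I \<Longrightarrow> 0 < h1 u"
  using G_pos v_pos by (simp add: h1_def)

text \<open>The information identity. The first form is the weight in the negative mean derivative
  of the score, the second the variance factor of a score summand.\<close>

lemma phi_sq: "(glm_phi J b G u)\<^sup>2 = h1 u * deriv G u"
  and phi_sq': "(glm_phi J b G u)\<^sup>2 = (h1 u)\<^sup>2 * deriv (deriv b) (h u)" if "u \<in> I"
  using v_pos[OF that] by (simp_all add: glm_phi_def h1_def power_divide power2_eq_square)

text \<open>The left-hand side is the Kullback-Leibler divergence of the response distribution at \<open>u\<close>
  from the one at \<open>w\<close>.\<close>

lemma KL_lower_bound:
  assumes lohi: "{lo..hi} \<subseteq> I"
  obtains \<kappa> where "0 < \<kappa>" "\<And>u w. u \<in> {lo..hi} \<Longrightarrow> w \<in> {lo..hi} \<Longrightarrow>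
    \<kappa> * (u - w)\<^sup>2 \<le> (h w - h u) * G w - b (h w) + b (h u)"
proof -
  have sub: "u \<in> {lo..hi} \<Longrightarrow> u \<in> I" for u using lohi by auto
  obtain m1 where m1: "0 < m1" "\<And>u. u \<in> {lo..hi} \<Longrightarrow> m1 \<le> h1 u"
    using pos_lower_bound_interval[of lo hi h1] continuous_on_subset[OF cont_h(2) lohi] h1_pos sub by blast
  obtain m2 where m2: "0 < m2" "\<And>u. u \<in> {lo..hi} \<Longrightarrow> m2 \<le> deriv G u"
    using pos_lower_bound_interval[of lo hi "deriv G"] continuous_on_subset[OF cont_G'(1) lohi] G_pos sub by blast
  have Ginc: "m2 * (u - w) \<le> G u - G w" if "w \<in> {lo..hi}" "u \<in> {lo..hi}" "w \<le> u" for u w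
  proof (cases "w = u")
    case False
    then have "w < u" using that by simp
    have "\<exists>z. w < z \<and> z < u \<and> G u - G w = (u - w) * deriv G z"
    proof (rule MVT2[OF \<open>w < u\<close>])
      fix x assume "w \<le> x" "x \<le> u"
      then have "x \<in> {lo..hi}" using that by auto
      then show "(G has_real_derivative deriv G x) (at x)" by (intro DERIV_G sub)
    qed
    then obtain z where z: "w < z" "z < u" "G u - G w = (u - w) * deriv G z" by blast
    then have "m2 \<le> deriv G z" using m2(2)[of z] that by auto
    then show ?thesis using z(3) that(3) mult_right_mono[of m2 "deriv G z" "u - w"] by (simp add: mult.commute)
  qed auto
  define \<kappa> where "\<kappa> = m1 * m2 / 2"
  \<comment> \<open>Up to a term free of u this is the divergence minus the quadratic. Its
    derivative in u is h1 u * (G u - G w) - m1 * m2 * (u - w), which has the sign of u - w, so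
    \<open>A w\<close> is minimal at w; \<kappa> carries the factor 1/2 for this reason.\<close>
  define A where "A w u = b (h u) - h u * G w - \<kappa> * (u - w)\<^sup>2" for w u
  have dA: "(A w has_real_derivative h1 u * (G u - G w) - m1 * m2 * (u - w)) (at u)" if "u \<in> {lo..hi}" for u w
  proof -
    have "((\<lambda>u. b (h u)) has_real_derivative deriv b (h u) * h1 u) (at u)"
      by (rule DERIV_chain2[OF exp_family_regular(1)[OF ef h_in[OF sub[OF that]]] DERIV_h[OF sub[OF that]]])
    then show ?thesis unfolding A_def[abs_def]
      using DERIV_h[OF sub[OF that]] db_h[OF sub[OF that]]
      by (auto intro!: derivative_eq_intros simp: \<kappa>_def field_simps)
  qed
  show ?thesis
  proof (rule that[of \<kappa>])
    show "0 < \<kappa>" using m1 m2 by (simp add: \<kappa>_def)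
    fix u w assume u: "u \<in> {lo..hi}" and w: "w \<in> {lo..hi}"
    have "A w w \<le> A w u"
    proof (cases "w \<le> u")
      case True
      show ?thesis
      proof (rule DERIV_nonneg_imp_nondecreasing[OF True])
        fix z assume z: "w \<le> z" "z \<le> u"
        then have zI: "z \<in> {lo..hi}" using u w by auto
        have "m1 * (m2 * (z - w)) \<le> h1 z * (G z - G w)"
          using m1(1) m2(1) Ginc[OF w zI] z less_imp_le[OF h1_pos[OF sub[OF zI]]] by (intro mult_mono m1(2)[OF zI]) auto
        then show "\<exists>y. (A w has_real_derivative y) (at z) \<and> 0 \<le> y"
          using dA[OF zI] by (intro exI conjI) (auto simp: mult.assoc)
      qed
    next
      case False
      then have "u \<le> w" by simp
      show ?thesis
      proof (rule DERIV_nonpos_imp_nonincreasing[OF \<open>u \<le> w\<close>])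
        fix z assume z: "u \<le> z" "z \<le> w"
        then have zI: "z \<in> {lo..hi}" using u w by auto
        have "m1 * (m2 * (w - z)) \<le> h1 z * (G w - G z)"
          using m1(1) m2(1) Ginc[OF zI w] z less_imp_le[OF h1_pos[OF sub[OF zI]]] by (intro mult_mono m1(2)[OF zI]) auto
        then show "\<exists>y. (A w has_real_derivative y) (at z) \<and> y \<le> 0"
          using dA[OF zI] by (intro exI conjI) (auto simp: algebra_simps)
      qed
    qed
    then show "\<kappa> * (u - w)\<^sup>2 \<le> (h w - h u) * G w - b (h w) + b (h u)"
      by (simp add: A_def algebra_simps)
  qed
qed

end

section \<open>Sums of centred responses\<close>

lemma stage_subset: "stage p n\<^sub>1 (Suc k) = {n_obs p n\<^sub>1 k<..n_obs p n\<^sub>1 (Suc k)}"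
  by (simp add: stage_def)

lemma n_obs_Suc_le: "n_obs p n\<^sub>1 k \<le> n_obs p n\<^sub>1 (Suc k)"
  by (simp add: n_obs_def)

lemma n_obs_mono: "j \<le> k \<Longrightarrow> n_obs p n\<^sub>1 j \<le> n_obs p n\<^sub>1 k"
  by (rule lift_Suc_mono_le[of "n_obs p n\<^sub>1"]) (rule n_obs_Suc_le)

lemma upto_n_obs_Suc:
  "{1..n_obs p n\<^sub>1 (Suc k)} = {1..n_obs p n\<^sub>1 k} \<union> stage p n\<^sub>1 (Suc k)"
  "{1..n_obs p n\<^sub>1 k} \<inter> stage p n\<^sub>1 (Suc k) = {}"
  using n_obs_Suc_le[of p n\<^sub>1 k] by (auto simp: stage_subset)

lemma finite_stage [simp]: "finite (stage p n\<^sub>1 k)" by (simp add: stage_def)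

lemma stage_ex: "1 \<le> i \<Longrightarrow> i \<le> n_obs p n\<^sub>1 k \<Longrightarrow> \<exists>j. i \<in> stage p n\<^sub>1 (Suc j) \<and> Suc j \<le> k"
proof (induction k)
  case 0 then show ?case by (simp add: n_obs_def)
next
  case (Suc k)
  show ?case
  proof (cases "i \<le> n_obs p n\<^sub>1 k")
    case True
    from Suc.IH[OF Suc.prems(1) True] obtain j where "i \<in> stage p n\<^sub>1 (Suc j)" "Suc j \<le> k" by blast
    then show ?thesis by (intro exI[of _ j]) simp
  next
    case False
    then show ?thesis using Suc.prems by (intro exI[of _ k]) (simp add: stage_subset)
  qed
qed

lemma le_n_obs: "1 \<le> p \<Longrightarrow> k \<le> n_obs p n\<^sub>1 (Suc k)"
  by (simp add: n_obs_def trans_le_add2)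

text \<open>Forgets the regression structure: the natural parameter is merely a continuous function
  of the design point with values in a compact part of \<open>J\<close>, which is enough for moment
  bounds uniform over all stages.\<close>

locale staged_responses = prob_space M
  for M :: "'w measure" +
  fixes XX :: "'x::metric_space set" and p n\<^sub>1 :: nat
    and X :: "nat \<Rightarrow> 'w \<Rightarrow> 'x" and Y :: "nat \<Rightarrow> 'w \<Rightarrow> real" and F :: "nat \<Rightarrow> 'w measure"
    and J :: "real set" and \<nu> :: "real measure" and K b :: "real \<Rightarrow> real" and P :: "real \<Rightarrow> real measure"
    and tau :: "'x \<Rightarrow> real" and tlo thi :: real
  assumes p: "1 \<le> p" and n1: "1 \<le> n\<^sub>1"
    and compact: "compact XX"
    and ef: "exp_family J \<nu> K b P"
    and tJ: "{tlo..thi} \<subseteq> J" "tlo \<le> thi"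
    and tau: "continuous_on XX tau" "\<And>x. x \<in> XX \<Longrightarrow> tau x \<in> {tlo..thi}"
    and X_M: "\<And>i. 1 \<le> i \<Longrightarrow> X i \<in> M \<rightarrow>\<^sub>M restrict_space borel XX"
    and Y_M: "\<And>i. 1 \<le> i \<Longrightarrow> Y i \<in> borel_measurable M"
    and a1: "cond_a1 M XX p n\<^sub>1 X Y F"
    and a2: "\<And>k. is_cond_distr M (F k) (PiM (stage p n\<^sub>1 (Suc k)) (\<lambda>_. borel))
        (\<lambda>\<omega>. \<lambda>i\<in>stage p n\<^sub>1 (Suc k). Y i \<omega>)
        (\<lambda>\<omega>. PiM (stage p n\<^sub>1 (Suc k)) (\<lambda>i. P (tau (X i \<omega>))))"
begin

abbreviation "N \<equiv> n_obs p n\<^sub>1"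
abbreviation "st k \<equiv> stage p n\<^sub>1 (Suc k)"

text \<open>The first two derivatives of \<open>b\<close> are mean and variance of a response, so
  \<open>err\<close> is conditionally centred and its conditional variance is \<open>vr\<close> at
  the design point.\<close>

definition err :: "nat \<Rightarrow> 'w \<Rightarrow> real" where "err i \<omega> = Y i \<omega> - deriv b (tau (X i \<omega>))"
definition vr :: "'x \<Rightarrow> real" where "vr x = deriv (deriv b) (tau x)"

lemma sub: "subalgebra M (F k)" using a1 by (simp add: cond_a1_def)

lemma space_F: "space (F k) = space M" using sub[of k] by (simp add: subalgebra_def)

lemma F_mono: "j \<le> k \<Longrightarrow> subalgebra (F k) (F j)"
  using a1 unfolding subalgebra_def space_F by (simp add: cond_a1_def filtration_def)

lemma X_in: "1 \<le> i \<Longrightarrow> \<omega> \<in> space M \<Longrightarrow> X i \<omega> \<in> XX"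
  using measurable_space[OF X_M] by (auto simp: space_restrict_space)

lemma one_le_stage: "i \<in> st k \<Longrightarrow> 1 \<le> i" by (auto simp: stage_def)

text \<open>Design points are predictable: those of the stage to come are already measurable for
  \<open>F k\<close>, hence the bound \<open>N (Suc k)\<close>, whereas responses are so only up to
  \<open>N k\<close>.\<close>

lemma X_F:
  assumes "1 \<le> i" "i \<le> N (Suc k)"
  shows "X i \<in> F k \<rightarrow>\<^sub>M restrict_space borel XX"
proof -
  obtain j where j: "i \<in> st j" "Suc j \<le> Suc k" using stage_ex[OF assms] by blast
  have "(\<lambda>\<omega>. \<lambda>i\<in>st j. X i \<omega>) \<in> F j \<rightarrow>\<^sub>M PiM (st j) (\<lambda>_. restrict_space borel XX)"
    using a1 unfolding cond_a1_def by (metis le_add1 plus_1_eq_Suc diff_Suc_1)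
  from measurable_compose[OF this measurable_component_singleton[OF j(1)]]
  have "X i \<in> F j \<rightarrow>\<^sub>M restrict_space borel XX" using j(1) by simp
  moreover have "j \<le> k" using j(2) by simp
  ultimately show ?thesis using measurable_from_subalg[OF F_mono] by metis
qed

lemma Y_F:
  assumes "1 \<le> i" "i \<le> N k"
  shows "Y i \<in> borel_measurable (F k)"
proof -
  obtain j where j: "i \<in> st j" "Suc j \<le> k" using stage_ex[OF assms] by blast
  have "(\<lambda>\<omega>. \<lambda>i\<in>st j. Y i \<omega>) \<in> F (Suc j) \<rightarrow>\<^sub>M PiM (st j) (\<lambda>_. borel)"
    using a1 unfolding cond_a1_def by (metis le_add1 plus_1_eq_Suc)
  from measurable_compose[OF this measurable_component_singleton[OF j(1)]]
  have "Y i \<in> F (Suc j) \<rightarrow>\<^sub>M borel" using j(1) by simp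
  then show ?thesis by (rule measurable_from_subalg[OF F_mono[OF j(2)]])
qed

lemma cX_F:
  assumes "continuous_on XX (c :: 'x \<Rightarrow> real)" "1 \<le> i" "i \<le> N (Suc k)"
  shows "(\<lambda>\<omega>. c (X i \<omega>)) \<in> borel_measurable (F k)"
  by (rule measurable_compose[OF X_F[OF assms(2,3)] borel_measurable_continuous_on_restrict[OF assms(1)]])

lemma cX_M:
  assumes "continuous_on XX (c :: 'x \<Rightarrow> real)" "1 \<le> i"
  shows "(\<lambda>\<omega>. c (X i \<omega>)) \<in> borel_measurable M"
  by (rule measurable_compose[OF X_M[OF assms(2)] borel_measurable_continuous_on_restrict[OF assms(1)]])

lemma cont_m: "continuous_on XX (\<lambda>x. deriv b (tau x))" and cont_vr: "continuous_on XX vr"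
  unfolding vr_def using exp_family_regular(5,6)[OF ef] tJ tau
  by (auto intro!: continuous_on_compose2[OF _ tau(1)])

lemma err_F: "1 \<le> i \<Longrightarrow> i \<le> N k \<Longrightarrow> err i \<in> borel_measurable (F k)"
  unfolding err_def[abs_def]
  by (intro borel_measurable_diff Y_F cX_F[OF cont_m]) (assumption | erule order_trans[OF _ n_obs_Suc_le])+

lemma err_M [measurable]: "1 \<le> i \<Longrightarrow> err i \<in> borel_measurable M"
  unfolding err_def[abs_def] by (intro borel_measurable_diff Y_M cX_M[OF cont_m])

lemma tau_J: "x \<in> XX \<Longrightarrow> tau x \<in> J"
  by (rule subsetD[OF tJ(1) tau(2)])

lemma vr_nonneg: "x \<in> XX \<Longrightarrow> 0 \<le> vr x"
  unfolding vr_def by (rule less_imp_le[OF exp_familyD(5)[OF ef tau_J]])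

text \<open>The index set of \<^const>\<open>PiM\<close> families is a whole type; outside the stage any
  probability measure will do.\<close>

definition stage_law :: "nat \<Rightarrow> 'w \<Rightarrow> nat \<Rightarrow> real measure" where
  "stage_law k \<omega> i = (if i \<in> st k then P (tau (X i \<omega>)) else return borel 0)"

lemma product_prob_space_stage_law:
  assumes "\<omega> \<in> space M"
  shows "product_prob_space (stage_law k \<omega>)"
proof -
  have "prob_space (stage_law k \<omega> i)" for i
  proof (cases "i \<in> st k")
    case True
    then show ?thesis unfolding stage_law_def if_P[OF True]
      by (intro exp_familyD(1)[OF ef tau_J] X_in[OF one_le_stage assms])
  qed (simp add: stage_law_def prob_space_return)
  then show ?thesis by (intro product_prob_spaceI)
qed

lemma PiM_stage_law: "PiM (st k) (\<lambda>i. P (tau (X i \<omega>))) = PiM (st k) (stage_law k \<omega>)"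
  by (rule PiM_cong) (auto simp: stage_law_def)

lemma YZ_M: "(\<lambda>\<omega>. \<lambda>i\<in>st k. Y i \<omega>) \<in> M \<rightarrow>\<^sub>M PiM (st k) (\<lambda>_. borel)"
  by (rule measurable_restrict) (use Y_M one_le_stage in blast)

lemma sets_P: "x \<in> XX \<Longrightarrow> sets (P (tau x)) = sets borel"
  and prob_P: "x \<in> XX \<Longrightarrow> prob_space (P (tau x))"
  by (rule exp_familyD(2)[OF ef tau_J], assumption) (rule exp_familyD(1)[OF ef tau_J])

text \<open>The real factor compensates the decay of the conditional characteristic function of a stage up
  to an error that is cubic in \<open>s\<close>; so \<open>U c s\<close> is almost a martingale, started at 1.\<close>

definition U :: "('x \<Rightarrow> real) \<Rightarrow> real \<Rightarrow> nat \<Rightarrow> 'w \<Rightarrow> complex" where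
  "U c s k \<omega> = iexp (s * (\<Sum>i\<in>{1..N k}. c (X i \<omega>) * err i \<omega>)) *
     complex_of_real (exp (s\<^sup>2 / 2 * (\<Sum>i\<in>{1..N k}. (c (X i \<omega>))\<^sup>2 * vr (X i \<omega>))))"

lemma U_F:
  assumes "continuous_on XX c"
  shows "U c s k \<in> borel_measurable (F k)"
proof -
  have [measurable]: "(\<lambda>\<omega>. c (X i \<omega>)) \<in> borel_measurable (F k)" "(\<lambda>\<omega>. vr (X i \<omega>)) \<in> borel_measurable (F k)"
    "err i \<in> borel_measurable (F k)"
    if "i \<in> {1..N k}" for i
    using that n_obs_Suc_le[of p n\<^sub>1 k] by (auto intro!: cX_F[OF assms] cX_F[OF cont_vr] err_F)
  show ?thesis unfolding U_def[abs_def] by measurable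
qed

lemma U_M: "continuous_on XX c \<Longrightarrow> U c s k \<in> borel_measurable M"
  by (rule measurable_from_subalg[OF sub U_F])

lemma U_bound:
  assumes V: "\<And>x. x \<in> XX \<Longrightarrow> (c x)\<^sup>2 * vr x \<le> V" and "\<omega> \<in> space M"
  shows "cmod (U c s k \<omega>) \<le> exp (s\<^sup>2 / 2 * (real (N k) * V))"
proof -
  have "(\<Sum>i\<in>{1..N k}. (c (X i \<omega>))\<^sup>2 * vr (X i \<omega>)) \<le> (\<Sum>i\<in>{1..N k}. V)"
    using V X_in[OF _ \<open>\<omega> \<in> space M\<close>] by (intro sum_mono) auto
  then show ?thesis by (simp add: U_def norm_mult mult_left_mono)
qed

text \<open>Conditionally on \<open>F k\<close>, the new stage multiplies \<open>U\<close> by a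
  product of characteristic functions times the compensating exponential. That exponential is
  exactly the reciprocal of the product of the Gaussian approximations, so only the approximation
  errors survive. Factors of modulus at most 1 make the error of the product at most the sum of the
  errors.\<close>

lemma char_step:
  assumes c: "continuous_on XX c" and s: "0 \<le> s" "s \<le> 1"
    and B: "\<And>x. x \<in> XX \<Longrightarrow> \<bar>c x\<bar> \<le> B"
    and V: "\<And>x. x \<in> XX \<Longrightarrow> (c x)\<^sup>2 * vr x \<le> V"
    and D: "0 \<le> D" "\<And>\<tau> x. \<tau> \<in> {tlo..thi} \<Longrightarrow> \<bar>x\<bar> \<le> B \<Longrightarrow>
     cmod ((\<integral>y. iexp (x * (y - deriv b \<tau>)) \<partial>P \<tau>) - complex_of_real (exp (- (x\<^sup>2 * deriv (deriv b) \<tau> / 2)))) \<le> D * \<bar>x\<bar> ^ 3"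
  shows "cmod (expectation (U c s (Suc k)) - expectation (U c s k))
    \<le> exp (s\<^sup>2 / 2 * (real (N (Suc k)) * V)) * (real (card (st k)) * (D * B ^ 3 * s ^ 3))"
proof -
  have sum_upto_Suc: "(\<Sum>i\<in>{1..N (Suc k)}. g i) = (\<Sum>i\<in>{1..N k}. g i) + (\<Sum>i\<in>st k. g i)" for g :: "nat \<Rightarrow> real"
    unfolding upto_n_obs_Suc(1) by (rule sum.union_disjoint) (simp_all only: upto_n_obs_Suc(2) finite_stage finite_atLeastAtMost)
  \<comment> \<open>Everything in the next \<open>U\<close> that is known before the responses of
    the stage, including the new compensator. The indicator makes the bound hold off
    \<open>space M\<close> as well, as \<open>cond_distr_integral_complex\<close> requires.\<close>
  define W where "W \<omega> = U c s k \<omega> * complex_of_real (exp (s\<^sup>2 / 2 * (\<Sum>i\<in>st k. (c (X i \<omega>))\<^sup>2 * vr (X i \<omega>))))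
    * complex_of_real (indicator (space M) \<omega>)" for \<omega>
  define H where "H = (\<lambda>(\<omega>, y). W \<omega> * (\<Prod>i\<in>st k. iexp (s * c (X i \<omega>) * (y i - deriv b (tau (X i \<omega>))))))"
  define \<phi> where "\<phi> \<omega> i = (\<integral>y. iexp (s * c (X i \<omega>) * (y - deriv b (tau (X i \<omega>)))) \<partial>P (tau (X i \<omega>)))" for \<omega> i
  define ee where "ee \<omega> i = complex_of_real (exp (- ((s * c (X i \<omega>))\<^sup>2 * vr (X i \<omega>) / 2)))" for \<omega> i
  let ?E = "exp (s\<^sup>2 / 2 * (real (N (Suc k)) * V))"
  have st_le: "1 \<le> i" "i \<le> N (Suc k)" if "i \<in> st k" for i using that by (auto simp: stage_def)
  have mc [measurable]: "(\<lambda>\<omega>. c (X i \<omega>)) \<in> borel_measurable (F k)" "(\<lambda>\<omega>. vr (X i \<omega>)) \<in> borel_measurable (F k)"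
    "(\<lambda>\<omega>. deriv b (tau (X i \<omega>))) \<in> borel_measurable (F k)" if "i \<in> st k" for i
    using cX_F[OF c] cX_F[OF cont_vr] cX_F[OF cont_m] st_le that by auto
  note [measurable] = U_F[OF c]
  have spM [measurable]: "space M \<in> sets (F k)" using space_F[of k] sets.top[of "F k"] by simp
  have WF [measurable]: "W \<in> borel_measurable (F k)" unfolding W_def[abs_def] by measurable
  have WM [measurable]: "W \<in> borel_measurable M" by (rule measurable_from_subalg[OF sub WF])
  have Wb: "cmod (W \<omega>) \<le> ?E" for \<omega>
  proof (cases "\<omega> \<in> space M")
    case True
    have cs: "card {1..N k} + card (st k) = N (Suc k)"
    proof -
      have "card {1..N (Suc k)} = card {1..N k} + card (st k)"
        unfolding upto_n_obs_Suc(1) by (rule card_Un_disjoint) (simp_all only: upto_n_obs_Suc(2) finite_stage finite_atLeastAtMost)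
      then show ?thesis by simp
    qed
    have "(\<Sum>i\<in>st k. (c (X i \<omega>))\<^sup>2 * vr (X i \<omega>)) \<le> (\<Sum>i\<in>st k. V)"
      using V X_in[OF _ True] st_le by (intro sum_mono) auto
    then have "exp (s\<^sup>2 / 2 * (\<Sum>i\<in>st k. (c (X i \<omega>))\<^sup>2 * vr (X i \<omega>))) \<le> exp (s\<^sup>2 / 2 * (real (card (st k)) * V))"
      by (simp add: mult_left_mono)
    then have "cmod (W \<omega>) \<le> exp (s\<^sup>2 / 2 * (real (N k) * V)) * exp (s\<^sup>2 / 2 * (real (card (st k)) * V))"
      using U_bound[OF V True, of s k] True unfolding W_def
      by (simp add: norm_mult mult_mono)
    also have "\<dots> = exp (s\<^sup>2 / 2 * ((real (N k) + real (card (st k))) * V))"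
      by (simp add: exp_add[symmetric] algebra_simps)
    also have "real (N k) + real (card (st k)) = real (N (Suc k))" using cs by simp
    finally show ?thesis .
  qed (simp add: W_def)
  have Hm: "H \<in> borel_measurable (F k \<Otimes>\<^sub>M PiM (st k) (\<lambda>_. borel))"
    unfolding H_def by measurable
  have Hb: "cmod (H q) \<le> ?E" for q
    using Wb[of "fst q"] by (simp add: H_def split_beta norm_mult prod_norm[symmetric])
  note CI = cond_distr_integral_complex[OF prob_space_axioms sub YZ_M a2 Hm Hb]
  have UH: "U c s (Suc k) \<omega> = H (\<omega>, \<lambda>i\<in>st k. Y i \<omega>)" if "\<omega> \<in> space M" for \<omega>
  proof -
    have "U c s (Suc k) \<omega> = U c s k \<omega> * (iexp (s * (\<Sum>i\<in>st k. c (X i \<omega>) * err i \<omega>)) *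
       complex_of_real (exp (s\<^sup>2 / 2 * (\<Sum>i\<in>st k. (c (X i \<omega>))\<^sup>2 * vr (X i \<omega>)))))"
      unfolding U_def sum_upto_Suc by (simp add: distrib_left exp_add mult_ac)
    also have "iexp (s * (\<Sum>i\<in>st k. c (X i \<omega>) * err i \<omega>)) = (\<Prod>i\<in>st k. iexp (s * c (X i \<omega>) * err i \<omega>))"
      by (simp add: exp_sum[symmetric] sum_distrib_left mult.assoc)
    finally show ?thesis using that by (simp add: H_def W_def err_def cong: prod.cong)
  qed
  \<comment> \<open>Conditional independence within the stage: the integral over the product measure
    factors.\<close>
  have inner: "(\<integral>y. H (\<omega>, y) \<partial>PiM (st k) (\<lambda>i. P (tau (X i \<omega>)))) = W \<omega> * (\<Prod>i\<in>st k. \<phi> \<omega> i)"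
    if \<omega>: "\<omega> \<in> space M" for \<omega>
  proof -
    let ?Q = "stage_law k \<omega>"
    interpret Q: product_prob_space ?Q by (rule product_prob_space_stage_law[OF \<omega>])
    have ii: "integrable (?Q i) (\<lambda>y. iexp (s * c (X i \<omega>) * (y - deriv b (tau (X i \<omega>)))))" if "i \<in> st k" for i
    proof -
      have x: "X i \<omega> \<in> XX" using X_in[OF one_le_stage[OF that] \<omega>] .
      interpret q: prob_space "P (tau (X i \<omega>))" by (rule prob_P[OF x])
      note [measurable_cong] = sets_P[OF x]
      show ?thesis unfolding stage_law_def if_P[OF that] by (rule q.integrable_const_bound[where B=1]) auto
    qed
    have "(\<integral>y. H (\<omega>, y) \<partial>PiM (st k) ?Q) = W \<omega> * (\<integral>y. (\<Prod>i\<in>st k. iexp (s * c (X i \<omega>) * (y i - deriv b (tau (X i \<omega>))))) \<partial>PiM (st k) ?Q)"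
      by (simp add: H_def)
    also have "(\<integral>y. (\<Prod>i\<in>st k. iexp (s * c (X i \<omega>) * (y i - deriv b (tau (X i \<omega>))))) \<partial>PiM (st k) ?Q)
        = (\<Prod>i\<in>st k. \<integral>y. iexp (s * c (X i \<omega>) * (y - deriv b (tau (X i \<omega>)))) \<partial>?Q i)"
      by (rule Q.product_integral_prod) (use ii in auto)
    also have "\<dots> = (\<Prod>i\<in>st k. \<phi> \<omega> i)" by (intro prod.cong) (auto simp: \<phi>_def stage_law_def)
    finally show ?thesis unfolding PiM_stage_law .
  qed
  have EU1: "expectation (U c s (Suc k)) = expectation (\<lambda>\<omega>. W \<omega> * (\<Prod>i\<in>st k. \<phi> \<omega> i))"
  proof -
    have "expectation (U c s (Suc k)) = expectation (\<lambda>\<omega>. H (\<omega>, \<lambda>i\<in>st k. Y i \<omega>))"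
      by (intro Bochner_Integration.integral_cong refl UH)
    also note CI(1)
    also have "expectation (\<lambda>\<omega>. \<integral>y. H (\<omega>, y) \<partial>PiM (st k) (\<lambda>i. P (tau (X i \<omega>)))) = expectation (\<lambda>\<omega>. W \<omega> * (\<Prod>i\<in>st k. \<phi> \<omega> i))"
      by (intro Bochner_Integration.integral_cong refl inner)
    finally show ?thesis .
  qed
  have int1: "integrable M (\<lambda>\<omega>. W \<omega> * (\<Prod>i\<in>st k. \<phi> \<omega> i))"
    by (rule iffD1[OF Bochner_Integration.integrable_cong[OF refl inner] CI(2)])
  \<comment> \<open>The compensator of the stage cancels the Gaussian factors \<open>ee\<close>, so
    both expectations have the same prefactor \<open>W\<close> and can be compared.\<close>
  have UW: "U c s k \<omega> = W \<omega> * (\<Prod>i\<in>st k. ee \<omega> i)" if "\<omega> \<in> space M" for \<omega>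
  proof -
    have "exp (s\<^sup>2 / 2 * (\<Sum>i\<in>st k. (c (X i \<omega>))\<^sup>2 * vr (X i \<omega>))) * (\<Prod>i\<in>st k. exp (- ((s * c (X i \<omega>))\<^sup>2 * vr (X i \<omega>) / 2))) = 1"
      by (simp add: exp_sum[symmetric] exp_add[symmetric] sum_distrib_left power_mult_distrib sum_negf algebra_simps)
    then have "complex_of_real (exp (s\<^sup>2 / 2 * (\<Sum>i\<in>st k. (c (X i \<omega>))\<^sup>2 * vr (X i \<omega>)))) * (\<Prod>i\<in>st k. ee \<omega> i) = 1"
      unfolding ee_def of_real_prod[symmetric] of_real_mult[symmetric] by (simp only: of_real_1)
    then show ?thesis using that by (simp add: W_def mult.assoc)
  qed
  have em: "(\<lambda>\<omega>. ee \<omega> i) \<in> borel_measurable M" if "i \<in> st k" for i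
    unfolding ee_def using cX_M[OF c] cX_M[OF cont_vr] st_le[OF that] by simp
  have ee1: "cmod (ee \<omega> i) \<le> 1" if "i \<in> st k" "\<omega> \<in> space M" for \<omega> i
    using vr_nonneg[OF X_in] st_le that by (simp add: ee_def)
  have int2: "integrable M (\<lambda>\<omega>. W \<omega> * (\<Prod>i\<in>st k. ee \<omega> i))"
  proof (rule integrable_const_bound[where B="?E * 1"])
    show "AE \<omega> in M. cmod (W \<omega> * (\<Prod>i\<in>st k. ee \<omega> i)) \<le> ?E * 1"
    proof (rule AE_I2)
      fix \<omega> assume "\<omega> \<in> space M"
      then have "cmod (\<Prod>i\<in>st k. ee \<omega> i) \<le> 1"
        unfolding prod_norm[symmetric] by (intro prod_le_1) (use ee1 in auto)
      then show "cmod (W \<omega> * (\<Prod>i\<in>st k. ee \<omega> i)) \<le> ?E * 1"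
        using Wb[of \<omega>] unfolding norm_mult by (intro mult_mono) auto
    qed
    show "(\<lambda>\<omega>. W \<omega> * (\<Prod>i\<in>st k. ee \<omega> i)) \<in> borel_measurable M" using em by measurable
  qed
  have EU2: "expectation (U c s k) = expectation (\<lambda>\<omega>. W \<omega> * (\<Prod>i\<in>st k. ee \<omega> i))"
    by (intro Bochner_Integration.integral_cong refl UW)
  have pt: "cmod (W \<omega> * (\<Prod>i\<in>st k. \<phi> \<omega> i) - W \<omega> * (\<Prod>i\<in>st k. ee \<omega> i)) \<le> ?E * (real (card (st k)) * (D * B ^ 3 * s ^ 3))"
    if \<omega>: "\<omega> \<in> space M" for \<omega>
  proof -
    have c1: "cmod (\<phi> \<omega> i) \<le> 1" "cmod (\<phi> \<omega> i - ee \<omega> i) \<le> D * B ^ 3 * s ^ 3" if "i \<in> st k" for i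
    proof -
      have x: "X i \<omega> \<in> XX" using X_in[OF one_le_stage[OF that] \<omega>] .
      interpret q: prob_space "P (tau (X i \<omega>))" by (rule prob_P[OF x])
      have "cmod (\<phi> \<omega> i) \<le> (\<integral>y. cmod (iexp (s * c (X i \<omega>) * (y - deriv b (tau (X i \<omega>))))) \<partial>P (tau (X i \<omega>)))"
        unfolding \<phi>_def by (rule integral_norm_bound)
      also have "\<dots> = 1" using q.prob_space by simp
      finally show "cmod (\<phi> \<omega> i) \<le> 1" .
      have B0: "0 \<le> B" using B[OF x] by linarith
      have sB: "\<bar>s * c (X i \<omega>)\<bar> \<le> s * B" using s B[OF x] by (simp add: abs_mult mult_left_mono)
      \<comment> \<open>Here s <= 1 is needed: it keeps the frequency in the range for which
        \<open>D\<close> was obtained.\<close>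
      also have "s * B \<le> B" using s B0 mult_right_mono[of s 1 B] by simp
      finally have "cmod (\<phi> \<omega> i - ee \<omega> i) \<le> D * \<bar>s * c (X i \<omega>)\<bar> ^ 3"
        unfolding \<phi>_def ee_def vr_def by (rule D(2)[OF tau(2)[OF x]])
      also have "\<dots> \<le> D * (s * B) ^ 3" using sB D(1) by (intro mult_left_mono power_mono) auto
      finally show "cmod (\<phi> \<omega> i - ee \<omega> i) \<le> D * B ^ 3 * s ^ 3" by (simp add: power_mult_distrib mult_ac)
    qed
    have "cmod ((\<Prod>i\<in>st k. \<phi> \<omega> i) - (\<Prod>i\<in>st k. ee \<omega> i)) \<le> (\<Sum>i\<in>st k. cmod (\<phi> \<omega> i - ee \<omega> i))"
      by (rule norm_prod_diff) (use c1 ee1 \<omega> in auto)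
    also have "\<dots> \<le> (\<Sum>i\<in>st k. D * B ^ 3 * s ^ 3)" by (intro sum_mono c1)
    finally have *: "cmod ((\<Prod>i\<in>st k. \<phi> \<omega> i) - (\<Prod>i\<in>st k. ee \<omega> i)) \<le> real (card (st k)) * (D * B ^ 3 * s ^ 3)" by simp
    show ?thesis
      unfolding right_diff_distrib[symmetric] norm_mult by (intro mult_mono Wb *) auto
  qed
  have "cmod (expectation (U c s (Suc k)) - expectation (U c s k))
      = cmod (expectation (\<lambda>\<omega>. W \<omega> * (\<Prod>i\<in>st k. \<phi> \<omega> i) - W \<omega> * (\<Prod>i\<in>st k. ee \<omega> i)))"
    unfolding EU1 EU2 using int1 int2 by simp
  also have "\<dots> \<le> expectation (\<lambda>\<omega>. cmod (W \<omega> * (\<Prod>i\<in>st k. \<phi> \<omega> i) - W \<omega> * (\<Prod>i\<in>st k. ee \<omega> i)))"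
    by (rule integral_norm_bound)
  also have "\<dots> \<le> expectation (\<lambda>_. ?E * (real (card (st k)) * (D * B ^ 3 * s ^ 3)))"
    by (rule integral_mono) (use int1 int2 pt in auto)
  finally show ?thesis by (simp add: prob_space)
qed

end

section \<open>Single responses, law of large numbers and central limit theorem\<close>

context staged_responses
begin

text \<open>A coordinate of the product law of a stage has the corresponding factor as its marginal;
  the integrand may still depend on the past.\<close>

lemma resp_nn_integral:
  assumes i: "i \<in> st k" and H [measurable]: "(\<lambda>(\<omega>, y). H \<omega> y) \<in> borel_measurable (F k \<Otimes>\<^sub>M borel)"
  shows "(\<integral>\<^sup>+\<omega>. H \<omega> (Y i \<omega>) \<partial>M) = (\<integral>\<^sup>+\<omega>. (\<integral>\<^sup>+y. H \<omega> y \<partial>P (tau (X i \<omega>))) \<partial>M)"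
proof -
  have m: "(\<lambda>(\<omega>, y). H \<omega> (y i)) \<in> borel_measurable (F k \<Otimes>\<^sub>M PiM (st k) (\<lambda>_. borel))"
    using i by measurable
  have "(\<integral>\<^sup>+\<omega>. H \<omega> (Y i \<omega>) \<partial>M) = (\<integral>\<^sup>+\<omega>. (\<lambda>(\<omega>, y). H \<omega> (y i)) (\<omega>, \<lambda>i\<in>st k. Y i \<omega>) \<partial>M)"
    using i by simp
  also have "\<dots> = (\<integral>\<^sup>+\<omega>. (\<integral>\<^sup>+y. H \<omega> (y i) \<partial>PiM (st k) (\<lambda>i. P (tau (X i \<omega>)))) \<partial>M)"
    using cond_distr_nn_integral[OF prob_space_axioms sub YZ_M a2 m] by simp
  also have "\<dots> = (\<integral>\<^sup>+\<omega>. (\<integral>\<^sup>+y. H \<omega> y \<partial>P (tau (X i \<omega>))) \<partial>M)"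
  proof (intro nn_integral_cong)
    fix \<omega> assume \<omega>: "\<omega> \<in> space M"
    interpret Q: product_prob_space "stage_law k \<omega>" "st k" by (rule product_prob_space_stage_law[OF \<omega>])
    have Pi: "stage_law k \<omega> i = P (tau (X i \<omega>))" using i by (simp add: stage_law_def)
    have sP: "sets (P (tau (X i \<omega>))) = sets borel" by (rule sets_P[OF X_in[OF one_le_stage[OF i] \<omega>]])
    have "\<omega> \<in> space (F k)" using \<omega> space_F by simp
    then have "H \<omega> \<in> borel_measurable borel" using H by simp
    then have Hm: "H \<omega> \<in> borel_measurable (stage_law k \<omega> i)" unfolding Pi by (simp only: measurable_cong_sets[OF sP refl])
    have "(\<integral>\<^sup>+y. H \<omega> y \<partial>P (tau (X i \<omega>))) = (\<integral>\<^sup>+y. H \<omega> y \<partial>distr (PiM (st k) (stage_law k \<omega>)) (stage_law k \<omega> i) (\<lambda>y. y i))"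
      by (subst Q.PiM_component[OF i]) (simp only: Pi)
    also have "\<dots> = (\<integral>\<^sup>+y. H \<omega> (y i) \<partial>PiM (st k) (stage_law k \<omega>))"
      by (rule nn_integral_distr[OF measurable_component_singleton[OF i]]) (use Hm in simp)
    finally show "(\<integral>\<^sup>+y. H \<omega> (y i) \<partial>PiM (st k) (\<lambda>i. P (tau (X i \<omega>)))) = (\<integral>\<^sup>+y. H \<omega> y \<partial>P (tau (X i \<omega>)))"
      by (simp only: PiM_stage_law)
  qed
  finally show ?thesis .
qed

lemma ex_stage:
  assumes "1 \<le> i"
  obtains k where "i \<in> st k"
  using stage_ex[OF assms le_n_obs[OF p]] by blast

lemma AE_K_nonzero: "AE \<omega> in M. \<forall>i\<ge>1. K (Y i \<omega>) \<noteq> 0"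
proof -
  have [measurable]: "K \<in> borel_measurable borel" using ef unfolding exp_family_def by blast
  have "AE \<omega> in M. 1 \<le> i \<longrightarrow> K (Y i \<omega>) \<noteq> 0" for i
  proof (cases "1 \<le> i")
    case True
    note [measurable] = Y_M[OF True]
    obtain k where k: "i \<in> st k" using ex_stage[OF True] .
    have "(\<integral>\<^sup>+\<omega>. indicator {y. K y = 0} (Y i \<omega>) \<partial>M) = (\<integral>\<^sup>+\<omega>. (\<integral>\<^sup>+y. indicator {y. K y = 0} y \<partial>P (tau (X i \<omega>))) \<partial>M)"
      by (rule resp_nn_integral[OF k]) measurable
    also have "\<dots> = (\<integral>\<^sup>+\<omega>. 0 \<partial>M)"
    proof (intro nn_integral_cong)
      fix \<omega> assume "\<omega> \<in> space M"
      then have x: "X i \<omega> \<in> XX" by (rule X_in[OF True])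
      have "AE y in P (tau (X i \<omega>)). K y \<noteq> 0" by (rule exp_family_K_pos[OF ef tau_J[OF x]])
      then have "AE y in P (tau (X i \<omega>)). indicator {y. K y = 0} y = (0::ennreal)"
        by (rule eventually_mono) simp
      then show "(\<integral>\<^sup>+y. indicator {y. K y = 0} y \<partial>P (tau (X i \<omega>))) = 0"
        by (subst nn_integral_cong_AE) auto
    qed
    finally have z: "(\<integral>\<^sup>+\<omega>. indicator {y. K y = 0} (Y i \<omega>) \<partial>M) = 0" by simp
    have "AE \<omega> in M. indicator {y. K y = 0} (Y i \<omega>) = (0::ennreal)"
      using z by (subst (asm) nn_integral_0_iff_AE) auto
    then show ?thesis by (rule eventually_mono) (auto simp: indicator_def split: if_splits)
  qed simp
  then show ?thesis by (simp add: AE_all_countable)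
qed

lemma err_first_moment:
  obtains C where "0 \<le> C" "\<And>i. 1 \<le> i \<Longrightarrow> (\<integral>\<^sup>+\<omega>. ennreal \<bar>err i \<omega>\<bar> \<partial>M) \<le> ennreal C"
proof -
  obtain C where C: "0 \<le> C" "\<And>\<tau>. \<tau> \<in> {tlo..thi} \<Longrightarrow> (\<integral>\<^sup>+y. ennreal \<bar>y - deriv b \<tau>\<bar> \<partial>P \<tau>) \<le> ennreal C"
    using exp_family_first_abs_moment[OF ef tJ] by blast
  show ?thesis
  proof (rule that[OF C(1)])
    fix i :: nat assume i: "1 \<le> i"
    obtain k where k: "i \<in> st k" using ex_stage[OF i] .
    have ik: "i \<le> N (Suc k)" using k by (simp add: stage_def)
    note [measurable] = cX_F[OF cont_m i ik]
    have "(\<integral>\<^sup>+\<omega>. ennreal \<bar>err i \<omega>\<bar> \<partial>M) = (\<integral>\<^sup>+\<omega>. (\<integral>\<^sup>+y. ennreal \<bar>y - deriv b (tau (X i \<omega>))\<bar> \<partial>P (tau (X i \<omega>))) \<partial>M)"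
      unfolding err_def by (rule resp_nn_integral[OF k]) measurable
    also have "\<dots> \<le> (\<integral>\<^sup>+\<omega>. ennreal C \<partial>M)"
      by (intro nn_integral_mono C(2) tau(2) X_in[OF i])
    finally show "(\<integral>\<^sup>+\<omega>. ennreal \<bar>err i \<omega>\<bar> \<partial>M) \<le> ennreal C" by (simp add: emeasure_space_1)
  qed
qed

text \<open>Markov's inequality with a constant independent of the stage. The mean absolute error
  multiplies the small oscillations over a parameter net and in Taylor remainders, so it has to be
  bounded in probability.\<close>

lemma mean_abs_err_bound:
  obtains C where "0 \<le> C"
    "\<And>k L. 0 < L \<Longrightarrow> prob {\<omega> \<in> space M. L \<le> (\<Sum>i\<in>{1..N k}. \<bar>err i \<omega>\<bar>) / real (N k)} \<le> C / L"
proof -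
  obtain C where C: "0 \<le> C" "\<And>i. 1 \<le> i \<Longrightarrow> (\<integral>\<^sup>+\<omega>. ennreal \<bar>err i \<omega>\<bar> \<partial>M) \<le> ennreal C"
    using err_first_moment by blast
  show ?thesis
  proof (rule that[OF C(1)])
    fix k and L :: real assume L: "0 < L"
    let ?m = "\<lambda>\<omega>. (\<Sum>i\<in>{1..N k}. \<bar>err i \<omega>\<bar>) / real (N k)"
    have ii: "integrable M (\<lambda>\<omega>. \<bar>err i \<omega>\<bar>)" "expectation (\<lambda>\<omega>. \<bar>err i \<omega>\<bar>) \<le> C" if "1 \<le> i" for i
    proof -
      show 1: "integrable M (\<lambda>\<omega>. \<bar>err i \<omega>\<bar>)"
      proof (rule integrableI_nonneg)
        show "(\<integral>\<^sup>+\<omega>. ennreal \<bar>err i \<omega>\<bar> \<partial>M) < \<infinity>"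
          using le_less_trans[OF C(2)[OF that] ennreal_less_top] by simp
      qed (use err_M[OF that] in auto)
      have "ennreal (expectation (\<lambda>\<omega>. \<bar>err i \<omega>\<bar>)) = (\<integral>\<^sup>+\<omega>. ennreal \<bar>err i \<omega>\<bar> \<partial>M)"
        by (rule nn_integral_eq_integral[symmetric, OF 1]) simp
      with C(2)[OF that] have "ennreal (expectation (\<lambda>\<omega>. \<bar>err i \<omega>\<bar>)) \<le> ennreal C" by (simp only:)
      then show "expectation (\<lambda>\<omega>. \<bar>err i \<omega>\<bar>) \<le> C" using C(1) by (simp only: ennreal_le_iff)
    qed
    have int: "integrable M ?m" by (intro Bochner_Integration.integrable_divide Bochner_Integration.integrable_sum ii) auto
    have "expectation ?m = (\<Sum>i\<in>{1..N k}. expectation (\<lambda>\<omega>. \<bar>err i \<omega>\<bar>)) / real (N k)"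
      using ii by simp
    also have "\<dots> \<le> (\<Sum>i\<in>{1..N k}. C) / real (N k)"
      by (intro divide_right_mono sum_mono ii) auto
    also have "\<dots> \<le> C" using C(1) by (cases "N k = 0") auto
    finally have E: "expectation ?m \<le> C" .
    have "prob {\<omega> \<in> space M. L \<le> ?m \<omega>} \<le> expectation ?m / L"
      by (rule integral_Markov_inequality_measure[OF int sets.empty_sets]) (use L in \<open>auto intro!: divide_nonneg_nonneg sum_nonneg\<close>)
    also have "\<dots> \<le> C / L" by (rule divide_right_mono[OF E less_imp_le[OF L]])
    finally show "prob {\<omega> \<in> space M. L \<le> ?m \<omega>} \<le> C / L" .
  qed
qed


lemma real_N_ge: "real k \<le> real (N (Suc k))"
  using le_n_obs[OF p] by simp

lemma N_pos: "1 \<le> k \<Longrightarrow> 1 \<le> N k"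
  using n1 by (simp add: n_obs_def)

lemma N_inverse_tendsto_0: "(\<lambda>k. 1 / real (N k)) \<longlonglongrightarrow> 0"
proof -
  have "(\<lambda>k. 1 / real (N (Suc k))) \<longlonglongrightarrow> 0"
  proof (rule tendsto_sandwich[OF _ _ tendsto_const lim_1_over_n])
    show "\<forall>\<^sub>F k in sequentially. 1 / real (N (Suc k)) \<le> 1 / real k"
      using eventually_gt_at_top[of 0]
    proof eventually_elim
      case (elim k)
      then show ?case using real_N_ge[of k] by (intro divide_left_mono) auto
    qed
  qed simp
  then show ?thesis by (rule LIMSEQ_imp_Suc)
qed

text \<open>With \<open>s k = 1 / n\<close> (where \<open>n\<close> is the sample size) and \<open>\<alpha> = 0\<close> this is a weak law of large
  numbers, with \<open>s k = 1 / sqrt n\<close> a central limit theorem.\<close>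

lemma char_conv:
  assumes c: "continuous_on XX c"
    and s: "\<And>k. 0 \<le> s k" "\<And>k. s k \<le> 1" "\<And>k. real (N k) * (s k)\<^sup>2 \<le> 1" "(\<lambda>k. real (N k) * s k ^ 3) \<longlonglongrightarrow> 0"
    and A: "AE \<omega> in M. (\<lambda>k. (s k)\<^sup>2 * (\<Sum>i\<in>{1..N k}. (c (X i \<omega>))\<^sup>2 * vr (X i \<omega>))) \<longlonglongrightarrow> \<alpha>"
  shows "(\<lambda>k. expectation (\<lambda>\<omega>. iexp (s k * (\<Sum>i\<in>{1..N k}. c (X i \<omega>) * err i \<omega>)))) \<longlonglongrightarrow> complex_of_real (exp (- \<alpha> / 2))"
proof -
  have "compact (c ` XX)" "compact ((\<lambda>x. (c x)\<^sup>2 * vr x) ` XX)"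
    using c cont_vr compact by (auto intro!: compact_continuous_image continuous_intros)
  then obtain B0 V0 where B0: "\<And>x. x \<in> XX \<Longrightarrow> \<bar>c x\<bar> \<le> B0" and V0: "\<And>x. x \<in> XX \<Longrightarrow> \<bar>(c x)\<^sup>2 * vr x\<bar> \<le> V0"
    by (metis (no_types, lifting) bounded_iff compact_imp_bounded imageI real_norm_def)
  define B where "B = max B0 0"
  define V where "V = max V0 0"
  have B: "\<And>x. x \<in> XX \<Longrightarrow> \<bar>c x\<bar> \<le> B" "0 \<le> B" using B0 by (force simp: B_def)+
  have V: "\<And>x. x \<in> XX \<Longrightarrow> (c x)\<^sup>2 * vr x \<le> V" "0 \<le> V" using V0 by (force simp: V_def)+
  obtain D where D: "0 \<le> D" "\<And>\<tau> x. \<tau> \<in> {tlo..thi} \<Longrightarrow> \<bar>x\<bar> \<le> B \<Longrightarrow>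
     cmod ((\<integral>y. iexp (x * (y - deriv b \<tau>)) \<partial>P \<tau>) - complex_of_real (exp (- (x\<^sup>2 * deriv (deriv b) \<tau> / 2)))) \<le> D * \<bar>x\<bar> ^ 3"
    using exp_family_char_approx[OF ef tJ, of B] by blast
  \<comment> \<open>Telescoping over the stages at a fixed frequency r. The exponential is bounded
    by its value at the last stage k throughout, so the stage sizes simply add up to
    \<open>N j\<close>.\<close>
  have step: "cmod (expectation (U c r j) - 1) \<le> exp (r\<^sup>2 / 2 * (real (N k) * V)) * (real (N j) * (D * B ^ 3 * r ^ 3))"
    if "j \<le> k" "0 \<le> r" "r \<le> 1" for j k r
    using that(1)
  proof (induction j)
    case 0
    have "U c r 0 = (\<lambda>\<omega>. 1)" by (simp add: fun_eq_iff U_def n_obs_def)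
    then have "expectation (U c r 0) = 1" by (simp add: prob_space)
    then show ?case by (simp add: n_obs_def)
  next
    case (Suc j)
    let ?E = "exp (r\<^sup>2 / 2 * (real (N k) * V))"
    have cs: "real (N j) + real (card (st j)) = real (N (Suc j))"
      using n_obs_Suc_le[of p n\<^sub>1 j] by (simp add: stage_subset)
    have "cmod (expectation (U c r (Suc j)) - expectation (U c r j))
        \<le> exp (r\<^sup>2 / 2 * (real (N (Suc j)) * V)) * (real (card (st j)) * (D * B ^ 3 * r ^ 3))"
      by (rule char_step[OF c that(2,3) B(1) V(1) D])
    also have "\<dots> \<le> ?E * (real (card (st j)) * (D * B ^ 3 * r ^ 3))"
    proof (rule mult_right_mono)
      have "real (N (Suc j)) * V \<le> real (N k) * V"
        using n_obs_mono[OF Suc.prems, of p n\<^sub>1] V(2) by (intro mult_right_mono) auto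
      then show "exp (r\<^sup>2 / 2 * (real (N (Suc j)) * V)) \<le> ?E" by (simp add: mult_left_mono)
      show "0 \<le> real (card (st j)) * (D * B ^ 3 * r ^ 3)" using D(1) B(2) that(2) by simp
    qed
    finally have "cmod (expectation (U c r (Suc j)) - expectation (U c r j)) \<le> ?E * (real (card (st j)) * (D * B ^ 3 * r ^ 3))" .
    moreover have "cmod (expectation (U c r j) - 1) \<le> ?E * (real (N j) * (D * B ^ 3 * r ^ 3))"
      using Suc by simp
    moreover have "cmod (expectation (U c r (Suc j)) - 1)
        \<le> cmod (expectation (U c r (Suc j)) - expectation (U c r j)) + cmod (expectation (U c r j) - 1)"
      by norm
    ultimately have "cmod (expectation (U c r (Suc j)) - 1)
        \<le> ?E * (real (card (st j)) * (D * B ^ 3 * r ^ 3)) + ?E * (real (N j) * (D * B ^ 3 * r ^ 3))" by linarith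
    also have "\<dots> = ?E * ((real (N j) + real (card (st j))) * (D * B ^ 3 * r ^ 3))" by (simp add: algebra_simps)
    finally show ?case by (simp only: cs)
  qed
  \<comment> \<open>This is where n * s^2 <= 1 keeps the compensated characters bounded.\<close>
  have sV: "exp ((s k)\<^sup>2 / 2 * (real (N k) * V)) \<le> exp (V / 2)" for k
  proof -
    have "(real (N k) * (s k)\<^sup>2) * V \<le> 1 * V" by (rule mult_right_mono[OF s(3) V(2)])
    then show ?thesis by (simp add: algebra_simps)
  qed
  have U1: "(\<lambda>k. expectation (U c (s k) k)) \<longlonglongrightarrow> 1"
  proof -
    have "(\<lambda>k. expectation (U c (s k) k) - 1) \<longlonglongrightarrow> 0"
    proof (rule tendsto_0_le[where K=1])
      show "(\<lambda>k. exp (V / 2) * (D * B ^ 3 * (real (N k) * s k ^ 3))) \<longlonglongrightarrow> 0"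
        by (intro tendsto_mult_right_zero s(4))
      have "cmod (expectation (U c (s k) k) - 1) \<le> exp (V / 2) * (D * B ^ 3 * (real (N k) * s k ^ 3))" for k
      proof -
        have "cmod (expectation (U c (s k) k) - 1) \<le> exp ((s k)\<^sup>2 / 2 * (real (N k) * V)) * (real (N k) * (D * B ^ 3 * s k ^ 3))"
          by (rule step[OF order_refl s(1,2)])
        also have "\<dots> \<le> exp (V / 2) * (real (N k) * (D * B ^ 3 * s k ^ 3))"
          using D(1) B(2) s(1)[of k] by (intro mult_right_mono sV) simp
        finally show ?thesis by (simp add: mult_ac)
      qed
      then show "\<forall>\<^sub>F k in sequentially. norm (expectation (U c (s k) k) - 1) \<le> norm (exp (V / 2) * (D * B ^ 3 * (real (N k) * s k ^ 3))) * 1"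
        unfolding real_norm_def mult_1_right by (intro always_eventually allI) (rule order_trans[OF _ abs_ge_self])
    qed
    then show ?thesis by (simp add: LIM_zero_iff)
  qed
  define a where "a k \<omega> = (s k)\<^sup>2 * (\<Sum>i\<in>{1..N k}. (c (X i \<omega>))\<^sup>2 * vr (X i \<omega>))" for k \<omega>
  define \<psi> where "\<psi> k \<omega> = iexp (s k * (\<Sum>i\<in>{1..N k}. c (X i \<omega>) * err i \<omega>))" for k \<omega>
  have U\<psi>: "U c (s k) k \<omega> = \<psi> k \<omega> * complex_of_real (exp (a k \<omega> / 2))" for k \<omega>
    by (simp add: U_def \<psi>_def a_def)
  have am [measurable]: "a k \<in> borel_measurable M" for k
    unfolding a_def[abs_def] using cX_M[OF c] cX_M[OF cont_vr] by (intro borel_measurable_times borel_measurable_sum borel_measurable_power) auto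
  have \<psi>m [measurable]: "\<psi> k \<in> borel_measurable M" for k
  proof -
    have [measurable]: "(\<lambda>\<omega>. \<Sum>i\<in>{1..N k}. c (X i \<omega>) * err i \<omega>) \<in> borel_measurable M"
      using cX_M[OF c] err_M by (intro borel_measurable_times borel_measurable_sum) auto
    show ?thesis unfolding \<psi>_def[abs_def] by measurable
  qed
  note [measurable] = U_M[OF c]
  have Ub: "cmod (U c (s k) k \<omega>) \<le> exp (V / 2)" if "\<omega> \<in> space M" for k \<omega>
    by (rule order_trans[OF U_bound[OF V(1) that] sV])
  have \<psi>1: "cmod (\<psi> k \<omega>) = 1" for k \<omega> by (simp add: \<psi>_def)
  have a0: "0 \<le> a k \<omega>" if "\<omega> \<in> space M" for k \<omega>
    unfolding a_def using vr_nonneg[OF X_in[OF _ that]] by (intro mult_nonneg_nonneg sum_nonneg) auto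
  let ?e = "exp (- \<alpha> / 2)"
  \<comment> \<open>The character \<psi> equals \<open>U\<close> times exp (- a / 2). Replacing this
    random factor by its almost sure limit is harmless because \<open>U\<close> is uniformly
    bounded.\<close>
  have "(\<lambda>k. expectation (\<lambda>\<omega>. U c (s k) k \<omega> * complex_of_real (exp (- a k \<omega> / 2) - ?e))) \<longlonglongrightarrow> expectation (\<lambda>\<omega>. 0 :: complex)"
  proof (rule integral_dominated_convergence[where w="\<lambda>_. exp (V / 2) * (1 + ?e)"])
    show "AE \<omega> in M. (\<lambda>k. U c (s k) k \<omega> * complex_of_real (exp (- a k \<omega> / 2) - ?e)) \<longlonglongrightarrow> 0"
      using A AE_space
    proof eventually_elim
      case (elim \<omega>)
      have "(\<lambda>k. exp (- a k \<omega> / 2) - ?e) \<longlonglongrightarrow> ?e - ?e"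
        using elim(1) by (intro tendsto_intros) (auto simp: a_def)
      then have "(\<lambda>k. exp (V / 2) * \<bar>exp (- a k \<omega> / 2) - ?e\<bar>) \<longlonglongrightarrow> 0"
        by (intro tendsto_mult_right_zero tendsto_rabs_zero) simp
      then show ?case
      proof (rule tendsto_0_le[where K=1], intro always_eventually allI)
        fix k
        have "cmod (U c (s k) k \<omega>) * \<bar>exp (- a k \<omega> / 2) - ?e\<bar> \<le> exp (V / 2) * \<bar>exp (- a k \<omega> / 2) - ?e\<bar>"
          using Ub[OF elim(2)] by (intro mult_right_mono) auto
        then show "norm (U c (s k) k \<omega> * complex_of_real (exp (- a k \<omega> / 2) - ?e)) \<le> norm (exp (V / 2) * \<bar>exp (- a k \<omega> / 2) - ?e\<bar>) * 1"
          unfolding norm_mult norm_of_real by simp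
      qed
    qed
    show "AE \<omega> in M. norm (U c (s k) k \<omega> * complex_of_real (exp (- a k \<omega> / 2) - ?e)) \<le> exp (V / 2) * (1 + ?e)" for k
    proof (rule AE_I2)
      fix \<omega> assume \<omega>: "\<omega> \<in> space M"
      have "exp (- a k \<omega> / 2) \<le> 1" using a0[OF \<omega>] by simp
      then have "\<bar>exp (- a k \<omega> / 2) - ?e\<bar> \<le> 1 + ?e"
        using exp_ge_zero[of "- a k \<omega> / 2"] exp_ge_zero[of "- \<alpha> / 2"] by linarith
      then show "norm (U c (s k) k \<omega> * complex_of_real (exp (- a k \<omega> / 2) - ?e)) \<le> exp (V / 2) * (1 + ?e)"
        unfolding norm_mult norm_of_real by (intro mult_mono Ub[OF \<omega>]) auto
    qed
  qed auto
  then have L: "(\<lambda>k. expectation (\<lambda>\<omega>. U c (s k) k \<omega> * complex_of_real (exp (- a k \<omega> / 2) - ?e))) \<longlonglongrightarrow> 0" by simp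
  have eq: "expectation (\<psi> k) = expectation (\<lambda>\<omega>. U c (s k) k \<omega> * complex_of_real (exp (- a k \<omega> / 2) - ?e)) + expectation (U c (s k) k) * complex_of_real ?e" for k
  proof -
    have iU: "integrable M (U c (s k) k)"
      by (rule integrable_const_bound[where B="exp (V / 2)"]) (use Ub in auto)
    have i\<psi>: "integrable M (\<psi> k)"
      by (rule integrable_const_bound[where B=1]) (use \<psi>1 in auto)
    have pt: "U c (s k) k \<omega> * complex_of_real (exp (- a k \<omega> / 2) - ?e) = \<psi> k \<omega> - U c (s k) k \<omega> * complex_of_real ?e" for \<omega>
    proof -
      have "complex_of_real (exp (a k \<omega> / 2)) * complex_of_real (exp (- a k \<omega> / 2)) = 1"
        unfolding of_real_mult[symmetric] exp_add[symmetric] by simp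
      then have "U c (s k) k \<omega> * complex_of_real (exp (- a k \<omega> / 2)) = \<psi> k \<omega>"
        unfolding U\<psi> by (simp add: mult.assoc)
      then show ?thesis by (simp only: of_real_diff right_diff_distrib)
    qed
    show ?thesis unfolding pt using iU i\<psi> by simp
  qed
  have "(\<lambda>k. expectation (\<psi> k)) \<longlonglongrightarrow> 0 + 1 * complex_of_real ?e"
    unfolding eq by (intro tendsto_add tendsto_mult L U1 tendsto_const)
  then show ?thesis by (simp add: \<psi>_def[abs_def])
qed

text \<open>The characteristic functions of the averages tend to 1, that of the point mass at 0.
  Weak convergence tested with a truncated multiple of the absolute value, followed by Markov's
  inequality, gives convergence in probability.\<close>

lemma lln:
  assumes c: "continuous_on XX c" and "0 < \<epsilon>"
  shows "(\<lambda>k. prob {\<omega> \<in> space M. \<epsilon> \<le> \<bar>(\<Sum>i\<in>{1..N k}. c (X i \<omega>) * err i \<omega>) / real (N k)\<bar>}) \<longlonglongrightarrow> 0"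
proof -
  define Z where "Z k \<omega> = (\<Sum>i\<in>{1..N k}. c (X i \<omega>) * err i \<omega>) / real (N k)" for k \<omega>
  have Zm [measurable]: "Z k \<in> borel_measurable M" for k
    unfolding Z_def[abs_def] using cX_M[OF c] err_M by (intro borel_measurable_times borel_measurable_sum borel_measurable_divide) auto
  have ch: "(\<lambda>k. expectation (\<lambda>\<omega>. iexp (t * Z k \<omega>))) \<longlonglongrightarrow> 1" for t
  proof -
    \<comment> \<open>The frequency t is arbitrary while the scaling has to lie between 0 and 1, so
      t is absorbed into the coefficient.\<close>
    let ?c = "\<lambda>x. t * c x"
    have c': "continuous_on XX ?c" by (intro continuous_intros c)
    have "compact ((\<lambda>x. (?c x)\<^sup>2 * vr x) ` XX)"
      using c cont_vr compact by (auto intro!: compact_continuous_image continuous_intros)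
    then obtain V where V: "\<And>x. x \<in> XX \<Longrightarrow> \<bar>(?c x)\<^sup>2 * vr x\<bar> \<le> V"
      by (metis (no_types, lifting) bounded_iff compact_imp_bounded imageI real_norm_def)
    have "(\<lambda>k. expectation (\<lambda>\<omega>. iexp ((1 / real (N k)) * (\<Sum>i\<in>{1..N k}. ?c (X i \<omega>) * err i \<omega>)))) \<longlonglongrightarrow> complex_of_real (exp (- 0 / 2))"
    proof (rule char_conv[OF c'])
      show "1 / real (N k) \<le> 1" "real (N k) * (1 / real (N k))\<^sup>2 \<le> 1" for k
        by (cases "N k = 0"; simp add: power2_eq_square field_simps)+
      have "(\<lambda>k. (1 / real (N k)) * (1 / real (N k))) \<longlonglongrightarrow> 0 * 0"
        by (intro tendsto_mult N_inverse_tendsto_0)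
      moreover have "(1 / real (N k)) * (1 / real (N k)) = real (N k) * (1 / real (N k)) ^ 3" for k
        by (simp add: power3_eq_cube)
      ultimately show "(\<lambda>k. real (N k) * (1 / real (N k)) ^ 3) \<longlonglongrightarrow> 0" by simp
      show "AE \<omega> in M. (\<lambda>k. (1 / real (N k))\<^sup>2 * (\<Sum>i\<in>{1..N k}. (?c (X i \<omega>))\<^sup>2 * vr (X i \<omega>))) \<longlonglongrightarrow> 0"
      proof (rule AE_I2)
        fix \<omega> assume \<omega>: "\<omega> \<in> space M"
        show "(\<lambda>k. (1 / real (N k))\<^sup>2 * (\<Sum>i\<in>{1..N k}. (?c (X i \<omega>))\<^sup>2 * vr (X i \<omega>))) \<longlonglongrightarrow> 0"
        proof (rule tendsto_0_le[where K=1])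
          show "(\<lambda>k. V * (1 / real (N k))) \<longlonglongrightarrow> 0"
            by (intro tendsto_mult_right_zero N_inverse_tendsto_0)
          show "\<forall>\<^sub>F k in sequentially. norm ((1 / real (N k))\<^sup>2 * (\<Sum>i\<in>{1..N k}. (?c (X i \<omega>))\<^sup>2 * vr (X i \<omega>))) \<le> norm (V * (1 / real (N k))) * 1"
          proof (intro always_eventually allI)
            fix k
            have "\<bar>\<Sum>i\<in>{1..N k}. (?c (X i \<omega>))\<^sup>2 * vr (X i \<omega>)\<bar> \<le> (\<Sum>i\<in>{1..N k}. \<bar>(?c (X i \<omega>))\<^sup>2 * vr (X i \<omega>)\<bar>)"
              by (rule sum_abs)
            also have "\<dots> \<le> (\<Sum>i\<in>{1..N k}. V)"
              using V X_in[OF _ \<omega>] by (intro sum_mono) auto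
            also have "\<dots> = real (N k) * V" by simp
            finally have "(1 / real (N k))\<^sup>2 * \<bar>\<Sum>i\<in>{1..N k}. (?c (X i \<omega>))\<^sup>2 * vr (X i \<omega>)\<bar> \<le> (1 / real (N k))\<^sup>2 * (real (N k) * V)"
              by (rule mult_left_mono) simp
            also have "\<dots> = V * (1 / real (N k))" by (simp add: power2_eq_square)
            also have "\<dots> \<le> \<bar>V * (1 / real (N k))\<bar>" by (rule abs_ge_self)
            finally show "norm ((1 / real (N k))\<^sup>2 * (\<Sum>i\<in>{1..N k}. (?c (X i \<omega>))\<^sup>2 * vr (X i \<omega>))) \<le> norm (V * (1 / real (N k))) * 1"
              unfolding real_norm_def abs_mult by simp
          qed
        qed
      qed
    qed simp
    moreover have "(1 / real (N k)) * (\<Sum>i\<in>{1..N k}. ?c (X i \<omega>) * err i \<omega>) = t * Z k \<omega>" for k \<omega>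

    proof -
      have "(\<Sum>i\<in>{1..N k}. ?c (X i \<omega>) * err i \<omega>) = t * (\<Sum>i\<in>{1..N k}. c (X i \<omega>) * err i \<omega>)"
        by (simp add: sum_distrib_left mult.assoc)
      then show ?thesis by (simp add: Z_def)
    qed
    ultimately show ?thesis by (simp only:) simp
  qed
  define g where "g x = min 1 (\<bar>x\<bar> / \<epsilon>)" for x :: real
  have gc: "continuous_on UNIV g" unfolding g_def by (intro continuous_intros) (use \<open>0 < \<epsilon>\<close> in auto)
  have g01: "0 \<le> g x" "g x \<le> 1" for x using \<open>0 < \<epsilon>\<close> by (auto simp: g_def)
  have [measurable]: "g \<in> borel_measurable borel" using gc by (rule borel_measurable_continuous_onI)
  have "(\<lambda>k. \<integral>x. g x \<partial>distr M borel (Z k)) \<longlonglongrightarrow> (\<integral>x. g x \<partial>return borel 0)"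
  proof (rule char_conv_imp_weak_conv)
    show "prob_space (distr M borel (Z k))" for k by (rule prob_space_distr) simp
    show "prob_space (return borel (0::real))" by (rule prob_space_return) simp
    show "(\<lambda>k. CLINT x|distr M borel (Z k). iexp (t \<bullet> x)) \<longlonglongrightarrow> (CLINT x|return borel 0. iexp (t \<bullet> x))" for t
      using ch[of t] by (simp add: integral_distr integral_return)
    show "bounded (range g)" unfolding bounded_iff using g01 by (intro exI[of _ 1]) auto
  qed (use gc in auto)
  then have lim: "(\<lambda>k. expectation (\<lambda>\<omega>. g (Z k \<omega>))) \<longlonglongrightarrow> 0"
    by (simp add: integral_distr integral_return) (simp add: g_def)
  show ?thesis
  proof (rule tendsto_sandwich[OF _ _ tendsto_const lim])
    show "\<forall>\<^sub>F k in sequentially. prob {\<omega> \<in> space M. \<epsilon> \<le> \<bar>(\<Sum>i\<in>{1..N k}. c (X i \<omega>) * err i \<omega>) / real (N k)\<bar>} \<le> expectation (\<lambda>\<omega>. g (Z k \<omega>))"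
    proof (intro always_eventually allI)
      fix k
      have ig: "integrable M (\<lambda>\<omega>. g (Z k \<omega>))" by (rule integrable_const_bound[where B=1]) (use g01 in auto)
      have "prob {\<omega> \<in> space M. 1 \<le> g (Z k \<omega>)} \<le> expectation (\<lambda>\<omega>. g (Z k \<omega>)) / 1"
        by (rule integral_Markov_inequality_measure[OF ig sets.empty_sets]) (use g01 in auto)
      moreover have "1 \<le> g (Z k \<omega>) \<longleftrightarrow> \<epsilon> \<le> \<bar>(\<Sum>i\<in>{1..N k}. c (X i \<omega>) * err i \<omega>) / real (N k)\<bar>" for \<omega>
        unfolding g_def Z_def[symmetric] using \<open>0 < \<epsilon>\<close> by (simp add: le_divide_eq)
      ultimately show "prob {\<omega> \<in> space M. \<epsilon> \<le> \<bar>(\<Sum>i\<in>{1..N k}. c (X i \<omega>) * err i \<omega>) / real (N k)\<bar>} \<le> expectation (\<lambda>\<omega>. g (Z k \<omega>))"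
        by simp
    qed
  qed simp
qed

end

section \<open>Linear images of Lebesgue measure\<close>

text \<open>The change-of-variables theorems of HOL-Analysis require a well-ordered index type. For a linear map
  this is avoidable: the induction over elementary matrices works over every finite index type.\<close>

definition scales_lborel :: "real ^ 'n ^ 'n \<Rightarrow> bool" where
  "scales_lborel A \<longleftrightarrow> (det A \<noteq> 0 \<longrightarrow> (\<forall>h \<in> borel_measurable borel.
     (\<integral>\<^sup>+x. h x \<partial>lborel) = ennreal \<bar>det A\<bar> * (\<integral>\<^sup>+x. h (A *v x) \<partial>lborel)))"

lemma measurable_matrix_vector_mult [measurable]:
  "(\<lambda>x. A *v x) \<in> borel_measurable borel" for A :: "real ^ 'n ^ 'm"
  by (intro borel_measurable_continuous_onI linear_continuous_on matrix_vector_mul_bounded_linear)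

lemma scales_lborel_diagonal:
  fixes A :: "real ^ 'n ^ 'n"
  assumes "\<And>i j. i \<noteq> j \<Longrightarrow> A $ i $ j = 0"
  shows "scales_lborel A"
  unfolding scales_lborel_def
proof (intro impI ballI)
  fix h :: "real ^ 'n \<Rightarrow> ennreal"
  assume d: "det A \<noteq> 0" and h [measurable]: "h \<in> borel_measurable borel"
  have det: "det A = (\<Prod>i\<in>UNIV. A $ i $ i)" by (rule det_diagonal) (use assms in auto)
  \<comment> \<open>On basis vectors this reads off the diagonal entry, which is how the
    coordinatewise scaling of \<open>lborel_affine_euclidean\<close> expects its factors.\<close>
  define c where "c v = v \<bullet> (A *v v)" for v :: "real ^ 'n"
  have Av: "A *v x = (\<chi> i. A $ i $ i * x $ i)" for x
  proof -
    have "(\<Sum>j\<in>UNIV. A $ i $ j * x $ j) = (\<Sum>j\<in>UNIV. if j = i then A $ i $ i * x $ i else 0)" for i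
      by (intro sum.cong) (auto simp: assms)
    then show ?thesis by (simp add: matrix_vector_mult_def)
  qed
  have ca: "c (axis i 1) = A $ i $ i" for i
    by (simp add: c_def inner_axis' Av)
  have nz: "c j \<noteq> 0" if "j \<in> Basis" for j
    using that d unfolding det by (auto simp: Basis_vec_def ca)
  have inj: "inj_on (\<lambda>i::'n. axis i (1::real)) UNIV" by (auto simp: inj_on_def axis_eq_axis)
  have B: "(Basis :: (real ^ 'n) set) = (\<lambda>i. axis i 1) ` UNIV" by (auto simp: Basis_vec_def)
  have T: "0 + (\<Sum>j\<in>Basis. (c j * (x \<bullet> j)) *\<^sub>R j) = A *v x" for x
  proof -
    have "(\<Sum>j\<in>Basis. (c j * (x \<bullet> j)) *\<^sub>R j) = (\<Sum>i\<in>UNIV. (A $ i $ i * x $ i) *\<^sub>R axis i 1)"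
      unfolding B by (subst sum.reindex[OF inj]) (simp add: ca inner_axis)
    also have "\<dots> = (\<Sum>i\<in>UNIV. (A *v x) $ i *s axis i 1)" by (simp add: Av scalar_mult_eq_scaleR)
    also have "\<dots> = A *v x" by (rule basis_expansion)
    finally show ?thesis by simp
  qed
  have P: "(\<Prod>j\<in>Basis. \<bar>c j\<bar>) = \<bar>det A\<bar>"
    unfolding B by (subst prod.reindex[OF inj]) (simp add: ca det abs_prod)
  have "lborel = density (distr lborel borel ((*v) A)) (\<lambda>_. ennreal \<bar>det A\<bar>)"
    using lborel_affine_euclidean[of c 0, OF nz] unfolding T P by simp
  then have "(\<integral>\<^sup>+x. h x \<partial>lborel) = (\<integral>\<^sup>+x. h x \<partial>density (distr lborel borel ((*v) A)) (\<lambda>_. ennreal \<bar>det A\<bar>))"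
    by simp
  also have "\<dots> = ennreal \<bar>det A\<bar> * (\<integral>\<^sup>+x. h (A *v x) \<partial>lborel)"
    by (subst nn_integral_density) (auto simp: nn_integral_cmult nn_integral_distr)
  finally show "(\<integral>\<^sup>+x. h x \<partial>lborel) = ennreal \<bar>det A\<bar> * (\<integral>\<^sup>+x. h (A *v x) \<partial>lborel)" .
qed

text \<open>Interchanging two coordinates maps boxes to boxes with the same side lengths, and boxes
  determine Lebesgue measure.\<close>

lemma scales_lborel_transpose:
  fixes m n :: "'n::finite"
  shows "scales_lborel ((\<chi> i j. mat 1 $ i $ Transposition.transpose m n j) :: real ^ 'n ^ 'n)"
  unfolding scales_lborel_def
proof (intro impI ballI)
  let ?t = "Transposition.transpose m n"
  let ?A = "(\<chi> i j. mat 1 $ i $ ?t j) :: real ^ 'n ^ 'n"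
  fix h :: "real ^ 'n \<Rightarrow> ennreal"
  assume hm [measurable]: "h \<in> borel_measurable borel"
  have tp: "?t permutes UNIV" by (rule permutes_swap_id) auto
  have "det ?A = of_int (sign ?t) * det (mat 1 :: real ^ 'n ^ 'n)"
    by (rule det_permute_columns[OF tp])
  then have det: "\<bar>det ?A\<bar> = 1" by (simp add: sign_def)
  have Ax: "?A *v x = (\<chi> i. x $ ?t i)" for x
  proof -
    have "(\<Sum>j\<in>UNIV. mat 1 $ i $ ?t j * x $ j) = x $ ?t i" for i
    proof -
      have "(\<Sum>j\<in>UNIV. mat 1 $ i $ ?t j * x $ j) = (\<Sum>j\<in>UNIV. if j = ?t i then x $ ?t i else 0)"
        by (intro sum.cong) (auto simp: mat_def transpose_eq_iff dest: transpose_eq_imp_eq)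
      then show ?thesis by simp
    qed
    then show ?thesis by (simp add: matrix_vector_mult_def)
  qed
  have "lborel = distr lborel borel ((*v) ?A)"
  proof (rule lborel_eqI)
    fix l u :: "real ^ 'n" assume le: "\<And>b. b \<in> Basis \<Longrightarrow> l \<bullet> b \<le> u \<bullet> b"
    then have le': "l $ i \<le> u $ i" for i using le[of "axis i 1"] by (auto simp: inner_axis)
    have "(*v) ?A -` box l u \<inter> space lborel = box (\<chi> i. l $ ?t i) (\<chi> i. u $ ?t i)"
      unfolding Ax[abs_def] by (auto simp: mem_box_cart) (metis transpose_involutory)+
    then have "emeasure (distr lborel borel ((*v) ?A)) (box l u) = emeasure lborel (box (\<chi> i. l $ ?t i) (\<chi> i. u $ ?t i))"
      by (subst emeasure_distr) auto
    also have "\<dots> = ennreal (\<Prod>b\<in>Basis. ((\<chi> i. u $ ?t i) - (\<chi> i. l $ ?t i)) \<bullet> b)"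
      by (rule emeasure_lborel_box) (use le' in \<open>auto simp: Basis_vec_def inner_axis\<close>)
    also have "(\<Prod>b\<in>Basis. ((\<chi> i. u $ ?t i) - (\<chi> i. l $ ?t i)) \<bullet> b) = (\<Prod>i\<in>UNIV. u $ ?t i - l $ ?t i)"
      by (simp add: Basis_vec_def prod.UNION_disjoint axis_eq_axis inner_axis)
    also have "\<dots> = (\<Prod>i\<in>UNIV. u $ i - l $ i)"
      by (rule prod.permute[OF tp, symmetric, unfolded o_def])
    also have "\<dots> = (\<Prod>b\<in>Basis. (u - l) \<bullet> b)"
      by (simp add: Basis_vec_def prod.UNION_disjoint axis_eq_axis inner_axis)
    finally show "emeasure (distr lborel borel ((*v) ?A)) (box l u) = (\<Prod>b\<in>Basis. (u - l) \<bullet> b)" .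
  qed simp
  then have "(\<integral>\<^sup>+x. h x \<partial>lborel) = (\<integral>\<^sup>+x. h x \<partial>distr lborel borel ((*v) ?A))" by (rule arg_cong)
  also have "\<dots> = (\<integral>\<^sup>+x. h (?A *v x) \<partial>lborel)" by (rule nn_integral_distr) auto
  finally show "(\<integral>\<^sup>+x. h x \<partial>lborel) = ennreal \<bar>det ?A\<bar> * (\<integral>\<^sup>+x. h (?A *v x) \<partial>lborel)"
    by (simp only: det ennreal_1 mult_1)
qed

text \<open>Coordinate m is integrated innermost. There the shear is a translation by an amount that
  depends only on another coordinate, and one-dimensional Lebesgue measure is translation
  invariant.\<close>

lemma scales_lborel_shear:
  fixes m n :: "'n::finite" and c :: real
  assumes mn: "m \<noteq> n"
  shows "scales_lborel ((\<chi> i j. if i = m \<and> j = n then c else of_bool (i = j)) :: real ^ 'n ^ 'n)"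
  unfolding scales_lborel_def
proof (intro impI ballI)
  let ?A = "(\<chi> i j. if i = m \<and> j = n then c else of_bool (i = j)) :: real ^ 'n ^ 'n"
  fix h :: "real ^ 'n \<Rightarrow> ennreal"
  assume hm [measurable]: "h \<in> borel_measurable borel"
  have "?A = (\<chi> k. if k = m then row m (mat 1) + c *s row n (mat 1) else row k (mat 1))"
    using mn by (auto simp: vec_eq_iff row_def mat_def)
  then have det: "det ?A = 1" using det_row_operation[OF mn, of "mat 1" c] by simp
  have Ax: "?A *v x = x + (c * x $ n) *\<^sub>R axis m 1" for x
  proof -
    have "(\<Sum>j\<in>UNIV. (if i = m \<and> j = n then c else of_bool (i = j)) * x $ j) = x $ i + (if i = m then c * x $ n else 0)" for i
    proof -
      have "(\<Sum>j\<in>UNIV. (if i = m \<and> j = n then c else of_bool (i = j)) * x $ j)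
          = (\<Sum>j\<in>UNIV. (if j = i then x $ i else 0) + (if j = n then (if i = m then c * x $ n else 0) else 0))"
        using mn by (intro sum.cong) auto
      then show ?thesis by (simp add: sum.distrib)
    qed
    then show ?thesis by (auto simp: matrix_vector_mult_def vec_eq_iff axis_def)
  qed
  interpret P: product_sigma_finite "\<lambda>_::real ^ 'n. lborel :: real measure" ..
  let ?S = "\<lambda>f. \<Sum>b\<in>(Basis::(real ^ 'n) set). f b *\<^sub>R b"
  let ?e = "axis m (1::real) :: real ^ 'n"
  let ?B = "Basis - {?e}"
  have eB: "?e \<in> Basis" and nB: "axis n 1 \<in> ?B" using mn by (auto simp: Basis_vec_def axis_eq_axis)
  have ins: "insert ?e ?B = Basis" using eB by auto
  have Sm [measurable]: "?S \<in> (\<Pi>\<^sub>M b\<in>Basis. lborel) \<rightarrow>\<^sub>M borel" by measurable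
  have int: "(\<integral>\<^sup>+x. g x \<partial>lborel) = (\<integral>\<^sup>+f. (\<integral>\<^sup>+y. g (?S (f(?e := y))) \<partial>lborel) \<partial>(\<Pi>\<^sub>M b\<in>?B. lborel))"
    if g [measurable]: "g \<in> borel_measurable borel" for g :: "real ^ 'n \<Rightarrow> ennreal"
  proof -
    have "(\<integral>\<^sup>+x. g x \<partial>lborel) = (\<integral>\<^sup>+f. g (?S f) \<partial>(\<Pi>\<^sub>M b\<in>Basis. lborel))"
      by (subst lborel_eq, subst nn_integral_distr) auto
    also have "\<dots> = (\<integral>\<^sup>+f. g (?S f) \<partial>(\<Pi>\<^sub>M b\<in>insert ?e ?B. lborel))" by (simp only: ins)
    also have "\<dots> = (\<integral>\<^sup>+f. (\<integral>\<^sup>+y. g (?S (f(?e := y))) \<partial>lborel) \<partial>(\<Pi>\<^sub>M b\<in>?B. lborel))"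
      by (rule P.product_nn_integral_insert) (auto simp only: ins, auto)
    finally show ?thesis .
  qed
  have Sn: "?S (f(?e := y)) $ n = f (axis n 1)" for f y
  proof -
    have "?S (f(?e := y)) $ n = ?S (f(?e := y)) \<bullet> axis n 1" by (simp add: inner_axis)
    also have "\<dots> = f (axis n 1)" using nB by (subst inner_sum_left_Basis) auto
    finally show ?thesis .
  qed
  have split: "?S (f(?e := y)) = y *\<^sub>R ?e + (\<Sum>b\<in>?B. f b *\<^sub>R b)" for f y
    by (subst sum.remove[OF _ eB]) (auto intro!: sum.cong)
  have shift: "?A *v ?S (f(?e := y)) = ?S (f(?e := c * f (axis n 1) + y))" for f y
    unfolding Ax Sn unfolding split by (simp add: algebra_simps)
  have "(\<integral>\<^sup>+x. h (?A *v x) \<partial>lborel) = (\<integral>\<^sup>+f. (\<integral>\<^sup>+y. h (?S (f(?e := c * f (axis n 1) + y))) \<partial>lborel) \<partial>(\<Pi>\<^sub>M b\<in>?B. lborel))"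
    by (subst int) (measurable, simp only: shift)
  also have "\<dots> = (\<integral>\<^sup>+f. (\<integral>\<^sup>+y. h (?S (f(?e := y))) \<partial>lborel) \<partial>(\<Pi>\<^sub>M b\<in>?B. lborel))"
  proof (rule nn_integral_cong)
    fix f
    have [measurable]: "(\<lambda>y. h (?S (f(?e := y)))) \<in> borel_measurable borel"
      unfolding split by measurable
    show "(\<integral>\<^sup>+y. h (?S (f(?e := c * f (axis n 1) + y))) \<partial>lborel) = (\<integral>\<^sup>+y. h (?S (f(?e := y))) \<partial>lborel)"
      using nn_integral_real_affine[of "\<lambda>y. h (?S (f(?e := y)))" 1 "c * f (axis n 1)"] by simp
  qed
  also have "\<dots> = (\<integral>\<^sup>+x. h x \<partial>lborel)" by (rule int[symmetric]) simp
  finally show "(\<integral>\<^sup>+x. h x \<partial>lborel) = ennreal \<bar>det ?A\<bar> * (\<integral>\<^sup>+x. h (?A *v x) \<partial>lborel)"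
    by (simp only: det abs_one ennreal_1 mult_1)
qed

lemma nn_integral_lborel_linear:
  fixes A :: "real ^ 'n ^ 'n"
  assumes "det A \<noteq> 0" "h \<in> borel_measurable borel"
  shows "(\<integral>\<^sup>+x. h x \<partial>lborel) = ennreal \<bar>det A\<bar> * (\<integral>\<^sup>+x. h (A *v x) \<partial>lborel)"
proof -
  have "scales_lborel A"
  proof (rule induct_matrix_elementary)
    fix A B :: "real ^ 'n ^ 'n"
    assume mult: "scales_lborel A" "scales_lborel B"
    show "scales_lborel (A ** B)" unfolding scales_lborel_def
    proof (intro impI ballI)
      fix h :: "real ^ 'n \<Rightarrow> ennreal"
      assume d: "det (A ** B) \<noteq> 0" and h [measurable]: "h \<in> borel_measurable borel"
      then have dA: "det A \<noteq> 0" and dB: "det B \<noteq> 0" by (auto simp: det_mul)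
      have "(\<integral>\<^sup>+x. h x \<partial>lborel) = ennreal \<bar>det A\<bar> * (\<integral>\<^sup>+x. h (A *v x) \<partial>lborel)"
        by (rule mult(1)[unfolded scales_lborel_def, rule_format, OF dA h])
      also have "(\<integral>\<^sup>+x. h (A *v x) \<partial>lborel) = ennreal \<bar>det B\<bar> * (\<integral>\<^sup>+x. h (A *v (B *v x)) \<partial>lborel)"
        by (rule mult(2)[unfolded scales_lborel_def, rule_format, OF dB]) measurable
      finally show "(\<integral>\<^sup>+x. h x \<partial>lborel) = ennreal \<bar>det (A ** B)\<bar> * (\<integral>\<^sup>+x. h ((A ** B) *v x) \<partial>lborel)"
        by (simp add: det_mul abs_mult ennreal_mult mult.assoc matrix_vector_mul_assoc)
    qed
  next
    fix A :: "real ^ 'n ^ 'n" and i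
    assume "row i A = 0"
    then have "det A = 0" by (rule det_zero_row)
    then show "scales_lborel A" by (simp add: scales_lborel_def)
  next
    fix A :: "real ^ 'n ^ 'n"
    assume "\<And>i j. i \<noteq> j \<Longrightarrow> A $ i $ j = 0"
    then show "scales_lborel A" by (rule scales_lborel_diagonal)
  qed (rule scales_lborel_transpose, rule scales_lborel_shear)
  then show ?thesis unfolding scales_lborel_def using assms by blast
qed

section \<open>Normal laws as linear images of the standard one\<close>

lemma inner_transpose_matrix: "(transpose A *v x) \<bullet> y = x \<bullet> (A *v y)" for A :: "real ^ 'n ^ 'm"
  by (metis dot_lmul_matrix transpose_matrix_vector)

lemma matrix_inv_inverse:
  fixes A :: "real ^ 'n ^ 'n"
  assumes "det A \<noteq> 0"
  shows "A ** matrix_inv A = mat 1" "matrix_inv A ** A = mat 1" "matrix_inv (matrix_inv A) = A"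
    "det (matrix_inv A) = 1 / det A"
proof -
  have "\<exists>B. A ** B = mat 1 \<and> B ** A = mat 1"
    using assms invertible_det_nz[of A] by (auto simp: invertible_def)
  then have inv: "A ** matrix_inv A = mat 1 \<and> matrix_inv A ** A = mat 1"
    unfolding matrix_inv_def by (rule someI_ex)
  then show 1: "A ** matrix_inv A = mat 1" and 2: "matrix_inv A ** A = mat 1" by auto
  have "\<exists>B. matrix_inv A ** B = mat 1 \<and> B ** matrix_inv A = mat 1" using inv by blast
  then have inv2: "matrix_inv A ** matrix_inv (matrix_inv A) = mat 1 \<and> matrix_inv (matrix_inv A) ** matrix_inv A = mat 1"
    unfolding matrix_inv_def[of "matrix_inv A"] by (rule someI_ex)
  have "A = A ** (matrix_inv A ** matrix_inv (matrix_inv A))" using inv2 by simp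
  also have "\<dots> = matrix_inv (matrix_inv A)" unfolding matrix_mul_assoc 1 by simp
  finally show "matrix_inv (matrix_inv A) = A" by simp
  have "det (matrix_inv A) * det A = 1" by (simp only: det_mul[symmetric] 2 det_I)
  then show "det (matrix_inv A) = 1 / det A" using assms by (simp add: field_simps)
qed

lemma mvnormal_eq_distr_gauss:
  fixes R :: "real ^ 'p ^ 'p"
  assumes R: "det R \<noteq> 0"
  shows "mvnormal (matrix_inv (transpose R ** R)) = distr gauss borel ((*v) (matrix_inv R))"
proof (rule measure_eqI)
  let ?M = "transpose R ** R" and ?S = "matrix_inv R"
  have dM: "det ?M = (det R)\<^sup>2" by (simp add: det_mul power2_eq_square)
  then have "det ?M \<noteq> 0" using R by simp
  note invM = matrix_inv_inverse[OF this] and invR = matrix_inv_inverse[OF R]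
  have dS: "det ?S \<noteq> 0" using R by (simp add: invR)
  have RS: "R *v (?S *v y) = y" for y by (simp add: matrix_vector_mul_assoc invR)
  have quad: "(?S *v y) \<bullet> (?M *v (?S *v y)) = (norm y)\<^sup>2" for y
  proof -
    have "?M *v (?S *v y) = transpose R *v y" by (simp add: matrix_vector_mul_assoc[symmetric] RS)
    then have "(?S *v y) \<bullet> (?M *v (?S *v y)) = y \<bullet> (R *v (?S *v y))"
      by (subst inner_commute) (simp only: inner_transpose_matrix)
    then show ?thesis by (simp add: RS power2_norm_eq_inner)
  qed
  have const: "\<bar>det ?S\<bar> * (e / sqrt ((2 * pi) ^ CARD('p) * det (matrix_inv ?M))) = e / sqrt (2 * pi) ^ CARD('p)" for e
  proof -
    have "sqrt ((2 * pi) ^ CARD('p) * det (matrix_inv ?M)) = sqrt (2 * pi) ^ CARD('p) / \<bar>det R\<bar>"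
      unfolding invM dM by (simp only: mult_1_right times_divide_eq_right real_sqrt_divide real_sqrt_abs) (simp only: real_sqrt_power)
    then show ?thesis using R by (simp only: invR) (simp add: abs_divide)
  qed
  show "sets (mvnormal (matrix_inv ?M)) = sets (distr gauss borel ((*v) ?S))"
    by (simp add: mvnormal_def)
  fix A assume "A \<in> sets (mvnormal (matrix_inv ?M))"
  then have A [measurable]: "A \<in> sets borel" by (simp add: mvnormal_def)
  let ?d = "\<lambda>x::real ^ 'p. ennreal (exp (- (x \<bullet> (?M *v x)) / 2) / sqrt ((2 * pi) ^ CARD('p) * det (matrix_inv ?M)))"
  have "emeasure (mvnormal (matrix_inv ?M)) A = (\<integral>\<^sup>+x. ?d x * indicator A x \<partial>lborel)"
    unfolding mvnormal_def invM by (subst emeasure_density) auto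
  also have "\<dots> = ennreal \<bar>det ?S\<bar> * (\<integral>\<^sup>+y. ?d (?S *v y) * indicator A (?S *v y) \<partial>lborel)"
    by (rule nn_integral_lborel_linear[OF dS]) measurable
  also have "\<dots> = (\<integral>\<^sup>+y. ennreal \<bar>det ?S\<bar> * (?d (?S *v y) * indicator A (?S *v y)) \<partial>lborel)"
    by (rule nn_integral_cmult[symmetric]) measurable
  also have "\<dots> = (\<integral>\<^sup>+y. ennreal (exp (- (norm y)\<^sup>2 / 2) / sqrt (2 * pi) ^ CARD('p)) * indicator A (?S *v y) \<partial>lborel)"
  proof (rule nn_integral_cong)
    fix y :: "real ^ 'p"
    have "ennreal \<bar>det ?S\<bar> * ?d (?S *v y) = ennreal (exp (- (norm y)\<^sup>2 / 2) / sqrt (2 * pi) ^ CARD('p))"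
      unfolding quad by (simp only: ennreal_mult'[symmetric] abs_ge_zero const)
    then show "ennreal \<bar>det ?S\<bar> * (?d (?S *v y) * indicator A (?S *v y)) = ennreal (exp (- (norm y)\<^sup>2 / 2) / sqrt (2 * pi) ^ CARD('p)) * indicator A (?S *v y)"
      by (simp only: mult.assoc[symmetric])
  qed
  also have "\<dots> = emeasure gauss ((*v) ?S -` A \<inter> space gauss)"
  proof -
    have m: "(*v) ?S -` A \<inter> space lborel \<in> sets lborel" by measurable
    show ?thesis unfolding gauss_def using m
      by (subst emeasure_density) (auto intro!: nn_integral_cong simp: indicator_def)
  qed
  also have "\<dots> = emeasure (distr gauss borel ((*v) ?S)) A"
    by (rule emeasure_distr[symmetric]) auto
  finally show "emeasure (mvnormal (matrix_inv ?M)) A = emeasure (distr gauss borel ((*v) ?S)) A" .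
qed

text \<open>Frequencies are written as (R^T R) w because the score equation delivers limits in
  exactly this form; the inverse matrix then disappears from the exponent.\<close>

lemma mvnormal_char:
  fixes R :: "real ^ 'p ^ 'p"
  assumes R: "det R \<noteq> 0"
  shows "prob_space (mvnormal (matrix_inv (transpose R ** R)))"
    and "sets (mvnormal (matrix_inv (transpose R ** R))) = sets borel"
    and "(\<integral>x. iexp (((transpose R ** R) *v w) \<bullet> x) \<partial>mvnormal (matrix_inv (transpose R ** R))) =
      complex_of_real (exp (- (norm (R *v w))\<^sup>2 / 2))"
proof -
  show "prob_space (mvnormal (matrix_inv (transpose R ** R)))"
    unfolding mvnormal_eq_distr_gauss[OF R] by (rule prob_space.prob_space_distr[OF prob_space_gauss]) measurable
  show "sets (mvnormal (matrix_inv (transpose R ** R))) = sets borel"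
    unfolding mvnormal_eq_distr_gauss[OF R] by simp
  have eq: "((transpose R ** R) *v w) \<bullet> (matrix_inv R *v y) = (R *v w) \<bullet> y" for y
  proof -
    have "((transpose R ** R) *v w) \<bullet> (matrix_inv R *v y) = (R *v w) \<bullet> (R *v (matrix_inv R *v y))"
      by (simp only: matrix_vector_mul_assoc[symmetric] inner_transpose_matrix)
    then show ?thesis by (simp add: matrix_vector_mul_assoc matrix_inv_inverse[OF R])
  qed
  have "(\<integral>x. iexp (((transpose R ** R) *v w) \<bullet> x) \<partial>mvnormal (matrix_inv (transpose R ** R)))
      = (\<integral>y. iexp (((transpose R ** R) *v w) \<bullet> (matrix_inv R *v y)) \<partial>gauss)"
    unfolding mvnormal_eq_distr_gauss[OF R] by (rule integral_distr) measurable
  then show "(\<integral>x. iexp (((transpose R ** R) *v w) \<bullet> x) \<partial>mvnormal (matrix_inv (transpose R ** R))) =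
      complex_of_real (exp (- (norm (R *v w))\<^sup>2 / 2))"
    unfolding eq gauss_char .
qed

section \<open>Saturated designs\<close>

text \<open>Regression vectors are stored as rows, so that the Gram matrix R^T R is a sum of their
  outer products.\<close>

definition rows_matrix :: "('x \<Rightarrow> real ^ 'p) \<Rightarrow> ('p \<Rightarrow> 'x) \<Rightarrow> real ^ 'p ^ 'p" where
  "rows_matrix g z = (\<chi> j. g (z j))"

lemma sq_det_cols_eq: "sq_det_cols f\<^sub>\<theta> \<theta> z = (det (rows_matrix (f\<^sub>\<theta> \<theta>) z))\<^sup>2"
proof -
  have "(\<chi> i j. f\<^sub>\<theta> \<theta> (z j) $ i) = transpose (rows_matrix (f\<^sub>\<theta> \<theta>) z)"
    by (simp add: rows_matrix_def transpose_def vec_eq_iff)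
  then show ?thesis by (simp add: sq_det_cols_def)
qed

text \<open>An information matrix on p points is the Gram matrix of a square matrix, with square
  roots of the weights scaling the rows. Its determinant therefore separates into weights and
  points.\<close>

lemma weighted_gram:
  fixes g :: "'x \<Rightarrow> real ^ 'p" and z :: "'p \<Rightarrow> 'x"
  assumes "\<And>j. 0 \<le> c j"
  defines "R \<equiv> (\<chi> j. sqrt (c j) *s g (z j)) :: real ^ 'p ^ 'p"
  shows "transpose R ** R = (\<Sum>j\<in>UNIV. c j *\<^sub>R outer (g (z j)))"
    and "det (transpose R ** R) = (\<Prod>j\<in>UNIV. c j) * (det (rows_matrix g z))\<^sup>2"
proof -
  have c: "sqrt (c j) * sqrt (c j) = c j" for j using assms(1)[of j] by simp
  have c': "sqrt (c j) * (a * (sqrt (c j) * b)) = c j * (a * b)" for j a b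
  proof -
    have "sqrt (c j) * (a * (sqrt (c j) * b)) = (sqrt (c j) * sqrt (c j)) * (a * b)" by (simp only: mult_ac)
    then show ?thesis by (simp only: c)
  qed
  show "transpose R ** R = (\<Sum>j\<in>UNIV. c j *\<^sub>R outer (g (z j)))"
    by (simp add: vec_eq_iff R_def transpose_def matrix_matrix_mult_def outer_def sum_component mult.assoc c')
  have "det R = (\<Prod>j\<in>UNIV. sqrt (c j)) * det (rows_matrix g z)"
    unfolding R_def rows_matrix_def by (rule det_rows_mul)
  then have "det (transpose R ** R) = (\<Prod>j\<in>UNIV. sqrt (c j))\<^sup>2 * (det (rows_matrix g z))\<^sup>2"
    by (simp add: det_mul power2_eq_square mult_ac)
  also have "(\<Prod>j\<in>UNIV. sqrt (c j))\<^sup>2 = (\<Prod>j\<in>UNIV. c j)"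
    by (simp add: prod_power_distrib assms(1))
  finally show "det (transpose R ** R) = (\<Prod>j\<in>UNIV. c j) * (det (rows_matrix g z))\<^sup>2" .
qed

text \<open>The inequality of arithmetic and geometric means: among weights summing to 1 the equal
  ones have the largest product.\<close>

lemma prod_le_power_mean:
  fixes c :: "'p::finite \<Rightarrow> real"
  assumes "\<And>j. 0 \<le> c j" "(\<Sum>j\<in>UNIV. c j) = 1"
  shows "(\<Prod>j\<in>UNIV. c j) \<le> (1 / real CARD('p)) ^ CARD('p)"
proof -
  let ?n = "CARD('p)"
  have n: "0 < ?n" by simp
  have P0: "0 \<le> (\<Prod>j\<in>UNIV. c j)" using assms(1) by (intro prod_nonneg) auto
  have "(\<Prod>j\<in>UNIV. c j) powr (1 / real ?n) \<le> (\<Sum>j\<in>UNIV. c j / real ?n)"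
    by (rule arith_geom_mean) (use assms(1) in auto)
  also have "\<dots> = 1 / real ?n" using assms(2) by (simp add: sum_divide_distrib[symmetric])
  finally have "((\<Prod>j\<in>UNIV. c j) powr (1 / real ?n)) ^ ?n \<le> (1 / real ?n) ^ ?n"
    by (rule power_mono) simp
  also have "((\<Prod>j\<in>UNIV. c j) powr (1 / real ?n)) ^ ?n = (\<Prod>j\<in>UNIV. c j)"
  proof (cases "(\<Prod>j\<in>UNIV. c j) = 0")
    case True
    then show ?thesis using n by (simp only: powr_0 power_0_left) (simp add: True)
  next
    case False
    then have "0 < (\<Prod>j\<in>UNIV. c j)" using P0 by linarith
    then have "((\<Prod>j\<in>UNIV. c j) powr (1 / real ?n)) ^ ?n = ((\<Prod>j\<in>UNIV. c j) powr (1 / real ?n)) powr real ?n"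
      by (intro powr_realpow[symmetric]) (use False in auto)
    also have "\<dots> = (\<Prod>j\<in>UNIV. c j)" using P0 False by (auto simp: powr_powr)
    finally show ?thesis .
  qed
  finally show ?thesis .
qed

lemma det_info_matrix_saturated:
  fixes f\<^sub>\<theta> :: "'t \<Rightarrow> 'x \<Rightarrow> real ^ 'p"
  assumes "saturated_design TYPE('p) XX \<eta>"
  obtains z :: "'p \<Rightarrow> 'x" where "\<And>j. z j \<in> XX"
    "det (info_matrix f\<^sub>\<theta> \<eta> \<theta>) \<le> (1 / real CARD('p)) ^ CARD('p) * sq_det_cols f\<^sub>\<theta> \<theta> z"
proof -
  have fin: "finite (set_pmf \<eta>)" and sub: "set_pmf \<eta> \<subseteq> XX" and card: "card (set_pmf \<eta>) = CARD('p)"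
    using assms by (auto simp: saturated_design_def design_def)
  obtain z :: "'p \<Rightarrow> 'x" where z: "bij_betw z UNIV (set_pmf \<eta>)"
    using finite_same_card_bij[of "UNIV :: 'p set" "set_pmf \<eta>"] fin card by auto
  let ?c = "\<lambda>j. pmf \<eta> (z j)"
  have "info_matrix f\<^sub>\<theta> \<eta> \<theta> = (\<Sum>j\<in>UNIV. ?c j *\<^sub>R outer (f\<^sub>\<theta> \<theta> (z j)))"
    unfolding info_matrix_def by (rule sum.reindex_bij_betw[OF z, symmetric])
  then have "det (info_matrix f\<^sub>\<theta> \<eta> \<theta>) = (\<Prod>j\<in>UNIV. ?c j) * sq_det_cols f\<^sub>\<theta> \<theta> z"
    using weighted_gram[of ?c "f\<^sub>\<theta> \<theta>" z] by (simp add: sq_det_cols_eq)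
  moreover have "(\<Prod>j\<in>UNIV. ?c j) \<le> (1 / real CARD('p)) ^ CARD('p)"
  proof (rule prod_le_power_mean)
    have "(\<Sum>j\<in>UNIV. ?c j) = (\<Sum>x\<in>set_pmf \<eta>. pmf \<eta> x)" by (rule sum.reindex_bij_betw[OF z])
    then show "(\<Sum>j\<in>UNIV. ?c j) = 1" using sum_pmf_eq_1[OF fin, of \<eta>] by simp
  qed simp
  ultimately have "det (info_matrix f\<^sub>\<theta> \<eta> \<theta>) \<le> (1 / real CARD('p)) ^ CARD('p) * sq_det_cols f\<^sub>\<theta> \<theta> z"
    by (simp add: mult_right_mono sq_det_cols_def)
  moreover have "z j \<in> XX" for j using z sub by (auto simp: bij_betw_def)
  ultimately show ?thesis using that by blast
qed

text \<open>A nonzero determinant forces the points to be distinct, so equal weights on them form a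
  saturated design; it attains the bound of \<open>det_info_matrix_saturated\<close> for its own
  points.\<close>

lemma info_matrix_uniform:
  fixes f\<^sub>\<theta> :: "'t \<Rightarrow> 'x \<Rightarrow> real ^ 'p" and z :: "'p \<Rightarrow> 'x"
  assumes "sq_det_cols f\<^sub>\<theta> \<theta> z \<noteq> 0" "\<And>j. z j \<in> XX"
  shows "saturated_design TYPE('p) XX (pmf_of_set (range z))"
    and "info_matrix f\<^sub>\<theta> (pmf_of_set (range z)) \<theta> = (\<Sum>j\<in>UNIV. (1 / real CARD('p)) *\<^sub>R outer (f\<^sub>\<theta> \<theta> (z j)))"
    and "det (info_matrix f\<^sub>\<theta> (pmf_of_set (range z)) \<theta>) = (1 / real CARD('p)) ^ CARD('p) * sq_det_cols f\<^sub>\<theta> \<theta> z"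
proof -
  have inj: "inj z"
  proof (rule ccontr)
    assume "\<not> inj z"
    then obtain i j where ij: "i \<noteq> j" "z i = z j" by (auto simp: inj_def)
    then have "row i (rows_matrix (f\<^sub>\<theta> \<theta>) z) = row j (rows_matrix (f\<^sub>\<theta> \<theta>) z)"
      by (simp add: row_def rows_matrix_def)
    then have "det (rows_matrix (f\<^sub>\<theta> \<theta>) z) = 0" using ij(1) by (intro det_identical_rows)
    then show False using assms(1) by (simp add: sq_det_cols_eq)
  qed
  have card: "card (range z) = CARD('p)" using inj by (simp add: card_image)
  have sp: "set_pmf (pmf_of_set (range z)) = range z" by (simp add: set_pmf_of_set)
  show "saturated_design TYPE('p) XX (pmf_of_set (range z))"
    using assms(2) by (auto simp: saturated_design_def design_def sp card)
  have "info_matrix f\<^sub>\<theta> (pmf_of_set (range z)) \<theta> = (\<Sum>x\<in>range z. (1 / real CARD('p)) *\<^sub>R outer (f\<^sub>\<theta> \<theta> x))"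
    unfolding info_matrix_def sp by (intro sum.cong) (auto simp: pmf_of_set card)
  also have "\<dots> = (\<Sum>j\<in>UNIV. (1 / real CARD('p)) *\<^sub>R outer (f\<^sub>\<theta> \<theta> (z j)))"
    by (simp add: sum.reindex[OF inj])
  finally show eq: "info_matrix f\<^sub>\<theta> (pmf_of_set (range z)) \<theta> = (\<Sum>j\<in>UNIV. (1 / real CARD('p)) *\<^sub>R outer (f\<^sub>\<theta> \<theta> (z j)))" .
  show "det (info_matrix f\<^sub>\<theta> (pmf_of_set (range z)) \<theta>) = (1 / real CARD('p)) ^ CARD('p) * sq_det_cols f\<^sub>\<theta> \<theta> z"
    unfolding eq using weighted_gram[of "\<lambda>_. 1 / real CARD('p)" "f\<^sub>\<theta> \<theta>" z] by (simp add: sq_det_cols_eq)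
qed

lemma ex_det_nonzero:
  fixes g :: "'x \<Rightarrow> real ^ 'p"
  assumes "span (g ` XX) = UNIV"
  obtains z where "\<And>j. z j \<in> XX" "det (rows_matrix g z) \<noteq> 0"
proof -
  obtain B where B: "B \<subseteq> g ` XX" "independent B" "g ` XX \<subseteq> span B" "card B = dim (g ` XX)"
    using basis_exists[of "g ` XX"] by blast
  have sB: "span B = UNIV" using B(3) assms span_mono[of "g ` XX" "span B"] by (auto simp: span_span)
  have "dim (g ` XX) = CARD('p)" using dim_span[of "g ` XX"] assms by (simp add: dim_UNIV)
  then have "card B = CARD('p)" using B(4) by simp
  moreover have "finite B" using B(2) by (rule independent_imp_finite)
  ultimately obtain \<beta> :: "'p \<Rightarrow> real ^ 'p" where \<beta>: "bij_betw \<beta> UNIV B"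
    using finite_same_card_bij[of "UNIV :: 'p set" B] by auto
  then have "\<forall>j. \<exists>x. x \<in> XX \<and> \<beta> j = g x" using B(1) by (auto simp: bij_betw_def)
  then obtain z where z: "\<And>j. z j \<in> XX" "\<And>j. \<beta> j = g (z j)" by metis
  have "rows (rows_matrix g z) = B"
    using \<beta> z(2) by (auto simp: rows_def row_def rows_matrix_def bij_betw_def)
  then have "\<exists>A. A ** rows_matrix g z = mat 1"
    using sB by (simp add: matrix_left_invertible_span_rows)
  then have "det (rows_matrix g z) \<noteq> 0"
    using invertible_left_inverse invertible_det_nz by blast
  with z show ?thesis using that by blast
qed

text \<open>Compactness of the set of tuples, obtained by refining the subsequence one coordinate at
  a time.\<close>

lemma finite_index_subseq:
  fixes z :: "nat \<Rightarrow> 'i \<Rightarrow> 'x::metric_space"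
  assumes "compact XX" "finite S" "\<And>k j. z k j \<in> XX"
  shows "\<exists>r l. strict_mono (r :: nat \<Rightarrow> nat) \<and> (\<forall>j\<in>S. l j \<in> XX \<and> (\<lambda>k. z (r k) j) \<longlonglongrightarrow> l j)"
  using assms(2)
proof (induction S)
  case empty
  show ?case by (intro exI[of _ id]) (auto simp: strict_mono_def)
next
  case (insert i S)
  then obtain r l where r: "strict_mono (r :: nat \<Rightarrow> nat)" "\<forall>j\<in>S. l j \<in> XX \<and> (\<lambda>k. z (r k) j) \<longlonglongrightarrow> l j" by blast
  have "seq_compact XX" using assms(1) by (rule compact_imp_seq_compact)
  moreover have "\<forall>k. z (r k) i \<in> XX" using assms(3) by blast
  ultimately obtain a r' where r': "a \<in> XX" "strict_mono (r' :: nat \<Rightarrow> nat)" "((\<lambda>k. z (r k) i) \<circ> r') \<longlonglongrightarrow> a"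
    by (rule seq_compactE)
  show ?case
  proof (intro exI conjI ballI)
    show "strict_mono (r \<circ> r')" using r(1) r'(2) by (rule strict_mono_o)
    fix j assume j: "j \<in> insert i S"
    show "(l(i := a)) j \<in> XX" using j r r' by (cases "j = i") auto
    show "(\<lambda>k. z ((r \<circ> r') k) j) \<longlonglongrightarrow> (l(i := a)) j"
    proof (cases "j = i")
      case True
      then show ?thesis using r'(3) by (simp add: o_def)
    next
      case False
      then have "(\<lambda>k. z (r k) j) \<longlonglongrightarrow> l j" using j r by auto
      from LIMSEQ_subseq_LIMSEQ[OF this r'(2)] show ?thesis using False by (simp add: o_def)
    qed
  qed
qed

lemma tendsto_det:
  fixes A :: "'a \<Rightarrow> real ^ 'n ^ 'n"
  assumes "(A \<longlongrightarrow> L) F"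
  shows "((\<lambda>x. det (A x)) \<longlongrightarrow> det L) F"
  unfolding det_def by (intro tendsto_intros tendsto_vec_nth assms)

lemma sq_det_cols_tendsto:
  fixes f\<^sub>\<theta> :: "real ^ 'p \<Rightarrow> 'x::metric_space \<Rightarrow> real ^ 'p" and z :: "nat \<Rightarrow> 'p \<Rightarrow> 'x"
  assumes cont: "continuous_on (XX \<times> \<Theta>) (\<lambda>(x, \<theta>). f\<^sub>\<theta> \<theta> x)"
    and \<theta>: "\<And>k. \<theta> k \<in> \<Theta>" "\<theta> \<longlonglongrightarrow> \<theta>\<^sub>0" "\<theta>\<^sub>0 \<in> \<Theta>"
    and z: "\<And>k j. z k j \<in> XX" "\<And>j. (\<lambda>k. z k j) \<longlonglongrightarrow> l j" "\<And>j. l j \<in> XX"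
  shows "(\<lambda>k. sq_det_cols f\<^sub>\<theta> (\<theta> k) (z k)) \<longlonglongrightarrow> sq_det_cols f\<^sub>\<theta> \<theta>\<^sub>0 l"
proof -
  have "(\<lambda>k. f\<^sub>\<theta> (\<theta> k) (z k j)) \<longlonglongrightarrow> f\<^sub>\<theta> \<theta>\<^sub>0 (l j)" for j
  proof -
    have "(\<lambda>k. (\<lambda>(x, \<theta>). f\<^sub>\<theta> \<theta> x) (z k j, \<theta> k)) \<longlonglongrightarrow> (\<lambda>(x, \<theta>). f\<^sub>\<theta> \<theta> x) (l j, \<theta>\<^sub>0)"
      by (rule continuous_on_tendsto_compose[OF cont]) (use \<theta> z in \<open>auto intro!: tendsto_Pair\<close>)
    then show ?thesis by simp
  qed
  then show ?thesis unfolding sq_det_cols_eq rows_matrix_def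
    by (intro tendsto_power tendsto_det tendsto_vec_lambda)
qed

section \<open>Maximal tuples and their information matrices\<close>

locale sat_design =
  fixes XX :: "'x::metric_space set" and \<Theta> :: "(real ^ 'p) set"
    and f\<^sub>\<theta> :: "real ^ 'p \<Rightarrow> 'x \<Rightarrow> real ^ 'p" and \<theta>\<^sub>0 :: "real ^ 'p"
  assumes compact: "compact XX"
    and cont: "continuous_on (XX \<times> \<Theta>) (\<lambda>(x, \<theta>). f\<^sub>\<theta> \<theta> x)"
    and span: "span (f\<^sub>\<theta> \<theta>\<^sub>0 ` XX) = UNIV"
    and SD: "cond_SD XX f\<^sub>\<theta> \<theta>\<^sub>0"
    and \<theta>0: "\<theta>\<^sub>0 \<in> \<Theta>"
begin

abbreviation "maximal \<theta> z \<equiv> is_arg_max (sq_det_cols f\<^sub>\<theta> \<theta>) (\<lambda>z. \<forall>j. z j \<in> XX) z"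

lemma ex_maximal: "\<exists>z. maximal \<theta>\<^sub>0 z"
proof -
  let ?S = "sq_det_cols f\<^sub>\<theta> \<theta>\<^sub>0 ` {z. \<forall>j. z j \<in> XX}"
  have "seq_compact ?S"
    unfolding seq_compact_def
  proof (intro allI impI)
    fix s :: "nat \<Rightarrow> real" assume "\<forall>n. s n \<in> ?S"
    then have "\<forall>n. \<exists>z. (\<forall>j. z j \<in> XX) \<and> s n = sq_det_cols f\<^sub>\<theta> \<theta>\<^sub>0 z" by blast
    then obtain z where z: "\<And>n j. z n j \<in> XX" "\<And>n. s n = sq_det_cols f\<^sub>\<theta> \<theta>\<^sub>0 (z n)" by metis
    obtain r l where r: "strict_mono (r :: nat \<Rightarrow> nat)" "\<forall>j\<in>UNIV. l j \<in> XX \<and> (\<lambda>k. z (r k) j) \<longlonglongrightarrow> l j"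
      using finite_index_subseq[OF compact finite[of UNIV], of z] z(1) by blast
    have "(\<lambda>k. sq_det_cols f\<^sub>\<theta> \<theta>\<^sub>0 (z (r k))) \<longlonglongrightarrow> sq_det_cols f\<^sub>\<theta> \<theta>\<^sub>0 l"
      by (rule sq_det_cols_tendsto[OF cont]) (use r z(1) \<theta>0 in auto)
    then have "(s \<circ> r) \<longlonglongrightarrow> sq_det_cols f\<^sub>\<theta> \<theta>\<^sub>0 l" by (simp add: o_def z(2))
    then show "\<exists>l\<in>?S. \<exists>r. strict_mono r \<and> (s \<circ> r) \<longlonglongrightarrow> l" using r by blast
  qed
  then have "compact ?S" by (simp only: compact_eq_seq_compact_metric)
  moreover have "?S \<noteq> {}" using ex_det_nonzero[OF span] by blast
  ultimately have "\<exists>m\<in>?S. \<forall>t\<in>?S. t \<le> m" by (rule compact_attains_sup)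
  then obtain m where m: "m \<in> ?S" "\<And>t. t \<in> ?S \<Longrightarrow> t \<le> m" by blast
  then obtain z where "\<forall>j. z j \<in> XX" "m = sq_det_cols f\<^sub>\<theta> \<theta>\<^sub>0 z" by blast
  then have "maximal \<theta>\<^sub>0 z" using m(2) by (force simp: is_arg_max_def not_less)
  then show ?thesis by blast
qed

lemma maximal_D:
  assumes "maximal \<theta> z"
  shows "\<And>j. z j \<in> XX" "\<And>y. (\<And>j. y j \<in> XX) \<Longrightarrow> sq_det_cols f\<^sub>\<theta> \<theta> y \<le> sq_det_cols f\<^sub>\<theta> \<theta> z"
proof -
  show "z j \<in> XX" for j using assms unfolding is_arg_max_def by blast
  show "sq_det_cols f\<^sub>\<theta> \<theta> y \<le> sq_det_cols f\<^sub>\<theta> \<theta> z" if "\<And>j. y j \<in> XX" for y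
  proof (rule ccontr)
    assume "\<not> ?thesis"
    then have "sq_det_cols f\<^sub>\<theta> \<theta> z < sq_det_cols f\<^sub>\<theta> \<theta> y" by (rule not_le_imp_less)
    then show False using assms that unfolding is_arg_max_def by blast
  qed
qed

lemma maximal_nonzero: "maximal \<theta>\<^sub>0 z \<Longrightarrow> sq_det_cols f\<^sub>\<theta> \<theta>\<^sub>0 z \<noteq> 0"
proof -
  assume z: "maximal \<theta>\<^sub>0 z"
  obtain y where y: "\<And>j. y j \<in> XX" "det (rows_matrix (f\<^sub>\<theta> \<theta>\<^sub>0) y) \<noteq> 0" using ex_det_nonzero[OF span] by blast
  have "0 < sq_det_cols f\<^sub>\<theta> \<theta>\<^sub>0 y" using y(2) by (simp add: sq_det_cols_eq)
  also have "\<dots> \<le> sq_det_cols f\<^sub>\<theta> \<theta>\<^sub>0 z" by (rule maximal_D(2)[OF z y(1)])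
  finally show ?thesis by simp
qed

text \<open>Every saturated design has determinant at most p^(-p) times the squared determinant of
  its points, and equal weights on a maximal tuple reach the largest such bound. This links the
  criterion of the algorithm to D-optimality.\<close>

lemma maximal_D_opt:
  assumes z: "maximal \<theta>\<^sub>0 z"
  shows "D_opt_saturated XX f\<^sub>\<theta> \<theta>\<^sub>0 (pmf_of_set (range z))"
  unfolding D_opt_saturated_def is_arg_max_def
proof (intro conjI notI)
  note u = info_matrix_uniform[OF maximal_nonzero[OF z] maximal_D(1)[OF z]]
  show "saturated_design TYPE('p) XX (pmf_of_set (range z))" by (rule u)
  assume "\<exists>\<eta>. saturated_design TYPE('p) XX \<eta> \<and> det (info_matrix f\<^sub>\<theta> (pmf_of_set (range z)) \<theta>\<^sub>0) < det (info_matrix f\<^sub>\<theta> \<eta> \<theta>\<^sub>0)"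
  then obtain \<eta> where \<eta>: "saturated_design TYPE('p) XX \<eta>" "det (info_matrix f\<^sub>\<theta> (pmf_of_set (range z)) \<theta>\<^sub>0) < det (info_matrix f\<^sub>\<theta> \<eta> \<theta>\<^sub>0)" by blast
  obtain y where y: "\<And>j. y j \<in> XX" "det (info_matrix f\<^sub>\<theta> \<eta> \<theta>\<^sub>0) \<le> (1 / real CARD('p)) ^ CARD('p) * sq_det_cols f\<^sub>\<theta> \<theta>\<^sub>0 y"
    by (rule det_info_matrix_saturated[OF \<eta>(1), of f\<^sub>\<theta> \<theta>\<^sub>0]) (rule that)
  have "(1 / real CARD('p)) ^ CARD('p) * sq_det_cols f\<^sub>\<theta> \<theta>\<^sub>0 y \<le> (1 / real CARD('p)) ^ CARD('p) * sq_det_cols f\<^sub>\<theta> \<theta>\<^sub>0 z"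
    by (intro mult_left_mono maximal_D(2)[OF z y(1)]) simp
  then show False using y(2) \<eta>(2) u(3) by linarith
qed

text \<open>(SD) enters here: it makes the definite description in \<open>M_sat\<close> well
  defined, and existence is supplied by the uniform design on the maximal tuple.\<close>

lemma maximal_gram:
  assumes z: "maximal \<theta>\<^sub>0 z"
  shows "(\<Sum>j\<in>UNIV. (1 / real CARD('p)) *\<^sub>R outer (f\<^sub>\<theta> \<theta>\<^sub>0 (z j))) = M_sat XX f\<^sub>\<theta> \<theta>\<^sub>0"
proof -
  have "M_sat XX f\<^sub>\<theta> \<theta>\<^sub>0 = info_matrix f\<^sub>\<theta> (pmf_of_set (range z)) \<theta>\<^sub>0"
    unfolding M_sat_def
  proof (rule the_equality)
    show "\<exists>\<eta>. D_opt_saturated XX f\<^sub>\<theta> \<theta>\<^sub>0 \<eta> \<and>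
        info_matrix f\<^sub>\<theta> (pmf_of_set (range z)) \<theta>\<^sub>0 = info_matrix f\<^sub>\<theta> \<eta> \<theta>\<^sub>0"
      by (rule exI[of _ "pmf_of_set (range z)"]) (rule conjI[OF maximal_D_opt[OF z] refl])
    fix A assume "\<exists>\<eta>. D_opt_saturated XX f\<^sub>\<theta> \<theta>\<^sub>0 \<eta> \<and> A = info_matrix f\<^sub>\<theta> \<eta> \<theta>\<^sub>0"
    then obtain \<eta> where \<eta>: "D_opt_saturated XX f\<^sub>\<theta> \<theta>\<^sub>0 \<eta>" "A = info_matrix f\<^sub>\<theta> \<eta> \<theta>\<^sub>0" by (elim exE conjE)
    show "A = info_matrix f\<^sub>\<theta> (pmf_of_set (range z)) \<theta>\<^sub>0"
      unfolding \<eta>(2) by (rule SD[unfolded cond_SD_def, rule_format, OF \<eta>(1) maximal_D_opt[OF z]])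
  qed
  then show ?thesis using info_matrix_uniform(2)[OF maximal_nonzero[OF z] maximal_D(1)[OF z]] by simp
qed

lemma M_sat_factor:
  obtains R where "det R \<noteq> 0" "M_sat XX f\<^sub>\<theta> \<theta>\<^sub>0 = transpose R ** R"
    "\<And>w. w \<bullet> (M_sat XX f\<^sub>\<theta> \<theta>\<^sub>0 *v w) = (norm (R *v w))\<^sup>2"
proof -
  obtain z where z: "maximal \<theta>\<^sub>0 z" using ex_maximal by blast
  let ?R = "\<chi> j. sqrt (1 / real CARD('p)) *s f\<^sub>\<theta> \<theta>\<^sub>0 (z j)"
  have "det (transpose ?R ** ?R) = (\<Prod>j\<in>(UNIV :: 'p set). 1 / real CARD('p)) * sq_det_cols f\<^sub>\<theta> \<theta>\<^sub>0 z"
    using weighted_gram(2)[of "\<lambda>_. 1 / real CARD('p)" "f\<^sub>\<theta> \<theta>\<^sub>0" z] by (simp add: sq_det_cols_eq)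
  then have "det ?R \<noteq> 0" using maximal_nonzero[OF z] by (auto simp: det_mul)
  moreover have eq: "M_sat XX f\<^sub>\<theta> \<theta>\<^sub>0 = transpose ?R ** ?R"
    using weighted_gram(1)[of "\<lambda>_. 1 / real CARD('p)" "f\<^sub>\<theta> \<theta>\<^sub>0" z] maximal_gram[OF z] by simp
  moreover have "w \<bullet> (M_sat XX f\<^sub>\<theta> \<theta>\<^sub>0 *v w) = (norm (?R *v w))\<^sup>2" for w
  proof -
    have "w \<bullet> (M_sat XX f\<^sub>\<theta> \<theta>\<^sub>0 *v w) = (transpose ?R *v (?R *v w)) \<bullet> w"
      unfolding eq matrix_vector_mul_assoc[symmetric] by (rule inner_commute)
    then show ?thesis by (simp only: inner_transpose_matrix power2_norm_eq_inner)
  qed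
  ultimately show ?thesis by (rule that)
qed

lemma cont_f0: "continuous_on XX (f\<^sub>\<theta> \<theta>\<^sub>0)"
proof -
  have "continuous_on XX (\<lambda>x. (\<lambda>(x, \<theta>). f\<^sub>\<theta> \<theta> x) (x, \<theta>\<^sub>0))"
    by (rule continuous_on_compose2[OF cont]) (use \<theta>0 in \<open>auto intro!: continuous_intros\<close>)
  then show ?thesis by simp
qed

lemma tendsto_outer: "(u \<longlongrightarrow> v) F \<Longrightarrow> ((\<lambda>k. outer (u k)) \<longlongrightarrow> outer v) F"
  unfolding outer_def by (intro tendsto_vec_lambda tendsto_mult tendsto_vec_nth)

text \<open>Maximal tuples need not converge, as the optimal design may be non-unique. If the
  matrices stayed away from the limit along a subsequence, a further subsequence of tuples would
  converge; by joint continuity its limit is maximal at \<open>\<theta>\<^sub>0\<close>, and by (SD)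
  its matrix is \<open>M_sat\<close>, a contradiction.\<close>

lemma maximal_sequence_gram:
  assumes \<theta>: "\<And>k. \<theta> k \<in> \<Theta>" "\<theta> \<longlonglongrightarrow> \<theta>\<^sub>0" and z: "\<And>k. maximal (\<theta> k) (z k)"
  shows "(\<lambda>k. \<Sum>j\<in>UNIV. (1 / real CARD('p)) *\<^sub>R outer (f\<^sub>\<theta> \<theta>\<^sub>0 (z k j))) \<longlonglongrightarrow> M_sat XX f\<^sub>\<theta> \<theta>\<^sub>0"
proof (rule ccontr)
  let ?a = "\<lambda>k. \<Sum>j\<in>UNIV. (1 / real CARD('p)) *\<^sub>R outer (f\<^sub>\<theta> \<theta>\<^sub>0 (z k j))"
  let ?M = "M_sat XX f\<^sub>\<theta> \<theta>\<^sub>0"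
  assume "\<not> ?a \<longlonglongrightarrow> ?M"
  then obtain e where e: "0 < e" "\<forall>n. \<exists>k\<ge>n. e \<le> dist (?a k) ?M"
    unfolding lim_sequentially not_less[symmetric] by blast
  obtain q :: "nat \<Rightarrow> nat" where q: "strict_mono q" "\<And>n. e \<le> dist (?a (q n)) ?M"
  proof -
    have inf: "infinite {k. e \<le> dist (?a k) ?M}"
      unfolding infinite_nat_iff_unbounded_le using e(2) by blast
    show ?thesis
      by (rule that[of "enumerate {k. e \<le> dist (?a k) ?M}"])
         (use enumerate_in_set[OF inf] strict_mono_enumerate[OF inf] in auto)
  qed
  have zX: "z k j \<in> XX" for k j by (rule maximal_D(1)[OF z])
  obtain r l where r: "strict_mono (r :: nat \<Rightarrow> nat)" "\<forall>j\<in>UNIV. l j \<in> XX \<and> (\<lambda>k. z (q (r k)) j) \<longlonglongrightarrow> l j"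
    using finite_index_subseq[OF compact finite[of UNIV], of "\<lambda>k. z (q k)"] zX by blast
  have qr: "strict_mono (\<lambda>k. q (r k))" using q(1) r(1) by (simp add: strict_mono_def)
  have \<theta>q: "(\<lambda>k. \<theta> (q (r k))) \<longlonglongrightarrow> \<theta>\<^sub>0"
    using LIMSEQ_subseq_LIMSEQ[OF \<theta>(2) qr] by (simp add: o_def)
  have "maximal \<theta>\<^sub>0 l"
    unfolding is_arg_max_def
  proof (intro conjI notI)
    show "\<forall>j. l j \<in> XX" using r by auto
    assume "\<exists>y. (\<forall>j. y j \<in> XX) \<and> sq_det_cols f\<^sub>\<theta> \<theta>\<^sub>0 l < sq_det_cols f\<^sub>\<theta> \<theta>\<^sub>0 y"
    then obtain y where y: "\<And>j. y j \<in> XX" "sq_det_cols f\<^sub>\<theta> \<theta>\<^sub>0 l < sq_det_cols f\<^sub>\<theta> \<theta>\<^sub>0 y" by blast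
    have "(\<lambda>k. sq_det_cols f\<^sub>\<theta> (\<theta> (q (r k))) (z (q (r k)))) \<longlonglongrightarrow> sq_det_cols f\<^sub>\<theta> \<theta>\<^sub>0 l"
      by (rule sq_det_cols_tendsto[OF cont]) (use \<theta> \<theta>q \<theta>0 zX r in auto)
    moreover have "(\<lambda>k. sq_det_cols f\<^sub>\<theta> (\<theta> (q (r k))) y) \<longlonglongrightarrow> sq_det_cols f\<^sub>\<theta> \<theta>\<^sub>0 y"
      by (rule sq_det_cols_tendsto[OF cont]) (use \<theta> \<theta>q \<theta>0 y in auto)
    ultimately have "sq_det_cols f\<^sub>\<theta> \<theta>\<^sub>0 y \<le> sq_det_cols f\<^sub>\<theta> \<theta>\<^sub>0 l"
      using maximal_D(2)[OF z y(1)] by (intro LIMSEQ_le) auto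
    then show False using y(2) by simp
  qed
  have "(\<lambda>k. ?a (q (r k))) \<longlonglongrightarrow> (\<Sum>j\<in>UNIV. (1 / real CARD('p)) *\<^sub>R outer (f\<^sub>\<theta> \<theta>\<^sub>0 (l j)))"
  proof (intro tendsto_sum tendsto_scaleR tendsto_const tendsto_outer)
    fix j
    show "(\<lambda>k. f\<^sub>\<theta> \<theta>\<^sub>0 (z (q (r k)) j)) \<longlonglongrightarrow> f\<^sub>\<theta> \<theta>\<^sub>0 (l j)"
      by (rule continuous_on_tendsto_compose[OF cont_f0]) (use r zX in auto)
  qed
  then have "(\<lambda>k. ?a (q (r k))) \<longlonglongrightarrow> ?M" using maximal_gram[OF \<open>maximal \<theta>\<^sub>0 l\<close>] by simp
  then have "\<forall>\<^sub>F k in sequentially. dist (?a (q (r k))) ?M < e" using e(1) by (rule tendstoD)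
  then show False using q(2) by (auto simp: eventually_sequentially not_less[symmetric])
qed

end

section \<open>Exceptional events of small probability\<close>

text \<open>Cesaro averaging in terms of increments: beyond some index they are small, and the fixed
  earlier part vanishes after division by k.\<close>

lemma cesaro_increments:
  fixes B d :: "nat \<Rightarrow> 'a::real_normed_vector"
  assumes "\<And>k. B (Suc k) = B k + d k" "d \<longlonglongrightarrow> 0"
  shows "(\<lambda>k. (1 / real k) *\<^sub>R B k) \<longlonglongrightarrow> 0"
proof (rule LIMSEQ_I)
  fix r :: real assume "0 < r"
  obtain n where n: "\<And>k. k \<ge> n \<Longrightarrow> norm (d k) < r / 2"
    using LIMSEQ_D[OF assms(2), of "r / 2"] \<open>0 < r\<close> by auto
  have bound: "norm (B k) \<le> norm (B n) + real (k - n) * (r / 2)" if "k \<ge> n" for k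
    using that
  proof (induction k rule: dec_induct)
    case (step k)
    have "norm (B (Suc k)) \<le> norm (B k) + norm (d k)" unfolding assms(1) by (rule norm_triangle_ineq)
    also have "\<dots> \<le> (norm (B n) + real (k - n) * (r / 2)) + r / 2" using step n[of k] by auto
    also have "\<dots> = norm (B n) + real (Suc k - n) * (r / 2)"
    proof -
      have "real (Suc k - n) = real (k - n) + 1" using step(1) by (simp add: Suc_diff_le)
      then show ?thesis by (simp only: distrib_right)
    qed
    finally show ?case .
  qed simp
  have "(\<lambda>k. norm (B n) / real k) \<longlonglongrightarrow> 0" by (rule lim_const_over_n)
  then obtain m where m: "\<And>k. k \<ge> m \<Longrightarrow> norm (norm (B n) / real k - 0) < r / 2"
    using LIMSEQ_D[of _ 0 "r / 2"] \<open>0 < r\<close> by (meson half_gt_zero)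
  have "norm ((1 / real k) *\<^sub>R B k - 0) < r" if "k \<ge> max (max n m) 1" for k
  proof -
    have k: "0 < real k" "k \<ge> n" "k \<ge> m" using that by auto
    have "norm ((1 / real k) *\<^sub>R B k - 0) = norm (B k) / real k" by simp
    also have "\<dots> \<le> (norm (B n) + real (k - n) * (r / 2)) / real k"
      using bound[OF k(2)] k(1) by (intro divide_right_mono) auto
    also have "\<dots> = norm (B n) / real k + real (k - n) / real k * (r / 2)" by (simp add: add_divide_distrib)
    also have "\<dots> \<le> norm (B n) / real k + 1 * (r / 2)"
      using k \<open>0 < r\<close> by (intro add_left_mono mult_right_mono) auto
    also have "\<dots> < r"
      using m[OF k(3)] abs_ge_self[of "norm (B n) / real k"] unfolding real_norm_def diff_0_right by linarith
    finally show ?thesis .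
  qed
  then show "\<exists>n0. \<forall>k\<ge>n0. norm ((1 / real k) *\<^sub>R B k - 0) < r" by blast
qed

lemma norm_matrix_vector_mult_le: "norm (A *v x) \<le> norm A * norm x" for A :: "real ^ 'n ^ 'm"
proof -
  have "norm (A *v x) = L2_set (\<lambda>i. norm ((A $ i) \<bullet> x)) UNIV"
    by (simp add: norm_vec_def matrix_vector_mul_component)
  also have "\<dots> \<le> L2_set (\<lambda>i. norm (A $ i) * norm x) UNIV"
    by (rule L2_set_mono) (auto intro: Cauchy_Schwarz_ineq2)
  also have "\<dots> = norm A * norm x"
    by (subst norm_vec_def[of A]) (rule L2_set_left_distrib[symmetric], simp)
  finally show ?thesis .
qed

lemma outer_mult: "outer v *v w = (v \<bullet> w) *\<^sub>R v"
  by (simp add: outer_def vec_eq_iff matrix_vector_mult_def inner_vec_def sum_distrib_left mult_ac)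

lemma sum_matrix_vector_mult: "(\<Sum>i\<in>S. A i) *v w = (\<Sum>i\<in>S. A i *v w)" for A :: "'i \<Rightarrow> real ^ 'n ^ 'm"
  by (induction S rule: infinite_finite_induct) (auto simp: matrix_vector_mult_add_rdistrib)

context prob_space
begin

text \<open>Convergence in probability, phrased with measurable covers so that no measurability has to be
  checked for the sets of exceptional outcomes.\<close>

definition rarely :: "(nat \<Rightarrow> 'a \<Rightarrow> bool) \<Rightarrow> bool" where
  "rarely P \<longleftrightarrow> (\<forall>\<delta>>0. \<forall>\<^sub>F k in sequentially. \<exists>B\<in>events. {\<omega> \<in> space M. P k \<omega>} \<subseteq> B \<and> prob B < \<delta>)"

lemma rarelyD:
  assumes "rarely P" "0 < \<delta>"
  shows "\<forall>\<^sub>F k in sequentially. \<exists>B\<in>events. {\<omega> \<in> space M. P k \<omega>} \<subseteq> B \<and> prob B < \<delta>"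
  using assms by (simp add: rarely_def)

text \<open>Allows an exceptional event whose probability stays at \<delta> instead of tending to 0.
  This matches bounds in probability, where the threshold, and with it \<open>Q\<close>, depends on
  \<delta>.\<close>

lemma rarelyI_cover:
  assumes "\<And>\<delta>. 0 < \<delta> \<Longrightarrow> \<exists>Q B. rarely Q \<and> (\<forall>k. B k \<in> events \<and> prob (B k) \<le> \<delta>) \<and>
    (\<forall>\<^sub>F k in sequentially. \<forall>\<omega>\<in>space M. P k \<omega> \<longrightarrow> Q k \<omega> \<or> \<omega> \<in> B k)"
  shows "rarely P"
  unfolding rarely_def
proof (intro allI impI)
  fix \<delta> :: real assume "0 < \<delta>"
  then obtain Q B where Q: "rarely Q" and B: "\<And>k. B k \<in> events" "\<And>k. prob (B k) \<le> \<delta> / 2"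
    and PQ: "\<forall>\<^sub>F k in sequentially. \<forall>\<omega>\<in>space M. P k \<omega> \<longrightarrow> Q k \<omega> \<or> \<omega> \<in> B k"
    using assms[of "\<delta> / 2"] by auto
  have "\<forall>\<^sub>F k in sequentially. \<exists>A\<in>events. {\<omega> \<in> space M. Q k \<omega>} \<subseteq> A \<and> prob A < \<delta> / 2"
    by (rule rarelyD[OF Q]) (use \<open>0 < \<delta>\<close> in simp)
  with PQ show "\<forall>\<^sub>F k in sequentially. \<exists>B\<in>events. {\<omega> \<in> space M. P k \<omega>} \<subseteq> B \<and> prob B < \<delta>"
  proof eventually_elim
    case (elim k)
    then obtain A where A: "A \<in> events" "{\<omega> \<in> space M. Q k \<omega>} \<subseteq> A" "prob A < \<delta> / 2" by auto
    have "prob (A \<union> B k) \<le> prob A + prob (B k)" by (rule measure_Un_le) (use A B in auto)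
    then have "prob (A \<union> B k) < \<delta>" using A(3) B(2)[of k] by linarith
    moreover have "{\<omega> \<in> space M. P k \<omega>} \<subseteq> A \<union> B k" using elim A(2) by blast
    ultimately show ?case using A(1) B(1) by (intro bexI[of _ "A \<union> B k"]) auto
  qed
qed

lemma rarely_mono:
  assumes "rarely Q" "\<forall>\<^sub>F k in sequentially. \<forall>\<omega>\<in>space M. P k \<omega> \<longrightarrow> Q k \<omega>"
  shows "rarely P"
  unfolding rarely_def
proof (intro allI impI)
  fix \<delta> :: real assume "0 < \<delta>"
  with assms(1) have "\<forall>\<^sub>F k in sequentially. \<exists>A\<in>events. {\<omega> \<in> space M. Q k \<omega>} \<subseteq> A \<and> prob A < \<delta>"
    by (simp add: rarely_def)
  with assms(2) show "\<forall>\<^sub>F k in sequentially. \<exists>B\<in>events. {\<omega> \<in> space M. P k \<omega>} \<subseteq> B \<and> prob B < \<delta>"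
    by eventually_elim blast
qed

lemma rarely_lim:
  assumes "\<And>k. {\<omega> \<in> space M. P k \<omega>} \<in> events" "(\<lambda>k. prob {\<omega> \<in> space M. P k \<omega>}) \<longlonglongrightarrow> 0"
  shows "rarely P"
  unfolding rarely_def
proof (intro allI impI)
  fix \<delta> :: real assume "0 < \<delta>"
  then have "\<forall>\<^sub>F k in sequentially. prob {\<omega> \<in> space M. P k \<omega>} < \<delta>"
    using assms(2) by (rule order_tendstoD(2)[rotated])
  then show "\<forall>\<^sub>F k in sequentially. \<exists>B\<in>events. {\<omega> \<in> space M. P k \<omega>} \<subseteq> B \<and> prob B < \<delta>"
    by eventually_elim (use assms(1) in blast)
qed

lemma rarely_disj:
  assumes "rarely P" "rarely Q"
  shows "rarely (\<lambda>k \<omega>. P k \<omega> \<or> Q k \<omega>)"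
  unfolding rarely_def
proof (intro allI impI)
  fix \<delta> :: real assume "0 < \<delta>"
  then have "\<forall>\<^sub>F k in sequentially. \<exists>A\<in>events. {\<omega> \<in> space M. P k \<omega>} \<subseteq> A \<and> prob A < \<delta> / 2"
    "\<forall>\<^sub>F k in sequentially. \<exists>A\<in>events. {\<omega> \<in> space M. Q k \<omega>} \<subseteq> A \<and> prob A < \<delta> / 2"
    by (intro rarelyD assms; simp)+
  then show "\<forall>\<^sub>F k in sequentially. \<exists>B\<in>events. {\<omega> \<in> space M. P k \<omega> \<or> Q k \<omega>} \<subseteq> B \<and> prob B < \<delta>"
  proof eventually_elim
    case (elim k)
    then obtain A B where A: "A \<in> events" "{\<omega> \<in> space M. P k \<omega>} \<subseteq> A" "prob A < \<delta> / 2"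
      and B: "B \<in> events" "{\<omega> \<in> space M. Q k \<omega>} \<subseteq> B" "prob B < \<delta> / 2" by auto
    have "prob (A \<union> B) \<le> prob A + prob B" by (rule measure_Un_le) (use A B in auto)
    then show ?case using A B by (intro bexI[of _ "A \<union> B"]) auto
  qed
qed

lemma rarely_False: "rarely (\<lambda>k \<omega>. False)"
  unfolding rarely_def by (auto intro!: always_eventually bexI[of _ "{}"])

lemma rarely_bex:
  assumes "finite T" "\<And>t. t \<in> T \<Longrightarrow> rarely (P t)"
  shows "rarely (\<lambda>k \<omega>. \<exists>t\<in>T. P t k \<omega>)"
  using assms
proof (induction T)
  case empty
  show ?case using rarely_False by simp
next
  case (insert t T)
  have "rarely (\<lambda>k \<omega>. P t k \<omega> \<or> (\<exists>t\<in>T. P t k \<omega>))"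
    by (rule rarely_disj) (use insert in auto)
  then show ?case by simp
qed

lemma rarely_AE_tendsto:
  fixes a :: "nat \<Rightarrow> 'a \<Rightarrow> 'b::{metric_space, second_countable_topology}"
  assumes [measurable]: "\<And>k. a k \<in> borel_measurable M"
    and conv: "AE \<omega> in M. (\<lambda>k. a k \<omega>) \<longlonglongrightarrow> l" and "0 < \<epsilon>"
  shows "rarely (\<lambda>k \<omega>. \<epsilon> \<le> dist (a k \<omega>) l)"
proof (rule rarely_lim)
  have m [measurable]: "{\<omega> \<in> space M. \<epsilon> \<le> dist (a k \<omega>) l} \<in> events" for k by measurable
  then show "{\<omega> \<in> space M. \<epsilon> \<le> dist (a k \<omega>) l} \<in> events" for k .
  have "(\<lambda>k. expectation (indicator {\<omega> \<in> space M. \<epsilon> \<le> dist (a k \<omega>) l} :: 'a \<Rightarrow> real)) \<longlonglongrightarrow> expectation (\<lambda>\<omega>. 0 :: real)"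
  proof (rule integral_dominated_convergence[where w="\<lambda>_. 1"])
    show "AE \<omega> in M. (\<lambda>k. indicator {\<omega> \<in> space M. \<epsilon> \<le> dist (a k \<omega>) l} \<omega> :: real) \<longlonglongrightarrow> 0"
      using conv
    proof eventually_elim
      case (elim \<omega>)
      have "\<forall>\<^sub>F k in sequentially. dist (a k \<omega>) l < \<epsilon>" by (rule tendstoD[OF elim \<open>0 < \<epsilon>\<close>])
      then have "\<forall>\<^sub>F k in sequentially. (indicator {\<omega> \<in> space M. \<epsilon> \<le> dist (a k \<omega>) l} \<omega> :: real) = 0"
        by eventually_elim (simp add: indicator_def)
      then show ?case by (rule tendsto_eventually)
    qed
  qed (auto simp: indicator_def)
  then show "(\<lambda>k. prob {\<omega> \<in> space M. \<epsilon> \<le> dist (a k \<omega>) l}) \<longlonglongrightarrow> 0" by simp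
qed

lemma rarely_AE:
  assumes "AE \<omega> in M. \<forall>k. \<not> P k \<omega>"
  shows "rarely P"
proof -
  obtain Z where Z: "{\<omega> \<in> space M. \<not> (\<forall>k. \<not> P k \<omega>)} \<subseteq> Z" "emeasure M Z = 0" "Z \<in> events"
    using AE_E[OF assms] .
  then show ?thesis unfolding rarely_def
    by (intro allI impI always_eventually bexI[of _ Z]) (auto simp: measure_def)
qed

text \<open>A bound that holds off a rare event passes to expectations of bounded variables, since
  the rare event contributes at most \<open>B\<close> times its probability.\<close>

lemma rarely_expectation_bound:
  fixes X :: "nat \<Rightarrow> 'a \<Rightarrow> real"
  assumes P: "rarely P" and "0 < \<delta>"
    and X: "\<And>k. X k \<in> borel_measurable M" "\<And>k \<omega>. 0 \<le> X k \<omega>" "\<And>k \<omega>. X k \<omega> \<le> B"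
    and Z: "\<And>k. integrable M (Z k)" "\<And>k \<omega>. 0 \<le> Z k \<omega>"
    and le: "\<forall>\<^sub>F k in sequentially. \<forall>\<omega>\<in>space M. \<not> P k \<omega> \<longrightarrow> X k \<omega> \<le> Z k \<omega>"
  shows "\<forall>\<^sub>F k in sequentially. expectation (X k) \<le> expectation (Z k) + B * \<delta>"
proof -
  have B: "0 \<le> B" using X(2,3) order_trans by blast
  have "\<forall>\<^sub>F k in sequentially. \<exists>A\<in>events. {\<omega> \<in> space M. P k \<omega>} \<subseteq> A \<and> prob A < \<delta>"
    using P \<open>0 < \<delta>\<close> by (simp add: rarely_def)
  with le show ?thesis
  proof eventually_elim
    case (elim k)
    then obtain A where A: "A \<in> events" "{\<omega> \<in> space M. P k \<omega>} \<subseteq> A" "prob A < \<delta>" by blast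
    have iX: "integrable M (X k)" by (rule integrable_const_bound[where B=B]) (use X in auto)
    have iA: "integrable M (\<lambda>\<omega>. B * indicator A \<omega>)"
      by (rule integrable_const_bound[where B=B]) (use A(1) B in \<open>auto simp: indicator_def\<close>)
    have "expectation (X k) \<le> expectation (\<lambda>\<omega>. Z k \<omega> + B * indicator A \<omega>)"
    proof (rule integral_mono)
      fix \<omega> assume \<omega>: "\<omega> \<in> space M"
      show "X k \<omega> \<le> Z k \<omega> + B * indicator A \<omega>"
      proof (cases "\<omega> \<in> A")
        case True
        then show ?thesis using X(3)[of k \<omega>] Z(2)[of k \<omega>] by simp
      next
        case False
        then have "\<not> P k \<omega>" using A(2) \<omega> by blast
        then show ?thesis using elim(1) \<omega> False by simp
      qed
    qed (use iX iA Z in auto)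
    also have "\<dots> = expectation (Z k) + B * prob A" using Z(1) iA A(1) by simp
    also have "\<dots> \<le> expectation (Z k) + B * \<delta>" using A(3) B by (intro add_left_mono mult_left_mono) auto
    finally show ?case .
  qed
qed

end

section \<open>The adaptive process\<close>

text \<open>A score weight times residual splits into h1 u * err and - h1 u * (G u - G w). Both
  coefficients are linearised around w, uniformly on the interval.\<close>

lemma (in glm_link) score_remainders:
  assumes lohi: "{lo..hi} \<subseteq> I" and "0 < \<eta>"
  obtains \<delta> where "0 < \<delta>"
    "\<And>u w. u \<in> {lo..hi} \<Longrightarrow> w \<in> {lo..hi} \<Longrightarrow> \<bar>u - w\<bar> < \<delta> \<Longrightarrow>
      \<bar>h1 u - h1 w - h2 w * (u - w)\<bar> \<le> \<eta> * \<bar>u - w\<bar>"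
    "\<And>u w. u \<in> {lo..hi} \<Longrightarrow> w \<in> {lo..hi} \<Longrightarrow> \<bar>u - w\<bar> < \<delta> \<Longrightarrow>
      \<bar>h1 u * (G u - G w) - h1 w * deriv G w * (u - w)\<bar> \<le> \<eta> * \<bar>u - w\<bar>"
proof -
  have sub: "u \<in> {lo..hi} \<Longrightarrow> u \<in> I" for u using lohi by auto
  have "compact (G ` {lo..hi})"
    by (intro compact_continuous_image continuous_on_subset[OF cont_h(4) lohi] compact_Icc)
  then obtain C0 where C0: "\<And>w. w \<in> {lo..hi} \<Longrightarrow> \<bar>G w\<bar> \<le> C0"
    by (metis bounded_iff compact_imp_bounded imageI real_norm_def)
  define C where "C = max C0 0"
  have C: "0 \<le> C" "\<And>w. w \<in> {lo..hi} \<Longrightarrow> \<bar>G w\<bar> \<le> C" using C0 by (auto simp: C_def le_max_iff_disj)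
  \<comment> \<open>The second remainder is that of the product h1 * G minus \<open>G w\<close>
    times the first one, hence the factor 1 + C with \<open>C\<close> a bound for
    \<open>G\<close>.\<close>
  define e where "e = \<eta> / (1 + C)"
  have e: "0 < e" "e * (1 + C) = \<eta>" using \<open>0 < \<eta>\<close> C(1) by (auto simp: e_def)
  have "e * 1 \<le> e * (1 + C)" using e(1) C(1) by (intro mult_left_mono) auto
  then have e\<eta>: "e \<le> \<eta>" using e(2) by simp
  obtain d1 where d1: "0 < d1" "\<And>u w. u \<in> {lo..hi} \<Longrightarrow> w \<in> {lo..hi} \<Longrightarrow> \<bar>u - w\<bar> < d1 \<Longrightarrow>
      \<bar>h1 u - h1 w - h2 w * (u - w)\<bar> \<le> e * \<bar>u - w\<bar>"
    by (rule uniform_derivative_interval[of lo hi h1 h2 e, OF DERIV_h1[OF sub] continuous_on_subset[OF cont_h(3) lohi] e(1)])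
      (assumption, rule that)
  let ?g = "\<lambda>u. h1 u * G u" and ?g' = "\<lambda>u. h2 u * G u + deriv G u * h1 u"
  have dg: "(?g has_real_derivative ?g' u) (at u)" if "u \<in> {lo..hi}" for u
    by (rule DERIV_mult[OF DERIV_h1[OF sub[OF that]] DERIV_G[OF sub[OF that]]])
  have cg: "continuous_on {lo..hi} ?g'"
    by (intro continuous_intros continuous_on_subset[OF _ lohi] cont_h cont_G')
  obtain d2 where d2: "0 < d2" "\<And>u w. u \<in> {lo..hi} \<Longrightarrow> w \<in> {lo..hi} \<Longrightarrow> \<bar>u - w\<bar> < d2 \<Longrightarrow>
      \<bar>?g u - ?g w - ?g' w * (u - w)\<bar> \<le> e * \<bar>u - w\<bar>"
    by (rule uniform_derivative_interval[OF dg cg e(1)]) (assumption, rule that)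
  show ?thesis
  proof (rule that[of "min d1 d2"])
    show "0 < min d1 d2" using d1(1) d2(1) by simp
    fix u w assume u: "u \<in> {lo..hi}" and w: "w \<in> {lo..hi}" and uw: "\<bar>u - w\<bar> < min d1 d2"
    have r1: "\<bar>h1 u - h1 w - h2 w * (u - w)\<bar> \<le> e * \<bar>u - w\<bar>" by (rule d1(2)[OF u w]) (use uw in simp)
    have r2: "\<bar>?g u - ?g w - ?g' w * (u - w)\<bar> \<le> e * \<bar>u - w\<bar>" by (rule d2(2)[OF u w]) (use uw in simp)
    have "e * \<bar>u - w\<bar> \<le> \<eta> * \<bar>u - w\<bar>" by (rule mult_right_mono[OF e\<eta>]) simp
    with r1 show "\<bar>h1 u - h1 w - h2 w * (u - w)\<bar> \<le> \<eta> * \<bar>u - w\<bar>" by linarith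
    have eq: "h1 u * (G u - G w) - h1 w * deriv G w * (u - w)
        = (?g u - ?g w - ?g' w * (u - w)) - G w * (h1 u - h1 w - h2 w * (u - w))"
      by (simp add: algebra_simps)
    have "\<bar>h1 u * (G u - G w) - h1 w * deriv G w * (u - w)\<bar> \<le> \<bar>?g u - ?g w - ?g' w * (u - w)\<bar> + \<bar>G w\<bar> * \<bar>h1 u - h1 w - h2 w * (u - w)\<bar>"
      unfolding eq abs_mult[symmetric] by (rule abs_triangle_ineq4)
    also have "\<dots> \<le> e * \<bar>u - w\<bar> + C * (e * \<bar>u - w\<bar>)"
      by (rule add_mono[OF r2 mult_mono[OF C(2)[OF w] r1 C(1) abs_ge_zero]])
    also have "\<dots> = \<eta> * \<bar>u - w\<bar>" unfolding e(2)[symmetric] by (simp add: algebra_simps)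
    finally show "\<bar>h1 u * (G u - G w) - h1 w * deriv G w * (u - w)\<bar> \<le> \<eta> * \<bar>u - w\<bar>" .
  qed
qed

lemma (in glm_link) h_Lipschitz:
  assumes lohi: "{lo..hi} \<subseteq> I"
  obtains L where "0 \<le> L" "\<And>u w. u \<in> {lo..hi} \<Longrightarrow> w \<in> {lo..hi} \<Longrightarrow> \<bar>h u - h w\<bar> \<le> L * \<bar>u - w\<bar>"
proof -
  have sub: "u \<in> {lo..hi} \<Longrightarrow> u \<in> I" for u using lohi by auto
  have "compact (h1 ` {lo..hi})"
    by (intro compact_continuous_image continuous_on_subset[OF cont_h(2) lohi] compact_Icc)
  then obtain L0 where L0: "\<And>w. w \<in> {lo..hi} \<Longrightarrow> \<bar>h1 w\<bar> \<le> L0"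
    by (metis bounded_iff compact_imp_bounded imageI real_norm_def)
  show ?thesis
  proof (rule that[of "max L0 0"])
    fix u w assume uw: "u \<in> {lo..hi}" "w \<in> {lo..hi}"
    have "norm (h u - h w) \<le> max L0 0 * norm (u - w)"
    proof (rule field_differentiable_bound[of "{lo..hi}" h h1])
      show "(h has_field_derivative h1 z) (at z within {lo..hi})" if "z \<in> {lo..hi}" for z
        by (rule has_field_derivative_at_within[OF DERIV_h[OF sub[OF that]]])
    qed (use uw L0 in \<open>auto simp: le_max_iff_disj\<close>)
    then show "\<bar>h u - h w\<bar> \<le> max L0 0 * \<bar>u - w\<bar>" by simp
  qed simp
qed

text \<open>All linear predictors lie in the compact interval from \<open>lo\<close> to \<open>hi\<close>.\<close>

locale adaptive_glm = glm_link J I \<nu> K b G P + sat_design XX \<Theta> f\<^sub>\<theta> \<theta>\<^sub>0 + prob_space M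
  for J I :: "real set" and \<nu> :: "real measure" and K b G :: "real \<Rightarrow> real" and P :: "real \<Rightarrow> real measure"
    and XX :: "'x::metric_space set" and \<Theta> :: "(real ^ 'p) set"
    and f\<^sub>\<theta> :: "real ^ 'p \<Rightarrow> 'x \<Rightarrow> real ^ 'p" and \<theta>\<^sub>0 :: "real ^ 'p" and M :: "'w measure" +
  fixes f :: "'x \<Rightarrow> real ^ 'p" and F :: "nat \<Rightarrow> 'w measure"
    and X :: "nat \<Rightarrow> 'w \<Rightarrow> 'x" and Y :: "nat \<Rightarrow> 'w \<Rightarrow> real" and n\<^sub>1 :: nat
    and \<theta>hat \<theta>mle :: "nat \<Rightarrow> 'w \<Rightarrow> real ^ 'p" and lo hi :: real
  assumes compact_\<Theta>: "compact \<Theta>"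
    and \<theta>0_int: "\<theta>\<^sub>0 \<in> interior \<Theta>"
    and f_cont: "continuous_on XX f"
    and lohi: "{lo..hi} \<subseteq> I" "lo \<le> hi"
    and f_range: "\<And>x \<theta>. x \<in> XX \<Longrightarrow> \<theta> \<in> \<Theta> \<Longrightarrow> f x \<bullet> \<theta> \<in> {lo..hi}"
    and f_theta: "\<And>x \<theta>. x \<in> XX \<Longrightarrow> \<theta> \<in> \<Theta> \<Longrightarrow> f\<^sub>\<theta> \<theta> x = glm_phi J b G (f x \<bullet> \<theta>) *\<^sub>R f x"
    and X_meas: "\<And>i. 1 \<le> i \<Longrightarrow> X i \<in> M \<rightarrow>\<^sub>M restrict_space borel XX"
    and Y_meas: "\<And>i. 1 \<le> i \<Longrightarrow> Y i \<in> borel_measurable M"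
    and n1: "1 \<le> n\<^sub>1"
    and a1: "cond_a1 M XX CARD('p) n\<^sub>1 X Y F"
    and a2: "cond_a2' M CARD('p) n\<^sub>1 X Y F J b P G f \<theta>\<^sub>0"
    and \<theta>hat_in: "\<And>k \<omega>. 1 \<le> k \<Longrightarrow> \<omega> \<in> space M \<Longrightarrow> \<theta>hat k \<omega> \<in> \<Theta>"
    and p_step: "p_step_ahead M XX n\<^sub>1 X f\<^sub>\<theta> \<theta>hat"
    and \<theta>mle_meas: "\<And>k. 1 \<le> k \<Longrightarrow> \<theta>mle k \<in> borel_measurable M"
    and \<theta>mle_max: "\<And>k \<omega>. 1 \<le> k \<Longrightarrow> \<omega> \<in> space M \<Longrightarrow> is_arg_max
           (log_lik J b K G f (\<lambda>i. X i \<omega>) (\<lambda>i. Y i \<omega>) (n_obs CARD('p) n\<^sub>1 k)) (\<lambda>\<theta>. \<theta> \<in> \<Theta>) (\<theta>mle k \<omega>)"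
    and \<theta>hat_conv: "AE \<omega> in M. (\<lambda>k. \<theta>hat k \<omega>) \<longlonglongrightarrow> \<theta>\<^sub>0"
begin

lemma f0_range: "x \<in> XX \<Longrightarrow> f x \<bullet> \<theta>\<^sub>0 \<in> {lo..hi}" by (rule f_range[OF _ \<theta>0])

lemma h_interval: "h lo \<le> h hi" "{h lo..h hi} \<subseteq> J" "u \<in> {lo..hi} \<Longrightarrow> h u \<in> {h lo..h hi}"
proof -
  have mono: "h u \<le> h w" if "u \<in> {lo..hi}" "w \<in> {lo..hi}" "u \<le> w" for u w
  proof (rule DERIV_nonneg_imp_nondecreasing[OF that(3)])
    fix z assume "u \<le> z" "z \<le> w"
    then have "z \<in> I" using that lohi(1) by auto
    then show "\<exists>y. (h has_real_derivative y) (at z) \<and> 0 \<le> y"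
      using DERIV_h less_imp_le[OF h1_pos] by blast
  qed
  show "h lo \<le> h hi" "u \<in> {lo..hi} \<Longrightarrow> h u \<in> {h lo..h hi}" using mono lohi(2) by auto
  have "h lo \<in> J" "h hi \<in> J" using lohi by (auto intro!: h_in)
  then show "{h lo..h hi} \<subseteq> J" using J(2) unfolding is_interval_1 by (meson atLeastAtMost_iff subsetI)
qed

sublocale S: staged_responses M XX "CARD('p)" n\<^sub>1 X Y F J \<nu> K b P "\<lambda>x. h (f x \<bullet> \<theta>\<^sub>0)" "h lo" "h hi"
proof
  show "1 \<le> CARD('p)" by simp
  show "continuous_on XX (\<lambda>x. h (f x \<bullet> \<theta>\<^sub>0))"
    by (rule continuous_on_compose2[OF cont_h(1)]) (use f0_range lohi(1) in \<open>auto intro!: continuous_intros f_cont\<close>)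
  show "is_cond_distr M (F k) (PiM (stage CARD('p) n\<^sub>1 (Suc k)) (\<lambda>_. borel))
        (\<lambda>\<omega>. \<lambda>i\<in>stage CARD('p) n\<^sub>1 (Suc k). Y i \<omega>)
        (\<lambda>\<omega>. PiM (stage CARD('p) n\<^sub>1 (Suc k)) (\<lambda>i. P (h (f (X i \<omega>) \<bullet> \<theta>\<^sub>0))))" for k
    using a2[unfolded cond_a2'_def, rule_format, of "Suc k"] by simp
qed (use n1 compact ef h_interval f0_range X_meas Y_meas a1 in auto)

lemma err_eq: "S.err i \<omega> = Y i \<omega> - G (f (X i \<omega>) \<bullet> \<theta>\<^sub>0)" if "1 \<le> i" "\<omega> \<in> space M"
  unfolding S.err_def using db_h f0_range[OF S.X_in[OF that]] lohi(1) by (metis subsetD)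

lemma f_bound: obtains B where "0 < B" "\<And>x. x \<in> XX \<Longrightarrow> norm (f x) \<le> B"
proof -
  have "compact (f ` XX)" by (intro compact_continuous_image f_cont compact)
  then obtain B where "0 < B" "\<And>y. y \<in> f ` XX \<Longrightarrow> norm y \<le> B"
    using compact_imp_bounded bounded_pos by metis
  then show ?thesis using that by blast
qed

lemma \<theta>mle_in: "1 \<le> k \<Longrightarrow> \<omega> \<in> space M \<Longrightarrow> \<theta>mle k \<omega> \<in> \<Theta>"
  using \<theta>mle_max unfolding is_arg_max_def by blast

text \<open>The information matrix at the true parameter of the empirical design, with repeated
  points counted by multiplicity.\<close>

definition gram :: "nat \<Rightarrow> 'w \<Rightarrow> real ^ 'p ^ 'p" where
  "gram k \<omega> = (1 / real (S.N k)) *\<^sub>R (\<Sum>i\<in>{1..S.N k}. outer (f\<^sub>\<theta> \<theta>\<^sub>0 (X i \<omega>)))"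

abbreviation "MM \<equiv> M_sat XX f\<^sub>\<theta> \<theta>\<^sub>0"

text \<open>The initial stage has \<open>n\<^sub>1\<close> points, every later one exactly p. The
  enumeration is the one by which \<open>p_step_ahead\<close> assigns points to columns.\<close>

lemma sum_stage:
  fixes g :: "nat \<Rightarrow> 'b::comm_monoid_add"
  assumes "1 \<le> k"
  shows "(\<Sum>i\<in>S.st k. g i) = (\<Sum>j\<in>(UNIV :: 'p set). g (S.N k + 1 + to_nat_on UNIV j))"
proof -
  have b: "bij_betw (to_nat_on (UNIV :: 'p set)) UNIV {..<CARD('p)}"
    using to_nat_on_finite[of "UNIV :: 'p set"] by simp
  have N: "S.N (Suc k) = S.N k + CARD('p)" using assms by (cases k) (simp_all add: n_obs_def)
  have "bij_betw (\<lambda>m. S.N k + 1 + m) {..<CARD('p)} (S.st k)"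
    unfolding stage_subset N
    by (rule bij_betwI[where g="\<lambda>i. i - (S.N k + 1)"]) auto
  from bij_betw_trans[OF b this]
  have "bij_betw (\<lambda>j. S.N k + 1 + to_nat_on (UNIV :: 'p set) j) UNIV (S.st k)" by (simp add: o_def)
  then show ?thesis by (rule sum.reindex_bij_betw[symmetric])
qed

text \<open>The argument is pathwise. A block contributes p times a matrix converging to
  \<open>MM\<close>; the arbitrary initial points sit in the starting value of the centred sum
  \<open>B\<close>, which averaging removes.\<close>

lemma gram_conv: "AE \<omega> in M. (\<lambda>k. gram k \<omega>) \<longlonglongrightarrow> MM"
  using \<theta>hat_conv AE_space
proof eventually_elim
  case (elim \<omega>)
  let ?p = "real CARD('p)"
  let ?o = "\<lambda>i. outer (f\<^sub>\<theta> \<theta>\<^sub>0 (X i \<omega>))"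
  define z where "z k j = X (S.N (Suc k) + 1 + to_nat_on UNIV j) \<omega>" for k and j :: 'p
  define D where "D k = (\<Sum>i\<in>S.st (Suc k). ?o i) - ?p *\<^sub>R MM" for k
  define B where "B k = (\<Sum>i\<in>{1..S.N (Suc k)}. ?o i) - real (S.N (Suc k)) *\<^sub>R MM" for k
  have "(\<lambda>k. \<Sum>j\<in>UNIV. (1 / ?p) *\<^sub>R outer (f\<^sub>\<theta> \<theta>\<^sub>0 (z k j))) \<longlonglongrightarrow> MM"
  proof (rule maximal_sequence_gram)
    show "\<theta>hat (Suc k) \<omega> \<in> \<Theta>" for k using \<theta>hat_in elim(2) by simp
    show "(\<lambda>k. \<theta>hat (Suc k) \<omega>) \<longlonglongrightarrow> \<theta>\<^sub>0" using elim(1) by (rule LIMSEQ_Suc)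
    show "maximal (\<theta>hat (Suc k) \<omega>) (z k)" for k
      using p_step elim(2) unfolding p_step_ahead_def z_def by simp
  qed
  then have "(\<lambda>k. ?p *\<^sub>R (\<Sum>j\<in>UNIV. (1 / ?p) *\<^sub>R outer (f\<^sub>\<theta> \<theta>\<^sub>0 (z k j))) - ?p *\<^sub>R MM) \<longlonglongrightarrow> ?p *\<^sub>R MM - ?p *\<^sub>R MM"
    by (intro tendsto_intros)
  moreover have "?p *\<^sub>R (\<Sum>j\<in>UNIV. (1 / ?p) *\<^sub>R outer (f\<^sub>\<theta> \<theta>\<^sub>0 (z k j))) = (\<Sum>i\<in>S.st (Suc k). ?o i)" for k
    by (subst sum_stage) (simp_all add: z_def scaleR_sum_right)
  ultimately have D0: "D \<longlonglongrightarrow> 0" by (simp add: D_def[abs_def])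
  have NS: "real (S.N (Suc (Suc k))) = real (S.N (Suc k)) + ?p" for k by (simp add: n_obs_def)
  have "B (Suc k) = B k + D k" for k
  proof -
    have "(\<Sum>i\<in>{1..S.N (Suc (Suc k))}. ?o i) = (\<Sum>i\<in>{1..S.N (Suc k)}. ?o i) + (\<Sum>i\<in>S.st (Suc k). ?o i)"
      unfolding upto_n_obs_Suc(1)[of "CARD('p)" n\<^sub>1 "Suc k"]
      by (rule sum.union_disjoint) (simp_all only: upto_n_obs_Suc(2) finite_stage finite_atLeastAtMost)
    then show ?thesis by (simp only: B_def D_def NS scaleR_add_left) simp
  qed
  then have B0: "(\<lambda>k. (1 / real k) *\<^sub>R B k) \<longlonglongrightarrow> 0" by (rule cesaro_increments[OF _ D0])
  have "(\<lambda>k. gram (Suc k) \<omega> - MM) \<longlonglongrightarrow> 0"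
  \<comment> \<open>Averaging was done by the number of stages. The sample size is at least as
    large, so division by it gives a smaller norm.\<close>
  proof (rule Lim_null_comparison[OF _ tendsto_norm_zero[OF B0]])
    show "\<forall>\<^sub>F k in sequentially. norm (gram (Suc k) \<omega> - MM) \<le> norm ((1 / real k) *\<^sub>R B k)"
      using eventually_gt_at_top[of 0]
    proof eventually_elim
      case (elim k)
      have N0: "0 < real (S.N (Suc k))" using S.N_pos[of "Suc k"] by simp
      have "gram (Suc k) \<omega> - MM = (1 / real (S.N (Suc k))) *\<^sub>R B k"
        using N0 by (simp add: gram_def B_def scaleR_diff_right)
      then have "norm (gram (Suc k) \<omega> - MM) = (1 / real (S.N (Suc k))) * norm (B k)" by simp
      also have "\<dots> \<le> (1 / real k) * norm (B k)"
        using elim S.real_N_ge[of k] by (intro mult_right_mono divide_left_mono) auto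
      finally show ?case by simp
    qed
  qed
  then have "(\<lambda>k. gram (Suc k) \<omega>) \<longlonglongrightarrow> MM" by (simp add: LIM_zero_iff)
  then show "(\<lambda>k. gram k \<omega>) \<longlonglongrightarrow> MM" by (rule LIMSEQ_imp_Suc)
qed

end

section \<open>Likelihood inequality, score equation and lower bound on the design\<close>

context adaptive_glm
begin

definition regular :: "'w \<Rightarrow> bool" where
  "regular \<omega> \<longleftrightarrow> \<omega> \<in> space M \<and> (\<forall>i\<ge>1. K (Y i \<omega>) \<noteq> 0)"

definition loglik :: "nat \<Rightarrow> 'w \<Rightarrow> real ^ 'p \<Rightarrow> real" where
  "loglik k \<omega> \<theta> = (\<Sum>i\<in>{1..S.N k}. h (f (X i \<omega>) \<bullet> \<theta>) * Y i \<omega> - b (h (f (X i \<omega>) \<bullet> \<theta>)))"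

lemma AE_regular: "AE \<omega> in M. regular \<omega>"
  using S.AE_K_nonzero AE_space by eventually_elim (simp add: regular_def)

text \<open>On the almost sure event \<open>regular\<close> the extended-real likelihood is finite,
  and the part containing \<open>K\<close> is free of the parameter; maximising the real-valued
  \<open>loglik\<close> is then equivalent.\<close>

lemma log_lik_eq:
  assumes "regular \<omega>"
  shows "log_lik J b K G f (\<lambda>i. X i \<omega>) (\<lambda>i. Y i \<omega>) (S.N k) \<theta> =
    ereal ((\<Sum>i\<in>{1..S.N k}. ln (K (Y i \<omega>))) + loglik k \<omega> \<theta>)"
proof -
  have "log_lik J b K G f (\<lambda>i. X i \<omega>) (\<lambda>i. Y i \<omega>) (S.N k) \<theta> =
    (\<Sum>i\<in>{1..S.N k}. ereal (ln (K (Y i \<omega>)) + (h (f (X i \<omega>) \<bullet> \<theta>) * Y i \<omega> - b (h (f (X i \<omega>) \<bullet> \<theta>)))))"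
    unfolding log_lik_def
  proof (rule sum.cong[OF refl])
    fix i assume "i \<in> {1..S.N k}"
    then have "K (Y i \<omega>) \<noteq> 0" using assms by (auto simp: regular_def)
    then show "(if K (Y i \<omega>) = 0 then - \<infinity> else ereal (ln (K (Y i \<omega>)))) +
        ereal (h (f (X i \<omega>) \<bullet> \<theta>) * Y i \<omega> - b (h (f (X i \<omega>) \<bullet> \<theta>))) =
      ereal (ln (K (Y i \<omega>)) + (h (f (X i \<omega>) \<bullet> \<theta>) * Y i \<omega> - b (h (f (X i \<omega>) \<bullet> \<theta>))))"
      by simp
  qed
  also have "\<dots> = ereal (\<Sum>i\<in>{1..S.N k}. ln (K (Y i \<omega>)) + (h (f (X i \<omega>) \<bullet> \<theta>) * Y i \<omega> - b (h (f (X i \<omega>) \<bullet> \<theta>))))"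
    by (rule sum_ereal)
  also have "\<dots> = ereal ((\<Sum>i\<in>{1..S.N k}. ln (K (Y i \<omega>))) + loglik k \<omega> \<theta>)"
    by (simp only: loglik_def sum.distrib)
  finally show ?thesis .
qed

lemma loglik_max:
  assumes "1 \<le> k" "regular \<omega>" "\<theta> \<in> \<Theta>"
  shows "loglik k \<omega> \<theta> \<le> loglik k \<omega> (\<theta>mle k \<omega>)"
proof (rule ccontr)
  assume "\<not> ?thesis"
  then have "log_lik J b K G f (\<lambda>i. X i \<omega>) (\<lambda>i. Y i \<omega>) (S.N k) (\<theta>mle k \<omega>)
      < log_lik J b K G f (\<lambda>i. X i \<omega>) (\<lambda>i. Y i \<omega>) (S.N k) \<theta>"
    unfolding log_lik_eq[OF assms(2)] by simp
  moreover have "\<omega> \<in> space M" using assms(2) by (simp add: regular_def)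
  ultimately show False using \<theta>mle_max[OF assms(1)] assms(3) unfolding is_arg_max_def by blast
qed

text \<open>At an interior maximiser the derivative of the likelihood along every line vanishes, and
  \<open>deriv b\<close> composed with \<open>h\<close> is \<open>G\<close>.\<close>

lemma score_equation:
  assumes k: "1 \<le> k" and \<omega>: "regular \<omega>" and int: "\<theta>mle k \<omega> \<in> interior \<Theta>"
  shows "(\<Sum>i\<in>{1..S.N k}. h1 (f (X i \<omega>) \<bullet> \<theta>mle k \<omega>) * (Y i \<omega> - G (f (X i \<omega>) \<bullet> \<theta>mle k \<omega>)) * (f (X i \<omega>) \<bullet> v)) = 0"
proof -
  let ?t = "\<theta>mle k \<omega>"
  have \<omega>M: "\<omega> \<in> space M" using \<omega> by (simp add: regular_def)
  obtain r where r: "0 < r" "ball ?t r \<subseteq> \<Theta>" using int by (auto simp: mem_interior)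
  \<comment> \<open>Keeps the line segment inside the ball of radius r; adding 1 covers v =
    0.\<close>
  define d where "d = r / (norm v + 1)"
  have nv: "0 < norm v + 1" by (simp add: add_nonneg_pos)
  have d: "0 < d" using r nv by (simp add: d_def)
  have in\<Theta>: "?t + s *\<^sub>R v \<in> \<Theta>" if "\<bar>0 - s\<bar> < d" for s
  proof -
    have "\<bar>s\<bar> * norm v \<le> \<bar>s\<bar> * (norm v + 1)" by (intro mult_left_mono) auto
    also have "\<dots> < r" using that nv by (simp add: d_def less_divide_eq)
    finally show ?thesis by (intro subsetD[OF r(2)]) (simp add: dist_norm)
  qed
  have "((\<lambda>s. loglik k \<omega> (?t + s *\<^sub>R v)) has_real_derivative
     (\<Sum>i\<in>{1..S.N k}. (h1 (f (X i \<omega>) \<bullet> ?t) * (f (X i \<omega>) \<bullet> v)) * Y i \<omega>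
        - deriv b (h (f (X i \<omega>) \<bullet> ?t)) * (h1 (f (X i \<omega>) \<bullet> ?t) * (f (X i \<omega>) \<bullet> v)))) (at 0)"
    unfolding loglik_def
  proof (rule DERIV_sum)
    fix i assume "i \<in> {1..S.N k}"
    then have x: "X i \<omega> \<in> XX" using S.X_in \<omega>M by auto
    let ?u = "\<lambda>s. f (X i \<omega>) \<bullet> (?t + s *\<^sub>R v)"
    have u0: "?u 0 = f (X i \<omega>) \<bullet> ?t" by simp
    have uI: "?u 0 \<in> I" using f_range[OF x \<theta>mle_in[OF k \<omega>M]] lohi(1) by auto
    have du: "(?u has_real_derivative f (X i \<omega>) \<bullet> v) (at 0)"
      by (auto intro!: derivative_eq_intros simp: inner_add_right)
    have dh: "((\<lambda>s. h (?u s)) has_real_derivative h1 (?u 0) * (f (X i \<omega>) \<bullet> v)) (at 0)"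
      by (rule DERIV_chain2[OF DERIV_h[OF uI] du])
    have db: "((\<lambda>s. b (h (?u s))) has_real_derivative deriv b (h (?u 0)) * (h1 (?u 0) * (f (X i \<omega>) \<bullet> v))) (at 0)"
      by (rule DERIV_chain2[OF exp_family_regular(1)[OF ef h_in[OF uI]] dh])
    show "((\<lambda>s. h (?u s) * Y i \<omega> - b (h (?u s))) has_real_derivative
        (h1 (f (X i \<omega>) \<bullet> ?t) * (f (X i \<omega>) \<bullet> v)) * Y i \<omega>
        - deriv b (h (f (X i \<omega>) \<bullet> ?t)) * (h1 (f (X i \<omega>) \<bullet> ?t) * (f (X i \<omega>) \<bullet> v))) (at 0)"
      using DERIV_diff[OF DERIV_cmult_right[OF dh] db] unfolding u0 .
  qed
  then have "(\<Sum>i\<in>{1..S.N k}. (h1 (f (X i \<omega>) \<bullet> ?t) * (f (X i \<omega>) \<bullet> v)) * Y i \<omega>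
        - deriv b (h (f (X i \<omega>) \<bullet> ?t)) * (h1 (f (X i \<omega>) \<bullet> ?t) * (f (X i \<omega>) \<bullet> v))) = 0"
  proof (rule DERIV_local_max[OF _ d], intro allI impI)
    fix s :: real assume "\<bar>0 - s\<bar> < d"
    then show "loglik k \<omega> (?t + s *\<^sub>R v) \<le> loglik k \<omega> (?t + 0 *\<^sub>R v)"
      using loglik_max[OF k \<omega> in\<Theta>] by simp
  qed
  also have "(\<Sum>i\<in>{1..S.N k}. (h1 (f (X i \<omega>) \<bullet> ?t) * (f (X i \<omega>) \<bullet> v)) * Y i \<omega>
        - deriv b (h (f (X i \<omega>) \<bullet> ?t)) * (h1 (f (X i \<omega>) \<bullet> ?t) * (f (X i \<omega>) \<bullet> v)))
     = (\<Sum>i\<in>{1..S.N k}. h1 (f (X i \<omega>) \<bullet> ?t) * (Y i \<omega> - G (f (X i \<omega>) \<bullet> ?t)) * (f (X i \<omega>) \<bullet> v))"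
  proof (rule sum.cong[OF refl])
    fix i assume "i \<in> {1..S.N k}"
    then have x: "X i \<omega> \<in> XX" using S.X_in \<omega>M by auto
    have "f (X i \<omega>) \<bullet> ?t \<in> I" using f_range[OF x \<theta>mle_in[OF k \<omega>M]] lohi(1) by auto
    then have "deriv b (h (f (X i \<omega>) \<bullet> ?t)) = G (f (X i \<omega>) \<bullet> ?t)" by (rule db_h)
    then show "(h1 (f (X i \<omega>) \<bullet> ?t) * (f (X i \<omega>) \<bullet> v)) * Y i \<omega>
        - deriv b (h (f (X i \<omega>) \<bullet> ?t)) * (h1 (f (X i \<omega>) \<bullet> ?t) * (f (X i \<omega>) \<bullet> v))
      = h1 (f (X i \<omega>) \<bullet> ?t) * (Y i \<omega> - G (f (X i \<omega>) \<bullet> ?t)) * (f (X i \<omega>) \<bullet> v)"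
      by (simp add: algebra_simps)
  qed
  finally show ?thesis .
qed

text \<open>The likelihood ratio at the maximiser is nonnegative and equals the noise term minus a
  sum of divergences, each of which \<open>KL_lower_bound\<close> bounds below by a
  quadratic.\<close>

lemma KL_sum_bound:
  assumes \<kappa>: "\<And>u w. u \<in> {lo..hi} \<Longrightarrow> w \<in> {lo..hi} \<Longrightarrow>
    \<kappa> * (u - w)\<^sup>2 \<le> (h w - h u) * G w - b (h w) + b (h u)"
    and k: "1 \<le> k" and \<omega>: "regular \<omega>"
  shows "\<kappa> * (\<Sum>i\<in>{1..S.N k}. (f (X i \<omega>) \<bullet> (\<theta>mle k \<omega> - \<theta>\<^sub>0))\<^sup>2) \<le>
    (\<Sum>i\<in>{1..S.N k}. (h (f (X i \<omega>) \<bullet> \<theta>mle k \<omega>) - h (f (X i \<omega>) \<bullet> \<theta>\<^sub>0)) * S.err i \<omega>)"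
proof -
  let ?u = "\<lambda>i. f (X i \<omega>) \<bullet> \<theta>mle k \<omega>" and ?w = "\<lambda>i. f (X i \<omega>) \<bullet> \<theta>\<^sub>0"
  have \<omega>M: "\<omega> \<in> space M" using \<omega> by (simp add: regular_def)
  have "\<kappa> * (\<Sum>i\<in>{1..S.N k}. (f (X i \<omega>) \<bullet> (\<theta>mle k \<omega> - \<theta>\<^sub>0))\<^sup>2)
      \<le> (\<Sum>i\<in>{1..S.N k}. (h (?w i) - h (?u i)) * G (?w i) - b (h (?w i)) + b (h (?u i)))"
    unfolding sum_distrib_left
  proof (rule sum_mono)
    fix i assume "i \<in> {1..S.N k}"
    then have x: "X i \<omega> \<in> XX" using S.X_in \<omega>M by auto
    show "\<kappa> * (f (X i \<omega>) \<bullet> (\<theta>mle k \<omega> - \<theta>\<^sub>0))\<^sup>2 \<le> (h (?w i) - h (?u i)) * G (?w i) - b (h (?w i)) + b (h (?u i))"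
      unfolding inner_diff_right by (rule \<kappa>[OF f_range[OF x \<theta>mle_in[OF k \<omega>M]] f0_range[OF x]])
  qed
  also have "\<dots> = (\<Sum>i\<in>{1..S.N k}. (h (?u i) - h (?w i)) * S.err i \<omega>) - (loglik k \<omega> (\<theta>mle k \<omega>) - loglik k \<omega> \<theta>\<^sub>0)"
    unfolding loglik_def sum_subtractf[symmetric]
  proof (rule sum.cong[OF refl])
    fix i assume "i \<in> {1..S.N k}"
    then have Y: "Y i \<omega> = S.err i \<omega> + G (?w i)" using err_eq[of i \<omega>] \<omega>M by simp
    show "(h (?w i) - h (?u i)) * G (?w i) - b (h (?w i)) + b (h (?u i)) =
      (h (?u i) - h (?w i)) * S.err i \<omega> - (h (?u i) * Y i \<omega> - b (h (?u i)) - (h (?w i) * Y i \<omega> - b (h (?w i))))"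
      unfolding Y by (simp add: algebra_simps)
  qed
  also have "\<dots> \<le> (\<Sum>i\<in>{1..S.N k}. (h (?u i) - h (?w i)) * S.err i \<omega>)"
    using loglik_max[OF k \<omega> \<theta>0] by simp
  finally show ?thesis .
qed

lemma inner_gram: "w \<bullet> (gram k \<omega> *v v) = (\<Sum>i\<in>{1..S.N k}. (f\<^sub>\<theta> \<theta>\<^sub>0 (X i \<omega>) \<bullet> v) * (f\<^sub>\<theta> \<theta>\<^sub>0 (X i \<omega>) \<bullet> w)) / real (S.N k)"
proof -
  have "gram k \<omega> *v v = (1 / real (S.N k)) *\<^sub>R (\<Sum>i\<in>{1..S.N k}. (f\<^sub>\<theta> \<theta>\<^sub>0 (X i \<omega>) \<bullet> v) *\<^sub>R f\<^sub>\<theta> \<theta>\<^sub>0 (X i \<omega>))"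
    by (simp add: gram_def scaleR_matrix_vector_assoc[symmetric] sum_matrix_vector_mult outer_mult)
  then show ?thesis by (simp add: inner_sum_right inner_commute[of w])
qed

lemma f_theta0: "x \<in> XX \<Longrightarrow> f\<^sub>\<theta> \<theta>\<^sub>0 x \<bullet> v = glm_phi J b G (f x \<bullet> \<theta>\<^sub>0) * (f x \<bullet> v)"
  by (simp add: f_theta[OF _ \<theta>0])

text \<open>\<open>MM\<close> is positive definite, and half of its lower bound survives a
  perturbation of the empirical matrix. An upper bound for the squared weights
  \<open>glm_phi\<close> then passes from the weighted vectors to \<open>f\<close>. One \<epsilon>
  is chosen to serve the last claim, used in \<open>deviation_char\<close>, as well.\<close>

lemma gram_lower:
  obtains \<Lambda> \<epsilon> where "0 < \<Lambda>" "0 < \<epsilon>"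
    "\<And>k \<omega> v. 1 \<le> k \<Longrightarrow> \<omega> \<in> space M \<Longrightarrow> dist (gram k \<omega>) MM < \<epsilon> \<Longrightarrow>
      \<Lambda> * (norm v)\<^sup>2 * real (S.N k) \<le> (\<Sum>i\<in>{1..S.N k}. (f (X i \<omega>) \<bullet> v)\<^sup>2)"
    "\<And>v. \<epsilon> * norm v \<le> norm (MM *v v)"
proof -
  obtain R where R: "det R \<noteq> 0" "MM = transpose R ** R" and quad: "\<And>w. w \<bullet> (MM *v w) = (norm (R *v w))\<^sup>2"
    by (rule M_sat_factor) (rule that)
  have "inj ((*v) R)" using R(1) invertible_det_nz inj_matrix_vector_mult by blast
  then obtain B where B: "0 < B" "\<And>v. B * norm v \<le> norm (R *v v)"
    using linear_inj_bounded_below_pos[OF matrix_vector_mul_linear] by metis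
  have low: "B\<^sup>2 * (norm v)\<^sup>2 \<le> v \<bullet> (MM *v v)" for v
    unfolding quad power_mult_distrib[symmetric] using B by (intro power_mono) auto
  have "continuous_on XX (\<lambda>x. (glm_phi J b G (f x \<bullet> \<theta>\<^sub>0))\<^sup>2)"
  proof (rule continuous_on_eq)
    show "continuous_on XX (\<lambda>x. h1 (f x \<bullet> \<theta>\<^sub>0) * deriv G (f x \<bullet> \<theta>\<^sub>0))"
      by (intro continuous_on_mult continuous_on_compose2[OF cont_h(2)] continuous_on_compose2[OF cont_G'(1)])
         (use f0_range lohi(1) in \<open>auto intro!: continuous_intros f_cont\<close>)
    show "h1 (f x \<bullet> \<theta>\<^sub>0) * deriv G (f x \<bullet> \<theta>\<^sub>0) = (glm_phi J b G (f x \<bullet> \<theta>\<^sub>0))\<^sup>2" if "x \<in> XX" for x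
      using phi_sq[of "f x \<bullet> \<theta>\<^sub>0"] f0_range[OF that] lohi(1) by auto
  qed
  then have "compact ((\<lambda>x. (glm_phi J b G (f x \<bullet> \<theta>\<^sub>0))\<^sup>2) ` XX)" by (rule compact_continuous_image[OF _ compact])
  then obtain C0 where C0: "\<And>x. x \<in> XX \<Longrightarrow> \<bar>(glm_phi J b G (f x \<bullet> \<theta>\<^sub>0))\<^sup>2\<bar> \<le> C0"
    by (metis (no_types, lifting) bounded_iff compact_imp_bounded imageI real_norm_def)
  define C where "C = max C0 1"
  have C: "0 < C" "\<And>x. x \<in> XX \<Longrightarrow> (glm_phi J b G (f x \<bullet> \<theta>\<^sub>0))\<^sup>2 \<le> C"
    using C0 by (force simp: C_def)+
  show ?thesis
  proof (rule that[of "B\<^sup>2 / (2 * C)" "B\<^sup>2 / 2"])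
    show "0 < B\<^sup>2 / (2 * C)" "0 < B\<^sup>2 / 2" using B(1) C(1) by auto
    show "B\<^sup>2 / 2 * norm v \<le> norm (MM *v v)" for v
    proof (cases "v = 0")
      case False
      have "B\<^sup>2 * (norm v)\<^sup>2 \<le> norm v * norm (MM *v v)"
        using low[of v] norm_cauchy_schwarz[of v "MM *v v"] by linarith
      then have "norm v * (B\<^sup>2 * norm v) \<le> norm v * norm (MM *v v)"
        by (simp add: power2_eq_square mult_ac)
      then have "B\<^sup>2 * norm v \<le> norm (MM *v v)" using False by simp
      moreover have "0 \<le> B\<^sup>2 * norm v" by simp
      ultimately show ?thesis by linarith
    qed simp
    fix k \<omega> v assume k: "1 \<le> k" and \<omega>: "\<omega> \<in> space M" and d: "dist (gram k \<omega>) MM < B\<^sup>2 / 2"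
    have N0: "0 < real (S.N k)" using S.N_pos[OF k] by simp
    have "v \<bullet> ((MM - gram k \<omega>) *v v) \<le> norm v * norm ((MM - gram k \<omega>) *v v)" by (rule norm_cauchy_schwarz)
    also have "\<dots> \<le> norm v * (norm (MM - gram k \<omega>) * norm v)"
      by (intro mult_left_mono norm_matrix_vector_mult_le) simp
    also have "\<dots> \<le> norm v * (B\<^sup>2 / 2 * norm v)"
      using d by (intro mult_left_mono mult_right_mono) (auto simp: dist_norm norm_minus_commute)
    also have "\<dots> = B\<^sup>2 / 2 * (norm v)\<^sup>2" by (simp add: power2_eq_square)
    finally have "B\<^sup>2 / 2 * (norm v)\<^sup>2 \<le> v \<bullet> (gram k \<omega> *v v)"
      using low[of v] by (simp add: matrix_vector_mult_diff_rdistrib inner_diff_right)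
    also have "v \<bullet> (gram k \<omega> *v v) = (\<Sum>i\<in>{1..S.N k}. (f\<^sub>\<theta> \<theta>\<^sub>0 (X i \<omega>) \<bullet> v)\<^sup>2) / real (S.N k)"
      unfolding inner_gram power2_eq_square ..
    also have "\<dots> \<le> (\<Sum>i\<in>{1..S.N k}. C * (f (X i \<omega>) \<bullet> v)\<^sup>2) / real (S.N k)"
    proof (intro divide_right_mono sum_mono)
      fix i assume "i \<in> {1..S.N k}"
      then have x: "X i \<omega> \<in> XX" using S.X_in \<omega> by auto
      show "(f\<^sub>\<theta> \<theta>\<^sub>0 (X i \<omega>) \<bullet> v)\<^sup>2 \<le> C * (f (X i \<omega>) \<bullet> v)\<^sup>2"
        unfolding f_theta0[OF x] power_mult_distrib by (intro mult_right_mono C(2)[OF x]) simp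
    qed simp
    finally have "B\<^sup>2 / 2 * (norm v)\<^sup>2 \<le> C * (\<Sum>i\<in>{1..S.N k}. (f (X i \<omega>) \<bullet> v)\<^sup>2) / real (S.N k)"
      by (simp only: sum_distrib_left)
    then have "B\<^sup>2 / 2 * (norm v)\<^sup>2 * real (S.N k) \<le> C * (\<Sum>i\<in>{1..S.N k}. (f (X i \<omega>) \<bullet> v)\<^sup>2)"
      using N0 by (simp only: pos_le_divide_eq)
    then show "B\<^sup>2 / (2 * C) * (norm v)\<^sup>2 * real (S.N k) \<le> (\<Sum>i\<in>{1..S.N k}. (f (X i \<omega>) \<bullet> v)\<^sup>2)"
      using C(1) by (simp add: field_simps)
  qed
qed

end

section \<open>Consistency\<close>

context prob_space
begin

lemma rarely_Suc:
  assumes "rarely P"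
  shows "rarely (\<lambda>k. P (Suc k))"
  unfolding rarely_def
  by (intro allI impI eventually_compose_filterlim[OF rarelyD[OF assms] filterlim_Suc])

end

context adaptive_glm
begin

lemma rarely_irregular: "rarely (\<lambda>k \<omega>. \<not> regular \<omega>)"
  using AE_regular by (intro rarely_AE) simp

lemma gram_measurable [measurable]: "gram k \<in> borel_measurable M"
proof -
  have "(\<lambda>\<omega>. f\<^sub>\<theta> \<theta>\<^sub>0 (X i \<omega>)) \<in> borel_measurable M" if "1 \<le> i" for i
    by (rule measurable_compose[OF X_meas[OF that] borel_measurable_continuous_on_restrict[OF cont_f0]])
  moreover have "outer \<in> borel_measurable (borel :: (real ^ 'p) measure)"
    by (rule borel_measurable_continuous_onI) (auto simp: continuous_on_def intro!: tendsto_outer tendsto_ident_at)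
  ultimately show ?thesis unfolding gram_def[abs_def]
    by (intro borel_measurable_scaleR borel_measurable_sum borel_measurable_const) (auto intro: measurable_compose)
qed

lemma rarely_gram: "0 < \<epsilon> \<Longrightarrow> rarely (\<lambda>k \<omega>. \<epsilon> \<le> dist (gram k \<omega>) MM)"
  by (rule rarely_AE_tendsto[OF gram_measurable gram_conv])

lemma cont_h_f: "\<theta> \<in> \<Theta> \<Longrightarrow> continuous_on XX (\<lambda>x. h (f x \<bullet> \<theta>))"
  by (rule continuous_on_compose2[OF cont_h(1)]) (use f_range lohi(1) in \<open>auto intro!: continuous_intros f_cont\<close>)

lemma lln_rarely:
  assumes "continuous_on XX c" "0 < \<epsilon>"
  shows "rarely (\<lambda>k \<omega>. \<epsilon> \<le> \<bar>(\<Sum>i\<in>{1..S.N k}. c (X i \<omega>) * S.err i \<omega>) / real (S.N k)\<bar>)"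
proof (rule rarely_lim[OF _ S.lln[OF assms]])
  have [measurable]: "(\<lambda>\<omega>. \<Sum>i\<in>{1..S.N k}. c (X i \<omega>) * S.err i \<omega>) \<in> borel_measurable M" for k
    using S.cX_M[OF assms(1)] S.err_M by (intro borel_measurable_sum borel_measurable_times) auto
  show "{\<omega> \<in> space M. \<epsilon> \<le> \<bar>(\<Sum>i\<in>{1..S.N k}. c (X i \<omega>) * S.err i \<omega>) / real (S.N k)\<bar>} \<in> events" for k
    by measurable
qed

lemma mean_abs_err_cover:
  assumes "0 < \<delta>"
  obtains L where "0 < L"
    "\<And>k. {\<omega> \<in> space M. L \<le> (\<Sum>i\<in>{1..S.N k}. \<bar>S.err i \<omega>\<bar>) / real (S.N k)} \<in> events"
    "\<And>k. prob {\<omega> \<in> space M. L \<le> (\<Sum>i\<in>{1..S.N k}. \<bar>S.err i \<omega>\<bar>) / real (S.N k)} \<le> \<delta>"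
proof -
  obtain C where C: "0 \<le> C"
    "\<And>k L. 0 < L \<Longrightarrow> prob {\<omega> \<in> space M. L \<le> (\<Sum>i\<in>{1..S.N k}. \<bar>S.err i \<omega>\<bar>) / real (S.N k)} \<le> C / L"
    using S.mean_abs_err_bound by blast
  show ?thesis
  \<comment> \<open>Adding 1 keeps the threshold positive when C = 0.\<close>
  proof (rule that[of "C / \<delta> + 1"])
    show L: "0 < C / \<delta> + 1" using C(1) assms by (simp add: add_nonneg_pos)
    have [measurable]: "(\<lambda>\<omega>. \<Sum>i\<in>{1..S.N k}. \<bar>S.err i \<omega>\<bar>) \<in> borel_measurable M" for k
      using S.err_M by (intro borel_measurable_sum borel_measurable_abs) auto
    show "{\<omega> \<in> space M. C / \<delta> + 1 \<le> (\<Sum>i\<in>{1..S.N k}. \<bar>S.err i \<omega>\<bar>) / real (S.N k)} \<in> events" for k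
      by measurable
    have "C / (C / \<delta> + 1) \<le> \<delta>"
      using L assms C(1) by (simp add: divide_le_eq algebra_simps)
    with C(2)[OF L] show "prob {\<omega> \<in> space M. C / \<delta> + 1 \<le> (\<Sum>i\<in>{1..S.N k}. \<bar>S.err i \<omega>\<bar>) / real (S.N k)} \<le> \<delta>" for k
      by (rule order_trans)
  qed
qed

text \<open>An error of size \<epsilon> forces the noise per observation above \<open>q\<close>,
  whereas off the exceptional events it is at most q/4 at the nearest net point plus q/4 for the
  distance to it.\<close>

lemma consistency:
  assumes "0 < \<epsilon>"
  shows "rarely (\<lambda>k \<omega>. \<epsilon> \<le> norm (\<theta>mle k \<omega> - \<theta>\<^sub>0))"
proof (rule rarelyI_cover)
  fix \<delta> :: real assume "0 < \<delta>"
  obtain \<kappa> where \<kappa>: "0 < \<kappa>" "\<And>u w. u \<in> {lo..hi} \<Longrightarrow> w \<in> {lo..hi} \<Longrightarrow>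
    \<kappa> * (u - w)\<^sup>2 \<le> (h w - h u) * G w - b (h w) + b (h u)" by (rule KL_lower_bound[OF lohi(1)]) (rule that)
  obtain \<Lambda> \<epsilon>0 where \<Lambda>: "0 < \<Lambda>" "0 < \<epsilon>0" "\<And>k \<omega> v. 1 \<le> k \<Longrightarrow> \<omega> \<in> space M \<Longrightarrow> dist (gram k \<omega>) MM < \<epsilon>0 \<Longrightarrow>
      \<Lambda> * (norm v)\<^sup>2 * real (S.N k) \<le> (\<Sum>i\<in>{1..S.N k}. (f (X i \<omega>) \<bullet> v)\<^sup>2)" by (rule gram_lower) (rule that)
  obtain Lh where Lh: "0 \<le> Lh" "\<And>u w. u \<in> {lo..hi} \<Longrightarrow> w \<in> {lo..hi} \<Longrightarrow> \<bar>h u - h w\<bar> \<le> Lh * \<bar>u - w\<bar>"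
    by (rule h_Lipschitz[OF lohi(1)]) (rule that)
  obtain Bf where Bf: "0 < Bf" "\<And>x. x \<in> XX \<Longrightarrow> norm (f x) \<le> Bf" by (rule f_bound) (rule that)
  obtain L where L: "0 < L"
    "\<And>k. {\<omega> \<in> space M. L \<le> (\<Sum>i\<in>{1..S.N k}. \<bar>S.err i \<omega>\<bar>) / real (S.N k)} \<in> events"
    "\<And>k. prob {\<omega> \<in> space M. L \<le> (\<Sum>i\<in>{1..S.N k}. \<bar>S.err i \<omega>\<bar>) / real (S.N k)} \<le> \<delta>"
    by (rule mean_abs_err_cover[OF \<open>0 < \<delta>\<close>]) (rule that)
  define q where "q = \<kappa> * \<Lambda> * \<epsilon>\<^sup>2"
  have q: "0 < q" using \<kappa>(1) \<Lambda>(1) assms by (simp add: q_def)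
  define \<eta> where "\<eta> = q / (4 * L)"
  have \<eta>: "0 < \<eta>" "\<eta> * L = q / 4" using q L(1) by (auto simp: \<eta>_def)
  \<comment> \<open>The mesh of the net: within distance \<open>d\<close> the natural parameters
    differ by at most \<eta>, and \<eta> times the bound \<open>L\<close> for the mean absolute
    error is q/4.\<close>
  define d where "d = \<eta> / (Lh * Bf + 1)"
  have LB: "0 < Lh * Bf + 1" using Lh(1) Bf(1) by (simp add: add_nonneg_pos)
  have d: "0 < d" using \<eta>(1) LB by (simp add: d_def)
  obtain T where T: "T \<subseteq> \<Theta>" "finite T" "\<Theta> \<subseteq> (\<Union>t\<in>T. ball t d)"
    by (rule compactE_image[OF compact_\<Theta>, of \<Theta> "\<lambda>t. ball t d"]) (use d in auto)
  let ?c = "\<lambda>t x. h (f x \<bullet> t) - h (f x \<bullet> \<theta>\<^sub>0)"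
  let ?Q = "\<lambda>k \<omega>. \<not> regular \<omega> \<or> \<epsilon>0 \<le> dist (gram k \<omega>) MM \<or>
    (\<exists>t\<in>T. q / 4 \<le> \<bar>(\<Sum>i\<in>{1..S.N k}. ?c t (X i \<omega>) * S.err i \<omega>) / real (S.N k)\<bar>)"
  let ?B = "\<lambda>k. {\<omega> \<in> space M. L \<le> (\<Sum>i\<in>{1..S.N k}. \<bar>S.err i \<omega>\<bar>) / real (S.N k)}"
  have "rarely ?Q"
  proof (intro rarely_disj rarely_irregular rarely_gram[OF \<Lambda>(2)] rarely_bex[OF T(2)])
    fix t assume "t \<in> T"
    then have "continuous_on XX (?c t)" using T(1) \<theta>0 by (intro continuous_on_diff cont_h_f) auto
    then show "rarely (\<lambda>k \<omega>. q / 4 \<le> \<bar>(\<Sum>i\<in>{1..S.N k}. ?c t (X i \<omega>) * S.err i \<omega>) / real (S.N k)\<bar>)"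
      by (rule lln_rarely) (use q in simp)
  qed
  moreover have "\<forall>\<^sub>F k in sequentially. \<forall>\<omega>\<in>space M. \<epsilon> \<le> norm (\<theta>mle k \<omega> - \<theta>\<^sub>0) \<longrightarrow> ?Q k \<omega> \<or> \<omega> \<in> ?B k"
  proof (rule eventually_mono[OF eventually_ge_at_top[of 1]], intro ballI impI, rule ccontr)
    fix k \<omega> assume k: "1 \<le> k" and \<omega>: "\<omega> \<in> space M" and big: "\<epsilon> \<le> norm (\<theta>mle k \<omega> - \<theta>\<^sub>0)"
      and no: "\<not> (?Q k \<omega> \<or> \<omega> \<in> ?B k)"
    have reg: "regular \<omega>" and gr: "dist (gram k \<omega>) MM < \<epsilon>0"
      and ct: "\<And>t. t \<in> T \<Longrightarrow> \<bar>(\<Sum>i\<in>{1..S.N k}. ?c t (X i \<omega>) * S.err i \<omega>) / real (S.N k)\<bar> < q / 4"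
      and me: "(\<Sum>i\<in>{1..S.N k}. \<bar>S.err i \<omega>\<bar>) / real (S.N k) < L"
      using no \<omega> by (auto simp: not_le)
    have N0: "0 < real (S.N k)" using S.N_pos[OF k] by simp
    have th: "\<theta>mle k \<omega> \<in> \<Theta>" by (rule \<theta>mle_in[OF k \<omega>])
    then obtain t where t: "t \<in> T" "dist t (\<theta>mle k \<omega>) < d" using T(3) by auto
    let ?v = "\<theta>mle k \<omega> - \<theta>\<^sub>0"
    let ?A = "\<Sum>i\<in>{1..S.N k}. ?c t (X i \<omega>) * S.err i \<omega>" and ?E = "\<Sum>i\<in>{1..S.N k}. \<bar>S.err i \<omega>\<bar>"
    have "q * real (S.N k) \<le> \<kappa> * (\<Lambda> * (norm ?v)\<^sup>2 * real (S.N k))"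
    proof -
      have "\<epsilon>\<^sup>2 \<le> (norm ?v)\<^sup>2" using big assms by (intro power_mono) auto
      then have "(\<kappa> * \<Lambda>) * \<epsilon>\<^sup>2 * real (S.N k) \<le> (\<kappa> * \<Lambda>) * (norm ?v)\<^sup>2 * real (S.N k)"
        using \<kappa>(1) \<Lambda>(1) by (intro mult_right_mono mult_left_mono) auto
      then show ?thesis by (simp add: q_def mult.assoc)
    qed
    also have "\<dots> \<le> \<kappa> * (\<Sum>i\<in>{1..S.N k}. (f (X i \<omega>) \<bullet> ?v)\<^sup>2)"
      using \<kappa>(1) by (intro mult_left_mono \<Lambda>(3)[OF k \<omega> gr]) simp
    also have "\<dots> \<le> (\<Sum>i\<in>{1..S.N k}. ?c (\<theta>mle k \<omega>) (X i \<omega>) * S.err i \<omega>)"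
      by (rule KL_sum_bound[OF \<kappa>(2) k reg])
    also have "\<dots> = ?A + (\<Sum>i\<in>{1..S.N k}. (h (f (X i \<omega>) \<bullet> \<theta>mle k \<omega>) - h (f (X i \<omega>) \<bullet> t)) * S.err i \<omega>)"
      unfolding sum.distrib[symmetric] by (intro sum.cong refl) (simp add: algebra_simps)
    also have "\<dots> \<le> ?A + (\<Sum>i\<in>{1..S.N k}. \<eta> * \<bar>S.err i \<omega>\<bar>)"
    proof (intro add_left_mono sum_mono)
      fix i assume "i \<in> {1..S.N k}"
      then have x: "X i \<omega> \<in> XX" using S.X_in \<omega> by auto
      have "\<bar>h (f (X i \<omega>) \<bullet> \<theta>mle k \<omega>) - h (f (X i \<omega>) \<bullet> t)\<bar> \<le> Lh * \<bar>f (X i \<omega>) \<bullet> \<theta>mle k \<omega> - f (X i \<omega>) \<bullet> t\<bar>"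
        using T(1) t(1) by (intro Lh(2) f_range x th) auto
      also have "\<dots> \<le> Lh * (Bf * d)"
      proof (rule mult_left_mono[OF _ Lh(1)])
        have "\<bar>f (X i \<omega>) \<bullet> \<theta>mle k \<omega> - f (X i \<omega>) \<bullet> t\<bar> \<le> norm (f (X i \<omega>)) * norm (\<theta>mle k \<omega> - t)"
          unfolding inner_diff_right[symmetric] by (rule Cauchy_Schwarz_ineq2)
        also have "\<dots> \<le> Bf * d"
          using Bf(2)[OF x] Bf(1) t(2) by (intro mult_mono) (auto simp: dist_norm norm_minus_commute)
        finally show "\<bar>f (X i \<omega>) \<bullet> \<theta>mle k \<omega> - f (X i \<omega>) \<bullet> t\<bar> \<le> Bf * d" .
      qed
      also have "\<dots> \<le> (Lh * Bf + 1) * d" using d by (simp add: algebra_simps)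
      also have "\<dots> = \<eta>" using LB by (simp add: d_def)
      finally have "\<bar>h (f (X i \<omega>) \<bullet> \<theta>mle k \<omega>) - h (f (X i \<omega>) \<bullet> t)\<bar> * \<bar>S.err i \<omega>\<bar> \<le> \<eta> * \<bar>S.err i \<omega>\<bar>"
        by (rule mult_right_mono) simp
      then show "(h (f (X i \<omega>) \<bullet> \<theta>mle k \<omega>) - h (f (X i \<omega>) \<bullet> t)) * S.err i \<omega> \<le> \<eta> * \<bar>S.err i \<omega>\<bar>"
        unfolding abs_mult[symmetric] by (rule order_trans[OF abs_ge_self])
    qed
    also have "\<dots> = ?A + \<eta> * ?E" by (simp only: sum_distrib_left)
    finally have main: "q * real (S.N k) \<le> ?A + \<eta> * ?E" .
    have "\<bar>?A\<bar> < q / 4 * real (S.N k)"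
      using ct[OF t(1)] N0 by (simp only: abs_divide abs_of_pos[OF N0] pos_divide_less_eq)
    moreover have "\<eta> * ?E \<le> q / 4 * real (S.N k)"
    proof -
      have "?E \<le> L * real (S.N k)" using me N0 by (simp only: pos_divide_less_eq less_imp_le)
      then have "\<eta> * ?E \<le> \<eta> * (L * real (S.N k))" using \<eta>(1) by (intro mult_left_mono) auto
      then show ?thesis by (simp only: mult.assoc[symmetric] \<eta>(2))
    qed
    ultimately have "q * real (S.N k) < q / 4 * real (S.N k) + q / 4 * real (S.N k)"
      using main abs_ge_self[of ?A] by linarith
    then have "q * real (S.N k) < (q / 2) * real (S.N k)" by (simp add: algebra_simps)
    then have "q < q / 2" using N0 by (simp only: mult_less_cancel_right_pos)
    then show False using q by simp
  qed
  ultimately show "\<exists>Q B. rarely Q \<and> (\<forall>k. B k \<in> events \<and> prob (B k) \<le> \<delta>) \<and>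
      (\<forall>\<^sub>F k in sequentially. \<forall>\<omega>\<in>space M. \<epsilon> \<le> norm (\<theta>mle k \<omega> - \<theta>\<^sub>0) \<longrightarrow> Q k \<omega> \<or> \<omega> \<in> B k)"
    using L(2,3) by (intro exI[of _ ?Q] exI[of _ ?B] conjI allI)
qed

end

section \<open>Asymptotic normality\<close>

context adaptive_glm
begin

definition score :: "nat \<Rightarrow> 'w \<Rightarrow> real ^ 'p" where
  "score k \<omega> = (\<Sum>i\<in>{1..S.N k}. (h1 (f (X i \<omega>) \<bullet> \<theta>\<^sub>0) * S.err i \<omega>) *\<^sub>R f (X i \<omega>))"

text \<open>The centred random part of the derivative of the normalised score at the true parameter;
  the remaining part is minus \<open>gram\<close>.\<close>

definition noise :: "nat \<Rightarrow> 'w \<Rightarrow> real ^ 'p ^ 'p" where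
  "noise k \<omega> = (1 / real (S.N k)) *\<^sub>R (\<Sum>i\<in>{1..S.N k}. (h2 (f (X i \<omega>) \<bullet> \<theta>\<^sub>0) * S.err i \<omega>) *\<^sub>R outer (f (X i \<omega>)))"

lemma cont_link_f: "continuous_on I g \<Longrightarrow> continuous_on XX (\<lambda>x. g (f x \<bullet> \<theta>\<^sub>0))"
  by (rule continuous_on_compose2[of I g]) (use f0_range lohi(1) in \<open>auto intro!: continuous_intros f_cont\<close>)

lemma cont_f_nth: "continuous_on XX (\<lambda>x. f x $ a)"
  by (intro continuous_intros f_cont)

lemma norm_matrix_le_sum_abs: "norm A \<le> (\<Sum>a\<in>UNIV. \<Sum>c\<in>UNIV. \<bar>A $ a $ c\<bar>)" for A :: "real ^ 'n ^ 'm"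
proof -
  have "norm A \<le> (\<Sum>a\<in>UNIV. norm (A $ a))" unfolding norm_vec_def[of A] by (rule L2_set_le_sum) simp
  also have "\<dots> \<le> (\<Sum>a\<in>UNIV. \<Sum>c\<in>UNIV. \<bar>A $ a $ c\<bar>)" by (intro sum_mono norm_le_l1_cart)
  finally show ?thesis .
qed

lemma rarely_noise:
  assumes "0 < \<epsilon>"
  shows "rarely (\<lambda>k \<omega>. \<epsilon> \<le> norm (noise k \<omega>))"
proof -
  let ?n = "real CARD('p)"
  let ?c = "\<lambda>a c x. h2 (f x \<bullet> \<theta>\<^sub>0) * (f x $ a * f x $ c)"
  \<comment> \<open>The law of large numbers is applied to each of the p * p entries, whose absolute
    values bound the norm by their sum.\<close>
  let ?e = "\<epsilon> / (?n * ?n)"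
  have e: "0 < ?e" using assms by simp
  have entry: "noise k \<omega> $ a $ c = (\<Sum>i\<in>{1..S.N k}. ?c a c (X i \<omega>) * S.err i \<omega>) / real (S.N k)" for k \<omega> a c
    by (simp add: noise_def sum_component outer_def mult_ac)
  have ex: "rarely (\<lambda>k \<omega>. \<exists>ac\<in>UNIV. ?e \<le> \<bar>(\<Sum>i\<in>{1..S.N k}. ?c (fst ac) (snd ac) (X i \<omega>) * S.err i \<omega>) / real (S.N k)\<bar>)"
    by (intro rarely_bex lln_rarely e continuous_on_mult cont_link_f cont_h(3) cont_f_nth) simp
  show ?thesis
  proof (rule rarely_mono[OF ex], rule always_eventually, intro allI ballI impI, rule ccontr)
    fix k \<omega>
    assume big: "\<epsilon> \<le> norm (noise k \<omega>)"
      and no: "\<not> (\<exists>ac\<in>UNIV. ?e \<le> \<bar>(\<Sum>i\<in>{1..S.N k}. ?c (fst ac) (snd ac) (X i \<omega>) * S.err i \<omega>) / real (S.N k)\<bar>)"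
    have small: "\<bar>noise k \<omega> $ a $ c\<bar> < ?e" for a c
      using no[unfolded entry[symmetric]] by (simp add: not_le)
    have "norm (noise k \<omega>) \<le> (\<Sum>a\<in>UNIV. \<Sum>c\<in>UNIV. \<bar>noise k \<omega> $ a $ c\<bar>)" by (rule norm_matrix_le_sum_abs)
    also have "\<dots> < (\<Sum>a\<in>(UNIV :: 'p set). \<Sum>c\<in>(UNIV :: 'p set). ?e)" by (intro sum_strict_mono small) auto
    also have "\<dots> = \<epsilon>" by simp
    finally show False using big by simp
  qed
qed

text \<open>The expansion of the score is tested against the remainder vector itself, which avoids
  mean value points that depend on the coordinate.\<close>

lemma score_expansion:
  assumes k: "1 \<le> k" and \<omega>: "regular \<omega>" and int: "\<theta>mle k \<omega> \<in> interior \<Theta>"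
    and B: "0 < B" "\<And>x. x \<in> XX \<Longrightarrow> norm (f x) \<le> B"
    and \<eta>: "0 < \<eta>"
    and r1: "\<And>u w. u \<in> {lo..hi} \<Longrightarrow> w \<in> {lo..hi} \<Longrightarrow> \<bar>u - w\<bar> < d \<Longrightarrow>
      \<bar>h1 u - h1 w - h2 w * (u - w)\<bar> \<le> \<eta> * \<bar>u - w\<bar>"
    and r2: "\<And>u w. u \<in> {lo..hi} \<Longrightarrow> w \<in> {lo..hi} \<Longrightarrow> \<bar>u - w\<bar> < d \<Longrightarrow>
      \<bar>h1 u * (G u - G w) - h1 w * deriv G w * (u - w)\<bar> \<le> \<eta> * \<bar>u - w\<bar>"
    and close: "B * norm (\<theta>mle k \<omega> - \<theta>\<^sub>0) < d"
  shows "norm ((1 / real (S.N k)) *\<^sub>R score k \<omega> - MM *v (\<theta>mle k \<omega> - \<theta>\<^sub>0)) \<le>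
    (norm (noise k \<omega>) + dist (gram k \<omega>) MM + \<eta> * B\<^sup>2 * (1 + (\<Sum>i\<in>{1..S.N k}. \<bar>S.err i \<omega>\<bar>) / real (S.N k)))
      * norm (\<theta>mle k \<omega> - \<theta>\<^sub>0)"
proof -
  let ?N = "real (S.N k)"
  let ?v = "\<theta>mle k \<omega> - \<theta>\<^sub>0"
  let ?u = "\<lambda>i. f (X i \<omega>) \<bullet> \<theta>mle k \<omega>" and ?w = "\<lambda>i. f (X i \<omega>) \<bullet> \<theta>\<^sub>0"
  let ?e = "\<lambda>i. S.err i \<omega>"
  have \<omega>M: "\<omega> \<in> space M" using \<omega> by (simp add: regular_def)
  have N0: "0 < ?N" using S.N_pos[OF k] by simp
  define \<rho>1 where "\<rho>1 i = h1 (?u i) - h1 (?w i) - h2 (?w i) * (?u i - ?w i)" for i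
  define \<rho>2 where "\<rho>2 i = h1 (?u i) * (G (?u i) - G (?w i)) - h1 (?w i) * deriv G (?w i) * (?u i - ?w i)" for i
  have x: "X i \<omega> \<in> XX" if "i \<in> {1..S.N k}" for i using S.X_in \<omega>M that by auto
  have uw: "?u i - ?w i = f (X i \<omega>) \<bullet> ?v" for i by (simp add: inner_diff_right)
  have uwB: "\<bar>?u i - ?w i\<bar> \<le> B * norm ?v" if "i \<in> {1..S.N k}" for i
  proof -
    have "\<bar>f (X i \<omega>) \<bullet> ?v\<bar> \<le> norm (f (X i \<omega>)) * norm ?v" by (rule Cauchy_Schwarz_ineq2)
    also have "\<dots> \<le> B * norm ?v" by (intro mult_right_mono B(2) x that) simp
    finally show ?thesis unfolding uw .
  qed
  have \<rho>: "\<bar>\<rho>1 i\<bar> \<le> \<eta> * (B * norm ?v)" "\<bar>\<rho>2 i\<bar> \<le> \<eta> * (B * norm ?v)" if "i \<in> {1..S.N k}" for i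
  proof -
    note u = f_range[OF x[OF that] \<theta>mle_in[OF k \<omega>M]] and w = f0_range[OF x[OF that]]
    have cl: "\<bar>?u i - ?w i\<bar> < d" using uwB[OF that] close by linarith
    have "\<eta> * \<bar>?u i - ?w i\<bar> \<le> \<eta> * (B * norm ?v)" using \<eta> by (intro mult_left_mono uwB that) simp
    then show "\<bar>\<rho>1 i\<bar> \<le> \<eta> * (B * norm ?v)" "\<bar>\<rho>2 i\<bar> \<le> \<eta> * (B * norm ?v)"
      unfolding \<rho>1_def \<rho>2_def using r1[OF u w cl] r2[OF u w cl] by linarith+
  qed
  \<comment> \<open>The vector to be bounded also serves as direction in the score equation: the
    inner products then produce its squared norm, and one factor is cancelled at the end.\<close>
  define R where "R = (1 / ?N) *\<^sub>R score k \<omega> - MM *v ?v"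
  define y where "y i = f (X i \<omega>) \<bullet> R" for i
  have yB: "\<bar>y i\<bar> \<le> B * norm R" if "i \<in> {1..S.N k}" for i
  proof -
    have "\<bar>y i\<bar> \<le> norm (f (X i \<omega>)) * norm R" unfolding y_def by (rule Cauchy_Schwarz_ineq2)
    also have "\<dots> \<le> B * norm R" by (intro mult_right_mono B(2) x that) simp
    finally show ?thesis .
  qed
  have sc: "R \<bullet> score k \<omega> = (\<Sum>i\<in>{1..S.N k}. h1 (?w i) * ?e i * y i)"
    by (simp add: score_def inner_sum_right y_def inner_commute[of R])
  have no: "R \<bullet> (noise k \<omega> *v ?v) * ?N = (\<Sum>i\<in>{1..S.N k}. h2 (?w i) * ?e i * (?u i - ?w i) * y i)"
    unfolding uw using N0
    by (simp add: noise_def scaleR_matrix_vector_assoc[symmetric] sum_matrix_vector_mult outer_mult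
        inner_sum_right y_def inner_commute[of R] mult.assoc)
  have gr: "R \<bullet> (gram k \<omega> *v ?v) * ?N = (\<Sum>i\<in>{1..S.N k}. h1 (?w i) * deriv G (?w i) * (?u i - ?w i) * y i)"
  proof -
    have "R \<bullet> (gram k \<omega> *v ?v) * ?N = (\<Sum>i\<in>{1..S.N k}. (f\<^sub>\<theta> \<theta>\<^sub>0 (X i \<omega>) \<bullet> ?v) * (f\<^sub>\<theta> \<theta>\<^sub>0 (X i \<omega>) \<bullet> R))"
      unfolding inner_gram using N0 by simp
    also have "\<dots> = (\<Sum>i\<in>{1..S.N k}. h1 (?w i) * deriv G (?w i) * (?u i - ?w i) * y i)"
    proof (rule sum.cong[OF refl])
      fix i assume i: "i \<in> {1..S.N k}"
      have "?w i \<in> I" using f0_range[OF x[OF i]] lohi(1) by auto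
      then have "h1 (?w i) * deriv G (?w i) = (glm_phi J b G (?w i))\<^sup>2" by (simp only: phi_sq)
      then show "(f\<^sub>\<theta> \<theta>\<^sub>0 (X i \<omega>) \<bullet> ?v) * (f\<^sub>\<theta> \<theta>\<^sub>0 (X i \<omega>) \<bullet> R) = h1 (?w i) * deriv G (?w i) * (?u i - ?w i) * y i"
        unfolding f_theta0[OF x[OF i]] uw y_def by (simp add: power2_eq_square mult_ac)
    qed
    finally show ?thesis .
  qed
  have "0 = (\<Sum>i\<in>{1..S.N k}. h1 (?u i) * (Y i \<omega> - G (?u i)) * y i)"
    unfolding y_def by (rule score_equation[OF k \<omega> int, symmetric])
  \<comment> \<open>Linearisation at the true predictor: the three main terms sum to the score, the
    noise matrix and the Gram matrix tested against R, and the \<rho> terms are the uniform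
    remainders.\<close>
  also have "\<dots> = (\<Sum>i\<in>{1..S.N k}. (h1 (?w i) * ?e i * y i + h2 (?w i) * ?e i * (?u i - ?w i) * y i
      - h1 (?w i) * deriv G (?w i) * (?u i - ?w i) * y i) + (\<rho>1 i * ?e i - \<rho>2 i) * y i)"
  proof (rule sum.cong[OF refl])
    fix i assume "i \<in> {1..S.N k}"
    then have Yi: "Y i \<omega> = ?e i + G (?w i)" using err_eq[of i \<omega>] \<omega>M by simp
    show "h1 (?u i) * (Y i \<omega> - G (?u i)) * y i = (h1 (?w i) * ?e i * y i + h2 (?w i) * ?e i * (?u i - ?w i) * y i
      - h1 (?w i) * deriv G (?w i) * (?u i - ?w i) * y i) + (\<rho>1 i * ?e i - \<rho>2 i) * y i"
      unfolding Yi \<rho>1_def \<rho>2_def by (simp add: algebra_simps)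
  qed
  also have "\<dots> = R \<bullet> score k \<omega> + R \<bullet> (noise k \<omega> *v ?v) * ?N - R \<bullet> (gram k \<omega> *v ?v) * ?N
      + (\<Sum>i\<in>{1..S.N k}. (\<rho>1 i * ?e i - \<rho>2 i) * y i)"
    unfolding sc no gr by (simp only: sum.distrib sum_subtractf)
  finally have zero: "R \<bullet> score k \<omega> + R \<bullet> (noise k \<omega> *v ?v) * ?N - R \<bullet> (gram k \<omega> *v ?v) * ?N
      = - (\<Sum>i\<in>{1..S.N k}. (\<rho>1 i * ?e i - \<rho>2 i) * y i)" by linarith
  let ?m = "(\<Sum>i\<in>{1..S.N k}. \<bar>?e i\<bar>) / ?N"
  have rem: "\<bar>\<Sum>i\<in>{1..S.N k}. (\<rho>1 i * ?e i - \<rho>2 i) * y i\<bar> \<le> \<eta> * B\<^sup>2 * (1 + ?m) * norm ?v * norm R * ?N"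
  proof -
    have "\<bar>\<Sum>i\<in>{1..S.N k}. (\<rho>1 i * ?e i - \<rho>2 i) * y i\<bar> \<le> (\<Sum>i\<in>{1..S.N k}. \<bar>(\<rho>1 i * ?e i - \<rho>2 i) * y i\<bar>)"
      by (rule sum_abs)
    also have "\<dots> \<le> (\<Sum>i\<in>{1..S.N k}. (\<eta> * (B * norm ?v) * (1 + \<bar>?e i\<bar>)) * (B * norm R))"
    proof (rule sum_mono)
      fix i assume i: "i \<in> {1..S.N k}"
      have "\<bar>\<rho>1 i * ?e i - \<rho>2 i\<bar> \<le> \<bar>\<rho>1 i\<bar> * \<bar>?e i\<bar> + \<bar>\<rho>2 i\<bar>"
        unfolding abs_mult[symmetric] by (rule abs_triangle_ineq4)
      also have "\<dots> \<le> \<eta> * (B * norm ?v) * \<bar>?e i\<bar> + \<eta> * (B * norm ?v)"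
        by (intro add_mono mult_right_mono \<rho> i) simp
      also have "\<dots> = \<eta> * (B * norm ?v) * (1 + \<bar>?e i\<bar>)" by (simp add: algebra_simps)
      finally have "\<bar>\<rho>1 i * ?e i - \<rho>2 i\<bar> * \<bar>y i\<bar> \<le> (\<eta> * (B * norm ?v) * (1 + \<bar>?e i\<bar>)) * (B * norm R)"
        using \<eta> B(1) by (intro mult_mono yB i) auto
      then show "\<bar>(\<rho>1 i * ?e i - \<rho>2 i) * y i\<bar> \<le> (\<eta> * (B * norm ?v) * (1 + \<bar>?e i\<bar>)) * (B * norm R)"
        by (simp only: abs_mult)
    qed
    also have "\<dots> = (\<eta> * B\<^sup>2 * norm ?v * norm R) * (\<Sum>i\<in>{1..S.N k}. 1 + \<bar>?e i\<bar>)"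
      unfolding sum_distrib_left by (intro sum.cong refl) (simp add: power2_eq_square mult_ac)
    also have "(\<Sum>i\<in>{1..S.N k}. 1 + \<bar>?e i\<bar>) = (1 + ?m) * ?N"
      using N0 by (simp add: sum.distrib distrib_right)
    finally show ?thesis by (simp only: mult_ac)
  qed
  have "(norm R)\<^sup>2 * ?N = R \<bullet> score k \<omega> - R \<bullet> (MM *v ?v) * ?N"
  proof -
    have "(norm R)\<^sup>2 = R \<bullet> ((1 / ?N) *\<^sub>R score k \<omega> - MM *v ?v)"
      by (simp only: power2_norm_eq_inner R_def[symmetric])
    also have "\<dots> = R \<bullet> score k \<omega> / ?N - R \<bullet> (MM *v ?v)" by (simp add: inner_diff_right)
    finally show ?thesis using N0 by (simp add: left_diff_distrib)
  qed
  also have "\<dots> = - (R \<bullet> (noise k \<omega> *v ?v) * ?N) + R \<bullet> ((gram k \<omega> - MM) *v ?v) * ?N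
      - (\<Sum>i\<in>{1..S.N k}. (\<rho>1 i * ?e i - \<rho>2 i) * y i)"
    using zero by (simp add: matrix_vector_mult_diff_rdistrib inner_diff_right left_diff_distrib)
  also have "\<dots> \<le> norm R * (norm (noise k \<omega>) * norm ?v) * ?N + norm R * (dist (gram k \<omega>) MM * norm ?v) * ?N
      + \<eta> * B\<^sup>2 * (1 + ?m) * norm ?v * norm R * ?N"
  proof -
    have "\<bar>R \<bullet> (A *v ?v)\<bar> \<le> norm R * (norm A * norm ?v)" for A :: "real ^ 'p ^ 'p"
      by (rule order_trans[OF Cauchy_Schwarz_ineq2 mult_left_mono[OF norm_matrix_vector_mult_le norm_ge_zero]])
    then have a: "\<bar>R \<bullet> (A *v ?v)\<bar> * ?N \<le> norm R * (norm A * norm ?v) * ?N" for A :: "real ^ 'p ^ 'p"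
      by (rule mult_right_mono) simp
    have b: "z * ?N \<le> \<bar>z\<bar> * ?N" "- (z * ?N) \<le> \<bar>z\<bar> * ?N" for z
      using mult_right_mono[OF abs_ge_self[of z], of ?N] mult_right_mono[OF abs_ge_minus_self[of z], of ?N] by simp_all
    have "- (R \<bullet> (noise k \<omega> *v ?v) * ?N) \<le> norm R * (norm (noise k \<omega>) * norm ?v) * ?N"
      by (rule order_trans[OF b(2) a])
    moreover have "R \<bullet> ((gram k \<omega> - MM) *v ?v) * ?N \<le> norm R * (dist (gram k \<omega>) MM * norm ?v) * ?N"
      unfolding dist_norm by (rule order_trans[OF b(1) a])
    ultimately show ?thesis using rem by linarith
  qed
  also have "\<dots> = norm R * (((norm (noise k \<omega>) + dist (gram k \<omega>) MM + \<eta> * B\<^sup>2 * (1 + ?m)) * norm ?v)) * ?N"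
    by (simp add: algebra_simps)
  finally have "norm R * norm R \<le> norm R * ((norm (noise k \<omega>) + dist (gram k \<omega>) MM + \<eta> * B\<^sup>2 * (1 + ?m)) * norm ?v)"
    using N0 by (simp only: power2_eq_square mult_le_cancel_right_pos)
  moreover have "0 \<le> (norm (noise k \<omega>) + dist (gram k \<omega>) MM + \<eta> * B\<^sup>2 * (1 + ?m)) * norm ?v"
    using \<eta> by (intro mult_nonneg_nonneg add_nonneg_nonneg divide_nonneg_nonneg sum_nonneg) auto
  ultimately have "norm R \<le> (norm (noise k \<omega>) + dist (gram k \<omega>) MM + \<eta> * B\<^sup>2 * (1 + ?m)) * norm ?v"
    by (cases "norm R = 0") (simp_all only: mult_le_cancel_left_pos zero_less_norm_iff norm_eq_zero, auto)
  then show ?thesis by (simp only: R_def)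
qed

text \<open>The bound is relative to the estimation error, since consistency gives no rate;
  invertibility of \<open>MM\<close> later converts it into a bound by the score.\<close>

lemma score_remainder:
  assumes "0 < \<epsilon>"
  shows "rarely (\<lambda>k \<omega>. \<epsilon> * norm (\<theta>mle k \<omega> - \<theta>\<^sub>0) <
    norm ((1 / real (S.N k)) *\<^sub>R score k \<omega> - MM *v (\<theta>mle k \<omega> - \<theta>\<^sub>0)))"
proof (rule rarelyI_cover)
  fix \<delta> :: real assume "0 < \<delta>"
  obtain B where B: "0 < B" "\<And>x. x \<in> XX \<Longrightarrow> norm (f x) \<le> B" by (rule f_bound) (rule that)
  obtain L where L: "0 < L"
    "\<And>k. {\<omega> \<in> space M. L \<le> (\<Sum>i\<in>{1..S.N k}. \<bar>S.err i \<omega>\<bar>) / real (S.N k)} \<in> events"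
    "\<And>k. prob {\<omega> \<in> space M. L \<le> (\<Sum>i\<in>{1..S.N k}. \<bar>S.err i \<omega>\<bar>) / real (S.N k)} \<le> \<delta>"
    by (rule mean_abs_err_cover[OF \<open>0 < \<delta>\<close>]) (rule that)
  \<comment> \<open>Makes the Taylor part of \<open>score_expansion\<close> at most \<epsilon>/3
    when the mean absolute error is below \<open>L\<close>; noise and Gram error take the other two
    thirds.\<close>
  define \<eta> where "\<eta> = \<epsilon> / (3 * (B\<^sup>2 * (1 + L)))"
  have BL: "0 < B\<^sup>2 * (1 + L)" using B(1) L(1) by simp
  have \<eta>: "0 < \<eta>" using assms BL by (simp add: \<eta>_def)
  have \<eta>e: "\<eta> * B\<^sup>2 * (1 + L) = \<epsilon> / 3"
  proof -
    have "\<eta> * (B\<^sup>2 * (1 + L)) = \<epsilon> / 3" using BL unfolding \<eta>_def by (simp only: times_divide_eq_left mult_divide_mult_cancel_right)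
    then show ?thesis by (simp only: mult.assoc)
  qed
  obtain d where d: "0 < d"
    "\<And>u w. u \<in> {lo..hi} \<Longrightarrow> w \<in> {lo..hi} \<Longrightarrow> \<bar>u - w\<bar> < d \<Longrightarrow>
      \<bar>h1 u - h1 w - h2 w * (u - w)\<bar> \<le> \<eta> * \<bar>u - w\<bar>"
    "\<And>u w. u \<in> {lo..hi} \<Longrightarrow> w \<in> {lo..hi} \<Longrightarrow> \<bar>u - w\<bar> < d \<Longrightarrow>
      \<bar>h1 u * (G u - G w) - h1 w * deriv G w * (u - w)\<bar> \<le> \<eta> * \<bar>u - w\<bar>"
    by (rule score_remainders[OF lohi(1) \<eta>]) (rule that)
  obtain r where r: "0 < r" "ball \<theta>\<^sub>0 r \<subseteq> interior \<Theta>"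
    using \<theta>0_int open_contains_ball[of "interior \<Theta>"] open_interior by blast
  \<comment> \<open>The first bound puts the maximiser in the interior, where the score equation
    holds; the second makes all predictors close enough to linearise.\<close>
  define \<rho> where "\<rho> = min r (d / B)"
  have \<rho>: "0 < \<rho>" using r(1) d(1) B(1) by (simp add: \<rho>_def)
  let ?Q = "\<lambda>k \<omega>. \<not> regular \<omega> \<or> \<rho> \<le> norm (\<theta>mle k \<omega> - \<theta>\<^sub>0) \<or> \<epsilon> / 3 \<le> norm (noise k \<omega>) \<or> \<epsilon> / 3 \<le> dist (gram k \<omega>) MM"
  let ?B = "\<lambda>k. {\<omega> \<in> space M. L \<le> (\<Sum>i\<in>{1..S.N k}. \<bar>S.err i \<omega>\<bar>) / real (S.N k)}"
  have "rarely ?Q"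
    using assms by (intro rarely_disj rarely_irregular consistency[OF \<rho>] rarely_noise rarely_gram) auto
  moreover have "\<forall>\<^sub>F k in sequentially. \<forall>\<omega>\<in>space M. \<epsilon> * norm (\<theta>mle k \<omega> - \<theta>\<^sub>0) <
    norm ((1 / real (S.N k)) *\<^sub>R score k \<omega> - MM *v (\<theta>mle k \<omega> - \<theta>\<^sub>0)) \<longrightarrow> ?Q k \<omega> \<or> \<omega> \<in> ?B k"
  proof (rule eventually_mono[OF eventually_ge_at_top[of 1]], intro ballI impI, rule ccontr)
    fix k \<omega> assume k: "1 \<le> k" and \<omega>: "\<omega> \<in> space M"
      and big: "\<epsilon> * norm (\<theta>mle k \<omega> - \<theta>\<^sub>0) < norm ((1 / real (S.N k)) *\<^sub>R score k \<omega> - MM *v (\<theta>mle k \<omega> - \<theta>\<^sub>0))"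
      and no: "\<not> (?Q k \<omega> \<or> \<omega> \<in> ?B k)"
    let ?m = "(\<Sum>i\<in>{1..S.N k}. \<bar>S.err i \<omega>\<bar>) / real (S.N k)"
    have reg: "regular \<omega>" and cl: "norm (\<theta>mle k \<omega> - \<theta>\<^sub>0) < \<rho>" and ns: "norm (noise k \<omega>) < \<epsilon> / 3"
      and gr: "dist (gram k \<omega>) MM < \<epsilon> / 3" and me: "?m < L"
      using no \<omega> by (auto simp: not_le)
    have "\<theta>mle k \<omega> \<in> ball \<theta>\<^sub>0 r" using cl by (simp add: \<rho>_def dist_norm norm_minus_commute)
    then have int: "\<theta>mle k \<omega> \<in> interior \<Theta>" using r(2) by blast
    have "norm (\<theta>mle k \<omega> - \<theta>\<^sub>0) < d / B" using cl by (simp add: \<rho>_def)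
    then have close: "B * norm (\<theta>mle k \<omega> - \<theta>\<^sub>0) < d" using B(1) by (simp add: pos_less_divide_eq mult.commute)
    have "norm ((1 / real (S.N k)) *\<^sub>R score k \<omega> - MM *v (\<theta>mle k \<omega> - \<theta>\<^sub>0))
        \<le> (norm (noise k \<omega>) + dist (gram k \<omega>) MM + \<eta> * B\<^sup>2 * (1 + ?m)) * norm (\<theta>mle k \<omega> - \<theta>\<^sub>0)"
      by (rule score_expansion[OF k reg int B \<eta> d(2,3) close])
    also have "\<dots> \<le> \<epsilon> * norm (\<theta>mle k \<omega> - \<theta>\<^sub>0)"
    proof (rule mult_right_mono)
      have "\<eta> * B\<^sup>2 * (1 + ?m) \<le> \<eta> * B\<^sup>2 * (1 + L)" using \<eta> me by (intro mult_left_mono) auto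
      then show "norm (noise k \<omega>) + dist (gram k \<omega>) MM + \<eta> * B\<^sup>2 * (1 + ?m) \<le> \<epsilon>"
        using ns gr \<eta>e by linarith
    qed simp
    finally show False using big by simp
  qed
  ultimately show "\<exists>Q B. rarely Q \<and> (\<forall>k. B k \<in> events \<and> prob (B k) \<le> \<delta>) \<and>
      (\<forall>\<^sub>F k in sequentially. \<forall>\<omega>\<in>space M. \<epsilon> * norm (\<theta>mle k \<omega> - \<theta>\<^sub>0) <
        norm ((1 / real (S.N k)) *\<^sub>R score k \<omega> - MM *v (\<theta>mle k \<omega> - \<theta>\<^sub>0)) \<longrightarrow> Q k \<omega> \<or> \<omega> \<in> B k)"
    using L(2,3) by (intro exI[of _ ?Q] exI[of _ ?B] conjI allI)
qed

end

lemma cmod_iexp_diff_le: "cmod (iexp x - iexp y) \<le> min 2 \<bar>x - y\<bar>"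
proof -
  have "iexp x - iexp y = iexp y * (iexp (x - y) - 1)"
    by (simp add: right_diff_distrib exp_add[symmetric] algebra_simps)
  then have eq: "cmod (iexp x - iexp y) = cmod (iexp (x - y) - 1)" by (simp add: norm_mult)
  have "cmod (iexp (x - y) - 1) \<le> \<bar>x - y\<bar>"
    using iexp_approx1[of "x - y" 0] by simp
  moreover have "cmod (iexp x - iexp y) \<le> 2"
    using norm_triangle_ineq4[of "iexp x" "iexp y"] by simp
  ultimately show ?thesis using eq by simp
qed

section \<open>Transfer of the limit law from the score to the estimator\<close>

context adaptive_glm
begin

definition nscore :: "nat \<Rightarrow> 'w \<Rightarrow> real ^ 'p" where
  "nscore k \<omega> = (1 / sqrt (real (S.N k))) *\<^sub>R score k \<omega>"

lemma score_measurable [measurable]: "score k \<in> borel_measurable M"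
proof -
  have "(\<lambda>\<omega>. f (X i \<omega>)) \<in> borel_measurable M" if "1 \<le> i" for i
    by (rule measurable_compose[OF X_meas[OF that] borel_measurable_continuous_on_restrict[OF f_cont]])
  then show ?thesis unfolding score_def[abs_def]
    by (intro borel_measurable_sum borel_measurable_scaleR borel_measurable_times S.cX_M[OF cont_link_f[OF cont_h(2)]] S.err_M) auto
qed

lemma nscore_measurable [measurable]: "nscore k \<in> borel_measurable M"
  unfolding nscore_def[abs_def] by measurable

text \<open>\<open>char_conv\<close> is applied to the coefficient h1 * (f \<bullet> w). By
  \<open>phi_sq'\<close> the normalised conditional variance is the quadratic form of
  \<open>gram\<close> at w, so its almost sure limit is \<open>gram_conv\<close>.\<close>

lemma score_char:
  "(\<lambda>k. expectation (\<lambda>\<omega>. iexp (w \<bullet> nscore k \<omega>))) \<longlonglongrightarrow> complex_of_real (exp (- (w \<bullet> (MM *v w)) / 2))"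
proof -
  let ?c = "\<lambda>x. h1 (f x \<bullet> \<theta>\<^sub>0) * (f x \<bullet> w)"
  let ?s = "\<lambda>k. 1 / sqrt (real (S.N k))"
  have c: "continuous_on XX ?c" by (intro continuous_on_mult cont_link_f cont_h(2) continuous_intros f_cont)
  have "(\<lambda>k. expectation (\<lambda>\<omega>. iexp (?s k * (\<Sum>i\<in>{1..S.N k}. ?c (X i \<omega>) * S.err i \<omega>)))) \<longlonglongrightarrow> complex_of_real (exp (- (w \<bullet> (MM *v w)) / 2))"
  proof (rule S.char_conv[OF c])
    show "0 \<le> ?s k" for k by simp
    show "?s k \<le> 1" for k by (cases "S.N k = 0") auto
    show "real (S.N k) * (?s k)\<^sup>2 \<le> 1" for k by (cases "S.N k = 0") (auto simp: power_divide)
    have "(\<lambda>k. sqrt (1 / real (S.N k))) \<longlonglongrightarrow> sqrt 0" by (intro tendsto_real_sqrt S.N_inverse_tendsto_0)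
    moreover have "sqrt (1 / real (S.N k)) = real (S.N k) * (?s k) ^ 3" for k
    proof (cases "S.N k = 0")
      case False
      then have "real (S.N k) * (?s k)\<^sup>2 = 1" by (simp add: power_divide)
      then have "real (S.N k) * (?s k) ^ 3 = ?s k" by (simp add: power3_eq_cube power2_eq_square)
      then show ?thesis by (simp add: real_sqrt_divide)
    qed simp
    ultimately show "(\<lambda>k. real (S.N k) * (?s k) ^ 3) \<longlonglongrightarrow> 0" by simp
    show "AE \<omega> in M. (\<lambda>k. (?s k)\<^sup>2 * (\<Sum>i\<in>{1..S.N k}. (?c (X i \<omega>))\<^sup>2 * S.vr (X i \<omega>))) \<longlonglongrightarrow> w \<bullet> (MM *v w)"
      using gram_conv AE_space
    proof eventually_elim
      case (elim \<omega>)
      have "(\<lambda>k. w \<bullet> (gram k \<omega> *v w)) \<longlonglongrightarrow> w \<bullet> (MM *v w)"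
      proof (intro tendsto_inner tendsto_const)
        have "bounded_linear (\<lambda>A :: real ^ 'p ^ 'p. A *v w)"
          unfolding linear_conv_bounded_linear[symmetric]
          by (rule linearI) (simp_all add: matrix_vector_mult_add_rdistrib scaleR_matrix_vector_assoc)
        from bounded_linear.tendsto[OF this elim(1)] show "(\<lambda>k. gram k \<omega> *v w) \<longlonglongrightarrow> MM *v w" .
      qed
      moreover have "w \<bullet> (gram k \<omega> *v w) = (?s k)\<^sup>2 * (\<Sum>i\<in>{1..S.N k}. (?c (X i \<omega>))\<^sup>2 * S.vr (X i \<omega>))" for k
      proof -
        have "(\<Sum>i\<in>{1..S.N k}. (f\<^sub>\<theta> \<theta>\<^sub>0 (X i \<omega>) \<bullet> w) * (f\<^sub>\<theta> \<theta>\<^sub>0 (X i \<omega>) \<bullet> w)) = (\<Sum>i\<in>{1..S.N k}. (?c (X i \<omega>))\<^sup>2 * S.vr (X i \<omega>))"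
        proof (rule sum.cong[OF refl])
          fix i assume "i \<in> {1..S.N k}"
          then have x: "X i \<omega> \<in> XX" using S.X_in elim(2) by auto
          have "f (X i \<omega>) \<bullet> \<theta>\<^sub>0 \<in> I" using f0_range[OF x] lohi(1) by auto
          from phi_sq'[OF this]
          show "(f\<^sub>\<theta> \<theta>\<^sub>0 (X i \<omega>) \<bullet> w) * (f\<^sub>\<theta> \<theta>\<^sub>0 (X i \<omega>) \<bullet> w) = (?c (X i \<omega>))\<^sup>2 * S.vr (X i \<omega>)"
            unfolding f_theta0[OF x] S.vr_def power2_eq_square[symmetric] power_mult_distrib by (simp only: mult_ac)
        qed
        then show ?thesis unfolding inner_gram by (simp add: power_divide)
      qed
      ultimately show ?case by simp
    qed
  qed
  moreover have "?s k * (\<Sum>i\<in>{1..S.N k}. ?c (X i \<omega>) * S.err i \<omega>) = w \<bullet> nscore k \<omega>" for k \<omega>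
  proof -
    have "w \<bullet> score k \<omega> = (\<Sum>i\<in>{1..S.N k}. ?c (X i \<omega>) * S.err i \<omega>)"
      by (simp add: score_def inner_sum_right inner_commute[of w] mult_ac)
    then show ?thesis by (simp add: nscore_def)
  qed
  ultimately show ?thesis by (simp only:)
qed

text \<open>Tightness of the normalised score, stated as the integral needed in the transfer. Under
  the Gaussian limit the truncated linear function is small for small \<open>a\<close>, and weak
  convergence carries this over to large k.\<close>

lemma score_tails:
  assumes "0 < \<tau>"
  obtains a where "0 < a" "\<forall>\<^sub>F k in sequentially. expectation (\<lambda>\<omega>. min 2 (a * norm (nscore k \<omega>))) < \<tau>"
proof -
  obtain R where R: "det R \<noteq> 0" "MM = transpose R ** R" and quad: "\<And>w. w \<bullet> (MM *v w) = (norm (R *v w))\<^sup>2"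
    by (rule M_sat_factor) (rule that)
  interpret g: prob_space "gauss :: (real ^ 'p) measure" by (rule prob_space_gauss)
  let ?\<nu> = "distr gauss borel ((*v) (transpose R))"
  have \<nu>: "prob_space ?\<nu>" by (rule g.prob_space_distr) measurable
  have law: "(\<integral>x. iexp (w \<bullet> x) \<partial>?\<nu>) = complex_of_real (exp (- (w \<bullet> (MM *v w)) / 2))" for w
  proof -
    have "(\<integral>x. iexp (w \<bullet> x) \<partial>?\<nu>) = (\<integral>y. iexp (w \<bullet> (transpose R *v y)) \<partial>gauss)"
      by (rule integral_distr) measurable
    also have "\<dots> = (\<integral>y. iexp ((R *v w) \<bullet> y) \<partial>gauss)"
      by (simp only: inner_commute[of w] inner_transpose_matrix) (simp only: inner_commute)
    finally show ?thesis unfolding gauss_char quad .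
  qed
  define m where "m n x = min 2 ((1 / real (Suc n)) * norm x)" for n and x :: "real ^ 'p"
  have mc: "continuous_on UNIV (m n)" for n unfolding m_def by (intro continuous_intros)
  have [measurable]: "m n \<in> borel_measurable borel" for n using mc by (rule borel_measurable_continuous_onI)
  have m02: "0 \<le> m n x" "m n x \<le> 2" for n x by (auto simp: m_def)
  have "(\<lambda>n. \<integral>x. m n x \<partial>?\<nu>) \<longlonglongrightarrow> (\<integral>x. 0 \<partial>?\<nu>)"
  proof (rule integral_dominated_convergence[where w="\<lambda>_. 2"])
    show "AE x in ?\<nu>. (\<lambda>n. m n x) \<longlonglongrightarrow> 0"
    proof (rule AE_I2)
      fix x :: "real ^ 'p"
      have "(\<lambda>n. min 2 ((1 / real (Suc n)) * norm x)) \<longlonglongrightarrow> min 2 (0 * norm x)"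
        by (intro tendsto_min tendsto_mult tendsto_const LIMSEQ_Suc[OF lim_1_over_n])
      then show "(\<lambda>n. m n x) \<longlonglongrightarrow> 0" by (simp add: m_def)
    qed
    show "integrable ?\<nu> (\<lambda>_. 2 :: real)"
      by (rule finite_measure.integrable_const[OF prob_space.axioms(1)[OF \<nu>]])
  qed (use m02 in auto)
  then have "\<forall>\<^sub>F n in sequentially. (\<integral>x. m n x \<partial>?\<nu>) < \<tau>"
    using order_tendstoD(2)[of _ 0 sequentially \<tau>] assms by simp
  then obtain n where n: "(\<integral>x. m n x \<partial>?\<nu>) < \<tau>" by (auto simp: eventually_sequentially)
  have "(\<lambda>k. \<integral>x. m n x \<partial>distr M borel (nscore k)) \<longlonglongrightarrow> (\<integral>x. m n x \<partial>?\<nu>)"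
  proof (rule char_conv_imp_weak_conv)
    show "prob_space (distr M borel (nscore k))" for k by (rule prob_space_distr) measurable
    show "prob_space ?\<nu>" by (rule \<nu>)
    show "(\<lambda>k. CLINT x|distr M borel (nscore k). iexp (w \<bullet> x)) \<longlonglongrightarrow> (CLINT x|?\<nu>. iexp (w \<bullet> x))" for w
    proof -
      have "(CLINT x|distr M borel (nscore k). iexp (w \<bullet> x)) = expectation (\<lambda>\<omega>. iexp (w \<bullet> nscore k \<omega>))" for k
        by (rule integral_distr) measurable
      then show ?thesis unfolding law using score_char by simp
    qed
    show "bounded (range (m n))" unfolding bounded_iff using m02 by (intro exI[of _ 2]) auto
  qed (use mc in auto)
  then have "\<forall>\<^sub>F k in sequentially. (\<integral>x. m n x \<partial>distr M borel (nscore k)) < \<tau>"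
    using n by (rule order_tendstoD(2))
  moreover have "(\<integral>x. m n x \<partial>distr M borel (nscore k)) = expectation (\<lambda>\<omega>. m n (nscore k \<omega>))" for k
    by (rule integral_distr) measurable
  ultimately have "\<forall>\<^sub>F k in sequentially. expectation (\<lambda>\<omega>. m n (nscore k \<omega>)) < \<tau>" by simp
  then show ?thesis using that[of "1 / real (Suc n)"] by (simp only: m_def) simp
qed

definition deviation :: "nat \<Rightarrow> 'w \<Rightarrow> real ^ 'p" where
  "deviation k \<omega> = sqrt (real (S.N k)) *\<^sub>R (\<theta>mle k \<omega> - \<theta>\<^sub>0)"

lemma deviation_measurable: "1 \<le> k \<Longrightarrow> deviation k \<in> borel_measurable M"
  unfolding deviation_def[abs_def] by (intro borel_measurable_scaleR borel_measurable_diff \<theta>mle_meas) auto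

text \<open>Indices are shifted because nothing is assumed about \<open>\<theta>mle 0\<close>.\<close>

lemma deviation_char:
  "(\<lambda>k. expectation (\<lambda>\<omega>. iexp ((MM *v w) \<bullet> deviation (Suc k) \<omega>))) \<longlonglongrightarrow> complex_of_real (exp (- (w \<bullet> (MM *v w)) / 2))"
proof -
  obtain R where R: "det R \<noteq> 0" "MM = transpose R ** R" and quad: "\<And>w. w \<bullet> (MM *v w) = (norm (R *v w))\<^sup>2"
    by (rule M_sat_factor) (rule that)
  have sym: "(MM *v w) \<bullet> z = w \<bullet> (MM *v z)" for w z
  proof -
    have "(MM *v w) \<bullet> z = (R *v w) \<bullet> (R *v z)"
      unfolding R(2) matrix_vector_mul_assoc[symmetric] by (rule inner_transpose_matrix)
    also have "\<dots> = (MM *v z) \<bullet> w"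
      unfolding R(2) matrix_vector_mul_assoc[symmetric] inner_transpose_matrix by (rule inner_commute)
    finally show ?thesis by (simp only: inner_commute)
  qed
  obtain \<Lambda> \<epsilon>0 where \<epsilon>0: "0 < \<epsilon>0" "\<And>v. \<epsilon>0 * norm v \<le> norm (MM *v v)" by (rule gram_lower) (rule that)
  define D where "D k \<omega> = cmod (iexp ((MM *v w) \<bullet> deviation (Suc k) \<omega>) - iexp (w \<bullet> nscore (Suc k) \<omega>))" for k \<omega>
  have Dm: "D k \<in> borel_measurable M" for k
    unfolding D_def[abs_def] using deviation_measurable[of "Suc k"] by simp
  have D02: "0 \<le> D k \<omega>" "D k \<omega> \<le> 2" for k \<omega>
    unfolding D_def using cmod_iexp_diff_le[of "(MM *v w) \<bullet> deviation (Suc k) \<omega>" "w \<bullet> nscore (Suc k) \<omega>"] by auto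
  have "(\<lambda>k. expectation (D k)) \<longlonglongrightarrow> 0"
  proof (rule LIMSEQ_I)
    fix r :: real assume "0 < r"
    define \<tau> where "\<tau> = r / 4"
    have \<tau>: "0 < \<tau>" using \<open>0 < r\<close> by (simp add: \<tau>_def)
    obtain a where a: "0 < a" "\<forall>\<^sub>F k in sequentially. expectation (\<lambda>\<omega>. min 2 (a * norm (nscore k \<omega>))) < \<tau>"
      by (rule score_tails[OF \<tau>]) (rule that)
    \<comment> \<open>The first bound lets the remainder be absorbed by the lower bound for
      \<open>MM\<close>; the second makes the resulting difference of exponents at most
      \<open>a\<close> times the norm of the score.\<close>
    define \<epsilon> where "\<epsilon> = min (\<epsilon>0 / 2) (a * \<epsilon>0 / (2 * (norm w + 1)))"
    have nw: "0 < norm w + 1" by (simp add: add_nonneg_pos)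
    have \<epsilon>: "0 < \<epsilon>" using \<epsilon>0(1) a(1) nw by (simp add: \<epsilon>_def)
    have \<epsilon>a: "norm w * \<epsilon> * (2 / \<epsilon>0) \<le> a"
    proof -
      have "\<epsilon> \<le> a * \<epsilon>0 / (2 * (norm w + 1))" by (simp add: \<epsilon>_def)
      then have "(norm w + 1) * \<epsilon> * (2 / \<epsilon>0) \<le> a" using nw \<epsilon>0(1) by (simp add: field_simps)
      moreover have "norm w * \<epsilon> * (2 / \<epsilon>0) \<le> (norm w + 1) * \<epsilon> * (2 / \<epsilon>0)"
        using \<epsilon> \<epsilon>0(1) by (intro mult_right_mono) auto
      ultimately show ?thesis by linarith
    qed
    have "\<forall>\<^sub>F k in sequentially. expectation (D k) \<le> expectation (\<lambda>\<omega>. min 2 (a * norm (nscore (Suc k) \<omega>))) + 2 * \<tau>"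
    proof (rule rarely_expectation_bound[OF rarely_Suc[OF score_remainder[OF \<epsilon>]] \<tau> Dm D02])
      show "integrable M (\<lambda>\<omega>. min 2 (a * norm (nscore (Suc k) \<omega>)))" for k
        by (rule integrable_const_bound[where B=2]) (use a(1) in auto)
      show "0 \<le> min 2 (a * norm (nscore (Suc k) \<omega>))" for k \<omega> using a(1) by simp
      show "\<forall>\<^sub>F k in sequentially. \<forall>\<omega>\<in>space M. \<not> \<epsilon> * norm (\<theta>mle (Suc k) \<omega> - \<theta>\<^sub>0) <
          norm ((1 / real (S.N (Suc k))) *\<^sub>R score (Suc k) \<omega> - MM *v (\<theta>mle (Suc k) \<omega> - \<theta>\<^sub>0)) \<longrightarrow>
          D k \<omega> \<le> min 2 (a * norm (nscore (Suc k) \<omega>))"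
      proof (intro always_eventually allI ballI impI)
        fix k \<omega>
        let ?k = "Suc k"
        let ?v = "\<theta>mle ?k \<omega> - \<theta>\<^sub>0" and ?q = "sqrt (real (S.N ?k))"
        assume "\<not> \<epsilon> * norm ?v < norm ((1 / real (S.N ?k)) *\<^sub>R score ?k \<omega> - MM *v ?v)"
        then have good: "norm ((1 / real (S.N ?k)) *\<^sub>R score ?k \<omega> - MM *v ?v) \<le> \<epsilon> * norm ?v" by simp
        have q0: "0 < ?q" using S.N_pos[of ?k] by simp
        have q: "?q *\<^sub>R ((1 / real (S.N ?k)) *\<^sub>R score ?k \<omega>) = nscore ?k \<omega>"
          unfolding nscore_def scaleR_scaleR using q0 by (simp add: field_simps)
        have dev: "deviation ?k \<omega> = ?q *\<^sub>R ?v" by (simp add: deviation_def)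
        have diff: "norm (nscore ?k \<omega> - MM *v deviation ?k \<omega>) \<le> \<epsilon> * norm (deviation ?k \<omega>)"
        proof -
          have "nscore ?k \<omega> - MM *v deviation ?k \<omega> = ?q *\<^sub>R ((1 / real (S.N ?k)) *\<^sub>R score ?k \<omega> - MM *v ?v)"
            by (simp only: scaleR_diff_right[of ?q "(1 / real (S.N ?k)) *\<^sub>R score ?k \<omega>" "MM *v ?v"] q dev matrix_vector_mult_scaleR)
          then have "norm (nscore ?k \<omega> - MM *v deviation ?k \<omega>) = ?q * norm ((1 / real (S.N ?k)) *\<^sub>R score ?k \<omega> - MM *v ?v)"
            using q0 by simp
          also have "\<dots> \<le> ?q * (\<epsilon> * norm ?v)" using q0 by (intro mult_left_mono good) simp
          also have "\<dots> = \<epsilon> * norm (deviation ?k \<omega>)" using q0 by (simp add: dev)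
          finally show ?thesis .
        qed
        have "\<epsilon>0 * norm (deviation ?k \<omega>) \<le> norm (nscore ?k \<omega>) + \<epsilon> * norm (deviation ?k \<omega>)"
        proof -
          have "norm (MM *v deviation ?k \<omega>) \<le> norm (nscore ?k \<omega>) + norm (nscore ?k \<omega> - MM *v deviation ?k \<omega>)" by norm
          then show ?thesis using \<epsilon>0(2)[of "deviation ?k \<omega>"] diff by linarith
        qed
        moreover have "\<epsilon> * norm (deviation ?k \<omega>) \<le> \<epsilon>0 / 2 * norm (deviation ?k \<omega>)"
          unfolding \<epsilon>_def by (rule mult_right_mono[OF min.cobounded1 norm_ge_zero])
        \<comment> \<open>The absorption step: the deviation is bounded by the score pathwise, which
          replaces a separate proof of root-n consistency.\<close>
        ultimately have "\<epsilon>0 / 2 * norm (deviation ?k \<omega>) \<le> norm (nscore ?k \<omega>)" by linarith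
        then have dn: "norm (deviation ?k \<omega>) \<le> (2 / \<epsilon>0) * norm (nscore ?k \<omega>)" using \<epsilon>0(1) by (simp add: field_simps)
        have "\<bar>(MM *v w) \<bullet> deviation ?k \<omega> - w \<bullet> nscore ?k \<omega>\<bar> = \<bar>w \<bullet> (nscore ?k \<omega> - MM *v deviation ?k \<omega>)\<bar>"
          unfolding sym inner_diff_right by (rule abs_minus_commute)
        also have "\<dots> \<le> norm w * norm (nscore ?k \<omega> - MM *v deviation ?k \<omega>)" by (rule Cauchy_Schwarz_ineq2)
        also have "\<dots> \<le> norm w * (\<epsilon> * ((2 / \<epsilon>0) * norm (nscore ?k \<omega>)))"
          using \<epsilon> by (intro mult_left_mono order_trans[OF diff] dn) auto
        also have "\<dots> = (norm w * \<epsilon> * (2 / \<epsilon>0)) * norm (nscore ?k \<omega>)" by (simp only: mult.assoc)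
        also have "\<dots> \<le> a * norm (nscore ?k \<omega>)" by (intro mult_right_mono \<epsilon>a) simp
        finally have "\<bar>(MM *v w) \<bullet> deviation ?k \<omega> - w \<bullet> nscore ?k \<omega>\<bar> \<le> a * norm (nscore ?k \<omega>)" .
        then show "D k \<omega> \<le> min 2 (a * norm (nscore ?k \<omega>))"
          unfolding D_def by (intro order_trans[OF cmod_iexp_diff_le] min.mono) auto
      qed
    qed
    moreover have "\<forall>\<^sub>F k in sequentially. expectation (\<lambda>\<omega>. min 2 (a * norm (nscore (Suc k) \<omega>))) < \<tau>"
      by (rule eventually_compose_filterlim[OF a(2) filterlim_Suc])
    ultimately have "\<forall>\<^sub>F k in sequentially. norm (expectation (D k) - 0) < r"
    proof eventually_elim
      case (elim k)
      have "0 \<le> expectation (D k)" by (intro integral_nonneg_AE AE_I2 D02)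
      moreover have "expectation (D k) < 4 * \<tau>" using elim \<tau> by linarith
      ultimately show ?case by (simp add: \<tau>_def)
    qed
    then show "\<exists>n0. \<forall>k\<ge>n0. norm (expectation (D k) - 0) < r" by (simp add: eventually_sequentially)
  qed
  then have "(\<lambda>k. expectation (\<lambda>\<omega>. iexp ((MM *v w) \<bullet> deviation (Suc k) \<omega>)) - expectation (\<lambda>\<omega>. iexp (w \<bullet> nscore (Suc k) \<omega>))) \<longlonglongrightarrow> 0"
  proof (rule Lim_null_comparison[rotated], intro always_eventually allI)
    fix k
    have i1: "integrable M (\<lambda>\<omega>. iexp ((MM *v w) \<bullet> deviation (Suc k) \<omega>))"
      by (rule integrable_const_bound[where B=1]) (use deviation_measurable[of "Suc k"] in auto)
    have i2: "integrable M (\<lambda>\<omega>. iexp (w \<bullet> nscore (Suc k) \<omega>))"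
      by (rule integrable_const_bound[where B=1]) auto
    have "expectation (\<lambda>\<omega>. iexp ((MM *v w) \<bullet> deviation (Suc k) \<omega>)) - expectation (\<lambda>\<omega>. iexp (w \<bullet> nscore (Suc k) \<omega>))
        = expectation (\<lambda>\<omega>. iexp ((MM *v w) \<bullet> deviation (Suc k) \<omega>) - iexp (w \<bullet> nscore (Suc k) \<omega>))"
      by (rule Bochner_Integration.integral_diff[OF i1 i2, symmetric])
    also have "cmod \<dots> \<le> expectation (D k)" unfolding D_def by (rule integral_norm_bound)
    finally show "norm (expectation (\<lambda>\<omega>. iexp ((MM *v w) \<bullet> deviation (Suc k) \<omega>)) - expectation (\<lambda>\<omega>. iexp (w \<bullet> nscore (Suc k) \<omega>))) \<le> expectation (D k)" .
  qed
  from tendsto_add[OF this LIMSEQ_Suc[OF score_char[of w]]] show ?thesis by simp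
qed

text \<open>As \<open>MM\<close> is invertible, every frequency has the form \<open>MM *v w\<close>,
  so \<open>deviation_char\<close> covers all characteristic functions needed for weak
  convergence.\<close>

theorem asymptotic_normality:
  "converges_in_distribution M (\<lambda>k \<omega>. sqrt (real (n_obs CARD('p) n\<^sub>1 k)) *\<^sub>R (\<theta>mle k \<omega> - \<theta>\<^sub>0)) (mvnormal (matrix_inv MM))"
  unfolding converges_in_distribution_def
proof (intro allI impI)
  fix g :: "real ^ 'p \<Rightarrow> real" assume g: "continuous_on UNIV g \<and> bounded (range g)"
  obtain R where R: "det R \<noteq> 0" "MM = transpose R ** R" and quad: "\<And>w. w \<bullet> (MM *v w) = (norm (R *v w))\<^sup>2"
    by (rule M_sat_factor) (rule that)
  have dM: "det MM \<noteq> 0" using R by (simp add: det_mul)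
  note mv = mvnormal_char[OF R(1), folded R(2)]
  have [measurable]: "deviation (Suc k) \<in> borel_measurable M" for k by (rule deviation_measurable) simp
  have [measurable]: "g \<in> borel_measurable borel" using g by (intro borel_measurable_continuous_onI) blast
  have "(\<lambda>k. \<integral>x. g x \<partial>distr M borel (deviation (Suc k))) \<longlonglongrightarrow> (\<integral>x. g x \<partial>mvnormal (matrix_inv MM))"
  proof (rule char_conv_imp_weak_conv)
    show "prob_space (distr M borel (deviation (Suc k)))" for k by (rule prob_space_distr) measurable
    fix t :: "real ^ 'p"
    define w where "w = matrix_inv MM *v t"
    have t: "t = MM *v w" by (simp add: w_def matrix_vector_mul_assoc matrix_inv_inverse[OF dM])
    have "(CLINT x|distr M borel (deviation (Suc k)). iexp (t \<bullet> x)) = expectation (\<lambda>\<omega>. iexp ((MM *v w) \<bullet> deviation (Suc k) \<omega>))" for k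
      unfolding t by (rule integral_distr) measurable
    then show "(\<lambda>k. CLINT x|distr M borel (deviation (Suc k)). iexp (t \<bullet> x)) \<longlonglongrightarrow> (CLINT x|mvnormal (matrix_inv MM). iexp (t \<bullet> x))"
      using deviation_char[of w] unfolding t mv(3) quad by simp
  qed (use mv(1,2) g in auto)
  moreover have "(\<integral>x. g x \<partial>distr M borel (deviation (Suc k))) = expectation (\<lambda>\<omega>. g (deviation (Suc k) \<omega>))" for k
    by (rule integral_distr) measurable
  ultimately have "(\<lambda>k. expectation (\<lambda>\<omega>. g (deviation (Suc k) \<omega>))) \<longlonglongrightarrow> (\<integral>x. g x \<partial>mvnormal (matrix_inv MM))" by simp
  then have "(\<lambda>k. expectation (\<lambda>\<omega>. g (deviation k \<omega>))) \<longlonglongrightarrow> (\<integral>x. g x \<partial>mvnormal (matrix_inv MM))" by (rule LIMSEQ_imp_Suc)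
  then show "(\<lambda>k. expectation (\<lambda>\<omega>. g (sqrt (real (n_obs CARD('p) n\<^sub>1 k)) *\<^sub>R (\<theta>mle k \<omega> - \<theta>\<^sub>0)))) \<longlonglongrightarrow> (\<integral>x. g x \<partial>mvnormal (matrix_inv MM))"
    by (simp only: deviation_def)
qed

end

lemma estimator_measurable:
  assumes T: "estimator M XX \<Theta> X Y n T"
    and X: "\<And>i. 1 \<le> i \<Longrightarrow> X i \<in> M \<rightarrow>\<^sub>M restrict_space borel XX"
    and Y: "\<And>i. 1 \<le> i \<Longrightarrow> Y i \<in> borel_measurable M"
  shows "T \<in> borel_measurable M" "\<And>\<omega>. \<omega> \<in> space M \<Longrightarrow> T \<omega> \<in> \<Theta>"
proof -
  let ?Z = "\<lambda>\<omega>. \<lambda>i\<in>{1..n}. (X i \<omega>, Y i \<omega>)"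
  obtain g where g: "g \<in> PiM {1..n} (\<lambda>_. restrict_space borel XX \<Otimes>\<^sub>M borel) \<rightarrow>\<^sub>M restrict_space borel \<Theta>"
    and Tg: "\<And>\<omega>. \<omega> \<in> space M \<Longrightarrow> T \<omega> = g (?Z \<omega>)"
    using T unfolding estimator_def by blast
  have "?Z \<in> M \<rightarrow>\<^sub>M PiM {1..n} (\<lambda>_. restrict_space borel XX \<Otimes>\<^sub>M borel)"
    by (intro measurable_restrict measurable_Pair X Y) auto
  from measurable_compose[OF this g] have gZ: "(\<lambda>\<omega>. g (?Z \<omega>)) \<in> M \<rightarrow>\<^sub>M restrict_space borel \<Theta>" .
  then show "T \<omega> \<in> \<Theta>" if "\<omega> \<in> space M" for \<omega>
    using measurable_space[OF gZ that] Tg[OF that] by (simp add: space_restrict_space)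
  have "(\<lambda>\<omega>. g (?Z \<omega>)) \<in> borel_measurable M"
    using gZ by (simp add: measurable_restrict_space2_iff)
  then show "T \<in> borel_measurable M" using measurable_cong[of M T "\<lambda>\<omega>. g (?Z \<omega>)" borel, OF Tg] by simp
qed

text \<open>What remains is to place all linear predictors in one compact subinterval of
  \<open>I\<close>, since every uniform estimate rests on it.\<close>

theorem theorem6p2:
  fixes XX :: "'x::metric_space set"
    and \<Theta> :: "(real ^ 'p) set"
    and \<mu> :: "'x \<Rightarrow> real ^ 'p \<Rightarrow> real"
    and f\<^sub>\<theta> :: "real ^ 'p \<Rightarrow> 'x \<Rightarrow> real ^ 'p"
    and J I :: "real set"
    and \<nu> :: "real measure"
    and K b G :: "real \<Rightarrow> real"
    and P :: "real \<Rightarrow> real measure"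
    and f :: "'x \<Rightarrow> real ^ 'p"
    and M :: "'w measure"
    and F :: "nat \<Rightarrow> 'w measure"
    and X :: "nat \<Rightarrow> 'w \<Rightarrow> 'x"
    and Y :: "nat \<Rightarrow> 'w \<Rightarrow> real"
    and n\<^sub>1 :: nat
    and \<theta>hat \<theta>mle :: "nat \<Rightarrow> 'w \<Rightarrow> real ^ 'p"
    and \<theta>\<^sub>0 :: "real ^ 'p"
  assumes "compact XX" "compact \<Theta>"
    and "continuous_on (XX \<times> \<Theta>) (\<lambda>(x, \<theta>). \<mu> x \<theta>)"
    and "continuous_on (XX \<times> \<Theta>) (\<lambda>(x, \<theta>). f\<^sub>\<theta> \<theta> x)"
    and "\<And>\<theta>. \<theta> \<in> \<Theta> \<Longrightarrow> span (f\<^sub>\<theta> \<theta> ` XX) = UNIV"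
    and "exp_family J \<nu> K b P"
    and "prob_space M"
    and "\<And>i. 1 \<le> i \<Longrightarrow> X i \<in> M \<rightarrow>\<^sub>M restrict_space borel XX"
    and "\<And>i. 1 \<le> i \<Longrightarrow> Y i \<in> borel_measurable M"
    and "1 \<le> n\<^sub>1"
    and "\<And>k. 1 \<le> k \<Longrightarrow> estimator M XX \<Theta> X Y (n_obs CARD('p) n\<^sub>1 k) (\<theta>hat k)"
    and "p_step_ahead M XX n\<^sub>1 X f\<^sub>\<theta> \<theta>hat"
    and "adaptive_mle M XX \<Theta> n\<^sub>1 X Y J b K G f \<theta>mle"
    and GLM_star: "cond_GLM_star XX \<Theta> \<mu> f\<^sub>\<theta> J b I G f"
    and a1: "cond_a1 M XX CARD('p) n\<^sub>1 X Y F"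
    and a2': "cond_a2' M CARD('p) n\<^sub>1 X Y F J b P G f \<theta>\<^sub>0"
    and SD: "cond_SD XX f\<^sub>\<theta> \<theta>\<^sub>0"
    and "deriv G C1_differentiable_on I"
    and "\<theta>\<^sub>0 \<in> \<Theta>" "\<theta>\<^sub>0 \<in> interior \<Theta>"
    and "AE \<omega> in M. (\<lambda>k. \<theta>hat k \<omega>) \<longlonglongrightarrow> \<theta>\<^sub>0"
  shows "converges_in_distribution M
           (\<lambda>k \<omega>. sqrt (real (n_obs CARD('p) n\<^sub>1 k)) *\<^sub>R (\<theta>mle k \<omega> - \<theta>\<^sub>0))
           (mvnormal (matrix_inv (M_sat XX f\<^sub>\<theta> \<theta>\<^sub>0)))"
proof -
  have I: "open I" "is_interval I" and G: "G C1_differentiable_on I" "\<And>u. u \<in> I \<Longrightarrow> 0 < deriv G u"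
    "G ` I \<subseteq> deriv b ` J" and fc: "continuous_on XX f"
    and fI: "\<And>x \<theta>. x \<in> XX \<Longrightarrow> \<theta> \<in> \<Theta> \<Longrightarrow> f x \<bullet> \<theta> \<in> I"
    and f\<theta>: "\<And>x \<theta>. x \<in> XX \<Longrightarrow> \<theta> \<in> \<Theta> \<Longrightarrow> f\<^sub>\<theta> \<theta> x = glm_phi J b G (f x \<bullet> \<theta>) *\<^sub>R f x"
    using GLM_star unfolding cond_GLM_star_def by blast+
  \<comment> \<open>The span of the empty set is 0, but p is at least 1.\<close>
  have "XX \<noteq> {}"
  proof
    assume "XX = {}"
    then have "UNIV = {0 :: real ^ 'p}" using assms(5)[OF \<open>\<theta>\<^sub>0 \<in> \<Theta>\<close>] by simp
    then have "(axis undefined 1 :: real ^ 'p) = 0" by blast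
    then show False by (simp add: axis_eq_0_iff)
  qed
  let ?S = "(\<lambda>(x, \<theta>). f x \<bullet> \<theta>) ` (XX \<times> \<Theta>)"
  have "compact ?S"
    unfolding split_beta
    by (intro compact_continuous_image continuous_intros continuous_on_compose2[OF fc] compact_Times assms) auto
  moreover have S0: "?S \<noteq> {}" using \<open>XX \<noteq> {}\<close> \<open>\<theta>\<^sub>0 \<in> \<Theta>\<close> by blast
  \<comment> \<open>The extremes are attained predictors, hence lie in \<open>I\<close>; as
    \<open>I\<close> is an interval, everything between them does too.\<close>
  ultimately obtain lo hi where lh: "lo \<in> ?S" "\<And>u. u \<in> ?S \<Longrightarrow> lo \<le> u" "hi \<in> ?S" "\<And>u. u \<in> ?S \<Longrightarrow> u \<le> hi"
    using compact_attains_inf[of ?S] compact_attains_sup[of ?S] by blast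
  have lohi: "lo \<in> I" "hi \<in> I" "lo \<le> hi" using lh fI by auto
  have lhI: "{lo..hi} \<subseteq> I"
  proof
    fix u assume "u \<in> {lo..hi}"
    then show "u \<in> I" using I(2)[unfolded is_interval_1, rule_format, of lo hi u] lohi by simp
  qed
  interpret prob_space M by fact
  interpret adaptive_glm J I \<nu> K b G P XX \<Theta> f\<^sub>\<theta> \<theta>\<^sub>0 M f F X Y n\<^sub>1 \<theta>hat \<theta>mle lo hi
  proof
    show "span (f\<^sub>\<theta> \<theta>\<^sub>0 ` XX) = UNIV" by (rule assms(5)[OF \<open>\<theta>\<^sub>0 \<in> \<Theta>\<close>])
    show "f x \<bullet> \<theta> \<in> {lo..hi}" if "x \<in> XX" "\<theta> \<in> \<Theta>" for x \<theta>
      using lh(2)[of "f x \<bullet> \<theta>"] lh(4)[of "f x \<bullet> \<theta>"] that by force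
    show "\<theta>hat k \<omega> \<in> \<Theta>" if "1 \<le> k" "\<omega> \<in> space M" for k \<omega>
      by (rule estimator_measurable(2)[OF assms(11)[OF that(1)] assms(8,9) that(2)])
    have mle: "estimator M XX \<Theta> X Y (n_obs CARD('p) n\<^sub>1 k) (\<theta>mle k)" if "1 \<le> k" for k
      using assms(13) that unfolding adaptive_mle_def by blast
    show "\<theta>mle k \<in> borel_measurable M" if "1 \<le> k" for k
      by (rule estimator_measurable(1)[OF mle[OF that] assms(8,9)])
    show "is_arg_max (log_lik J b K G f (\<lambda>i. X i \<omega>) (\<lambda>i. Y i \<omega>) (n_obs CARD('p) n\<^sub>1 k)) (\<lambda>\<theta>. \<theta> \<in> \<Theta>) (\<theta>mle k \<omega>)"
      if "1 \<le> k" "\<omega> \<in> space M" for k \<omega>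
      using assms(13) that unfolding adaptive_mle_def by blast
  qed (fact assms I G fc f\<theta> lhI lohi)+
  show ?thesis by (rule asymptotic_normality)
qed

end
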